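(* Assume the Riemann hypothesis and $\liminf\,(\beta'-1/2)\log\gamma'\neq 0$, where the limit inferior is taken over the zeros $\rho'=\beta'+i\gamma'$ of $\zeta'(s)$ with $\gamma'>0$, as $\gamma'\to\infty$. Then, for any $c>0$ and $s=\sigma+it$ ($t\geqslant 10$), we have $$\frac{\zeta'}{\zeta}(s)=O\left((\log t)^{2-2\sigma}\right)$$ uniformly for $1/2+c/\log t\leqslant\sigma\leqslant\sigma_1<1$.
   Context: $\zeta(s)$ is the Riemann zeta function, $\zeta'$ its derivative, $\frac{\zeta'}{\zeta}(s)=\zeta'(s)/\zeta(s)$, and $s=\sigma+it$ with $\sigma,t$ real. The Riemann hypothesis (RH) states that every nonreal zero of $\zeta(s)$ has real part $1/2$; under RH, $\beta'\geqslant 1/2$ for every nonreal zero $\rho'=\beta'+i\gamma'$ of $\zeta'(s)$. Here $\sigma_1<1$ is fixed, and the implied constant may depend on $c$ and $\sigma_1$ only. *)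

theory Defs
  imports "HOL-Complex_Analysis.Complex_Analysis" "HOL-Library.Extended_Real"
begin

text \<open>
  The Riemann zeta function is the analytic continuation of its Dirichlet series to the complex
  plane punctured at 1. The value at the pole is set to 0, which makes the function unique;
  that exactly one such function exists is shown in \<open>ex1_zeta_continuation\<close> below.
\<close>

definition zeta_continuation :: "(complex \<Rightarrow> complex) \<Rightarrow> bool" where
  "zeta_continuation f \<longleftrightarrow> f holomorphic_on (- {1}) \<and> f 1 = 0 \<and>
     (\<forall>s. Re s > 1 \<longrightarrow> (\<lambda>n. 1 / of_nat (Suc n) powr s) sums f s)"

definition zeta :: "complex \<Rightarrow> complex" where
  "zeta = (THE f. zeta_continuation f)"

definition riemann_hypothesis :: bool where
  "riemann_hypothesis \<longleftrightarrow> (\<forall>s. zeta s = 0 \<and> Im s \<noteq> 0 \<longrightarrow> Re s = 1 / 2)"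

definition upper_zeta_deriv_zeros :: "complex set" where
  "upper_zeta_deriv_zeros = {\<rho>. deriv zeta \<rho> = 0 \<and> Im \<rho> > 0}"


subsection \<open>Existence and uniqueness of the continuation\<close>

text \<open>
  Expanding \<open>n powr (1 - s)\<close> in a Taylor series around \<open>n + 1\<close> and summing over \<open>n\<close> expresses
  \<open>(s - 1) * zeta s\<close> through the values at \<open>s + 1, s + 2, \<dots>\<close> and a remainder that converges
  further to the left. Hence \<open>(s - 1) * zeta s\<close> extends from one half plane to the next.
\<close>

lemma holomorphic_on_suminf:
  fixes f :: "nat \<Rightarrow> complex \<Rightarrow> complex"
  assumes S: "open S" and hol: "\<And>n. f n holomorphic_on S"
    and bd: "\<And>x d. d > 0 \<Longrightarrow> cball x d \<subseteq> S \<Longrightarrow>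
               \<exists>M. summable M \<and> (\<forall>n. \<forall>y\<in>cball x d. norm (f n y) \<le> M n)"
  shows "(\<lambda>s. \<Sum>n. f n s) holomorphic_on S"
proof (rule holomorphic_uniform_sequence[OF S])
  show "(\<lambda>s. \<Sum>i<n. f i s) holomorphic_on S" for n
    by (intro holomorphic_intros hol)
  fix x assume "x \<in> S"
  then obtain d where d: "d > 0" "cball x d \<subseteq> S"
    using S open_contains_cball by blast
  from bd[OF d] obtain M where "summable M" "\<forall>n. \<forall>y\<in>cball x d. norm (f n y) \<le> M n"
    by blast
  then have "uniform_limit (cball x d) (\<lambda>n s. \<Sum>i<n. f i s) (\<lambda>s. \<Sum>n. f n s) sequentially"
    by (intro Weierstrass_m_test) auto
  with d show "\<exists>d>0. cball x d \<subseteq> S \<and>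
      uniform_limit (cball x d) (\<lambda>n s. \<Sum>i<n. f i s) (\<lambda>s. \<Sum>n. f n s) sequentially"
    by blast
qed

definition dirichlet_zeta :: "complex \<Rightarrow> complex" where
  "dirichlet_zeta s = (\<Sum>n. of_nat (Suc n) powr (- s))"

lemma norm_of_nat_Suc_powr: "norm (of_nat (Suc n) powr s :: complex) = real (Suc n) powr Re s"
  by (subst norm_powr_real_powr) auto

lemma summable_Suc_powr: "a < -1 \<Longrightarrow> summable (\<lambda>n. real (Suc n) powr a)"
  by (subst summable_Suc_iff) (simp add: summable_real_powr_iff)

lemma dirichlet_zeta_sums:
  assumes "Re s > 1"
  shows "(\<lambda>n. of_nat (Suc n) powr (- s)) sums dirichlet_zeta s"
proof -
  have "summable (\<lambda>n. norm (of_nat (Suc n) powr (- s) :: complex))"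
    unfolding norm_of_nat_Suc_powr using assms by (intro summable_Suc_powr) auto
  then show ?thesis
    unfolding dirichlet_zeta_def by (rule summable_sums[OF summable_norm_cancel])
qed

lemma holomorphic_dirichlet_zeta: "dirichlet_zeta holomorphic_on {s. Re s > 1}"
  unfolding dirichlet_zeta_def[abs_def]
proof (rule holomorphic_on_suminf)
  show "open {s. Re s > 1}" by (rule open_halfspace_Re_gt)
  show "(\<lambda>s. of_nat (Suc n) powr (- s)) holomorphic_on {s. Re s > 1}" for n
    by (auto intro!: holomorphic_intros)
  fix x :: complex and d :: real
  assume d: "d > 0" and sub: "cball x d \<subseteq> {s. Re s > 1}"
  have "x - of_real d \<in> cball x d" using d by (simp add: dist_norm)
  with sub have "x - of_real d \<in> {s. Re s > 1}" by (rule subsetD)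
  then have gt: "Re x - d > 1" by simp
  have "norm (of_nat (Suc n) powr (- y) :: complex) \<le> real (Suc n) powr (- (Re x - d))"
    if "y \<in> cball x d" for n y
  proof -
    have "Re x - Re y \<le> d"
      using that abs_Re_le_cmod[of "x - y"] by (simp add: dist_norm)
    then show ?thesis
      unfolding norm_of_nat_Suc_powr by (intro powr_mono) auto
  qed
  moreover have "summable (\<lambda>n. real (Suc n) powr (- (Re x - d)))"
    using gt by (intro summable_Suc_powr) auto
  ultimately show "\<exists>M. summable M \<and>
      (\<forall>n. \<forall>y\<in>cball x d. norm (of_nat (Suc n) powr (- y) :: complex) \<le> M n)"
    by blast
qed

definition taylor_rem :: "nat \<Rightarrow> nat \<Rightarrow> complex \<Rightarrow> complex" where
  "taylor_rem p n s = of_nat (Suc n) powr (1 - s) -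
     (\<Sum>i\<le>p. pochhammer (s - 1) i / fact i * of_nat (Suc (Suc n)) powr (1 - s - of_nat i))"

lemma norm_pochhammer_le:
  fixes z :: complex
  shows "norm (pochhammer z n) \<le> (norm z + real n) ^ n"
proof -
  have "norm (pochhammer z n) = (\<Prod>i<n. norm (z + of_nat i))"
    by (simp add: pochhammer_prod prod_norm atLeast0LessThan)
  also have "\<dots> \<le> (\<Prod>i<n. norm z + real n)"
  proof (rule prod_mono)
    fix i assume "i \<in> {..<n}"
    then show "0 \<le> norm (z + of_nat i) \<and> norm (z + of_nat i) \<le> norm z + real n"
      using norm_triangle_ineq[of z "of_nat i"] by auto
  qed
  finally show ?thesis by simp
qed

lemma norm_taylor_rem_le:
  assumes s: "Re s + real p \<ge> 2"
  shows "norm (taylor_rem p n s) \<le> (norm (s - 1) + real (Suc p)) ^ Suc p * real (Suc n) powr (-2)"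
proof -
  define f where
    "f = (\<lambda>i x. (-1) ^ i * pochhammer (s - 1) i * x powr (1 - s - of_nat i) :: complex)"
  define w z :: complex where "w = of_nat (Suc (Suc n))" and "z = of_nat (Suc n)"
  define S where "S = closed_segment w z"
  define B where "B = (norm (s - 1) + real (Suc p)) ^ Suc p * real (Suc n) powr (-2)"
  have S: "x \<in> \<real> \<and> Re x \<ge> real (Suc n)" if "x \<in> S" for x
  proof -
    from that obtain u where u: "0 \<le> u" "u \<le> 1" "x = (1 - u) *\<^sub>R w + u *\<^sub>R z"
      by (auto simp: S_def in_segment)
    define r where "r = real (Suc n) + (1 - u)"
    have "x = of_real r"
      unfolding u(3) by (simp add: r_def w_def z_def scaleR_conv_of_real algebra_simps)
    moreover have "r \<ge> real (Suc n)" using u by (simp add: r_def)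
    ultimately show ?thesis by simp
  qed
  have "norm (f 0 z - (\<Sum>i\<le>p. f i w * (z - w) ^ i / fact i)) \<le> B * norm (z - w) ^ Suc p / fact p"
  proof (rule complex_Taylor)
    show "convex S" "w \<in> S" "z \<in> S" by (auto simp: S_def)
    fix x assume x: "x \<in> S"
    have nonpos: "x \<notin> \<real>\<^sub>\<le>\<^sub>0"
      using S[OF x] by (auto simp: complex_nonpos_Reals_iff)
    show "(f i has_field_derivative f (Suc i) x) (at x within S)" if "i \<le> p" for i
    proof -
      have "(f i has_field_derivative (-1) ^ i * pochhammer (s - 1) i *
              ((1 - s - of_nat i) * x powr (1 - s - of_nat i - 1))) (at x)"
        unfolding f_def by (intro DERIV_cmult has_field_derivative_powr nonpos)
      also have "(-1) ^ i * pochhammer (s - 1) i *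
              ((1 - s - of_nat i) * x powr (1 - s - of_nat i - 1)) = f (Suc i) x"
      proof -
        have "1 - s - of_nat i - 1 = 1 - s - of_nat (Suc i)" by simp
        moreover have "(-1) ^ i * q * ((1 - s - of_nat i) * y) =
            (-1) ^ Suc i * ((s - 1 + of_nat i) * q) * y" for q y :: complex
          by (simp add: algebra_simps)
        ultimately show ?thesis by (simp only: f_def pochhammer_rec')
      qed
      finally show ?thesis by (rule has_field_derivative_at_within)
    qed
    have bound: "norm (x powr (1 - s - of_nat (Suc p))) \<le> real (Suc n) powr (-2)"
    proof -
      have "norm (x powr (1 - s - of_nat (Suc p))) = Re x powr (- Re s - real p)"
        using S[OF x] by (subst norm_powr_real_powr) auto
      also have "\<dots> \<le> Re x powr (-2)"
        using S[OF x] s by (intro powr_mono) auto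
      also have "\<dots> \<le> real (Suc n) powr (-2)"
        using S[OF x] by (intro powr_mono2') auto
      finally show ?thesis .
    qed
    have "norm (f (Suc p) x) =
        norm (pochhammer (s - 1) (Suc p)) * norm (x powr (1 - s - of_nat (Suc p)))"
      unfolding f_def by (simp only: norm_mult norm_power norm_minus_cancel norm_one power_one mult_1)
    also have "\<dots> \<le>
        norm (pochhammer (s - 1) (Suc p)) * real (Suc n) powr (-2)"
      by (rule mult_left_mono[OF bound norm_ge_zero])
    also have "\<dots> \<le> B"
      unfolding B_def by (intro mult_right_mono norm_pochhammer_le powr_ge_zero)
    finally show "norm (f (Suc p) x) \<le> B" .
  qed
  moreover have "z - w = -1" by (simp add: z_def w_def)
  moreover have "f 0 z - (\<Sum>i\<le>p. f i w * (-1) ^ i / fact i) = taylor_rem p n s"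
  proof -
    have "f i w * (-1) ^ i / fact i =
        pochhammer (s - 1) i / fact i * w powr (1 - s - of_nat i)" for i
      by (cases "even i") (simp_all add: f_def)
    then have "(\<Sum>i\<le>p. f i w * (-1) ^ i / fact i) =
        (\<Sum>i\<le>p. pochhammer (s - 1) i / fact i * w powr (1 - s - of_nat i))"
      by (intro sum.cong refl)
    then show ?thesis by (simp only: taylor_rem_def w_def z_def) (simp add: f_def)
  qed
  ultimately have "norm (taylor_rem p n s) \<le> B / fact p" by simp
  also have "\<dots> \<le> B / 1"
    unfolding B_def by (intro divide_left_mono) (auto simp: fact_ge_1)
  finally show ?thesis by (simp add: B_def)
qed

lemma holomorphic_suminf_taylor_rem:
  "(\<lambda>s. \<Sum>n. taylor_rem p n s) holomorphic_on {s. Re s > 2 - real p}"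
proof (rule holomorphic_on_suminf)
  show "open {s. Re s > 2 - real p}" by (rule open_halfspace_Re_gt)
  show "taylor_rem p n holomorphic_on {s. Re s > 2 - real p}" for n
    unfolding taylor_rem_def[abs_def] pochhammer_prod
    by (intro holomorphic_intros) (auto simp del: of_nat_Suc)
  fix x :: complex and d :: real
  assume d: "d > 0" and sub: "cball x d \<subseteq> {s. Re s > 2 - real p}"
  define C where "C = (norm (x - 1) + d + real (Suc p)) ^ Suc p"
  have "norm (taylor_rem p n y) \<le> C * real (Suc n) powr (-2)" if y: "y \<in> cball x d" for n y
  proof -
    have "norm (taylor_rem p n y) \<le> (norm (y - 1) + real (Suc p)) ^ Suc p * real (Suc n) powr (-2)"
      using y sub by (intro norm_taylor_rem_le) auto
    also have "norm (y - 1) \<le> norm (x - 1) + d"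
      using y norm_triangle_ineq[of "x - 1" "y - x"] by (simp add: dist_norm norm_minus_commute)
    then have "(norm (y - 1) + real (Suc p)) ^ Suc p * real (Suc n) powr (-2)
                 \<le> C * real (Suc n) powr (-2)"
      unfolding C_def by (intro mult_right_mono power_mono) auto
    finally show ?thesis .
  qed
  moreover have "summable (\<lambda>n. C * real (Suc n) powr (-2))"
    by (intro summable_mult summable_Suc_powr) auto
  ultimately show "\<exists>M. summable M \<and> (\<forall>n. \<forall>y\<in>cball x d. norm (taylor_rem p n y) \<le> M n)"
    by blast
qed

lemma dirichlet_zeta_recurrence:
  assumes s: "Re s > 1"
  shows "(s - 1) * dirichlet_zeta s = s - (\<Sum>i\<in>{2..Suc p}.
           pochhammer (s - 1) (i - 1) / fact i *
             ((s + of_nat i - 2) * dirichlet_zeta (s + of_nat i - 1) - (s + of_nat i - 2)))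
           - (\<Sum>n. taylor_rem (Suc p) n s)"
proof -
  define t where "t = (\<lambda>i n. pochhammer (s - 1) i / fact i *
                     of_nat (Suc (Suc n)) powr (1 - s - of_nat i) :: complex)"
  have t: "t i sums (pochhammer (s - 1) i / fact i * (dirichlet_zeta (s + of_nat i - 1) - 1))"
    if "i \<ge> 1" for i
  proof -
    have "(\<lambda>n. of_nat (Suc n) powr (- (s + of_nat i - 1))) sums dirichlet_zeta (s + of_nat i - 1)"
      using s that by (intro dirichlet_zeta_sums) auto
    then have "(\<lambda>n. of_nat (Suc (Suc n)) powr (- (s + of_nat i - 1)))
        sums (dirichlet_zeta (s + of_nat i - 1) - 1)"
      by (subst (asm) sums_iff_shift'[of _ 1, symmetric]) simp
    then show ?thesis
      unfolding t_def by (intro sums_mult) (simp add: algebra_simps)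
  qed
  have lim: "(\<lambda>n. of_nat (Suc n) powr (1 - s) :: complex) \<longlonglongrightarrow> 0"
  proof (rule tendsto_norm_zero_cancel)
    have "(\<lambda>n. real (Suc n) powr (1 - Re s)) \<longlonglongrightarrow> 0"
      using s by (intro tendsto_neg_powr filterlim_compose[OF filterlim_real_sequentially filterlim_Suc]) auto
    then show "(\<lambda>n. norm (of_nat (Suc n) powr (1 - s) :: complex)) \<longlonglongrightarrow> 0"
      unfolding norm_of_nat_Suc_powr by simp
  qed
  have tele: "(\<lambda>n. of_nat (Suc n) powr (1 - s) - of_nat (Suc (Suc n)) powr (1 - s)) sums
                (1 :: complex)"
    using telescope_sums'[OF lim] by simp
  have rem: "taylor_rem (Suc p) n s =
      (of_nat (Suc n) powr (1 - s) - of_nat (Suc (Suc n)) powr (1 - s)) - (\<Sum>i\<in>{1..Suc p}. t i n)"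
    for n
  proof -
    have "{..Suc p} = insert 0 {1..Suc p}" by auto
    then show ?thesis by (simp add: taylor_rem_def t_def)
  qed
  have "(\<lambda>n. taylor_rem (Suc p) n s) sums (1 - (\<Sum>i\<in>{1..Suc p}.
      pochhammer (s - 1) i / fact i * (dirichlet_zeta (s + of_nat i - 1) - 1)))"
    unfolding rem by (intro sums_diff tele sums_sum t) auto
  then have "(\<Sum>n. taylor_rem (Suc p) n s) = 1 - (\<Sum>i\<in>{1..Suc p}.
      pochhammer (s - 1) i / fact i * (dirichlet_zeta (s + of_nat i - 1) - 1))"
    by (simp add: sums_iff)
  also have "{1..Suc p} = insert 1 {2..Suc p}" by auto
  also have "(\<Sum>i\<in>insert 1 {2..Suc p}.
      pochhammer (s - 1) i / fact i * (dirichlet_zeta (s + of_nat i - 1) - 1)) =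
      (s - 1) * (dirichlet_zeta s - 1) + (\<Sum>i\<in>{2..Suc p}.
      pochhammer (s - 1) i / fact i * (dirichlet_zeta (s + of_nat i - 1) - 1))"
    by (subst sum.insert) auto
  also have "(\<Sum>i\<in>{2..Suc p}.
      pochhammer (s - 1) i / fact i * (dirichlet_zeta (s + of_nat i - 1) - 1)) =
      (\<Sum>i\<in>{2..Suc p}. pochhammer (s - 1) (i - 1) / fact i *
             ((s + of_nat i - 2) * dirichlet_zeta (s + of_nat i - 1) - (s + of_nat i - 2)))"
  proof (rule sum.cong[OF refl])
    fix i assume "i \<in> {2..Suc p}"
    then obtain k where k: "i = Suc k" by (cases i) auto
    have i: "s + of_nat i - 2 = s - 1 + of_nat k" by (simp add: k)
    have distr: "a * q / b * (x - 1) = q / b * (a * x - a)" for a q b x :: complex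
      by (simp add: divide_inverse algebra_simps)
    have "pochhammer (s - 1) i = (s - 1 + of_nat k) * pochhammer (s - 1) (i - 1)"
      unfolding k pochhammer_rec' by simp
    then show "pochhammer (s - 1) i / fact i * (dirichlet_zeta (s + of_nat i - 1) - 1) =
      pochhammer (s - 1) (i - 1) / fact i *
        ((s + of_nat i - 2) * dirichlet_zeta (s + of_nat i - 1) - (s + of_nat i - 2))"
      unfolding i by (simp only: distr)
  qed
  finally show ?thesis by (simp add: algebra_simps)
qed

lemma zeta_half_plane_continuation:
  "\<exists>F. F holomorphic_on {s. Re s > 1 - real m} \<and>
       (\<forall>s. Re s > 1 \<longrightarrow> F s = (s - 1) * dirichlet_zeta s)"
proof (induction m)
  case 0
  show ?case
    by (rule exI[of _ "\<lambda>s. (s - 1) * dirichlet_zeta s"])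
       (auto intro!: holomorphic_intros holomorphic_dirichlet_zeta)
next
  case (Suc m)
  then obtain F where F: "F holomorphic_on {s. Re s > 1 - real m}"
    "\<And>s. Re s > 1 \<Longrightarrow> F s = (s - 1) * dirichlet_zeta s" by blast
  define p where "p = Suc m"
  define G where "G = (\<lambda>s. s - (\<Sum>i\<in>{2..Suc p}. pochhammer (s - 1) (i - 1) / fact i *
             (F (s + of_nat i - 1) - (s + of_nat i - 2))) - (\<Sum>n. taylor_rem (Suc p) n s))"
  have "(\<lambda>s. F (s + of_nat i - 1)) holomorphic_on {s. Re s > 1 - real (Suc m)}"
    if "i \<in> {2..Suc p}" for i
    by (rule holomorphic_on_compose_gen[OF _ F(1), unfolded o_def])
       (use that in \<open>auto intro!: holomorphic_intros\<close>)
  moreover have "(\<lambda>s. \<Sum>n. taylor_rem (Suc p) n s) holomorphic_on {s. Re s > 1 - real (Suc m)}"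
    by (rule holomorphic_on_subset[OF holomorphic_suminf_taylor_rem]) (auto simp: p_def)
  ultimately have "G holomorphic_on {s. Re s > 1 - real (Suc m)}"
    unfolding G_def pochhammer_prod by (intro holomorphic_intros) auto
  moreover have "G s = (s - 1) * dirichlet_zeta s" if "Re s > 1" for s
  proof -
    have "F (s + of_nat i - 1) = (s + of_nat i - 2) * dirichlet_zeta (s + of_nat i - 1)"
      if "i \<in> {2..Suc p}" for i
      using \<open>Re s > 1\<close> that by (subst F(2)) (auto simp: algebra_simps)
    then show ?thesis
      unfolding G_def dirichlet_zeta_recurrence[OF that, of p] by simp
  qed
  ultimately show ?case by blast
qed

lemma zeta_entire_continuation:
  "\<exists>F. F holomorphic_on UNIV \<and> (\<forall>s. Re s > 1 \<longrightarrow> F s = (s - 1) * dirichlet_zeta s)"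
proof -
  define H where "H = (\<lambda>m. {s. Re s > 1 - real m})"
  have "\<exists>F. \<forall>m. F m holomorphic_on H m \<and> (\<forall>s. Re s > 1 \<longrightarrow> F m s = (s - 1) * dirichlet_zeta s)"
    unfolding H_def by (rule choice, rule allI, rule zeta_half_plane_continuation)
  then obtain F where F: "\<And>m. F m holomorphic_on H m"
    "\<And>m s. Re s > 1 \<Longrightarrow> F m s = (s - 1) * dirichlet_zeta s" by blast
  have openH: "open (H m)" for m
    unfolding H_def by (rule open_halfspace_Re_gt)
  have agree_le: "F m s = F k s" if "m \<le> k" "s \<in> H m" for m k s
  proof (rule analytic_continuation_open[where f = "F m" and g = "F k" and z = s
          and s = "{s. Re s > 1}" and s' = "H m"])
    show "{s. Re s > 1} \<noteq> {}" by (auto intro!: exI[of _ 2])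
    show "connected (H m)"
      unfolding H_def by (intro convex_connected convex_halfspace_Re_gt)
    show "F k holomorphic_on H m"
      by (rule holomorphic_on_subset[OF F(1)]) (use that in \<open>auto simp: H_def\<close>)
    show "F m z = F k z" if "z \<in> {s. Re s > 1}" for z
      using that by (simp add: F(2))
    show "{s. Re s > 1} \<subseteq> H m" by (auto simp: H_def)
  qed (use that in \<open>simp_all add: F(1) openH open_halfspace_Re_gt\<close>)
  have agree: "F m s = F k s" if "s \<in> H m" "s \<in> H k" for m k s
    using agree_le that nat_le_linear by metis
  have cover: "\<exists>m. s \<in> H m" for s
    using reals_Archimedean2[of "1 - Re s"] by (auto simp: H_def algebra_simps)
  define f where "f = (\<lambda>s. F (SOME m. s \<in> H m) s)"
  have f: "f s = F m s" if "s \<in> H m" for m s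
    unfolding f_def by (rule agree) (use that someI[of "\<lambda>m. s \<in> H m" m] in auto)
  have "f holomorphic_on (\<Union>m. H m)"
  proof (rule holomorphic_on_UN_open)
    show "f holomorphic_on H m" for m
      using F(1)[of m] by (rule holomorphic_transform) (simp add: f)
  qed (rule openH)
  also have "(\<Union>m. H m) = UNIV" using cover by auto
  finally have "f holomorphic_on UNIV" .
  moreover have "f s = (s - 1) * dirichlet_zeta s" if "Re s > 1" for s
    using f[of s 0] F(2)[of s 0] that by (simp add: H_def)
  ultimately show ?thesis by blast
qed

lemma ex1_zeta_continuation: "\<exists>!f. zeta_continuation f"
proof -
  obtain F where F: "F holomorphic_on UNIV"
    "\<And>s. Re s > 1 \<Longrightarrow> F s = (s - 1) * dirichlet_zeta s"
    using zeta_entire_continuation by blast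
  define f where "f = (\<lambda>s. F s / (s - 1))"
  have "f holomorphic_on - {1}"
    unfolding f_def by (intro holomorphic_intros holomorphic_on_subset[OF F(1)]) auto
  moreover have "(\<lambda>n. 1 / of_nat (Suc n) powr s) sums f s" if "Re s > 1" for s
  proof -
    have "s \<noteq> 1" using that by auto
    then have "f s = dirichlet_zeta s" by (simp add: f_def F(2)[OF that])
    then show ?thesis
      using dirichlet_zeta_sums[OF that] by (simp add: powr_minus_divide)
  qed
  ultimately have "zeta_continuation f" by (simp add: zeta_continuation_def f_def)
  moreover have "g = h" if "zeta_continuation g" "zeta_continuation h" for g h
  proof
    fix s
    show "g s = h s"
    proof (cases "s = 1")
      case False
      show ?thesis
      proof (rule analytic_continuation_open[where f = g and g = h and z = s
          and s = "{s. Re s > 1}" and s' = "- {1}"])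
        show "{s. Re s > 1} \<noteq> {}" by (auto intro!: exI[of _ 2])
        show "connected (- {1 :: complex})"
          by (intro connected_punctured_universe) simp
        show "g z = h z" if "z \<in> {s. Re s > 1}" for z
          using that \<open>zeta_continuation g\<close> \<open>zeta_continuation h\<close>
          by (auto simp: zeta_continuation_def intro: sums_unique2)
      qed (use that False in \<open>auto simp: zeta_continuation_def open_halfspace_Re_gt\<close>)
    qed (use that in \<open>auto simp: zeta_continuation_def\<close>)
  qed
  ultimately show ?thesis by blast
qed

lemma zeta_continuation_zeta: "zeta_continuation zeta"
  unfolding zeta_def by (rule theI'[OF ex1_zeta_continuation])

end

theory Submission
  imports Defs "HOL-Computational_Algebra.Primes" "HOL-Real_Asymp.Real_Asymp"
begin

text \<open>
  Write \<open>F = \<zeta>' / \<zeta>\<close> and \<open>L = log t\<close>. High up, \<open>\<zeta>'\<close> has no zeros to the left of the critical line,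
  so the hypothesis keeps its zeros at distance \<open>a / L\<close> from the line, for some \<open>a > 0\<close>. By the
  functional equation \<open>F(s) + F(1 - s) = \<kappa>(s)\<close> with \<open>\<kappa>(s) = - L + O(1)\<close>. Around a zero \<open>w\<close> of \<open>\<zeta>\<close>
  the function \<open>B = 1 - \<kappa> \<zeta> / \<zeta>' = - F(1 - s) / F(s)\<close> is therefore holomorphic without zeros, has
  modulus 1 on the line, and essentially at most 1 to its left and at least 1 to its right. So
  \<open>log B\<close> is close to a typically real function with derivative \<open>- \<kappa>(w)\<close>, which forces \<open>B\<close> away
  from 1, and hence \<open>F = O(L)\<close>, on a circle of radius \<open>r / L\<close> around \<open>w\<close>.

  This bound spreads to all points \<open>1/2 + c / L + i t\<close>. If there is a zero at distance \<open>O(1 / L)\<close>,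
  Harnack's inequality applies to \<open>F + L\<close>, whose real part is positive to the right of the line.
  Otherwise \<open>Im F\<close> is almost increasing on the line between consecutive zeros, and its bounds at
  the two ends of the gap control the whole partial fraction sum.

  Finally the three lines theorem is applied to \<open>F + (\<Sum>p \<le> N. log p / (p\<^sup>s - 1))\<close> with \<open>N \<approx> L\<^sup>2\<close>,
  which is \<open>O(L)\<close> on the left line and \<open>O(1 / N)\<close> on \<open>Re s = 2\<close>; the sum over primes itself is
  \<open>O(N powr (1 - \<sigma>))\<close>.
\<close>

subsection \<open>Tools from complex analysis\<close>

text \<open>The obstacle is one factor \<open>L\<close>. Near height \<open>t\<close> the
  logarithmic derivative is a sum over \<open>O(L)\<close> zeros plus \<open>O(L)\<close>, and at
  distance \<open>c / L\<close> from the line a single term can have size \<open>L\<close>, so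
  counting zeros gives only \<open>O(L^2)\<close>. Nothing is known about the spacing of zeros on
  the scale \<open>1 / L\<close>: they may cluster there or leave much longer gaps. This is why the
  bound starts on circles around zeros and why the passage to the line at distance
  \<open>c / L\<close> splits into a near and a far case. The hypothesis on the derivative also
  makes high zeros of zeta simple, since a multiple zero would be a zero of the derivative on the
  critical line. The exponent \<open>2 - 2 * \<sigma>\<close> is the linear function with value 1 at
  \<open>1/2\<close> and \<open>-2\<close> at \<open>2\<close>. This explains the length
  \<open>N\<close> of order \<open>L^2\<close>: it turns the bound on \<open>Re s = 2\<close> into
  \<open>O(L^(-2))\<close>. Without the sum over primes one has only \<open>O(1)\<close> there, and
  the interpolated exponent would be \<open>(4 - 2 * \<sigma>) / 3\<close>, which is larger. The sum
  over primes then has the same size as the claimed bound, with a constant that grows as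
  \<open>\<sigma>\<close> approaches 1; hence the fixed upper limit below 1.\<close>

lemma Schwarz_ball:
  assumes hol: "f holomorphic_on ball w R" and R: "R > 0" and f0: "f w = 0"
    and less: "\<And>z. z \<in> ball w R \<Longrightarrow> norm (f z) < 1" and z: "z \<in> ball w R"
  shows "norm (f z) \<le> norm (z - w) / R"
proof -
  define g where "g = (\<lambda>u. f (w + of_real R * u))"
  have in_ball: "w + of_real R * u \<in> ball w R" if "norm u < 1" for u
    using that R by (simp add: dist_norm norm_mult)
  have "g holomorphic_on ball 0 1"
    unfolding g_def
    by (rule holomorphic_on_compose_gen[OF _ hol, unfolded o_def])
       (auto intro!: holomorphic_intros simp: in_ball simp del: mem_ball)
  moreover have "norm ((z - w) / of_real R) < 1"
    using z R by (simp add: norm_divide dist_norm norm_minus_commute)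
  ultimately have "norm (g ((z - w) / of_real R)) \<le> norm ((z - w) / of_real R)"
    using f0 in_ball less by (intro Schwarz_Lemma(1)) (auto simp: g_def)
  then show ?thesis using R by (simp add: g_def norm_divide)
qed

text \<open>With \<open>a = q w\<close>, the map \<open>u -> (u - a) / (u + cnj a)\<close> takes the
  right half plane to the unit disc and \<open>a\<close> to 0, so the Schwarz lemma applies to its
  composition with \<open>q\<close>. The triangle inequality turns this into a two-sided comparison
  of moduli, which is the form needed to move bounds between points of the disc.\<close>

lemma Harnack_norm:
  fixes q :: "complex \<Rightarrow> complex"
  assumes hol: "q holomorphic_on ball w R" and R: "R > 0"
    and pos: "\<And>z. z \<in> ball w R \<Longrightarrow> Re (q z) > 0"
    and z: "norm (z - w) \<le> \<rho> * R" and \<rho>: "\<rho> < 1"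
  shows "norm (q z) * (1 - \<rho>) \<le> norm (q w) * (1 + \<rho>)"
    and "norm (q w) * (1 - \<rho>) \<le> norm (q z) * (1 + \<rho>)"
proof -
  define a where "a = q w"
  define f where "f = (\<lambda>z. (q z - a) / (q z + cnj a))"
  have a: "Re a > 0" using pos[of w] R by (simp add: a_def)
  have nz: "q z + cnj a \<noteq> 0" if "z \<in> ball w R" for z
  proof
    assume "q z + cnj a = 0"
    then have "Re (q z + cnj a) = 0" by simp
    with pos[OF that] a show False by simp
  qed
  have "\<rho> * R < 1 * R" using \<rho> R by (rule mult_strict_right_mono)
  then have zb: "z \<in> ball w R"
    using z by (simp add: dist_norm norm_minus_commute)
  have fz: "norm (f z) \<le> norm (z - w) / R"
  proof (rule Schwarz_ball[OF _ R _ _ zb])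
    show "f holomorphic_on ball w R"
      unfolding f_def using nz by (intro holomorphic_intros hol) auto
    show "f w = 0" by (simp add: f_def a_def)
    show "norm (f z) < 1" if "z \<in> ball w R" for z
    proof -
      have "(norm (q z - a))\<^sup>2 < (norm (q z + cnj a))\<^sup>2"
        unfolding cmod_power2 using mult_pos_pos[OF pos[OF that] a]
        by (simp add: power2_eq_square algebra_simps)
      then have "norm (q z - a) < norm (q z + cnj a)"
        using norm_ge_zero power_less_imp_less_base by blast
      then show ?thesis using nz[OF that] by (simp add: f_def norm_divide)
    qed
  qed
  also have "\<dots> \<le> \<rho>" using z R by (simp add: field_simps)
  finally have f\<rho>: "norm (f z) \<le> \<rho>" .
  then have "norm (q z - a) \<le> \<rho> * norm (q z + cnj a)"
    using nz[OF zb] by (simp add: f_def norm_divide field_simps)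
  also have "\<dots> \<le> \<rho> * (norm (q z) + norm a)"
    using order_trans[OF norm_ge_zero f\<rho>] norm_triangle_ineq[of "q z" "cnj a"]
    by (intro mult_left_mono) auto
  finally have *: "norm (q z - a) \<le> \<rho> * (norm (q z) + norm a)" .
  have "norm (q z) \<le> norm (q z - a) + norm a" "norm a \<le> norm (q z - a) + norm (q z)"
    using norm_triangle_ineq[of "q z - a" a] norm_triangle_ineq4[of "q z" "q z - a"] by auto
  with * show "norm (q z) * (1 - \<rho>) \<le> norm (q w) * (1 + \<rho>)"
    "norm (q w) * (1 - \<rho>) \<le> norm (q z) * (1 + \<rho>)"
    by (auto simp: algebra_simps a_def)
qed

text \<open>Minimum principle for a harmonic function, read off from the maximum modulus principle
  for \<open>exp (- p)\<close>.\<close>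

lemma Re_ge_from_sphere:
  assumes hol: "p holomorphic_on ball w R'" and R: "0 < R" "R < R'"
    and ge: "\<And>z. norm (z - w) = R \<Longrightarrow> Re (p z) \<ge> - e"
    and z: "norm (z - w) \<le> R"
  shows "Re (p z) \<ge> - e"
proof -
  have sub: "cball w R \<subseteq> ball w R'" using R by auto
  have "norm (exp (- p z)) \<le> exp e"
  proof (rule maximum_modulus_frontier[where S = "cball w R" and f = "\<lambda>z. exp (- p z)" and \<xi> = z])
    have h: "(\<lambda>z. exp (- p z)) holomorphic_on cball w R"
      by (intro holomorphic_intros holomorphic_on_subset[OF hol sub])
    show "(\<lambda>z. exp (- p z)) holomorphic_on interior (cball w R)"
      by (rule holomorphic_on_subset[OF h interior_subset])
    show "continuous_on (closure (cball w R)) (\<lambda>z. exp (- p z))"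
      using holomorphic_on_imp_continuous_on[OF h] by simp
    show "norm (exp (- p z)) \<le> exp e" if "z \<in> frontier (cball w R)" for z
      using that ge[of z] R by (simp add: dist_norm norm_minus_commute)
  qed (use z in \<open>auto simp: dist_norm norm_minus_commute\<close>)
  then show ?thesis by simp
qed

lemma norm_deriv_le:
  assumes hol: "f holomorphic_on ball w R" and r: "0 < r"
    and sub: "cball z r \<subseteq> ball w R" and bd: "\<And>u. u \<in> cball z r \<Longrightarrow> norm (f u) \<le> B"
  shows "norm (deriv f z) \<le> B / r"
proof -
  have h: "f holomorphic_on cball z r" by (rule holomorphic_on_subset[OF hol sub])
  have "norm ((deriv ^^ 1) f z) \<le> fact 1 * B / r ^ 1"
    by (rule Cauchy_inequality)
       (use h r bd in \<open>auto simp: dist_norm norm_minus_commute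
          intro: holomorphic_on_imp_continuous_on holomorphic_on_subset\<close>)
  then show ?thesis by simp
qed

lemma Lipschitz_inner_ball:
  assumes hol: "f holomorphic_on ball w (2 * r)" and r: "0 < r"
    and bd: "\<And>u. u \<in> ball w (2 * r) \<Longrightarrow> norm (f u) \<le> B"
    and x: "x \<in> ball w r" and y: "y \<in> ball w r"
  shows "norm (f x - f y) \<le> B / r * norm (x - y)"
proof (rule field_differentiable_bound[where S = "ball w r" and f' = "deriv f"])
  fix u assume u: "u \<in> ball w r"
  have "f field_differentiable at u"
    using hol u r by (intro holomorphic_on_imp_differentiable_at[OF hol]) auto
  then show "(f has_field_derivative deriv f u) (at u within ball w r)"
    using DERIV_deriv_iff_field_differentiable has_field_derivative_at_within by blast
  have sub: "cball u r \<subseteq> ball w (2 * r)"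
  proof
    fix v assume "v \<in> cball u r"
    with u show "v \<in> ball w (2 * r)" using dist_triangle[of w v u] by (simp)
  qed
  show "norm (deriv f u) \<le> B / r"
    by (rule norm_deriv_le[OF hol r sub]) (use sub bd in blast)
qed (use x y in auto)

text \<open>The maximum principle is applied to \<open>G\<close> times two exponentials that equal 1
  at the point in question. The factor with slope \<open>k\<close> shifts weight between the
  vertical sides; the caller chooses it so that both sides give the same bound. The Gaussian factor
  contributes \<open>exp (- R\<^sup>2)\<close> on the horizontal sides and costs at most
  \<open>exp ((\<beta> - \<alpha>)\<^sup>2)\<close> elsewhere.\<close>

lemma three_lines_rectangle:
  fixes G :: "complex \<Rightarrow> complex" and k :: real
  assumes hol: "G holomorphic_on S" and S: "cbox (Complex \<alpha> (t - R)) (Complex \<beta> (t + R)) \<subseteq> S"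
    and \<alpha>: "\<alpha> \<le> \<sigma>" "\<sigma> \<le> \<beta>" and R: "R > 0"
    and left: "\<And>u. \<bar>u - t\<bar> \<le> R \<Longrightarrow> norm (G (Complex \<alpha> u)) * exp (k * (\<alpha> - \<sigma>)) \<le> B"
    and right: "\<And>u. \<bar>u - t\<bar> \<le> R \<Longrightarrow> norm (G (Complex \<beta> u)) * exp (k * (\<beta> - \<sigma>)) \<le> B"
    and hor: "\<And>x u. \<alpha> \<le> x \<Longrightarrow> x \<le> \<beta> \<Longrightarrow> \<bar>u - t\<bar> = R \<Longrightarrow>
                norm (G (Complex x u)) * exp (k * (x - \<sigma>)) * exp (- R\<^sup>2) \<le> B"
  shows "norm (G (Complex \<sigma> t)) \<le> exp ((\<beta> - \<alpha>)\<^sup>2) * B"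
proof -
  define s0 where "s0 = Complex \<sigma> t"
  define f where "f = (\<lambda>s. G s * exp (of_real k * (s - s0)) * exp ((s - s0)\<^sup>2))"
  define Q where "Q = cbox (Complex \<alpha> (t - R)) (Complex \<beta> (t + R))"
  have Q: "z \<in> Q \<longleftrightarrow> \<alpha> \<le> Re z \<and> Re z \<le> \<beta> \<and> \<bar>Im z - t\<bar> \<le> R" for z
    by (auto simp: Q_def in_cbox_complex_iff)
  have f_hol: "f holomorphic_on Q"
    unfolding f_def by (intro holomorphic_intros holomorphic_on_subset[OF hol]) (simp add: Q_def S)
  have nf: "norm (f s) = norm (G s) * exp (k * (Re s - \<sigma>)) * exp ((Re s - \<sigma>)\<^sup>2 - (Im s - t)\<^sup>2)" for s
    by (simp add: f_def norm_mult norm_exp_eq_Re s0_def power2_eq_square)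
  have "norm (f s0) \<le> exp ((\<beta> - \<alpha>)\<^sup>2) * B"
  proof (rule maximum_modulus_frontier[where S = Q and f = f and \<xi> = s0])
    show "f holomorphic_on interior Q" by (rule holomorphic_on_subset[OF f_hol interior_subset])
    show "continuous_on (closure Q) f"
      using holomorphic_on_imp_continuous_on[OF f_hol] by (simp add: Q_def)
    show "bounded Q" by (simp add: Q_def)
    show "s0 \<in> Q" using \<alpha> R by (simp add: Q s0_def)
    fix s assume "s \<in> frontier Q"
    then have s: "s \<in> Q" and "s \<notin> interior Q"
      by (auto simp: frontier_def Q_def)
    then have "Re s = \<alpha> \<or> Re s = \<beta> \<or> \<bar>Im s - t\<bar> = R"
      by (auto simp: Q_def interior_cbox in_cbox_complex_iff in_box_complex_iff)
    moreover have sq: "(Re s - \<sigma>)\<^sup>2 \<le> (\<beta> - \<alpha>)\<^sup>2"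
      using s \<alpha> unfolding Q by (intro abs_le_square_iff[THEN iffD1]) auto
    have B: "B \<ge> 0"
      using left[of t] R by (smt (verit) exp_ge_zero mult_nonneg_nonneg norm_ge_zero)
    have key: "exp ((\<beta> - \<alpha>)\<^sup>2) * X \<ge> norm (f s)"
      if "norm (G s) * exp (k * (Re s - \<sigma>)) * exp (- (Im s - t)\<^sup>2) \<le> X" for X
    proof -
      have "norm (f s) = exp ((Re s - \<sigma>)\<^sup>2) * (norm (G s) * exp (k * (Re s - \<sigma>)) * exp (- (Im s - t)\<^sup>2))"
        by (simp add: nf exp_diff exp_minus field_simps)
      also have "\<dots> \<le> exp ((\<beta> - \<alpha>)\<^sup>2) * X"
        using sq that by (intro mult_mono) auto
      finally show ?thesis .
    qed
    have drop: "x * exp (- (Im s - t)\<^sup>2) \<le> B" if "x \<le> B" "x \<ge> 0" for x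
      using that mult_mono[of x B "exp (- (Im s - t)\<^sup>2)" 1] B by simp
    ultimately show "norm (f s) \<le> exp ((\<beta> - \<alpha>)\<^sup>2) * B"
    proof (elim disjE)
      assume *: "Re s = \<alpha>"
      then have "s = Complex \<alpha> (Im s)" by (simp add: complex_eq_iff)
      then show ?thesis using left[of "Im s"] s * unfolding Q by (intro key drop) auto
    next
      assume *: "Re s = \<beta>"
      then have "s = Complex \<beta> (Im s)" by (simp add: complex_eq_iff)
      then show ?thesis using right[of "Im s"] s * unfolding Q by (intro key drop) auto
    next
      assume *: "\<bar>Im s - t\<bar> = R"
      then have "(Im s - t)\<^sup>2 = R\<^sup>2" by (metis power2_abs)
      then show ?thesis using hor[of "Re s" "Im s"] s * unfolding Q by (intro key) auto
    qed
  qed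
  then show ?thesis by (simp add: f_def s0_def)
qed

section \<open>Factoring out zeros, and logarithmic derivatives\<close>

lemma holomorphic_divide_zero:
  assumes hol: "f holomorphic_on S" and S: "open S" "connected S"
    and nz: "z0 \<in> S" "f z0 \<noteq> 0" and a: "a \<in> S" "f a = 0"
  shows "\<exists>n g. n > (0::nat) \<and> g holomorphic_on S \<and> g a \<noteq> 0 \<and> (\<forall>z\<in>S. f z = (z - a) ^ n * g z)"
proof -
  have "\<not> f constant_on S" using nz a unfolding constant_on_def by metis
  then obtain g r n where g: "0 < n" "0 < r" "ball a r \<subseteq> S" "g holomorphic_on ball a r"
    "\<And>w. w \<in> ball a r \<Longrightarrow> f w = (w - a) ^ n * g w" "\<And>w. w \<in> ball a r \<Longrightarrow> g w \<noteq> 0"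
    using holomorphic_factor_zero_nonconstant[OF hol S a(1) a(2)] by metis
  define G where "G = (\<lambda>z. if z = a then g a else f z / (z - a) ^ n)"
  have "G holomorphic_on ball a r"
    using g(4) by (rule holomorphic_transform) (auto simp: G_def g(5))
  moreover have "(\<lambda>z. f z / (z - a) ^ n) holomorphic_on S - {a}"
    by (intro holomorphic_intros holomorphic_on_subset[OF hol]) auto
  then have "G holomorphic_on S - {a}"
    by (rule holomorphic_transform) (auto simp: G_def)
  ultimately have "G holomorphic_on ball a r \<union> (S - {a})"
    using S by (intro holomorphic_on_Un) auto
  moreover have "ball a r \<union> (S - {a}) = S" using g(2,3) a by auto
  moreover have "G a \<noteq> 0" using g(2) g(6)[of a] by (simp add: G_def)
  moreover have "f z = (z - a) ^ n * G z" if "z \<in> S" for z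
    using a(2) g(1) by (auto simp: G_def)
  ultimately show ?thesis using g(1) by auto
qed

text \<open>Multiplicities are not defined separately: \<open>g a \<noteq> 0\<close> forces
  \<open>m a\<close> to be the multiplicity of the zero \<open>a\<close>.\<close>

lemma holomorphic_divide_zeros:
  assumes fin: "finite Z" and S: "open S" "connected S" and Z: "Z \<subseteq> S"
    and hol: "f holomorphic_on S" and nz: "z0 \<in> S" "f z0 \<noteq> 0" and zero: "\<And>a. a \<in> Z \<Longrightarrow> f a = 0"
  shows "\<exists>(m :: complex \<Rightarrow> nat) g. g holomorphic_on S \<and> (\<forall>a\<in>Z. m a > 0 \<and> g a \<noteq> 0) \<and>
           (\<forall>z\<in>S. f z = g z * (\<Prod>a\<in>Z. (z - a) ^ m a))"
  using fin Z zero
proof (induction Z rule: finite_induct)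
  case empty
  show ?case using hol by (intro exI[of _ "\<lambda>_. 0"] exI[of _ f]) auto
next
  case (insert b Z)
  then obtain m g where g: "g holomorphic_on S" "\<forall>a\<in>Z. m a > (0::nat) \<and> g a \<noteq> 0"
    "\<forall>z\<in>S. f z = g z * (\<Prod>a\<in>Z. (z - a) ^ m a)" by auto
  have b: "b \<in> S" "f b = 0" using insert.prems by auto
  have "g b = 0" using g(3) b insert.hyps by (auto simp: prod_zero_iff)
  moreover have "g z0 \<noteq> 0" using g(3) nz by auto
  ultimately obtain n h where h: "n > 0" "h holomorphic_on S" "h b \<noteq> 0"
    "\<forall>z\<in>S. g z = (z - b) ^ n * h z"
    using holomorphic_divide_zero[OF g(1) S nz(1) _ b(1)] by blast
  show ?case
  proof (intro exI conjI ballI)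
    show "h holomorphic_on S" by fact
    show "(m(b := n)) a > 0" if "a \<in> insert b Z" for a using that g(2) h(1) by auto
    show "h a \<noteq> 0" if "a \<in> insert b Z" for a
      using that g(2) h(3,4) insert.prems(1) by fastforce
    show "f z = h z * (\<Prod>a\<in>insert b Z. (z - a) ^ (m(b := n)) a)" if "z \<in> S" for z
    proof -
      have "(\<Prod>a\<in>insert b Z. (z - a) ^ (m(b := n)) a) = (z - b) ^ n * (\<Prod>a\<in>Z. (z - a) ^ m a)"
      proof -
        have "(\<Prod>a\<in>Z. (z - a) ^ (m(b := n)) a) = (\<Prod>a\<in>Z. (z - a) ^ m a)"
          by (rule prod.cong) (use insert.hyps in auto)
        then show ?thesis using insert.hyps by simp
      qed
      then show ?thesis using g(3) h(4) that by simp
    qed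
  qed
qed

text \<open>The derivative is stated as the product times a sum of logarithmic derivatives, so that
  the product cancels on division. It is used for linear factors, for Blaschke factors and for Euler
  factors.\<close>

lemma has_field_derivative_prod_power:
  fixes \<phi> :: "'a \<Rightarrow> complex \<Rightarrow> complex" and m :: "'a \<Rightarrow> nat"
  assumes "finite Z" "\<And>a. a \<in> Z \<Longrightarrow> (\<phi> a has_field_derivative \<phi>' a) (at z)"
    and "\<And>a. a \<in> Z \<Longrightarrow> \<phi> a z \<noteq> 0"
  shows "((\<lambda>z. \<Prod>a\<in>Z. \<phi> a z ^ m a) has_field_derivative
           (\<Prod>a\<in>Z. \<phi> a z ^ m a) * (\<Sum>a\<in>Z. of_nat (m a) * \<phi>' a / \<phi> a z)) (at z)"
  using assms
proof (induction Z rule: finite_induct)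
  case (insert b Z)
  have b: "(\<phi> b has_field_derivative \<phi>' b) (at z)" "\<phi> b z \<noteq> 0" by (rule insert.prems, simp)+
  have "((\<lambda>z. \<phi> b z ^ m b) has_field_derivative (\<phi> b z ^ m b * (of_nat (m b) * \<phi>' b / \<phi> b z))) (at z)"
  proof -
    have "\<phi> b z ^ m b * (of_nat (m b) * \<phi>' b / \<phi> b z) = of_nat (m b) * (\<phi>' b * \<phi> b z ^ (m b - Suc 0))"
      using b(2) by (cases "m b") (simp_all del: of_nat_Suc)
    then show ?thesis using DERIV_power[OF b(1), of "m b"] by (simp only:)
  qed
  moreover have "((\<lambda>z. \<Prod>a\<in>Z. \<phi> a z ^ m a) has_field_derivative
      (\<Prod>a\<in>Z. \<phi> a z ^ m a) * (\<Sum>a\<in>Z. of_nat (m a) * \<phi>' a / \<phi> a z)) (at z)"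
    by (rule insert.IH; rule insert.prems) simp_all
  ultimately have "((\<lambda>z. \<phi> b z ^ m b * (\<Prod>a\<in>Z. \<phi> a z ^ m a)) has_field_derivative
      (\<phi> b z ^ m b * (of_nat (m b) * \<phi>' b / \<phi> b z)) * (\<Prod>a\<in>Z. \<phi> a z ^ m a) +
      (\<Prod>a\<in>Z. \<phi> a z ^ m a) * (\<Sum>a\<in>Z. of_nat (m a) * \<phi>' a / \<phi> a z) * \<phi> b z ^ m b) (at z)"
    by (rule DERIV_mult)
  moreover have "x * d * y + y * s * x = x * y * (d + s)" for x y d s :: complex
    by (simp add: algebra_simps)
  ultimately show ?case
    unfolding prod.insert[OF insert.hyps] sum.insert[OF insert.hyps] by (simp only:)
qed auto

lemma logderiv_mult:
  fixes f g :: "complex \<Rightarrow> complex"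
  assumes "(f has_field_derivative f') (at z)" "(g has_field_derivative g') (at z)"
    and "f z \<noteq> 0" "g z \<noteq> 0"
  shows "deriv (\<lambda>z. f z * g z) z / (f z * g z) = f' / f z + g' / g z"
proof -
  have "deriv (\<lambda>z. f z * g z) z = f' * g z + g' * f z"
    by (rule DERIV_imp_deriv) (rule DERIV_mult[OF assms(1,2)])
  then show ?thesis using assms by (simp add: field_simps)
qed

lemma deriv_cong_open:
  assumes "open S" "z \<in> S" "\<And>x. x \<in> S \<Longrightarrow> f x = g x"
  shows "deriv f z = deriv g z"
  by (rule deriv_cong_ev) (use assms in \<open>auto simp: eventually_nhds\<close>)

text \<open>Landau's local form of the partial fraction expansion of a logarithmic derivative:
  multiplying by the Blaschke factors of the zeros bounds their number (Jensen), and the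
  quotient has a holomorphic logarithm whose real part is bounded above.\<close>

lemma local_logderiv:
  fixes R0 R1 R2 R3 :: real
  assumes R: "0 < R0" "R0 < R1" "R1 < R2" "R2 < R3"
  shows "\<exists>C. \<forall>f w M. f holomorphic_on ball w R3 \<longrightarrow> f w \<noteq> 0 \<longrightarrow> M \<ge> 1 \<longrightarrow>
      (\<forall>z. norm (z - w) = R2 \<longrightarrow> norm (f z) \<le> exp M * norm (f w)) \<longrightarrow>
      (\<exists>Z m h. finite Z \<and> Z = {z \<in> cball w R1. f z = 0} \<and> (\<forall>a\<in>Z. m a > (0::nat)) \<and>
         real (\<Sum>a\<in>Z. m a) \<le> C * M \<and> h holomorphic_on ball w R1 \<and>
         (\<forall>z\<in>cball w R0. norm (h z) \<le> C * M) \<and>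
         (\<forall>z\<in>ball w R1. f z \<noteq> 0 \<longrightarrow> deriv f z / f z = (\<Sum>a\<in>Z. of_nat (m a) / (z - a)) + h z))"
proof -
  \<comment> \<open>Gain per zero in Jensen's inequality: each zero in the disc of radius
    \<open>R1\<close> contributes a factor at least \<open>R2 / R1\<close> at the centre.\<close>
  define \<kappa> where "\<kappa> = ln (R2 / R1)"
  have \<kappa>: "\<kappa> > 0" using R by (simp add: \<kappa>_def)
  define \<rho> where "\<rho> = (R0 + R1) / 2 / R1"
  have \<rho>: "0 < \<rho>" "\<rho> < 1" using R by (auto simp: \<rho>_def field_simps)
  \<comment> \<open>Harnack on the disc of radius \<open>(R0 + R1) / 2\<close>, followed by Cauchy's
    inequality with radius \<open>(R1 - R0) / 2\<close>.\<close>
  define C1 where "C1 = 2 * (1 + \<rho>) / (1 - \<rho>) / ((R1 - R0) / 2)"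
  define C where "C = 1 / \<kappa> + C1 + 1 / \<kappa> * (R1 / (R2\<^sup>2 - R1 * R1))"
  have R12: "R2\<^sup>2 - R1 * R1 > 0"
    using R mult_strict_mono[of R1 R2 R1 R2] by (simp add: power2_eq_square)
  have C1: "C1 \<ge> 0" using R \<rho> by (simp add: C1_def)
  have C: "C \<ge> 1 / \<kappa>" "C \<ge> C1 + 1 / \<kappa> * (R1 / (R2\<^sup>2 - R1 * R1))"
    using C1 \<kappa> R R12 by (auto simp: C_def)
  show ?thesis
  proof (intro exI[of _ C] allI impI)
    fix f :: "complex \<Rightarrow> complex" and w M
    assume hol: "f holomorphic_on ball w R3" and fw: "f w \<noteq> 0" and M: "M \<ge> (1::real)"
      and bd: "\<forall>z. norm (z - w) = R2 \<longrightarrow> norm (f z) \<le> exp M * norm (f w)"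
    define Z where "Z = {z \<in> cball w R1. f z = 0}"
    have w3: "w \<in> ball w R3" using R by simp
    have Zsub: "Z \<subseteq> ball w R3" using R by (auto simp: Z_def)
    have "finite Z"
    proof (cases "Z = {}")
      case False
      then obtain a where a: "a \<in> Z" by blast
      then have "f a = 0" "a \<in> ball w R3" using Zsub by (auto simp: Z_def)
      then have "\<not> f constant_on ball w R3"
        using fw w3 unfolding constant_on_def by metis
      then show ?thesis
        unfolding Z_def using R by (intro holomorphic_compact_finite_zeros[OF hol]) auto
    qed auto
    have zero: "f a = 0" if "a \<in> Z" for a using that by (simp add: Z_def)
    obtain m g where g: "g holomorphic_on ball w R3" "\<forall>a\<in>Z. m a > (0::nat) \<and> g a \<noteq> 0"
      "\<forall>z\<in>ball w R3. f z = g z * (\<Prod>a\<in>Z. (z - a) ^ m a)"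
      using holomorphic_divide_zeros[OF \<open>finite Z\<close> open_ball connected_ball Zsub hol w3 fw zero] by blast
    have g_nz: "g z \<noteq> 0" if "z \<in> cball w R1" for z
    proof
      assume "g z = 0"
      moreover have "z \<in> ball w R3" using that R by auto
      ultimately have "f z = 0" using g(3) by simp
      then show False using that g(2) \<open>g z = 0\<close> by (auto simp: Z_def)
    qed
    define N where "N = (\<Sum>a\<in>Z. m a)"
    \<comment> \<open>Replacing \<open>z - a\<close> by this factor amounts to dividing by the
      Blaschke factor of \<open>a\<close>: the modulus on the sphere of radius \<open>R2\<close> is
      unchanged, but there is no zero in the disc of radius \<open>R1\<close>. So \<open>E\<close>
      is \<open>f\<close> with these zeros removed at no cost on the sphere.\<close>
    define \<beta> where "\<beta> = (\<lambda>a z. (of_real R2 ^ 2 - cnj (a - w) * (z - w)) / of_real R2 :: complex)"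
    define E where "E = (\<lambda>z. g z * (\<Prod>a\<in>Z. \<beta> a z ^ m a))"
    have aR: "norm (a - w) \<le> R1" if "a \<in> Z" for a
      using that by (simp add: Z_def dist_norm norm_minus_commute)
    have denom: "norm (of_real R2 ^ 2 - cnj (a - w) * (z - w)) \<ge> R2\<^sup>2 - R1 * R1"
      if "a \<in> Z" "z \<in> cball w R1" for a z
    proof -
      have "norm (cnj (a - w) * (z - w)) \<le> R1 * R1"
        unfolding norm_mult complex_mod_cnj using aR[OF that(1)] that(2) R
        by (intro mult_mono) (auto simp: dist_norm norm_minus_commute)
      moreover have "norm (of_real R2 ^ 2 :: complex) = R2\<^sup>2" by (simp add: norm_power)
      ultimately show ?thesis
        using norm_triangle_ineq2[of "of_real R2 ^ 2" "cnj (a - w) * (z - w)"] by simp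
    qed
    have \<beta>_nz: "\<beta> a z \<noteq> 0" if "a \<in> Z" "z \<in> cball w R1" for a z
      using denom[OF that] R12 R by (auto simp: \<beta>_def)
    have E_hol: "E holomorphic_on ball w R3"
      unfolding E_def \<beta>_def using R by (intro holomorphic_intros g(1)) auto
    have E_sphere: "norm (E z) \<le> exp M * norm (f w)" if z: "norm (z - w) = R2" for z
    proof -
      have "norm (\<beta> a z) = norm (z - a)" for a
      proof -
        have "of_real R2 ^ 2 = (z - w) * cnj (z - w)"
          using z by (simp only: complex_norm_square[symmetric]) simp
        then have "of_real R2 ^ 2 - cnj (a - w) * (z - w) = (z - w) * cnj (z - a)"
          by (simp add: algebra_simps)
        then have "norm (\<beta> a z) = R2 * norm (cnj (z - a)) / R2"
          using z R by (simp add: \<beta>_def norm_divide norm_mult del: complex_cnj_diff)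
        then show ?thesis using R unfolding complex_mod_cnj by simp
      qed
      then have "norm (E z) = norm (f z)"
        using g(3) z R by (simp add: E_def norm_mult prod_norm[symmetric] norm_power dist_norm norm_minus_commute)
      then show ?thesis using bd z by simp
    qed
    have E_le: "norm (E z) \<le> exp M * norm (f w)" if "norm (z - w) \<le> R2" for z
    proof (rule maximum_modulus_frontier[where S = "cball w R2" and f = E and \<xi> = z])
      have h: "E holomorphic_on cball w R2" by (rule holomorphic_on_subset[OF E_hol]) (use R in auto)
      show "E holomorphic_on interior (cball w R2)"
        by (rule holomorphic_on_subset[OF h interior_subset])
      show "continuous_on (closure (cball w R2)) E"
        using holomorphic_on_imp_continuous_on[OF h] by simp
      show "norm (E z) \<le> exp M * norm (f w)" if "z \<in> frontier (cball w R2)" for z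
        using that R by (intro E_sphere) (simp add: dist_norm norm_minus_commute)
    qed (use that in \<open>auto simp: dist_norm norm_minus_commute\<close>)
    \<comment> \<open>At the centre every new factor has modulus \<open>R2\<close>, whereas
      \<open>norm (w - a) \<le> R1\<close>. Together with the bound on the sphere this limits the
      number of zeros.\<close>
    have E_w: "norm (E w) \<ge> norm (f w) * (R2 / R1) ^ N"
    proof -
      have "norm (f w) = norm (g w) * (\<Prod>a\<in>Z. norm (w - a) ^ m a)"
        using g(3) w3 by (simp add: norm_mult prod_norm[symmetric] norm_power)
      also have "\<dots> \<le> norm (g w) * (\<Prod>a\<in>Z. R1 ^ m a)"
        using aR by (intro mult_left_mono prod_mono conjI power_mono) (auto simp: norm_minus_commute)
      also have "(\<Prod>a\<in>Z. R1 ^ m a) = R1 ^ N" by (simp add: N_def power_sum)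
      finally have "norm (f w) * (R2 / R1) ^ N \<le> norm (g w) * R1 ^ N * (R2 / R1) ^ N"
        using R by (intro mult_right_mono) auto
      also have "\<dots> = norm (g w) * R2 ^ N" using R by (simp add: power_divide)
      also have "\<dots> = norm (E w)"
        using R by (simp add: E_def norm_mult \<beta>_def power2_eq_square prod_norm[symmetric] norm_power N_def power_sum)
      finally show ?thesis .
    qed
    have "norm (f w) * (R2 / R1) ^ N \<le> norm (f w) * exp M"
      using E_w E_le[of w] R by (simp add: mult.commute)
    then have "(R2 / R1) ^ N \<le> exp M" using fw by simp
    then have "ln ((R2 / R1) ^ N) \<le> ln (exp M)" using R by (subst ln_le_cancel_iff) auto
    then have N_le: "real N \<le> 1 / \<kappa> * M"
      using R \<kappa> unfolding \<kappa>_def by (subst (asm) ln_realpow) (simp_all add: field_simps)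
    have "(R2 / R1) ^ N \<ge> 1" using R by (intro one_le_power) auto
    then have E_w': "norm (E w) \<ge> norm (f w)"
      using E_w mult_left_mono[of 1 "(R2 / R1) ^ N" "norm (f w)"] by simp
    have E_nz: "E z \<noteq> 0" if "z \<in> ball w R1" for z
      using that g_nz[of z] \<beta>_nz \<open>finite Z\<close> by (auto simp: E_def prod_zero_iff)
    have sub1: "ball w R1 \<subseteq> ball w R3" using R by auto
    obtain l where l: "l holomorphic_on ball w R1" "\<And>z. z \<in> ball w R1 \<Longrightarrow> exp (l z) = E z"
      by (rule holomorphic_logarithm_exists[of "ball w R1" E w])
         (use R E_nz in \<open>auto intro!: holomorphic_on_subset[OF E_hol sub1]\<close>)
    \<comment> \<open>The real part of \<open>l z - l w\<close> is at most \<open>M\<close>, so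
      \<open>q\<close> has real part at least 1 and Harnack's inequality applies. Its derivative is
      minus the logarithmic derivative of \<open>E\<close>.\<close>
    define q where "q = (\<lambda>z. of_real (M + 1) - (l z - l w))"
    have q_hol: "q holomorphic_on ball w R1" unfolding q_def by (intro holomorphic_intros l)
    have w1: "w \<in> ball w R1" using R by simp
    have q_pos: "Re (q z) > 0" if "z \<in> ball w R1" for z
    proof -
      have "exp (Re (l z)) = norm (E z)" using l(2)[OF that] by (metis norm_exp_eq_Re)
      also have "\<dots> \<le> exp M * norm (f w)"
        using that R by (intro E_le) (auto simp: dist_norm norm_minus_commute)
      also have "\<dots> \<le> exp M * norm (E w)" using E_w' by simp
      also have "norm (E w) = exp (Re (l w))" using l(2)[OF w1] by (metis norm_exp_eq_Re)
      finally have "Re (l z) \<le> M + Re (l w)" by (simp add: exp_add[symmetric])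
      then show ?thesis by (simp add: q_def)
    qed
    have q_le: "norm (q z) \<le> 2 * (1 + \<rho>) / (1 - \<rho>) * M" if "norm (z - w) \<le> (R0 + R1) / 2" for z
    proof -
      have "norm (q z) * (1 - \<rho>) \<le> norm (q w) * (1 + \<rho>)"
        using that R \<rho> by (intro Harnack_norm(1)[OF q_hol _ q_pos]) (auto simp: \<rho>_def)
      also have "norm (q w) = M + 1"
        using M norm_of_real[of "M + 1", where 'a = complex] by (simp add: q_def)
      also have "(M + 1) * (1 + \<rho>) \<le> (2 * M) * (1 + \<rho>)" using M \<rho> by (intro mult_right_mono) auto
      finally show ?thesis using \<rho> by (simp add: field_simps)
    qed
    have q'_le: "norm (deriv q z) \<le> C1 * M" if "z \<in> cball w R0" for z
    proof -
      have sub: "cball z ((R1 - R0) / 2) \<subseteq> cball w ((R0 + R1) / 2)"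
      proof
        fix v assume "v \<in> cball z ((R1 - R0) / 2)"
        then have "dist w v \<le> R0 + (R1 - R0) / 2"
          using that dist_triangle[of w v z] by (simp add: dist_commute field_simps)
        then show "v \<in> cball w ((R0 + R1) / 2)" by (simp add: field_simps)
      qed
      have "norm (deriv q z) \<le> (2 * (1 + \<rho>) / (1 - \<rho>) * M) / ((R1 - R0) / 2)"
      proof (rule norm_deriv_le[OF q_hol])
        show "cball z ((R1 - R0) / 2) \<subseteq> ball w R1"
          using sub R by (rule_tac order_trans[OF sub]) auto
        show "norm (q u) \<le> 2 * (1 + \<rho>) / (1 - \<rho>) * M" if "u \<in> cball z ((R1 - R0) / 2)" for u
          using subsetD[OF sub that] by (intro q_le) (simp add: dist_norm norm_minus_commute)
      qed (use R in auto)
      also have "\<dots> = C1 * M" by (simp add: C1_def)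
      finally show ?thesis .
    qed
    \<comment> \<open>The holomorphic remainder is bounded through \<open>E\<close>: it differs from
      the logarithmic derivative of \<open>E\<close> by those of the factors \<open>\<beta>\<close>,
      at most \<open>O(M)\<close> terms with denominators bounded away from 0.\<close>
    define h where "h = (\<lambda>z. deriv g z / g z)"
    have h_hol: "h holomorphic_on ball w R1"
      unfolding h_def using g_nz
      by (intro holomorphic_intros holomorphic_deriv holomorphic_on_subset[OF g(1) sub1]) auto
    have g': "(g has_field_derivative deriv g z) (at z)" if "z \<in> ball w R1" for z
      using that sub1 by (intro holomorphic_derivI[OF g(1)]) auto
    have h_le: "norm (h z) \<le> C * M" if z: "z \<in> cball w R0" for z
    proof -
      have z1: "z \<in> ball w R1" using z R by auto
      have d\<beta>: "(\<beta> a has_field_derivative (- cnj (a - w) / of_real R2)) (at z)" for a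
        unfolding \<beta>_def using R by (auto intro!: derivative_eq_intros)
      have "deriv E z / E z = h z + (\<Prod>a\<in>Z. \<beta> a z ^ m a) *
          (\<Sum>a\<in>Z. of_nat (m a) * (- cnj (a - w) / of_real R2) / \<beta> a z) / (\<Prod>a\<in>Z. \<beta> a z ^ m a)"
        unfolding E_def h_def
        using g'[OF z1] g_nz \<beta>_nz z1 \<open>finite Z\<close>
        by (intro logderiv_mult has_field_derivative_prod_power d\<beta>) (auto simp: prod_zero_iff)
      also have "\<dots> = h z + (\<Sum>a\<in>Z. of_nat (m a) * (- cnj (a - w) / of_real R2) / \<beta> a z)"
        using \<beta>_nz z1 \<open>finite Z\<close> by (auto simp: prod_zero_iff)
      finally have 1: "h z = deriv E z / E z - (\<Sum>a\<in>Z. of_nat (m a) * (- cnj (a - w) / of_real R2) / \<beta> a z)"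
        by simp
      have dl: "(l has_field_derivative deriv l z) (at z)"
        using z1 by (intro holomorphic_derivI[OF l(1)]) auto
      have "deriv E z = deriv (\<lambda>z. exp (l z)) z"
        using z1 by (intro deriv_cong_open[of "ball w R1"]) (auto simp: l(2))
      also have "\<dots> = exp (l z) * deriv l z"
        by (rule DERIV_imp_deriv) (use dl in \<open>auto intro!: derivative_eq_intros\<close>)
      finally have "deriv E z / E z = deriv l z" using l(2)[OF z1] by (metis exp_not_eq_zero nonzero_mult_div_cancel_left)
      also have "deriv l z = - deriv q z"
      proof -
        have "(q has_field_derivative (0 - (deriv l z - 0))) (at z)"
          unfolding q_def by (intro derivative_intros dl)
        then show ?thesis by (simp add: DERIV_imp_deriv)
      qed
      finally have 2: "norm (deriv E z / E z) \<le> C1 * M" using q'_le[OF z] by simp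
      have "norm (\<Sum>a\<in>Z. of_nat (m a) * (- cnj (a - w) / of_real R2) / \<beta> a z) \<le>
          (\<Sum>a\<in>Z. real (m a) * (R1 / (R2\<^sup>2 - R1 * R1)))"
      proof (rule sum_norm_le)
        fix a assume a: "a \<in> Z"
        have "norm (of_nat (m a) * (- cnj (a - w) / of_real R2) / \<beta> a z) =
            real (m a) * (norm (a - w) / norm (of_real R2 ^ 2 - cnj (a - w) * (z - w)))"
          using R by (simp add: \<beta>_def norm_mult norm_divide del: complex_cnj_diff)
        also have "\<dots> \<le> real (m a) * (R1 / (R2\<^sup>2 - R1 * R1))"
          using aR[OF a] denom[OF a, of z] z1 R R12
          by (intro mult_left_mono frac_le) auto
        finally show "norm (of_nat (m a) * (- cnj (a - w) / of_real R2) / \<beta> a z) \<le> \<dots>" .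
      qed
      also have "\<dots> = real N * (R1 / (R2\<^sup>2 - R1 * R1))" by (simp only: N_def of_nat_sum sum_distrib_right)
      also have "\<dots> \<le> 1 / \<kappa> * M * (R1 / (R2\<^sup>2 - R1 * R1))"
        using N_le R R12 by (intro mult_right_mono) auto
      finally have "norm (h z) \<le> C1 * M + 1 / \<kappa> * M * (R1 / (R2\<^sup>2 - R1 * R1))"
        unfolding 1 using 2 by (intro order_trans[OF norm_triangle_ineq4]) auto
      also have "\<dots> = (C1 + 1 / \<kappa> * (R1 / (R2\<^sup>2 - R1 * R1))) * M" by (simp add: algebra_simps)
      also have "\<dots> \<le> C * M" using C M by (intro mult_right_mono) auto
      finally show ?thesis .
    qed
    show "\<exists>Z m h. finite Z \<and> Z = {z \<in> cball w R1. f z = 0} \<and> (\<forall>a\<in>Z. m a > (0::nat)) \<and>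
         real (\<Sum>a\<in>Z. m a) \<le> C * M \<and> h holomorphic_on ball w R1 \<and>
         (\<forall>z\<in>cball w R0. norm (h z) \<le> C * M) \<and>
         (\<forall>z\<in>ball w R1. f z \<noteq> 0 \<longrightarrow> deriv f z / f z = (\<Sum>a\<in>Z. of_nat (m a) / (z - a)) + h z)"
    proof (intro exI[of _ Z] exI[of _ m] exI[of _ h] conjI ballI impI)
      show "real (\<Sum>a\<in>Z. m a) \<le> C * M"
        using N_le C M mult_right_mono[of "1 / \<kappa>" C M] by (simp add: N_def)
      show "deriv f z / f z = (\<Sum>a\<in>Z. of_nat (m a) / (z - a)) + h z"
        if z: "z \<in> ball w R1" and fz: "f z \<noteq> 0" for z
      proof -
        have ne: "z - a \<noteq> 0" if "a \<in> Z" for a using fz zero[OF that] by auto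
        have "deriv f z / f z = deriv (\<lambda>z. g z * (\<Prod>a\<in>Z. (z - a) ^ m a)) z / (g z * (\<Prod>a\<in>Z. (z - a) ^ m a))"
          using g(3) z sub1 deriv_cong_open[of "ball w R3" z f "\<lambda>z. g z * (\<Prod>a\<in>Z. (z - a) ^ m a)"]
          by auto
        also have "\<dots> = h z + (\<Prod>a\<in>Z. (z - a) ^ m a) *
            (\<Sum>a\<in>Z. of_nat (m a) * 1 / (z - a)) / (\<Prod>a\<in>Z. (z - a) ^ m a)"
          unfolding h_def using g'[OF z] g_nz z ne \<open>finite Z\<close>
          by (intro logderiv_mult has_field_derivative_prod_power)
             (auto simp: prod_zero_iff intro!: derivative_eq_intros)
        also have "\<dots> = (\<Sum>a\<in>Z. of_nat (m a) / (z - a)) + h z"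
          using ne \<open>finite Z\<close> by (auto simp: prod_zero_iff)
        finally show ?thesis .
      qed
    qed (use \<open>finite Z\<close> g(2) h_hol h_le in \<open>auto simp: Z_def\<close>)
  qed
qed

subsection \<open>Elementary properties of zeta\<close>

lemma zeta_holomorphic: "zeta holomorphic_on - {1}"
  using zeta_continuation_zeta by (simp add: zeta_continuation_def)

lemma zeta_sums: "Re s > 1 \<Longrightarrow> (\<lambda>n. of_nat (Suc n) powr (- s)) sums zeta s"
  using zeta_continuation_zeta by (simp add: zeta_continuation_def powr_minus_divide)

lemma zeta_eq_dirichlet_zeta: "Re s > 1 \<Longrightarrow> zeta s = dirichlet_zeta s"
  using zeta_sums dirichlet_zeta_sums sums_unique2 by blast

lemma zeta_field_differentiable: "s \<noteq> 1 \<Longrightarrow> zeta field_differentiable at s"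
  using zeta_holomorphic by (auto intro!: holomorphic_on_imp_differentiable_at)

lemma has_field_derivative_zeta: "s \<noteq> 1 \<Longrightarrow> (zeta has_field_derivative deriv zeta s) (at s)"
  using zeta_field_differentiable DERIV_deriv_iff_field_differentiable by blast

text \<open>Conjugating argument and value gives another continuation of the same Dirichlet series,
  so uniqueness applies.\<close>

lemma zeta_cnj: "zeta (cnj s) = cnj (zeta s)"
proof -
  define g where "g = (\<lambda>s. cnj (zeta (cnj s)))"
  have "zeta_continuation g"
    unfolding zeta_continuation_def
  proof (intro conjI allI impI)
    have im: "cnj ` (- {1}) = - {1}"
    proof (intro equalityI subsetI)
      fix x :: complex assume "x \<in> - {1}"
      then have "cnj x \<in> - {1}" by (auto simp: complex_eq_iff)
      then show "x \<in> cnj ` (- {1})" by (intro image_eqI[of _ _ "cnj x"]) auto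
    qed (auto simp: complex_eq_iff)
    have "(cnj \<circ> zeta \<circ> cnj) holomorphic_on - {1}"
      by (rule holomorphic_on_compose_cnj_cnj) (simp_all add: im zeta_holomorphic open_Compl)
    then show "g holomorphic_on - {1}" by (simp add: g_def o_def)
    show "g 1 = 0" using zeta_continuation_zeta by (simp add: g_def zeta_continuation_def)
    fix s :: complex assume "Re s > 1"
    then have "(\<lambda>n. cnj (of_nat (Suc n) powr (- cnj s))) sums cnj (zeta (cnj s))"
      unfolding sums_cnj by (intro zeta_sums) simp
    moreover have "cnj (of_nat (Suc n) powr (- cnj s)) = 1 / of_nat (Suc n) powr s" for n
      by (subst cnj_powr) (auto simp: powr_minus_divide)
    ultimately show "(\<lambda>n. 1 / of_nat (Suc n) powr s) sums g s" by (simp add: g_def)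
  qed
  then have "g = zeta" using ex1_zeta_continuation zeta_continuation_zeta by blast
  then show ?thesis by (metis complex_cnj_cnj g_def)
qed

lemma deriv_zeta_cnj:
  assumes "s \<noteq> 1"
  shows "deriv zeta (cnj s) = cnj (deriv zeta s)"
proof -
  have "(cnj \<circ> zeta \<circ> cnj has_field_derivative cnj (deriv zeta s)) (at (cnj s))"
    using has_field_derivative_zeta[OF assms] by (intro has_field_derivative_cnj_cnj) simp
  moreover have "cnj \<circ> zeta \<circ> cnj = zeta" by (auto simp: zeta_cnj)
  ultimately show ?thesis by (simp add: DERIV_imp_deriv)
qed

text \<open>This is \<open>F\<close> of the overview. At a zero of \<open>zeta\<close> the value is
  0 by the convention for division, so expansions always ask for \<open>zeta s \<noteq> 0\<close>;
  on the other hand, a nonzero value shows that neither \<open>zeta\<close> nor its derivative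
  vanishes.\<close>

definition zeta_logderiv :: "complex \<Rightarrow> complex" where
  "zeta_logderiv s = deriv zeta s / zeta s"

lemma zeta_logderiv_cnj: "s \<noteq> 1 \<Longrightarrow> zeta_logderiv (cnj s) = cnj (zeta_logderiv s)"
  by (simp add: zeta_logderiv_def zeta_cnj deriv_zeta_cnj)

lemma zeta_logderiv_holomorphic:
  assumes "S \<subseteq> {s. s \<noteq> 1 \<and> zeta s \<noteq> 0}"
  shows "zeta_logderiv holomorphic_on S"
  unfolding zeta_logderiv_def
  by (intro holomorphic_intros holomorphic_on_subset[OF zeta_holomorphic]
        holomorphic_on_subset[OF holomorphic_deriv[OF zeta_holomorphic]]) (use assms in auto)

lemma norm_zeta_minus_1_le:
  assumes "Re s \<ge> 2"
  shows "norm (zeta s - 1) \<le> pi\<^sup>2 / 6 - 1"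
proof -
  have "(\<lambda>n. of_nat (Suc (Suc n)) powr (- s)) sums (zeta s - 1)"
    using sums_split_initial_segment[OF zeta_sums[of s], of 1] assms by simp
  moreover have "(\<lambda>n. 1 / real (Suc (Suc n)) ^ 2) sums (pi\<^sup>2 / 6 - 1)"
    using sums_split_initial_segment[OF inverse_squares_sums, of 1] by (simp add: add_ac)
  moreover have "norm (of_nat (Suc (Suc n)) powr (- s) :: complex) \<le> 1 / real (Suc (Suc n)) ^ 2" for n
  proof -
    have "norm (of_nat (Suc (Suc n)) powr (- s) :: complex) = real (Suc (Suc n)) powr (- Re s)"
      by (subst norm_powr_real_powr) auto
    also have "\<dots> \<le> real (Suc (Suc n)) powr (-2)" using assms by (intro powr_mono) auto
    also have "\<dots> = 1 / real (Suc (Suc n)) ^ 2" by (simp add: powr_minus_divide)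
    finally show ?thesis .
  qed
  ultimately show ?thesis by (rule norm_sums_le)
qed

lemma norm_zeta_ge:
  assumes "Re s \<ge> 2"
  shows "norm (zeta s) \<ge> 1 / 4"
proof -
  have "pi \<le> 3.2" using pi_approx by simp
  then have "pi\<^sup>2 \<le> 3.2\<^sup>2" by (intro power_mono) auto
  then show ?thesis
    using norm_zeta_minus_1_le[OF assms] norm_triangle_ineq2[of 1 "1 - zeta s"]
    by (simp add: norm_minus_commute power2_eq_square)
qed

lemma norm_dirichlet_zeta_le:
  assumes "Re s \<ge> 3 / 2"
  shows "norm (dirichlet_zeta s) \<le> (\<Sum>n. real (Suc n) powr (-3/2))"
proof -
  have "summable (\<lambda>n. real (Suc n) powr (-3/2))" by (rule summable_Suc_powr) simp
  moreover have "norm (of_nat (Suc n) powr (- s) :: complex) \<le> real (Suc n) powr (-3/2)" for n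
    unfolding norm_of_nat_Suc_powr using assms by (intro powr_mono) auto
  ultimately show ?thesis
    using norm_sums_le[OF dirichlet_zeta_sums summable_sums] assms by auto
qed

section \<open>Polynomial growth of zeta in a half plane\<close>

text \<open>The base \<open>2 + norm s\<close> is at least 1, so raising the exponent only weakens
  the bound and exponents can simply be added, both for sums and for products.\<close>

definition poly_bounded_on :: "complex set \<Rightarrow> (complex \<Rightarrow> complex) \<Rightarrow> bool" where
  "poly_bounded_on S f \<longleftrightarrow> (\<exists>C A. C \<ge> 0 \<and> (\<forall>s\<in>S. norm (f s) \<le> C * (2 + norm s) ^ A))"

lemma poly_bounded_onI:
  "C \<ge> 0 \<Longrightarrow> (\<And>s. s \<in> S \<Longrightarrow> norm (f s) \<le> C * (2 + norm s) ^ A) \<Longrightarrow> poly_bounded_on S f"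
  unfolding poly_bounded_on_def by blast

lemma poly_bounded_on_const: "poly_bounded_on S (\<lambda>_. c)"
  by (rule poly_bounded_onI[of "norm c" _ _ 0]) auto

lemma poly_bounded_on_id: "poly_bounded_on S (\<lambda>s. s)"
  by (rule poly_bounded_onI[of 1 _ _ 1]) auto

lemma poly_bounded_on_add:
  assumes "poly_bounded_on S f" "poly_bounded_on S g"
  shows "poly_bounded_on S (\<lambda>s. f s + g s)"
proof -
  obtain C A C' A' where C: "C \<ge> 0" "\<And>s. s \<in> S \<Longrightarrow> norm (f s) \<le> C * (2 + norm s) ^ A"
    and C': "C' \<ge> 0" "\<And>s. s \<in> S \<Longrightarrow> norm (g s) \<le> C' * (2 + norm s) ^ A'"
    using assms unfolding poly_bounded_on_def by metis
  show ?thesis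
  proof (rule poly_bounded_onI[of "C + C'" _ _ "A + A'"])
    fix s assume s: "s \<in> S"
    have "C * (2 + norm s) ^ A \<le> C * (2 + norm s) ^ (A + A')"
      "C' * (2 + norm s) ^ A' \<le> C' * (2 + norm s) ^ (A + A')"
      using C C' norm_ge_zero[of s] by (intro mult_left_mono power_increasing; simp)+
    then show "norm (f s + g s) \<le> (C + C') * (2 + norm s) ^ (A + A')"
      using C(2)[OF s] C'(2)[OF s] norm_triangle_ineq[of "f s" "g s"] by (simp add: algebra_simps)
  qed (use C C' in auto)
qed

lemma poly_bounded_on_mult:
  assumes "poly_bounded_on S f" "poly_bounded_on S g"
  shows "poly_bounded_on S (\<lambda>s. f s * g s)"
proof -
  obtain C A C' A' where C: "C \<ge> 0" "\<And>s. s \<in> S \<Longrightarrow> norm (f s) \<le> C * (2 + norm s) ^ A"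
    and C': "C' \<ge> 0" "\<And>s. s \<in> S \<Longrightarrow> norm (g s) \<le> C' * (2 + norm s) ^ A'"
    using assms unfolding poly_bounded_on_def by metis
  show ?thesis
  proof (rule poly_bounded_onI[of "C * C'" _ _ "A + A'"])
    fix s assume s: "s \<in> S"
    have "norm (f s * g s) \<le> (C * (2 + norm s) ^ A) * (C' * (2 + norm s) ^ A')"
      unfolding norm_mult using C C' s by (intro mult_mono) auto
    then show "norm (f s * g s) \<le> (C * C') * (2 + norm s) ^ (A + A')"
      by (simp add: power_add mult_ac)
  qed (use C C' in auto)
qed

lemma poly_bounded_on_uminus: "poly_bounded_on S f \<Longrightarrow> poly_bounded_on S (\<lambda>s. - f s)"
  unfolding poly_bounded_on_def by simp

lemma poly_bounded_on_diff:
  "poly_bounded_on S f \<Longrightarrow> poly_bounded_on S g \<Longrightarrow> poly_bounded_on S (\<lambda>s. f s - g s)"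
  using poly_bounded_on_add[OF _ poly_bounded_on_uminus, of S f g] by simp

lemma poly_bounded_on_sum:
  "(\<And>i. i \<in> I \<Longrightarrow> poly_bounded_on S (f i)) \<Longrightarrow> poly_bounded_on S (\<lambda>s. \<Sum>i\<in>I. f i s)"
  by (induction I rule: infinite_finite_induct) (auto intro: poly_bounded_on_const poly_bounded_on_add)

lemma poly_bounded_on_prod:
  "(\<And>i. i \<in> I \<Longrightarrow> poly_bounded_on S (f i)) \<Longrightarrow> poly_bounded_on S (\<lambda>s. \<Prod>i\<in>I. f i s)"
  by (induction I rule: infinite_finite_induct) (auto intro: poly_bounded_on_const poly_bounded_on_mult)

lemma poly_bounded_on_shift:
  assumes f: "poly_bounded_on T f" and sub: "\<And>s. s \<in> S \<Longrightarrow> s + c \<in> T"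
  shows "poly_bounded_on S (\<lambda>s. f (s + c))"
proof -
  obtain C A where C: "C \<ge> 0" "\<And>s. s \<in> T \<Longrightarrow> norm (f s) \<le> C * (2 + norm s) ^ A"
    using f unfolding poly_bounded_on_def by metis
  show ?thesis
  proof (rule poly_bounded_onI[of "C * (1 + norm c) ^ A" _ _ A])
    fix s assume "s \<in> S"
    then have "norm (f (s + c)) \<le> C * (2 + norm (s + c)) ^ A" using C sub by blast
    also have "\<dots> \<le> C * ((1 + norm c) * (2 + norm s)) ^ A"
    proof (intro mult_left_mono power_mono)
      have "norm (s + c) \<le> norm s + norm c" "0 \<le> norm c * norm s" "0 \<le> norm c"
        by (simp_all add: norm_triangle_ineq)
      then show "2 + norm (s + c) \<le> (1 + norm c) * (2 + norm s)" unfolding ring_distribs by linarith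
    qed (use C in auto)
    finally show "norm (f (s + c)) \<le> C * (1 + norm c) ^ A * (2 + norm s) ^ A"
      by (simp add: power_mult_distrib mult_ac)
  qed (use C in auto)
qed

lemma poly_bounded_on_subset: "poly_bounded_on T f \<Longrightarrow> S \<subseteq> T \<Longrightarrow> poly_bounded_on S f"
  unfolding poly_bounded_on_def by blast

lemmas poly_bounded_intros =
  poly_bounded_on_const poly_bounded_on_id poly_bounded_on_add poly_bounded_on_mult
  poly_bounded_on_diff poly_bounded_on_sum poly_bounded_on_prod

lemma poly_bounded_suminf_taylor_rem:
  "poly_bounded_on {s. Re s + real p \<ge> 2} (\<lambda>s. \<Sum>n. taylor_rem p n s)"
proof -
  define D where "D = (\<Sum>n. real (Suc n) powr (-2))"
  have sum: "summable (\<lambda>n. real (Suc n) powr (-2))" by (rule summable_Suc_powr) simp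
  have D: "D \<ge> 0" unfolding D_def by (intro suminf_nonneg sum) auto
  show ?thesis
  proof (rule poly_bounded_onI[of "real (Suc p) ^ Suc p * D" _ _ "Suc p"])
    fix s assume s: "s \<in> {s. Re s + real p \<ge> 2}"
    define K where "K = (norm (s - 1) + real (Suc p)) ^ Suc p"
    have s': "norm (taylor_rem p n s) \<le> K * real (Suc n) powr (-2)" for n
      unfolding K_def using s by (intro norm_taylor_rem_le) auto
    have "norm (\<Sum>n. taylor_rem p n s) \<le> (\<Sum>n. K * real (Suc n) powr (-2))"
      by (rule norm_suminf_le[OF s' summable_mult[OF sum]])
    also have "\<dots> = K * D" unfolding D_def by (rule suminf_mult[OF sum])
    also have "K \<le> (real (Suc p) * (2 + norm s)) ^ Suc p"
      unfolding K_def
    proof (rule power_mono)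
      have "norm (s - 1) \<le> norm s + 1" "0 \<le> real p * norm s" "0 \<le> real p"
        using norm_triangle_ineq4[of s 1] by simp_all
      then show "norm (s - 1) + real (Suc p) \<le> real (Suc p) * (2 + norm s)"
        unfolding of_nat_Suc ring_distribs by linarith
    qed auto
    then have "K * D \<le> (real (Suc p) * (2 + norm s)) ^ Suc p * D" using D by (rule mult_right_mono)
    finally show "norm (\<Sum>n. taylor_rem p n s) \<le> real (Suc p) ^ Suc p * D * (2 + norm s) ^ Suc p"
      by (simp only: power_mult_distrib mult_ac)
  qed (use D in auto)
qed

text \<open>The recurrence that continues zeta also transports growth: the values on a half plane
  are polynomials times values at least one unit further right, plus a remainder of polynomial size.
  Two steps lead from \<open>Re s \<ge> 3/2\<close> to \<open>-1/2\<close>, which is how far the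
  disc of radius \<open>5/2\<close> around \<open>2 + \<i>T\<close> reaches.\<close>

lemma zeta_poly_bounded: "poly_bounded_on {s. Re s \<ge> -1/2 \<and> s \<noteq> 1} (\<lambda>s. (s - 1) * zeta s)"
proof -
  obtain F where F: "F holomorphic_on UNIV" "\<And>s. Re s > 1 \<Longrightarrow> F s = (s - 1) * dirichlet_zeta s"
    using zeta_entire_continuation by blast
  have "poly_bounded_on {s. Re s \<ge> 3 / 2 - real m} F" for m
  proof (induction m)
    case 0
    define D where "D = (\<Sum>n. real (Suc n) powr (-3/2))"
    have D: "D \<ge> 0" unfolding D_def
      by (intro suminf_nonneg) (auto intro!: summable_Suc_powr simp del: of_nat_Suc)
    show ?case
    proof (rule poly_bounded_onI[of D _ _ 1])
      fix s assume s: "s \<in> {s. Re s \<ge> 3 / 2 - real 0}"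
      then have "norm (F s) = norm (s - 1) * norm (dirichlet_zeta s)" by (simp add: F(2) norm_mult)
      also have "\<dots> \<le> (norm s + 1) * D"
      proof (rule mult_mono)
        show "norm (dirichlet_zeta s) \<le> D" unfolding D_def by (rule norm_dirichlet_zeta_le) (use s in simp)
        show "norm (s - 1) \<le> norm s + 1" using norm_triangle_ineq4[of s 1] by simp
      qed auto
      also have "\<dots> \<le> D * (2 + norm s) ^ 1" using D by (simp add: algebra_simps)
      finally show "norm (F s) \<le> D * (2 + norm s) ^ 1" .
    qed (rule D)
  next
    case (Suc m)
    define p where "p = Suc m"
    \<comment> \<open>With \<open>p = m + 1\<close> the remainder series converges for
      \<open>Re s > - real m\<close>. This open half plane contains the closed one \<open>S\<close>,
      so the identity theorem on \<open>U\<close> yields the recurrence on \<open>S\<close>.\<close>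
    define U where "U = {s. Re s > - real m}"
    define S where "S = {s. Re s \<ge> 3 / 2 - real (Suc m)}"
    define G where "G = (\<lambda>s. s - (\<Sum>i\<in>{2..Suc p}. pochhammer (s - 1) (i - 1) / fact i *
             (F (s + (of_nat i - 1)) - (s + (of_nat i - 2)))) - (\<Sum>n. taylor_rem (Suc p) n s))"
    have U: "open U" "connected U"
      unfolding U_def by (auto intro: open_halfspace_Re_gt convex_connected convex_halfspace_Re_gt)
    have "G holomorphic_on U"
    proof -
      have "(\<lambda>s. F (s + (of_nat i - 1))) holomorphic_on U" for i
        by (rule holomorphic_on_compose_gen[OF _ F(1), unfolded o_def]) (auto intro!: holomorphic_intros)
      moreover have "(\<lambda>s. \<Sum>n. taylor_rem (Suc p) n s) holomorphic_on U"
        by (rule holomorphic_on_subset[OF holomorphic_suminf_taylor_rem]) (auto simp: p_def U_def)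
      ultimately show ?thesis
        unfolding G_def pochhammer_prod by (intro holomorphic_intros) auto
    qed
    moreover have GF1: "G s = F s" if "Re s > 1" for s
    proof -
      have "F (s + (of_nat i - 1)) - (s + (of_nat i - 2)) =
          (s + of_nat i - 2) * dirichlet_zeta (s + of_nat i - 1) - (s + of_nat i - 2)"
        if "i \<in> {2..Suc p}" for i
      proof -
        have i: "s + (of_nat i - 1) = s + of_nat i - 1" "s + (of_nat i - 2) = s + of_nat i - 2"
          "s + of_nat i - 1 - 1 = s + of_nat i - 2" by simp_all
        have "Re (s + of_nat i - 1) > 1" using \<open>Re s > 1\<close> that by auto
        then show ?thesis unfolding i by (subst F(2)) (simp_all only: i)
      qed
      then have "(\<Sum>i\<in>{2..Suc p}. pochhammer (s - 1) (i - 1) / fact i *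
             (F (s + (of_nat i - 1)) - (s + (of_nat i - 2)))) =
          (\<Sum>i\<in>{2..Suc p}. pochhammer (s - 1) (i - 1) / fact i *
             ((s + of_nat i - 2) * dirichlet_zeta (s + of_nat i - 1) - (s + of_nat i - 2)))"
        by (intro sum.cong) auto
      then show ?thesis
        unfolding G_def F(2)[OF that] dirichlet_zeta_recurrence[OF that, of p] by simp
    qed
    ultimately have GF: "G s = F s" if "s \<in> U" for s
    proof (intro analytic_continuation_open[where s = "{s. Re s > 1}" and s' = U and f = G and g = F and z = s])
      show "{s. Re s > 1} \<noteq> {}" by (auto intro!: exI[of _ 2])
      show "F holomorphic_on U" by (rule holomorphic_on_subset[OF F(1)]) simp
      show "{s. Re s > 1} \<subseteq> U" by (auto simp: U_def)
    qed (use that U in \<open>auto simp: open_halfspace_Re_gt GF1\<close>)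
    have "poly_bounded_on S G"
    proof -
      have F': "poly_bounded_on S (\<lambda>s. F (s + (of_nat i - 1)))"
        if "i \<in> {2..Suc p}" for i
        by (rule poly_bounded_on_shift[OF Suc.IH]) (use that in \<open>auto simp: S_def\<close>)
      have "poly_bounded_on S (\<lambda>s. \<Sum>n. taylor_rem (Suc p) n s)"
        by (rule poly_bounded_on_subset[OF poly_bounded_suminf_taylor_rem]) (auto simp: p_def S_def)
      then show ?thesis
        unfolding G_def pochhammer_prod divide_inverse by (intro poly_bounded_intros F')
    qed
    moreover have "F s = G s" if "s \<in> S" for s
      using that by (intro GF[symmetric]) (auto simp: U_def S_def)
    ultimately show ?case unfolding poly_bounded_on_def S_def[symmetric] by simp
  qed
  from this[of 2] have *: "poly_bounded_on {s. Re s \<ge> -1/2} F" by simp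
  \<comment> \<open>The point 1 is excluded here and in the statement: \<open>zeta 1\<close> is 0 by
    convention, so the right side carries no information about \<open>F 1\<close>.\<close>
  have FZ: "F s = (s - 1) * zeta s" if "s \<noteq> 1" for s
  proof (rule analytic_continuation_open[where s = "{s. Re s > 1}" and s' = "- {1}" and f = F
        and g = "\<lambda>s. (s - 1) * zeta s" and z = s])
    show "connected (- {1 :: complex})" by (intro connected_punctured_universe) simp
    show "(\<lambda>s. (s - 1) * zeta s) holomorphic_on - {1}"
      by (intro holomorphic_intros zeta_holomorphic)
    show "F holomorphic_on - {1}" by (rule holomorphic_on_subset[OF F(1)]) simp
    show "{s. Re s > 1} \<noteq> {}" by (auto intro!: exI[of _ 2])
    show "F z = (z - 1) * zeta z" if "z \<in> {s. Re s > 1}" for z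
      using that by (simp add: F(2) zeta_eq_dirichlet_zeta)
  qed (use that in \<open>auto simp: open_halfspace_Re_gt\<close>)
  obtain C A where C: "C \<ge> 0" "\<And>s. Re s \<ge> -1/2 \<Longrightarrow> norm (F s) \<le> C * (2 + norm s) ^ A"
    using * unfolding poly_bounded_on_def by auto
  show ?thesis
    by (rule poly_bounded_onI[of C _ _ A]) (use C in \<open>auto simp flip: FZ\<close>)
qed

text \<open>Only the ratio to the value at \<open>2 + \<i>T\<close> matters for the local expansion.\<close>

lemma zeta_growth:
  "\<exists>C\<ge>1. \<forall>T s. T \<ge> 10 \<longrightarrow> norm (s - Complex 2 T) \<le> 5 / 2 \<longrightarrow>
      norm (zeta s) \<le> exp (C * ln T) * norm (zeta (Complex 2 T))"
proof -
  obtain C A where C: "C \<ge> 0" "\<And>s. Re s \<ge> -1/2 \<Longrightarrow> s \<noteq> 1 \<Longrightarrow> norm ((s - 1) * zeta s) \<le> C * (2 + norm s) ^ A"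
    using zeta_poly_bounded unfolding poly_bounded_on_def by auto
  \<comment> \<open>Since \<open>ln T \<ge> 1\<close>, constant factors can be moved into the
    exponent. The 4 comes from the lower bound \<open>1/4\<close> for \<open>zeta\<close> on
    \<open>Re s = 2\<close>, and \<open>real A * 2\<close> from
    \<open>2 + norm s \<le> T\<^sup>2\<close>.\<close>
  define K where "K = 1 + ln (1 + 4 * C) + real A * 2"
  have "K \<ge> 1" using C by (simp add: K_def)
  moreover have "norm (zeta s) \<le> exp (K * ln T) * norm (zeta (Complex 2 T))"
    if T: "T \<ge> 10" and s: "norm (s - Complex 2 T) \<le> 5 / 2" for T s
  proof -
    have re: "Re s \<ge> -1/2" and im: "Im s \<ge> 5"
      using abs_Re_le_cmod[of "s - Complex 2 T"] abs_Im_le_cmod[of "s - Complex 2 T"] s T by auto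
    have s1: "norm (s - 1) \<ge> 1" using abs_Im_le_cmod[of "s - 1"] im by simp
    have "norm s \<le> T + 5"
      using s norm_triangle_ineq[of "s - Complex 2 T" "Complex 2 T"] cmod_le[of "Complex 2 T"] T by simp
    then have ns: "2 + norm s \<le> T\<^sup>2" using T mult_right_mono[of 10 T T] unfolding power2_eq_square by linarith
    have lnT: "ln T \<ge> 1" using T exp_le by (subst ln_ge_iff) auto
    have "norm (zeta s) \<le> norm (s - 1) * norm (zeta s)"
      using s1 mult_right_mono[of 1 "norm (s - 1)" "norm (zeta s)"] by simp
    also have "\<dots> \<le> C * (2 + norm s) ^ A"
    proof -
      have "s \<noteq> 1" using im by auto
      then show ?thesis using C(2)[of s] re unfolding norm_mult by blast
    qed
    also have "\<dots> \<le> C * (T\<^sup>2) ^ A" using C(1) ns by (intro mult_left_mono power_mono) auto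
    also have "(T\<^sup>2) ^ A = exp (real A * 2 * ln T)"
    proof -
      have "exp (real A * 2 * ln T) = exp (real (2 * A) * ln T)" by (simp add: mult_ac)
      also have "\<dots> = T ^ (2 * A)" using T by (simp only: exp_of_nat_mult) simp
      finally show ?thesis by (simp add: power_mult)
    qed
    also have "C * exp (real A * 2 * ln T) \<le> exp (K * ln T) / 4"
    proof -
      have "4 * C \<le> exp (ln (1 + 4 * C))" using C(1) by simp
      also have "\<dots> \<le> exp (ln (1 + 4 * C) * ln T)"
        using lnT C(1) mult_left_mono[of 1 "ln T" "ln (1 + 4 * C)"] by (subst exp_le_cancel_iff) simp
      also have "\<dots> \<le> exp ((1 + ln (1 + 4 * C)) * ln T)" using lnT by (simp add: algebra_simps)
      finally have "4 * C * exp (real A * 2 * ln T) \<le> exp ((1 + ln (1 + 4 * C)) * ln T) * exp (real A * 2 * ln T)"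
        by (rule mult_right_mono) simp
      also have "\<dots> = exp (K * ln T)" by (simp add: K_def exp_add[symmetric] algebra_simps)
      finally show ?thesis by simp
    qed
    also have "\<dots> \<le> exp (K * ln T) * norm (zeta (Complex 2 T))"
      using norm_zeta_ge[of "Complex 2 T"] by simp
    finally show ?thesis .
  qed
  ultimately show ?thesis by blast
qed

subsection \<open>Sums over primes\<close>

lemma prod_primes_dvd:
  fixes m :: nat
  assumes "finite P" "\<And>p. p \<in> P \<Longrightarrow> prime p \<and> p dvd m"
  shows "\<Prod>P dvd m"
  using assms
proof (induction P rule: finite_induct)
  case (insert q P)
  have "coprime q (\<Prod>P)"
    using insert by (intro prod_coprime_right) (metis insertI1 insertI2 primes_coprime)
  then show ?case using insert by (simp add: divides_mult)
qed auto

text \<open>Chebyshev's argument: the product of the primes in \<open>(n, 2n]\<close> divides the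
  central binomial coefficient, which is at most \<open>4^n\<close>.\<close>

lemma sum_ln_primes_le:
  "(\<Sum>p | prime p \<and> n < p \<and> p \<le> 2 * n. ln (real p)) \<le> 2 * real n * ln 2"
proof -
  define P where "P = {p. prime p \<and> n < p \<and> p \<le> 2 * n}"
  have fin: "finite P" by (rule finite_subset[of _ "{..2 * n}"]) (auto simp: P_def)
  have dvd: "p dvd (2 * n choose n)" if "p \<in> P" for p
  proof -
    have p: "prime p" "n < p" "p \<le> 2 * n" using that by (auto simp: P_def)
    have "fact n * fact n * (2 * n choose n) = (fact (2 * n) :: nat)"
      using binomial_fact_lemma[of n "2 * n"] by simp
    moreover have "p dvd (fact (2 * n) :: nat)" using p by (simp add: prime_dvd_fact_iff)
    moreover have "\<not> p dvd (fact n :: nat)" using p by (simp add: prime_dvd_fact_iff)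
    ultimately show ?thesis using p(1) by (metis prime_dvd_mult_iff)
  qed
  have "\<Prod>P dvd (2 * n choose n)"
    using dvd fin by (intro prod_primes_dvd) (auto simp: P_def)
  then have "\<Prod>P \<le> (2 * n choose n)" by (rule dvd_imp_le) simp
  also have "\<dots> \<le> 2 ^ (2 * n)"
    using choose_row_sum[of "2 * n"] member_le_sum[of n "{..2 * n}" "\<lambda>k. 2 * n choose k"] by simp
  finally have "real (\<Prod>P) \<le> real (2 ^ (2 * n))" by (rule of_nat_mono)
  then have "ln (\<Prod>p\<in>P. real p) \<le> ln (2 ^ (2 * n))"
    by (subst ln_le_cancel_iff) (auto intro!: prod_pos simp: P_def prime_gt_0_nat)
  also have "ln (\<Prod>p\<in>P. real p) = (\<Sum>p\<in>P. ln (real p))"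
    using fin by (intro ln_prod) (auto simp: P_def prime_gt_0_nat)
  finally show ?thesis by (simp add: P_def ln_realpow)
qed

text \<open>The Dirichlet series of the von Mangoldt function restricted to powers of primes
  \<open>p \<le> N\<close>. Keeping all powers of each prime makes it exactly minus the logarithmic
  derivative of the finite Euler product, so adding it to \<open>zeta_logderiv\<close> again gives a
  logarithmic derivative.\<close>

definition prime_part :: "nat \<Rightarrow> complex \<Rightarrow> complex" where
  "prime_part N s = (\<Sum>p | prime p \<and> p \<le> N. of_real (ln (real p)) / (of_nat p powr s - 1))"

lemma finite_primes_le: "finite {p::nat. prime p \<and> p \<le> N}"
  by (rule finite_subset[of _ "{..N}"]) auto

lemma norm_prime_powr_minus_1:
  assumes p: "prime (p::nat)" and s: "Re s > 0"
  shows "norm (of_nat p powr s - 1) \<ge> real p powr Re s - 1" "of_nat p powr s \<noteq> 1"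
proof -
  have "norm (of_nat p powr s :: complex) = real p powr Re s"
    using prime_gt_0_nat[OF p] by (subst norm_powr_real_powr) auto
  then show *: "norm (of_nat p powr s - 1) \<ge> real p powr Re s - 1"
    using norm_triangle_ineq2[of "of_nat p powr s" 1] by simp
  have "real p powr Re s > 1" using prime_gt_1_nat[OF p] s by simp
  with * show "of_nat p powr s \<noteq> 1" by auto
qed

lemma prime_part_holomorphic: "prime_part N holomorphic_on {s. Re s > 0}"
  unfolding prime_part_def
  by (intro holomorphic_intros) (use norm_prime_powr_minus_1(2) in auto)

text \<open>Chebyshev's bound on one dyadic block; \<open>b\<close> measures how far
  \<open>p powr s - 1\<close> may fall below \<open>p powr s\<close>. Working with blocks replaces
  partial summation by geometric series.\<close>

lemma prime_part_block:
  assumes s: "Re s > 0" and b: "0 < b"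
    and ge: "\<And>p. prime p \<Longrightarrow> real p powr Re s - 1 \<ge> b * real p powr Re s"
  shows "norm (\<Sum>p | prime p \<and> 2 ^ k < p \<and> p \<le> 2 ^ Suc k. of_real (ln (real p)) / (of_nat p powr s - 1))
         \<le> 2 / b * (2 powr (1 - Re s)) ^ k"
proof -
  define P where "P = {p::nat. prime p \<and> 2 ^ k < p \<and> p \<le> 2 ^ Suc k}"
  have "norm (\<Sum>p\<in>P. of_real (ln (real p)) / (of_nat p powr s - 1)) \<le>
     (\<Sum>p\<in>P. ln (real p) * (1 / (b * (2 powr Re s) ^ k)))"
  proof (rule sum_norm_le)
    fix p assume "p \<in> P"
    then have p: "prime p" "2 ^ k < p" by (auto simp: P_def)
    have "(2 powr Re s) ^ k = real (2 ^ k) powr Re s"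
      by (simp add: powr_powr powr_realpow[symmetric] mult.commute)
    also have "\<dots> \<le> real p powr Re s" using p(2) s by (intro powr_mono2) auto
    finally have "b * (2 powr Re s) ^ k \<le> b * real p powr Re s" using b by simp
    also have "\<dots> \<le> norm (of_nat p powr s - 1)"
      using ge[OF p(1)] norm_prime_powr_minus_1(1)[OF p(1) s] by linarith
    finally have "b * (2 powr Re s) ^ k \<le> norm (of_nat p powr s - 1)" .
    moreover have "0 < b * (2 powr Re s) ^ k" using b by simp
    moreover have "ln (real p) \<ge> 0" using prime_gt_0_nat[OF p(1)] by simp
    ultimately show "norm (of_real (ln (real p)) / (of_nat p powr s - 1)) \<le>
        ln (real p) * (1 / (b * (2 powr Re s) ^ k))"
      by (simp add: norm_divide frac_le)
  qed
  also have "\<dots> = (\<Sum>p\<in>P. ln (real p)) * (1 / (b * (2 powr Re s) ^ k))"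
    by (rule sum_distrib_right[symmetric])
  also have "\<dots> \<le> (2 * 2 ^ k * 1) * (1 / (b * (2 powr Re s) ^ k))"
  proof (rule mult_right_mono)
    have "(\<Sum>p\<in>P. ln (real p)) \<le> 2 * real (2 ^ k) * ln 2"
      using sum_ln_primes_le[of "2 ^ k"] by (simp add: P_def)
    also have "\<dots> \<le> 2 * 2 ^ k * 1" using ln_2_less_1 by simp
    finally show "(\<Sum>p\<in>P. ln (real p)) \<le> 2 * 2 ^ k * 1" .
  qed (use b in auto)
  also have "\<dots> = 2 / b * (2 powr (1 - Re s)) ^ k"
    by (simp add: powr_diff power_divide)
  finally show ?thesis by (simp add: P_def)
qed

lemma prime_part_diff:
  assumes "K \<le> J"
  shows "prime_part (2 ^ J) s - prime_part (2 ^ K) s =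
    (\<Sum>k=K..<J. \<Sum>p | prime p \<and> 2 ^ k < p \<and> p \<le> 2 ^ Suc k. of_real (ln (real p)) / (of_nat p powr s - 1))"
  using assms
proof (induction J rule: dec_induct)
  case (step J)
  have eq: "{p::nat. prime p \<and> p \<le> 2 ^ Suc J} =
      {p. prime p \<and> p \<le> 2 ^ J} \<union> {p. prime p \<and> 2 ^ J < p \<and> p \<le> 2 ^ Suc J}"
  proof -
    have "(2::nat) ^ J \<le> 2 ^ Suc J" by simp
    then show ?thesis by (auto simp del: power_Suc intro: order_trans)
  qed
  have "prime_part (2 ^ Suc J) s = prime_part (2 ^ J) s +
     (\<Sum>p | prime p \<and> 2 ^ J < p \<and> p \<le> 2 ^ Suc J. of_real (ln (real p)) / (of_nat p powr s - 1))"
    unfolding prime_part_def eq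
  proof (rule sum.union_disjoint)
    show "finite {p::nat. prime p \<and> 2 ^ J < p \<and> p \<le> 2 ^ Suc J}"
      by (rule finite_subset[OF _ finite_primes_le[of "2 ^ Suc J"]]) auto
  qed (auto intro: finite_primes_le)
  then show ?case using step by (simp add: algebra_simps)
qed simp

lemma prime_part_1: "prime_part (2 ^ 0) s = 0"
proof -
  have "{p::nat. prime p \<and> p \<le> 2 ^ 0} = {}" by (auto dest: prime_gt_1_nat)
  then show ?thesis by (simp only: prime_part_def sum.empty)
qed

lemma norm_prime_part_le:
  assumes s: "Re s \<ge> 1 / 2"
  shows "norm (prime_part (2 ^ K) s) \<le> 8 * (\<Sum>k<K. (2 powr (1 - Re s)) ^ k)"
proof -
  \<comment> \<open>The constant \<open>1/4\<close> comes from
    \<open>p powr (1/2) \<ge> sqrt 2 \<ge> 4/3\<close>.\<close>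
  have ge: "real p powr Re s - 1 \<ge> 1 / 4 * real p powr Re s" if "prime p" for p :: nat
  proof -
    have "(4 / 3 :: real) \<le> sqrt 2" by (rule real_le_rsqrt) (simp add: power2_eq_square)
    also have "sqrt 2 \<le> sqrt (real p)" using prime_ge_2_nat[OF that] by simp
    also have "\<dots> = real p powr (1 / 2)" by (simp add: powr_half_sqrt)
    also have "\<dots> \<le> real p powr Re s" using s prime_gt_0_nat[OF that] by (intro powr_mono) auto
    finally show ?thesis by simp
  qed
  have "norm (prime_part (2 ^ K) s) = norm (prime_part (2 ^ K) s - prime_part (2 ^ 0) s)"
    by (simp add: prime_part_1 del: power_0)
  also have "\<dots> \<le> (\<Sum>k=0..<K. 2 / (1 / 4) * (2 powr (1 - Re s)) ^ k)"
    unfolding prime_part_diff[of 0 K, OF le0]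
    by (intro sum_norm_le prime_part_block ge) (use s in auto)
  also have "\<dots> = 8 * (\<Sum>k<K. (2 powr (1 - Re s)) ^ k)"
    by (simp add: sum_distrib_left atLeast0LessThan)
  finally show ?thesis .
qed

lemma norm_prime_part_diff_le:
  assumes s: "Re s \<ge> 2" and KJ: "K \<le> J"
  shows "norm (prime_part (2 ^ J) s - prime_part (2 ^ K) s) \<le> 8 / 2 ^ K"
proof -
  have ge: "real p powr Re s - 1 \<ge> 1 / 2 * real p powr Re s" if "prime p" for p :: nat
  proof -
    have "2 \<le> real p powr 1" using prime_ge_2_nat[OF that] by simp
    also have "\<dots> \<le> real p powr Re s" using s prime_gt_0_nat[OF that] by (intro powr_mono) auto
    finally show ?thesis by simp
  qed
  have q: "2 powr (1 - Re s) \<le> 1 / 2"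
    using powr_mono[of "1 - Re s" "-1" 2] s by (simp add: powr_minus_divide)
  have "norm (prime_part (2 ^ J) s - prime_part (2 ^ K) s) \<le>
      (\<Sum>k=K..<J. 2 / (1 / 2) * (2 powr (1 - Re s)) ^ k)"
    unfolding prime_part_diff[OF KJ]
    by (intro sum_norm_le prime_part_block ge) (use s in auto)
  also have "\<dots> \<le> (\<Sum>k=K..<J. 4 * (1 / 2) ^ k)"
    using q by (intro sum_mono) (auto intro!: power_mono)
  also have "\<dots> = (\<Sum>k=K..<J. (- 8 / 2 ^ Suc k) - (- 8 / 2 ^ k))"
    by (intro sum.cong) (auto simp: power_divide)
  also have "\<dots> = 8 / 2 ^ K - 8 / 2 ^ J"
    using KJ by (subst sum_Suc_diff') auto
  also have "\<dots> \<le> 8 / 2 ^ K" by simp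
  finally show ?thesis .
qed

section \<open>Zeta with the small prime factors sieved out\<close>

text \<open>The sieve of Eratosthenes as induction on the set of primes: multiplying by
  \<open>1 - q powr (- s)\<close> removes the terms divisible by \<open>q\<close>. Unordered sums
  avoid enumerating the remaining integers.\<close>

lemma has_sum_coprime:
  assumes P: "finite P" "\<And>p. p \<in> P \<Longrightarrow> prime (p::nat)" and s: "Re s > 1"
  shows "((\<lambda>n. of_nat n powr (- s)) has_sum (zeta s * (\<Prod>p\<in>P. 1 - of_nat p powr (- s))))
           {n::nat. n > 0 \<and> (\<forall>p\<in>P. \<not> p dvd n)}"
  using P
proof (induction P rule: finite_induct)
  case empty
  have "((\<lambda>n. of_nat (Suc n) powr (- s)) has_sum zeta s) UNIV"
  proof (rule norm_summable_imp_has_sum[OF _ zeta_sums[OF s]])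
    show "summable (\<lambda>n. norm (of_nat (Suc n) powr (- s) :: complex))"
      using summable_Suc_powr[of "- Re s"] s by (simp add: norm_of_nat_Suc_powr del: of_nat_Suc)
  qed
  moreover have "((\<lambda>n. of_nat n powr (- s)) has_sum zeta s) (Suc ` UNIV) \<longleftrightarrow>
      (((\<lambda>n. of_nat n powr (- s)) \<circ> Suc) has_sum zeta s) UNIV"
    by (rule has_sum_reindex) simp
  moreover have "Suc ` UNIV = {n. n > 0}" by (auto simp: image_iff gr0_conv_Suc)
  ultimately show ?case by (simp add: o_def)
next
  case (insert q P)
  define A where "A = {n::nat. n > 0 \<and> (\<forall>p\<in>P. \<not> p dvd n)}"
  define x where "x = zeta s * (\<Prod>p\<in>P. 1 - of_nat p powr (- s))"
  have q: "prime q" using insert.prems by simp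
  have IH: "((\<lambda>n. of_nat n powr (- s)) has_sum x) A"
    using insert unfolding A_def x_def by simp
  have q0: "q > 0" using q prime_gt_0_nat by blast
  have "((\<lambda>n. of_nat n powr (- s)) has_sum (of_nat q powr (- s) * x)) (times q ` A)"
  proof (subst has_sum_reindex)
    show "inj_on (times q) A" using q0 by (auto simp: inj_on_def)
    have "(of_nat (q * n) :: complex) powr (- s) = of_nat q powr (- s) * of_nat n powr (- s)" for n
      using powr_times_real[of "of_nat q" "of_nat n" "- s"] by simp
    then show "((\<lambda>n. of_nat n powr (- s)) \<circ> times q has_sum of_nat q powr (- s) * x) A"
      using has_sum_cmult_right[OF IH, of "of_nat q powr (- s)"] by (simp add: o_def)
  qed
  moreover have "times q ` A \<subseteq> A"
  proof safe
    fix n assume n: "n \<in> A"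
    have "\<not> p dvd q * n" if p: "p \<in> P" for p
    proof
      assume "p dvd q * n"
      moreover have "prime p" using insert.prems p by auto
      ultimately have "p dvd q \<or> p dvd n" by (simp add: prime_dvd_mult_iff)
      moreover have "\<not> p dvd n" using n p by (auto simp: A_def)
      ultimately have "p = q" using \<open>prime p\<close> q by (simp add: primes_dvd_imp_eq)
      then show False using insert.hyps p by simp
    qed
    then show "q * n \<in> A" using n q0 by (auto simp: A_def)
  qed
  ultimately have "((\<lambda>n. of_nat n powr (- s)) has_sum (x - of_nat q powr (- s) * x)) (A - times q ` A)"
    by (intro has_sum_Diff IH)
  moreover have "A - times q ` A = {n. n > 0 \<and> (\<forall>p\<in>insert q P. \<not> p dvd n)}"
  proof (intro equalityI subsetI)
    fix n assume n: "n \<in> A - times q ` A"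
    have "\<not> q dvd n"
    proof
      assume "q dvd n"
      then obtain m where "n = q * m" by (elim dvdE)
      moreover from this n have "m \<in> A" by (auto simp: A_def)
      ultimately show False using n by auto
    qed
    then show "n \<in> {n. n > 0 \<and> (\<forall>p\<in>insert q P. \<not> p dvd n)}" using n by (auto simp: A_def)
  qed (auto simp: A_def)
  moreover have "x - of_nat q powr (- s) * x = zeta s * (\<Prod>p\<in>insert q P. 1 - of_nat p powr (- s))"
    using insert.hyps by (simp add: x_def algebra_simps)
  ultimately show ?case by simp
qed

definition sifted_zeta :: "nat \<Rightarrow> complex \<Rightarrow> complex" where
  "sifted_zeta N s = zeta s * (\<Prod>p | prime p \<and> p \<le> N. 1 - of_nat p powr (- s))"

text \<open>Apart from 1, every integer that survives has a prime factor above \<open>N\<close> and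
  thus exceeds \<open>N\<close>, so the error is a tail of a fixed convergent series. The range
  \<open>Re s \<ge> 3/2\<close> leaves room for Cauchy's inequality around points with
  \<open>Re s \<ge> 2\<close>.\<close>

lemma sifted_zeta_bound:
  "\<exists>\<epsilon>. \<epsilon> \<longlonglongrightarrow> 0 \<and> (\<forall>N s. Re s \<ge> 3 / 2 \<longrightarrow> norm (sifted_zeta N s - 1) \<le> \<epsilon> N)"
proof -
  define g where "g = (\<lambda>n::nat. real n powr (-3/2))"
  have "summable g" unfolding g_def by (simp add: summable_real_powr_iff)
  then have g_sum: "g summable_on UNIV"
    by (intro norm_summable_imp_summable_on) (simp add: g_def)
  define \<epsilon> where "\<epsilon> = (\<lambda>N. infsum g UNIV - sum g {..N})"
  have "(\<lambda>N. sum g {..N}) \<longlonglongrightarrow> infsum g UNIV"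
    using has_sum_imp_sums[OF has_sum_infsum[OF g_sum]] by (simp add: sums_def_le)
  then have "\<epsilon> \<longlonglongrightarrow> infsum g UNIV - infsum g UNIV"
    unfolding \<epsilon>_def by (intro tendsto_intros)
  then have "\<epsilon> \<longlonglongrightarrow> 0" by simp
  moreover have "norm (sifted_zeta N s - 1) \<le> \<epsilon> N" if s: "Re s \<ge> 3 / 2" for N s
  proof -
    define P where "P = {p::nat. prime p \<and> p \<le> N}"
    define A where "A = {n::nat. n > 0 \<and> (\<forall>p\<in>P. \<not> p dvd n)}"
    have "((\<lambda>n. of_nat n powr (- s)) has_sum sifted_zeta N s) A"
      unfolding A_def sifted_zeta_def P_def using s finite_primes_le
      by (intro has_sum_coprime) auto
    moreover have "((\<lambda>n. of_nat n powr (- s)) has_sum 1) {1 :: nat}"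
      using has_sum_finite[of "{1::nat}" "\<lambda>n. of_nat n powr (- s)"] by simp
    moreover have "{1} \<subseteq> A" by (auto simp: A_def P_def)
    ultimately have hs: "((\<lambda>n. of_nat n powr (- s)) has_sum (sifted_zeta N s - 1)) (A - {1})"
      by (rule has_sum_Diff)
    have sub: "A - {1} \<subseteq> - {..N}"
    proof
      fix n assume n: "n \<in> A - {1}"
      then obtain p where p: "prime p" "p dvd n" using prime_factor_nat[of n] by auto
      then have "p > N" using n by (auto simp: A_def P_def)
      moreover have "p \<le> n" using p n by (auto simp: A_def intro: dvd_imp_le)
      ultimately show "n \<in> - {..N}" by auto
    qed
    have le: "norm (of_nat n powr (- s) :: complex) \<le> g n" if "n \<in> A - {1}" for n
    proof -
      have "norm (of_nat n powr (- s) :: complex) = real n powr (- Re s)"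
        using that by (subst norm_powr_real_powr) (auto simp: A_def)
      also have "\<dots> \<le> g n" unfolding g_def using s that by (intro powr_mono) (auto simp: A_def)
      finally show ?thesis .
    qed
    have "((\<lambda>n. g n) has_sum \<epsilon> N) (UNIV - {..N})"
      unfolding \<epsilon>_def by (intro has_sum_Diff has_sum_infsum g_sum has_sum_finite) auto
    then have gs: "(g has_sum \<epsilon> N) (- {..N})" by (simp add: Compl_eq_Diff_UNIV)
    have "g summable_on (A - {1})" by (rule summable_on_subset_banach[OF g_sum]) simp
    then have "norm (sifted_zeta N s - 1) \<le> infsum g (A - {1})"
      by (intro norm_infsum_le[OF hs has_sum_infsum] le)
    also have "\<dots> \<le> \<epsilon> N"
      using has_sum_mono2[OF has_sum_infsum gs sub] \<open>g summable_on (A - {1})\<close> by (simp add: g_def)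
    finally show ?thesis .
  qed
  ultimately show ?thesis by blast
qed

lemma logderiv_sifted_zeta:
  assumes s: "Re s \<ge> 2"
  shows "deriv (sifted_zeta N) s / sifted_zeta N s = zeta_logderiv s + prime_part N s"
proof -
  define P where "P = {p::nat. prime p \<and> p \<le> N}"
  have P: "finite P" unfolding P_def by (rule finite_primes_le)
  have nz: "1 - of_nat p powr (- s) \<noteq> 0" if "p \<in> P" for p
  proof
    assume "1 - of_nat p powr (- s) = (0 :: complex)"
    then have "inverse (of_nat p powr s) = (1 :: complex)" by (simp add: powr_minus)
    then have "of_nat p powr s = (1 :: complex)" by (simp only: inverse_eq_1_iff)
    then show False using norm_prime_powr_minus_1(2)[of p s] that s by (simp add: P_def)
  qed
  have "((\<lambda>s. \<Prod>p\<in>P. (1 - of_nat p powr (- s)) ^ 1) has_field_derivative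
      (\<Prod>p\<in>P. (1 - of_nat p powr (- s)) ^ 1) *
      (\<Sum>p\<in>P. of_nat 1 * (of_real (ln (real p)) * of_nat p powr (- s)) / (1 - of_nat p powr (- s)))) (at s)"
  proof (rule has_field_derivative_prod_power[OF P])
    fix p assume p: "p \<in> P"
    then have "p > 0" by (simp add: P_def prime_gt_0_nat)
    then have "((\<lambda>s. of_nat p powr (- s)) has_field_derivative
        (Ln (of_nat p) * of_nat p powr (- s)) * (- 1)) (at s)"
      by (intro DERIV_chain2[OF has_field_derivative_powr_right] derivative_eq_intros) auto
    from DERIV_diff[OF DERIV_const[of 1] this]
    show "((\<lambda>s. 1 - of_nat p powr (- s)) has_field_derivative
        of_real (ln (real p)) * of_nat p powr (- s)) (at s)"
      using \<open>p > 0\<close> by (simp add: Ln_of_nat)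
  qed (use nz in auto)
  then have "((\<lambda>s. \<Prod>p\<in>P. 1 - of_nat p powr (- s)) has_field_derivative
      (\<Prod>p\<in>P. 1 - of_nat p powr (- s)) *
      (\<Sum>p\<in>P. of_real (ln (real p)) * of_nat p powr (- s) / (1 - of_nat p powr (- s)))) (at s)"
    by simp
  moreover have "zeta s \<noteq> 0" using norm_zeta_ge[OF s] by auto
  moreover have "(\<Prod>p\<in>P. 1 - of_nat p powr (- s)) \<noteq> 0" using nz P by (simp add: prod_zero_iff)
  moreover have "s \<noteq> 1" using s by auto
  ultimately have "deriv (\<lambda>s. zeta s * (\<Prod>p\<in>P. 1 - of_nat p powr (- s))) s /
      (zeta s * (\<Prod>p\<in>P. 1 - of_nat p powr (- s))) = deriv zeta s / zeta s +
      (\<Prod>p\<in>P. 1 - of_nat p powr (- s)) *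
      (\<Sum>p\<in>P. of_real (ln (real p)) * of_nat p powr (- s) / (1 - of_nat p powr (- s))) /
      (\<Prod>p\<in>P. 1 - of_nat p powr (- s))"
    by (intro logderiv_mult has_field_derivative_zeta) auto
  also have "\<dots> = zeta_logderiv s + (\<Sum>p\<in>P. of_real (ln (real p)) * of_nat p powr (- s) / (1 - of_nat p powr (- s)))"
    using \<open>(\<Prod>p\<in>P. 1 - of_nat p powr (- s)) \<noteq> 0\<close> by (simp add: zeta_logderiv_def)
  also have "(\<Sum>p\<in>P. of_real (ln (real p)) * of_nat p powr (- s) / (1 - of_nat p powr (- s))) = prime_part N s"
    unfolding prime_part_def P_def[symmetric]
  proof (rule sum.cong[OF refl])
    fix p assume p: "p \<in> P"
    have "(of_nat p :: complex) powr s \<noteq> 0" using p by (auto simp: P_def prime_gt_0_nat)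
    then have "l * of_nat p powr (- s) / (1 - of_nat p powr (- s)) = l / (of_nat p powr s - 1)" for l :: complex
      using nz[OF p] by (simp add: powr_minus divide_simps)
    then show "of_real (ln (real p)) * of_nat p powr (- s) / (1 - of_nat p powr (- s)) =
        of_real (ln (real p)) / (of_nat p powr s - (1 :: complex))" .
  qed
  finally show ?thesis by (simp add: sifted_zeta_def[abs_def] P_def)
qed

text \<open>As the cutoff \<open>2 ^ J\<close> grows, the sieved zeta function tends to 1 and its
  derivative to 0, so \<open>zeta_logderiv + prime_part (2 ^ J)\<close> tends to 0. The dyadic bound
  for the primes between \<open>2 ^ K\<close> and \<open>2 ^ J\<close> is uniform in
  \<open>J\<close> and survives the limit.\<close>

lemma norm_zeta_logderiv_add_prime_part_le:
  assumes s: "Re s \<ge> 2"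
  shows "norm (zeta_logderiv s + prime_part (2 ^ K) s) \<le> 8 / 2 ^ K"
proof -
  obtain \<epsilon> where \<epsilon>: "\<epsilon> \<longlonglongrightarrow> 0" "\<And>N s. Re s \<ge> 3 / 2 \<Longrightarrow> norm (sifted_zeta N s - 1) \<le> \<epsilon> N"
    using sifted_zeta_bound by blast
  have lim: "(\<lambda>J. \<epsilon> (2 ^ J)) \<longlonglongrightarrow> 0"
    using LIMSEQ_subseq_LIMSEQ[OF \<epsilon>(1), of "\<lambda>J. 2 ^ J"] by (simp add: o_def strict_mono_def)
  have "eventually (\<lambda>J. \<epsilon> (2 ^ J) < 1 / 2) sequentially"
    using lim by (rule order_tendstoD) simp
  then have "eventually (\<lambda>J. norm (zeta_logderiv s + prime_part (2 ^ K) s) \<le> 8 * \<epsilon> (2 ^ J) + 8 / 2 ^ K) sequentially"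
    using eventually_ge_at_top[of K]
  proof eventually_elim
    fix J assume J: "\<epsilon> (2 ^ J) < 1 / 2" "K \<le> J"
    define Z where "Z = sifted_zeta (2 ^ J)"
    have ball: "Re u \<ge> 3 / 2" if "u \<in> ball s (1 / 2)" for u
      using that s abs_Re_le_cmod[of "s - u"] by (simp add: dist_norm)
    have hol: "Z holomorphic_on ball s (1 / 2)"
      unfolding Z_def sifted_zeta_def[abs_def]
    proof (intro holomorphic_intros)
      show "zeta holomorphic_on ball s (1 / 2)"
        by (rule holomorphic_on_subset[OF zeta_holomorphic]) (use ball[of 1] in auto)
    qed
    have "(\<lambda>u. Z u - 1) holomorphic_on ball s (1 / 2)" by (intro holomorphic_intros hol)
    then have "norm (deriv (\<lambda>u. Z u - 1) s) \<le> \<epsilon> (2 ^ J) / (1 / 4)"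
      by (rule norm_deriv_le) (use ball in \<open>auto simp: Z_def intro!: \<epsilon>(2)\<close>)
    moreover have "deriv (\<lambda>u. Z u - 1) s = deriv Z s"
      using hol by (subst deriv_diff) (auto intro: holomorphic_on_imp_differentiable_at)
    ultimately have 1: "norm (deriv Z s) \<le> 4 * \<epsilon> (2 ^ J)" by simp
    have "norm (Z s - 1) \<le> 1 / 2" using \<epsilon>(2)[of s "2 ^ J"] s J by (simp add: Z_def)
    then have 2: "norm (Z s) \<ge> 1 / 2"
      using norm_triangle_ineq2[of 1 "1 - Z s"] by (simp add: norm_minus_commute)
    have "norm (zeta_logderiv s + prime_part (2 ^ J) s) = norm (deriv Z s) / norm (Z s)"
      using logderiv_sifted_zeta[OF s, of "2 ^ J"] by (simp add: Z_def norm_divide[symmetric])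
    also have "\<dots> \<le> 4 * \<epsilon> (2 ^ J) / (1 / 2)"
      using 1 2 by (intro frac_le order_trans[OF norm_ge_zero 1]) auto
    finally have 3: "norm (zeta_logderiv s + prime_part (2 ^ J) s) \<le> 8 * \<epsilon> (2 ^ J)" by simp
    have "norm (zeta_logderiv s + prime_part (2 ^ K) s) =
        norm ((zeta_logderiv s + prime_part (2 ^ J) s) - (prime_part (2 ^ J) s - prime_part (2 ^ K) s))" by simp
    also have "\<dots> \<le> 8 * \<epsilon> (2 ^ J) + 8 / 2 ^ K"
      by (rule order_trans[OF norm_triangle_ineq4 add_mono[OF 3 norm_prime_part_diff_le[OF s J(2)]]])
    finally show "norm (zeta_logderiv s + prime_part (2 ^ K) s) \<le> 8 * \<epsilon> (2 ^ J) + 8 / 2 ^ K" .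
  qed
  moreover have "(\<lambda>J. 8 * \<epsilon> (2 ^ J) + 8 / 2 ^ K) \<longlonglongrightarrow> 8 * 0 + 8 / 2 ^ K"
    by (intro tendsto_intros lim)
  ultimately have "norm (zeta_logderiv s + prime_part (2 ^ K) s) \<le> 8 * 0 + 8 / 2 ^ K"
    by (intro tendsto_lowerbound[of _ _ sequentially]) auto
  then show ?thesis by simp
qed

lemma norm_zeta_logderiv_le_8: "Re s \<ge> 2 \<Longrightarrow> norm (zeta_logderiv s) \<le> 8"
  using norm_zeta_logderiv_add_prime_part_le[of s 0] by (simp add: prime_part_1[unfolded power_0 One_nat_def])

subsection \<open>The functional equation\<close>

text \<open>
  The Mellin transform of \<open>exp u / (exp u + 1)\<^sup>2\<close> is \<open>\<Gamma>(s + 1) (1 - 2 powr (1 - s)) \<zeta>(s)\<close>. It converges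
  for \<open>Re s > -1\<close>, and for \<open>-1 < s < 0\<close> it can also be computed from the partial fractions of
  \<open>tanh\<close>, which gives \<open>\<zeta>(1 - s)\<close>.
\<close>

lemma nn_integral_powr_exp:
  assumes a: "a > -1" and c: "c > 0"
  shows "(\<integral>\<^sup>+u. ennreal (indicator {0<..} u * (u powr a * exp (- (c * u)))) \<partial>lborel) =
         ennreal (Gamma (a + 1) * c powr (- a - 1))"
proof -
  define f where "f = (\<lambda>u::real. indicator {0<..} u * (u powr a * exp (- u)) :: real)"
  define I where "I = (\<integral>\<^sup>+u. ennreal (indicator {0<..} u * (u powr a * exp (- (c * u)))) \<partial>lborel)"
  have [measurable]: "f \<in> borel_measurable borel" unfolding f_def by measurable
  have "ennreal (Gamma (a + 1)) = (\<integral>\<^sup>+u. ennreal (f u) \<partial>lborel)"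
    using Gamma_conv_nn_integral_real[of "a + 1"] a
    by (simp add: f_def exp_minus divide_inverse mult_ac)
       (intro nn_integral_cong, auto simp: indicator_def)
  also have "\<dots> = ennreal c * (\<integral>\<^sup>+u. ennreal (f (0 + c * u)) \<partial>lborel)"
    using c by (subst nn_integral_real_affine[of _ c 0]) auto
  also have "(\<lambda>u. ennreal (f (0 + c * u))) =
      (\<lambda>u. ennreal (c powr a) * ennreal (indicator {0<..} u * (u powr a * exp (- (c * u)))))"
    using c by (auto simp: f_def fun_eq_iff indicator_def powr_mult ennreal_mult'[symmetric]
        zero_less_mult_iff mult_ac)
  also have "(\<integral>\<^sup>+u. ennreal (c powr a) * ennreal (indicator {0<..} u * (u powr a * exp (- (c * u)))) \<partial>lborel)
      = ennreal (c powr a) * I"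
    unfolding I_def by (rule nn_integral_cmult) measurable
  finally have "ennreal (c powr (- a - 1)) * ennreal (Gamma (a + 1)) =
      ennreal (c powr (- a - 1) * (c * c powr a)) * I"
    using c by (simp add: ennreal_mult' mult.assoc)
  also have "c powr (- a - 1) * (c * c powr a) = 1"
  proof -
    have "c powr (- a - 1) * (c * c powr a) = c powr (- a - 1) * (c powr 1 * c powr a)" using c by simp
    also have "\<dots> = c powr (- a - 1 + (1 + a))" by (simp only: powr_add)
    finally show ?thesis using c by simp
  qed
  finally show ?thesis using a by (simp add: I_def ennreal_mult'[symmetric] mult.commute)
qed

definition zeta_real :: "real \<Rightarrow> real" where
  "zeta_real a = (\<Sum>n. real (Suc n) powr (- a))"

lemma zeta_real_sums: "a > 1 \<Longrightarrow> (\<lambda>n. real (Suc n) powr (- a)) sums zeta_real a"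
  unfolding zeta_real_def by (intro summable_sums summable_Suc_powr) simp

lemma zeta_real_nonneg: "a > 1 \<Longrightarrow> zeta_real a \<ge> 0"
  unfolding zeta_real_def by (intro suminf_nonneg summable_Suc_powr) auto

lemma zeta_of_real: "a > 1 \<Longrightarrow> zeta (of_real a) = of_real (zeta_real a)"
proof -
  assume a: "a > 1"
  have "(\<lambda>n. of_real (real (Suc n) powr (- a)) :: complex) sums of_real (zeta_real a)"
    unfolding sums_of_real_iff by (rule zeta_real_sums[OF a])
  moreover have "of_real (real (Suc n) powr (- a)) = (of_nat (Suc n) powr (- of_real a) :: complex)" for n
    by (subst powr_of_real[symmetric]) auto
  ultimately have "(\<lambda>n. of_nat (Suc n) powr (- of_real a) :: complex) sums of_real (zeta_real a)"
    by (simp only:)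
  moreover have "(\<lambda>n. of_nat (Suc n) powr (- of_real a) :: complex) sums zeta (of_real a)"
    using a by (intro zeta_sums) simp
  ultimately show ?thesis by (rule sums_unique2[symmetric])
qed

text \<open>The kernel is the sum of \<open>n * exp (- n * u)\<close> over \<open>n \<ge> 1\<close>,
  and each term contributes \<open>Gamma (a + 1)\<close> times \<open>n powr (- a)\<close>.\<close>

lemma mellin_exp_kernel:
  assumes a: "a > 1"
  shows "(\<integral>\<^sup>+u. ennreal (indicator {0<..} u * (exp u / (exp u - 1)\<^sup>2 * u powr a)) \<partial>lborel) =
         ennreal (Gamma (a + 1) * zeta_real a)"
proof -
  define g where "g = (\<lambda>n u. real (Suc n) * (indicator {0<..} u * (u powr a * exp (- (real (Suc n) * u)))))"
  have "ennreal (indicator {0<..} u * (exp u / (exp u - 1)\<^sup>2 * u powr a)) = (\<Sum>n. ennreal (g n u))" for u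
  proof (cases "u > 0")
    case True
    have "(\<lambda>n. of_nat (Suc n) * exp (- u) ^ n) sums (1 / (1 - exp (- u))\<^sup>2)"
      using True by (intro geometric_deriv_sums) auto
    then have "(\<lambda>n. of_nat (Suc n) * exp (- u) ^ n * (exp (- u) * u powr a)) sums
        (1 / (1 - exp (- u))\<^sup>2 * (exp (- u) * u powr a))"
      by (rule sums_mult2)
    moreover have "of_nat (Suc n) * exp (- u) ^ n * (exp (- u) * u powr a) = g n u" for n
    proof -
      have "exp (- (real (Suc n) * u)) = exp (- u) ^ Suc n"
        by (simp only: exp_of_nat_mult[symmetric] mult_minus_right)
      then show ?thesis using True by (simp add: g_def)
    qed
    moreover have "1 / (1 - exp (- u))\<^sup>2 * (exp (- u) * u powr a) = exp u / (exp u - 1)\<^sup>2 * u powr a"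
    proof -
      define x where "x = exp u"
      have x: "x \<noteq> 0" "x - 1 \<noteq> 0" using True by (auto simp: x_def)
      have e: "exp (- u) = 1 / x" by (simp add: x_def exp_minus inverse_eq_divide)
      have "1 - 1 / x = (x - 1) / x" using x by (simp add: diff_divide_distrib)
      then have "1 / (1 - 1 / x)\<^sup>2 * (1 / x * u powr a) = x / (x - 1)\<^sup>2 * u powr a"
        using x by (simp add: power_divide power2_eq_square)
      then show ?thesis unfolding e x_def[symmetric] .
    qed
    ultimately have "(\<lambda>n. g n u) sums (exp u / (exp u - 1)\<^sup>2 * u powr a)" by simp
    moreover have "g n u \<ge> 0" for n by (simp add: g_def)
    ultimately show ?thesis
      using True by (subst suminf_ennreal2) (auto simp: sums_iff)
  qed (simp add: g_def)
  then have "(\<integral>\<^sup>+u. ennreal (indicator {0<..} u * (exp u / (exp u - 1)\<^sup>2 * u powr a)) \<partial>lborel) =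
      (\<integral>\<^sup>+u. (\<Sum>n. ennreal (g n u)) \<partial>lborel)" by simp
  also have "\<dots> = (\<Sum>n. \<integral>\<^sup>+u. ennreal (g n u) \<partial>lborel)"
    unfolding g_def by (rule nn_integral_suminf) measurable
  also have "\<dots> = (\<Sum>n. ennreal (Gamma (a + 1) * real (Suc n) powr (- a)))"
  proof (rule suminf_cong)
    fix n
    have "(\<integral>\<^sup>+u. ennreal (g n u) \<partial>lborel) = ennreal (real (Suc n)) *
        (\<integral>\<^sup>+u. ennreal (indicator {0<..} u * (u powr a * exp (- (real (Suc n) * u)))) \<partial>lborel)"
      unfolding g_def by (subst ennreal_mult') (auto intro!: nn_integral_cmult simp del: of_nat_Suc)
    also have "\<dots> = ennreal (real (Suc n) * (Gamma (a + 1) * real (Suc n) powr (- a - 1)))"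
      using a by (subst nn_integral_powr_exp) (auto simp: ennreal_mult' simp del: of_nat_Suc)
    also have "real (Suc n) * (Gamma (a + 1) * real (Suc n) powr (- a - 1)) =
        Gamma (a + 1) * real (Suc n) powr (- a)"
      by (simp add: powr_diff del: of_nat_Suc)
    finally show "(\<integral>\<^sup>+u. ennreal (g n u) \<partial>lborel) = ennreal (Gamma (a + 1) * real (Suc n) powr (- a))" .
  qed
  also have "\<dots> = ennreal (\<Sum>n. Gamma (a + 1) * real (Suc n) powr (- a))"
    using a by (intro suminf_ennreal2 summable_mult summable_Suc_powr) auto
  also have "(\<Sum>n. Gamma (a + 1) * real (Suc n) powr (- a)) = Gamma (a + 1) * zeta_real a"
    using a unfolding zeta_real_def by (intro suminf_mult summable_Suc_powr) auto
  finally show ?thesis .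
qed

text \<open>A quarter of the squared hyperbolic secant of \<open>u / 2\<close>. In contrast to the
  kernel with \<open>exp u - 1\<close> it is bounded at 0, so its Mellin transform exists also for
  exponents in \<open>(-1, 0)\<close>, where it meets \<open>zeta (1 - s)\<close>.\<close>

definition sech_kernel :: "real \<Rightarrow> real" where
  "sech_kernel u = exp u / (exp u + 1)\<^sup>2"

lemma sech_kernel_nonneg: "sech_kernel u \<ge> 0"
  by (simp add: sech_kernel_def)

lemma sech_kernel_measurable [measurable]: "sech_kernel \<in> borel_measurable borel"
  unfolding sech_kernel_def by measurable

lemma sech_kernel_le: "sech_kernel u \<le> exp (- u)"
proof -
  have "sech_kernel u \<le> exp u / (exp u)\<^sup>2"
    unfolding sech_kernel_def by (intro frac_le power_mono) auto
  also have "\<dots> = exp (- u)" by (simp add: exp_minus power2_eq_square divide_simps)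
  finally show ?thesis .
qed

text \<open>With \<open>x = exp u\<close> one has
  \<open>x / (x + 1)^2 = x / (x - 1)^2 - 4 * x^2 / (x^2 - 1)^2\<close>, so this kernel is the
  previous one minus four times its dilation by 2. Dilation multiplies the transform by
  \<open>2 powr (- a) / 2\<close>. The identity is integrated as a sum, because subtraction in
  \<open>ennreal\<close> is truncated.\<close>

lemma mellin_sech_kernel:
  assumes a: "a > 1"
  shows "(\<integral>\<^sup>+u. ennreal (indicator {0<..} u * (sech_kernel u * u powr a)) \<partial>lborel) =
         ennreal ((1 - 2 powr (1 - a)) * (Gamma (a + 1) * zeta_real a))"
proof -
  define K where "K = (\<lambda>u::real. indicator {0<..} u * (exp u / (exp u - 1)\<^sup>2 * u powr a))"
  define I where "I = Gamma (a + 1) * zeta_real a"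
  have I: "I \<ge> 0" using a zeta_real_nonneg[OF a] by (simp add: I_def)
  have K_nonneg: "K u \<ge> 0" for u by (simp add: K_def)
  have [measurable]: "K \<in> borel_measurable borel" unfolding K_def by measurable
  have K: "(\<integral>\<^sup>+u. ennreal (K u) \<partial>lborel) = ennreal I"
    unfolding K_def I_def by (rule mellin_exp_kernel[OF a])
  have K2: "(\<integral>\<^sup>+u. ennreal (K (2 * u)) \<partial>lborel) = ennreal (I / 2)"
  proof -
    have "ennreal I = 2 * (\<integral>\<^sup>+u. ennreal (K (2 * u)) \<partial>lborel)"
      unfolding K[symmetric] by (subst nn_integral_real_affine[of _ 2 0]) auto
    then have "ennreal (1 / 2) * ennreal I = ennreal (1 / 2) * 2 * (\<integral>\<^sup>+u. ennreal (K (2 * u)) \<partial>lborel)"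
      by (simp only: mult.assoc)
    also have "ennreal (1 / 2) * 2 = ennreal (1 / 2 * 2)" by (subst ennreal_mult') simp_all
    also have "ennreal (1 / 2) * ennreal I = ennreal (I / 2)" by (subst ennreal_mult'[symmetric]) simp_all
    finally show ?thesis by simp
  qed
  have split: "indicator {0<..} u * (sech_kernel u * u powr a) + 4 * 2 powr (- a) * K (2 * u) = K u" for u
  proof (cases "u > 0")
    case True
    define x where "x = exp u"
    have x: "x > 1" using True by (simp add: x_def)
    have e1: "4 * 2 powr (- a) * K (2 * u) = 4 * (x\<^sup>2 / (x\<^sup>2 - 1)\<^sup>2) * u powr a"
      using True by (simp add: K_def x_def powr_mult powr_minus exp_double)
    have e2: "x / (x + 1)\<^sup>2 + 4 * (x\<^sup>2 / (x\<^sup>2 - 1)\<^sup>2) = x / (x - 1)\<^sup>2"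
    proof -
      define p q where "p = (x - 1)\<^sup>2" and "q = (x + 1)\<^sup>2"
      have pq: "p \<noteq> 0" "q \<noteq> 0" using x by (auto simp: p_def q_def)
      have "(x\<^sup>2 - 1)\<^sup>2 = p * q" by (simp add: p_def q_def power2_eq_square) (simp add: algebra_simps)
      moreover have "x * p + 4 * x\<^sup>2 = x * q" by (simp add: p_def q_def power2_eq_square algebra_simps)
      moreover have "x / q + 4 * (x\<^sup>2 / (p * q)) = (x * p + 4 * x\<^sup>2) / (p * q)"
        using pq by (simp add: add_divide_distrib)
      moreover have "x * q / (p * q) = x / p" using pq by simp
      ultimately show ?thesis by (simp only: p_def[symmetric] q_def[symmetric])
    qed
    have "indicator {0<..} u * (sech_kernel u * u powr a) = x / (x + 1)\<^sup>2 * u powr a"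
      "K u = x / (x - 1)\<^sup>2 * u powr a"
      using True by (simp_all add: K_def sech_kernel_def x_def)
    then show ?thesis by (simp only: e1 e2 distrib_right[symmetric])
  qed (simp add: K_def zero_less_mult_iff)
  have "ennreal I = (\<integral>\<^sup>+u. ennreal (indicator {0<..} u * (sech_kernel u * u powr a)) +
      ennreal (4 * 2 powr (- a)) * ennreal (K (2 * u)) \<partial>lborel)"
    unfolding K[symmetric]
  proof (rule nn_integral_cong)
    fix u
    have "ennreal (K u) = ennreal (indicator {0<..} u * (sech_kernel u * u powr a) + 4 * 2 powr (- a) * K (2 * u))"
      by (simp only: split)
    also have "\<dots> = ennreal (indicator {0<..} u * (sech_kernel u * u powr a)) + ennreal (4 * 2 powr (- a) * K (2 * u))"
      by (rule ennreal_plus) (simp_all add: sech_kernel_nonneg K_nonneg)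
    finally show "ennreal (K u) = ennreal (indicator {0<..} u * (sech_kernel u * u powr a)) +
        ennreal (4 * 2 powr (- a)) * ennreal (K (2 * u))"
      by (simp add: ennreal_mult' K_nonneg)
  qed
  also have "\<dots> = (\<integral>\<^sup>+u. ennreal (indicator {0<..} u * (sech_kernel u * u powr a)) \<partial>lborel) +
      ennreal (4 * 2 powr (- a)) * ennreal (I / 2)"
    unfolding K2[symmetric] by (subst nn_integral_add) (auto simp: nn_integral_cmult)
  also have "ennreal (4 * 2 powr (- a)) * ennreal (I / 2) = ennreal (2 powr (1 - a) * I)"
  proof -
    have "2 powr (1 - a) = 2 * 2 powr (- a)" by (simp add: powr_diff powr_minus divide_inverse)
    then have "2 powr (1 - a) * I = 4 * 2 powr (- a) * (I / 2)" by simp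
    moreover have "ennreal (4 * 2 powr (- a) * (I / 2)) = ennreal (4 * 2 powr (- a)) * ennreal (I / 2)"
      by (rule ennreal_mult') simp
    ultimately show ?thesis by (simp only:)
  qed
  finally have "ennreal I - ennreal (2 powr (1 - a) * I) =
      (\<integral>\<^sup>+u. ennreal (indicator {0<..} u * (sech_kernel u * u powr a)) \<partial>lborel)"
    by (simp add: ennreal_add_diff_cancel_right)
  then show ?thesis using I by (simp add: ennreal_minus I_def left_diff_distrib)
qed

lemma sech_kernel_integrable:
  assumes a: "a > -1"
  shows "integrable lborel (\<lambda>u. indicator {0<..} u * (sech_kernel u * u powr a))"
proof (rule integrableI_bounded)
  have "(\<integral>\<^sup>+u. ennreal (norm (indicator {0<..} u * (sech_kernel u * u powr a))) \<partial>lborel) \<le>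
      (\<integral>\<^sup>+u. ennreal (indicator {0<..} u * (u powr a * exp (- (1 * u)))) \<partial>lborel)"
  proof (intro nn_integral_mono ennreal_leI)
    fix u
    show "norm (indicator {0<..} u * (sech_kernel u * u powr a)) \<le>
        indicator {0<..} u * (u powr a * exp (- (1 * u)))"
      using mult_left_mono[OF sech_kernel_le[of u], of "u powr a"]
      by (cases "u > 0") (simp_all add: sech_kernel_nonneg mult.commute)
  qed
  also have "\<dots> < \<infinity>" using nn_integral_powr_exp[OF a, of 1] by simp
  finally show "(\<integral>\<^sup>+u. ennreal (norm (indicator {0<..} u * (sech_kernel u * u powr a))) \<partial>lborel) < \<infinity>" .
  show "(\<lambda>u. indicator {0<..} u * (sech_kernel u * u powr a)) \<in> borel_measurable lborel"
    by measurable
qed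

lemma norm_exp_minus_1_le:
  fixes z :: complex
  shows "norm (exp z - 1) \<le> norm z * exp (norm z)"
proof -
  have "norm (exp z - exp 0) \<le> exp (norm z) * norm (z - 0)"
  proof (rule field_differentiable_bound[where S = "cball 0 (norm z)" and f' = exp])
    fix w :: complex assume "w \<in> cball 0 (norm z)"
    then show "norm (exp w) \<le> exp (norm z)" using complex_Re_le_cmod[of w] by simp
  qed (auto intro!: derivative_eq_intros)
  then show ?thesis by (simp add: mult.commute)
qed

text \<open>Differentiation under the integral sign by dominated convergence; integrability at the
  neighbouring real exponents supplies the majorant.\<close>

lemma mellin_holomorphic:
  fixes w :: "real \<Rightarrow> real"
  assumes [measurable]: "w \<in> borel_measurable borel" and w: "\<And>u. w u \<ge> 0"
    and int: "\<And>a. A < a \<Longrightarrow> integrable lborel (\<lambda>u. indicator {0<..} u * (w u * u powr a))"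
  shows "(\<lambda>s. \<integral>u. of_real (indicator {0<..} u * w u) * of_real u powr s \<partial>lborel) holomorphic_on {s. Re s > A}"
proof -
  define f where "f = (\<lambda>s u. of_real (indicator {0<..} u * w u) * of_real u powr s :: complex)"
  define f' where "f' = (\<lambda>s u. f s u * of_real (ln u))"
  have nf: "norm (f s u) = indicator {0<..} u * (w u * u powr Re s)" for s u
    using w[of u] by (cases "u > 0") (auto simp: f_def norm_mult norm_powr_real_powr)
  have [measurable]: "f s \<in> borel_measurable borel" for s
    unfolding f_def by measurable
  have int_f: "integrable lborel (f s)" if "Re s > A" for s
    by (rule Bochner_Integration.integrable_bound[OF int[OF that]]) (auto simp: nf)
  have "((\<lambda>s. \<integral>u. f s u \<partial>lborel) has_field_derivative (\<integral>u. f' s u \<partial>lborel)) (at s)"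
    if s: "Re s > A" for s
  proof -
    define \<delta> where "\<delta> = (Re s - A) / 3"
    have \<delta>: "\<delta> > 0" "Re s - 2 * \<delta> > A" using s by (auto simp: \<delta>_def field_simps)
    \<comment> \<open>One \<open>\<delta>\<close> in the exponent pays for
      \<open>exp (\<delta> * \<bar>ln u\<bar>)\<close>, the other for the factor
      \<open>\<bar>ln u\<bar>\<close>, at the price \<open>1 / \<delta>\<close>. Both signs are
      needed, for large and for small \<open>u\<close>.\<close>
    define g where "g = (\<lambda>u. (1 / \<delta>) * (indicator {0<..} u * (w u * u powr (Re s + 2 * \<delta>)) +
        indicator {0<..} u * (w u * u powr (Re s - 2 * \<delta>))))"
    have g: "integrable lborel g"
      unfolding g_def by (intro integrable_mult_right Bochner_Integration.integrable_add int) (use \<delta> in auto)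
    have quot: "f (s + h) u - f s u = f s u * (exp (h * of_real (ln u)) - 1)" if "u > 0" for h u
    proof -
      have "of_real u powr h = exp (h * of_real (ln u))" using that by (simp add: powr_def Ln_of_real)
      then show ?thesis using that by (simp add: f_def powr_add algebra_simps)
    qed
    have bound: "norm ((f (s + h) u - f s u) / h) \<le> g u" if h: "norm h \<le> \<delta>" "h \<noteq> 0" for h u
    proof (cases "u > 0")
      case True
      define L where "L = \<bar>ln u\<bar>"
      have "norm (exp (h * of_real (ln u)) - 1) \<le> norm h * L * exp (norm h * L)"
        using norm_exp_minus_1_le[of "h * of_real (ln u)"] by (simp add: norm_mult L_def)
      also have "\<dots> \<le> norm h * L * exp (\<delta> * L)"
        using h by (intro mult_left_mono) (auto simp: L_def intro!: mult_right_mono)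
      finally have 1: "norm ((exp (h * of_real (ln u)) - 1) / h) \<le> L * exp (\<delta> * L)"
        using h by (simp add: norm_divide field_simps)
      have "\<delta> * L \<le> exp (\<delta> * L)" using exp_ge_add_one_self[of "\<delta> * L"] by linarith
      then have "L \<le> exp (\<delta> * L) / \<delta>" using \<delta> by (simp add: field_simps)
      then have "L * exp (\<delta> * L) \<le> exp (\<delta> * L) / \<delta> * exp (\<delta> * L)" by (intro mult_right_mono) auto
      also have "\<dots> = (1 / \<delta>) * exp (2 * \<delta> * L)" by (simp add: exp_add[symmetric])
      also have "exp (2 * \<delta> * L) \<le> u powr (2 * \<delta>) + u powr (- 2 * \<delta>)"
        using True by (cases "ln u \<ge> 0") (auto simp: L_def powr_def abs_if)
      finally have 2: "L * exp (\<delta> * L) \<le> (1 / \<delta>) * (u powr (2 * \<delta>) + u powr (- 2 * \<delta>))"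
        using \<delta> by (simp add: divide_right_mono)
      have "norm ((f (s + h) u - f s u) / h) = norm (f s u) * norm ((exp (h * of_real (ln u)) - 1) / h)"
        unfolding quot[OF True] by (simp add: norm_mult norm_divide)
      also have "\<dots> \<le> norm (f s u) * ((1 / \<delta>) * (u powr (2 * \<delta>) + u powr (- 2 * \<delta>)))"
        using 1 2 by (intro mult_left_mono) auto
      also have "\<dots> = g u"
        using True by (simp add: nf g_def powr_add powr_diff powr_minus divide_inverse algebra_simps)
      finally show ?thesis .
    qed (auto simp: f_def g_def)
    have lim: "((\<lambda>h. (f (s + h) u - f s u) / h) \<longlongrightarrow> f' s u) (at 0)" for u
    proof (cases "u > 0")
      case True
      have "((\<lambda>h. exp (h * of_real (ln u))) has_field_derivative of_real (ln u)) (at (0::complex))"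
        by (auto intro!: derivative_eq_intros)
      then have "((\<lambda>h. (exp (h * of_real (ln u)) - 1) / h) \<longlongrightarrow> of_real (ln u)) (at (0::complex))"
        by (simp add: has_field_derivative_iff)
      then have "((\<lambda>h. f s u * ((exp (h * of_real (ln u)) - 1) / h)) \<longlongrightarrow> f' s u) (at 0)"
        unfolding f'_def by (rule tendsto_mult_left)
      then show ?thesis unfolding quot[OF True] by simp
    qed (auto simp: f_def f'_def)
    have "((\<lambda>h. ((\<integral>u. f (s + h) u \<partial>lborel) - (\<integral>u. f s u \<partial>lborel)) / h) \<longlongrightarrow> (\<integral>u. f' s u \<partial>lborel)) (at 0)"
      unfolding tendsto_at_iff_sequentially
    proof (intro allI impI)
      fix X :: "nat \<Rightarrow> complex"
      assume X: "\<forall>i. X i \<in> UNIV - {0}" "X \<longlonglongrightarrow> 0"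
      have "eventually (\<lambda>i. norm (X i) < \<delta>) sequentially"
        using X(2) \<delta>(1) by (auto simp: tendsto_iff)
      then obtain N where N: "\<And>i. i \<ge> N \<Longrightarrow> norm (X i) < \<delta>" by (auto simp: eventually_sequentially)
      \<comment> \<open>Dropping finitely many terms makes the majorant valid along the whole
        sequence.\<close>
      define Y where "Y = (\<lambda>i. X (i + N))"
      have Y: "norm (Y i) \<le> \<delta>" "Y i \<noteq> 0" for i using N[of "i + N"] X(1) by (auto simp: Y_def)
      have Y0: "filterlim Y (at 0) sequentially"
        using X(2) Y(2) unfolding Y_def by (auto simp: filterlim_at intro: LIMSEQ_ignore_initial_segment)
      have "(\<lambda>i. \<integral>u. (f (s + Y i) u - f s u) / Y i \<partial>lborel) \<longlonglongrightarrow> (\<integral>u. f' s u \<partial>lborel)"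
      proof (rule integral_dominated_convergence[where w = g])
        show "f' s \<in> borel_measurable lborel" unfolding f'_def by measurable
        show "AE u in lborel. (\<lambda>i. (f (s + Y i) u - f s u) / Y i) \<longlonglongrightarrow> f' s u"
          using filterlim_compose[OF lim Y0] by auto
      qed (use g bound Y in auto)
      moreover have "(\<integral>u. (f (s + Y i) u - f s u) / Y i \<partial>lborel) =
          ((\<integral>u. f (s + Y i) u \<partial>lborel) - (\<integral>u. f s u \<partial>lborel)) / Y i" for i
      proof -
        have "Re (s + Y i) > A" using \<delta> Y(1)[of i] abs_Re_le_cmod[of "Y i"] by auto
        then show ?thesis
          using int_f[of "s + Y i"] int_f[OF s] by (subst integral_divide_zero) (auto simp: Bochner_Integration.integral_diff)
      qed
      ultimately have "(\<lambda>i. ((\<integral>u. f (s + Y i) u \<partial>lborel) - (\<integral>u. f s u \<partial>lborel)) / Y i)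
          \<longlonglongrightarrow> (\<integral>u. f' s u \<partial>lborel)" by (simp only:)
      then show "((\<lambda>h. ((\<integral>u. f (s + h) u \<partial>lborel) - (\<integral>u. f s u \<partial>lborel)) / h) \<circ> X)
          \<longlonglongrightarrow> (\<integral>u. f' s u \<partial>lborel)"
        unfolding o_def Y_def by (rule LIMSEQ_offset)
    qed
    then show ?thesis by (simp only: DERIV_def)
  qed
  then have "(\<lambda>s. \<integral>u. f s u \<partial>lborel) holomorphic_on {s. Re s > A}"
    by (subst holomorphic_on_open) (auto intro: open_halfspace_Re_gt)
  then show ?thesis by (simp only: f_def)
qed

section \<open>The transform to the left of 0\<close>

text \<open>With \<open>x = v^2\<close> this is half the beta integral of
  \<open>x powr b / (1 + x)\<close>. Writing \<open>1 / (1 + x)\<close> as an integral of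
  exponentials and exchanging the order yields \<open>Gamma (b + 1) * Gamma (- b)\<close>, and the
  reflection formula gives the cosine.\<close>

lemma nn_integral_powr_over_square_plus_1:
  assumes a: "-1 < a" "a < 1"
  shows "(\<integral>\<^sup>+v. ennreal (indicator {0<..} v * (v powr a / (1 + v\<^sup>2))) \<partial>lborel) =
         ennreal (pi / (2 * cos (pi * a / 2)))"
proof -
  define b where "b = (a - 1) / 2"
  have b: "-1 < b" "b < 0" using a by (auto simp: b_def field_simps)
  define I where "I = Gamma (b + 1) * Gamma (- b)"
  have "(\<integral>\<^sup>+x. ennreal (indicator {0<..} x * (x powr b / (1 + x))) \<partial>lborel) =
      (\<integral>\<^sup>+x. (\<integral>\<^sup>+w. ennreal (indicator {0<..} x * x powr b) * ennreal (indicator {0<..} w * exp (- ((1 + x) * w))) \<partial>lborel) \<partial>lborel)"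
  proof (rule nn_integral_cong)
    fix x :: real
    show "ennreal (indicator {0<..} x * (x powr b / (1 + x))) =
      (\<integral>\<^sup>+w. ennreal (indicator {0<..} x * x powr b) * ennreal (indicator {0<..} w * exp (- ((1 + x) * w))) \<partial>lborel)"
    proof (cases "x > 0")
      case True
      have "(\<integral>\<^sup>+w. ennreal (indicator {0<..} w * exp (- ((1 + x) * w))) \<partial>lborel) = 
          (\<integral>\<^sup>+w. ennreal (indicator {0<..} w * (w powr 0 * exp (- ((1 + x) * w)))) \<partial>lborel)"
        by (intro nn_integral_cong) (auto simp: indicator_def)
      also have "\<dots> = ennreal (1 / (1 + x))"
        using True by (subst nn_integral_powr_exp) (auto simp: powr_minus divide_inverse)
      finally show ?thesis
        using True by (subst nn_integral_cmult) (auto simp: ennreal_mult'[symmetric])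
    qed simp
  qed
  also have "\<dots> = (\<integral>\<^sup>+w. (\<integral>\<^sup>+x. ennreal (indicator {0<..} x * x powr b) * ennreal (indicator {0<..} w * exp (- ((1 + x) * w))) \<partial>lborel) \<partial>lborel)"
    by (rule lborel_pair.Fubini') measurable
  also have "\<dots> = (\<integral>\<^sup>+w. ennreal (Gamma (b + 1)) * ennreal (indicator {0<..} w * (w powr (- b - 1) * exp (- (1 * w)))) \<partial>lborel)"
  proof (rule nn_integral_cong)
    fix w :: real
    show "(\<integral>\<^sup>+x. ennreal (indicator {0<..} x * x powr b) * ennreal (indicator {0<..} w * exp (- ((1 + x) * w))) \<partial>lborel)
      = ennreal (Gamma (b + 1)) * ennreal (indicator {0<..} w * (w powr (- b - 1) * exp (- (1 * w))))"
    proof (cases "w > 0")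
      case True
      have "(\<integral>\<^sup>+x. ennreal (indicator {0<..} x * x powr b) * ennreal (indicator {0<..} w * exp (- ((1 + x) * w))) \<partial>lborel)
         = (\<integral>\<^sup>+x. ennreal (exp (- w)) * ennreal (indicator {0<..} x * (x powr b * exp (- (w * x)))) \<partial>lborel)"
        using True by (intro nn_integral_cong)
          (auto simp: indicator_def ennreal_mult'[symmetric] exp_add[symmetric] algebra_simps)
      also have "\<dots> = ennreal (exp (- w)) * ennreal (Gamma (b + 1) * w powr (- b - 1))"
        using True b by (subst nn_integral_cmult) (auto simp: nn_integral_powr_exp)
      finally show ?thesis
        using True b by (simp add: ennreal_mult'[symmetric] mult_ac)
    qed simp
  qed
  also have "\<dots> = ennreal (Gamma (b + 1)) * ennreal (Gamma (- b))"
    using b by (subst nn_integral_cmult) (auto simp: nn_integral_powr_exp[of "- b - 1" 1, simplified])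
  also have "\<dots> = ennreal I" using b by (simp add: I_def ennreal_mult'[symmetric])
  finally have nn: "(\<integral>\<^sup>+x. ennreal (indicator {0<..} x * (x powr b / (1 + x))) \<partial>lborel) = ennreal I" .
  have I: "I \<ge> 0" using b by (simp add: I_def)
  define F where "F = (\<lambda>x::real. x powr b / (1 + x))"
  have meas: "(\<lambda>x. indicator {0<..} x * F x) \<in> borel_measurable borel" unfolding F_def by measurable
  have hbi: "has_bochner_integral lborel (\<lambda>x. indicator {0<..} x * F x) I"
    by (rule has_bochner_integral_nn_integral) (use nn I meas in \<open>auto simp: F_def indicator_def\<close>)
  then have "set_integrable lborel {0<..} F"
    by (simp add: set_integrable_def has_bochner_integral_iff)
  then have F_abs: "F absolutely_integrable_on {0<..}"
    unfolding absolutely_integrable_on_def[symmetric]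
    by (simp add: set_integrable_def integrable_completion)
  have F_int: "integral {0<..} F = I"
    using hbi F_abs
    by (simp add: set_lebesgue_integral_eq_integral(2)[OF F_abs, symmetric] set_lebesgue_integral_def
        has_bochner_integral_iff integral_completion meas)
  have img: "(\<lambda>v::real. v\<^sup>2) ` {0<..} = {0<..}"
  proof (intro equalityI subsetI)
    fix x :: real assume "x \<in> {0<..}"
    then show "x \<in> (\<lambda>v. v\<^sup>2) ` {0<..}" by (intro image_eqI[of _ _ "sqrt x"]) auto
  qed auto
  have "(\<lambda>v. \<bar>2 * v\<bar> * F (v\<^sup>2)) absolutely_integrable_on {0<..} \<and>
      integral {0<..} (\<lambda>v. \<bar>2 * v\<bar> * F (v\<^sup>2)) = I"
  proof (subst has_absolute_integral_change_of_variables_1'[where f = F and g = "\<lambda>v. v\<^sup>2" and g' = "\<lambda>v. 2 * v"])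
    show "inj_on (\<lambda>v::real. v\<^sup>2) {0<..}" by (auto simp: inj_on_def)
    show "((\<lambda>v. v\<^sup>2) has_real_derivative 2 * x) (at x within {0<..})" for x :: real
      by (auto intro!: derivative_eq_intros)
  qed (use F_abs F_int img in auto)
  then have hi: "((\<lambda>v. \<bar>2 * v\<bar> * F (v\<^sup>2)) has_integral I) {0<..}"
    by (auto simp: has_integral_iff absolutely_integrable_on_def dest: set_lebesgue_integral_eq_integral(1))
  have "((\<lambda>v. v powr a / (1 + v\<^sup>2)) has_integral (I / 2)) {0<..}"
  proof -
    have "((\<lambda>v. (1 / 2) * (\<bar>2 * v\<bar> * F (v\<^sup>2))) has_integral ((1 / 2) * I)) {0<..}"
      by (rule has_integral_mult_right[OF hi])
    moreover have "(1 / 2) * (\<bar>2 * v\<bar> * F (v\<^sup>2)) = v powr a / (1 + v\<^sup>2)" if "v \<in> {0<..}" for v :: real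
    proof -
      have "(v\<^sup>2) powr b = (v powr 2) powr b" using that by simp
      also have "\<dots> = v powr (2 * b)" by (rule powr_powr)
      also have "2 * b = a - 1" by (simp add: b_def)
      finally have "(v\<^sup>2) powr b = v powr (a - 1)" .
      then have "v * (v\<^sup>2) powr b = v powr a" using that by (simp add: powr_diff)
      then show ?thesis using that by (simp add: F_def)
    qed
    ultimately have "((\<lambda>v. v powr a / (1 + v\<^sup>2)) has_integral ((1 / 2) * I)) {0<..}"
      by (rule has_integral_eq[rotated])
    then show ?thesis by (simp only: times_divide_eq_left mult_1)
  qed
  then have "(\<integral>\<^sup>+v. ennreal (indicator {0<..} v * (v powr a / (1 + v\<^sup>2))) \<partial>lborel) = ennreal (I / 2)"
    by (intro nn_integral_has_integral_lebesgue) auto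
  also have "I / 2 = pi / (2 * cos (pi * a / 2))"
  proof -
    have "complex_of_real I = Gamma (of_real (b + 1)) * Gamma (1 - of_real (b + 1))"
      by (simp add: I_def flip: Gamma_complex_of_real)
    also have "\<dots> = of_real pi / sin (of_real pi * of_real (b + 1))" by (rule Gamma_reflection_complex)
    also have "\<dots> = of_real (pi / sin (pi * (b + 1)))"
      by (simp only: of_real_mult[symmetric] sin_of_real of_real_divide)
    finally have "I = pi / sin (pi * (b + 1))" by (simp only: of_real_eq_iff)
    also have "pi * (b + 1) = pi * a / 2 + pi / 2" by (simp add: b_def field_simps)
    also have "sin (pi * a / 2 + pi / 2) = cos (pi * a / 2)" by (simp add: sin_add)
    finally show ?thesis by simp
  qed
  finally show ?thesis .
qed

text \<open>Differentiate the constant function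
  \<open>Gamma z * Gamma (1 - z) * sin (pi * z)\<close>.\<close>

lemma Digamma_reflection:
  assumes z: "z \<notin> (\<int> :: complex set)"
  shows "Digamma (1 - z) - Digamma z = of_real pi * cos (of_real pi * z) / sin (of_real pi * z)"
proof -
  have nz: "z \<notin> \<int>\<^sub>\<le>\<^sub>0" "1 - z \<notin> \<int>\<^sub>\<le>\<^sub>0"
    using z nonpos_Ints_Int[of z] nonpos_Ints_Int[of "1 - z"] Ints_diff[of 1 "1 - z"] by auto
  have sin: "sin (of_real pi * z) \<noteq> 0"
    using z by (auto simp: sin_eq_0 mult.commute)
  have "((\<lambda>z. Gamma z * Gamma (1 - z) * sin (of_real pi * z)) has_field_derivative
      (Gamma z * Digamma z * Gamma (1 - z) + Gamma z * (Gamma (1 - z) * Digamma (1 - z) * (- 1))) * sin (of_real pi * z)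
      + Gamma z * Gamma (1 - z) * (cos (of_real pi * z) * of_real pi)) (at z)"
    using nz by (auto intro!: derivative_eq_intros)
  moreover have "((\<lambda>z. Gamma z * Gamma (1 - z) * sin (of_real pi * z)) has_field_derivative 0) (at z)"
  proof (rule has_field_derivative_transform_within_open[where f = "\<lambda>_. of_real pi" and S = "- \<int>"])
    show "open (- (\<int> :: complex set))" by (simp add: open_Compl closed_Ints)
    fix w :: complex assume "w \<in> - \<int>"
    then have "sin (of_real pi * w) \<noteq> 0" by (auto simp: sin_eq_0 mult.commute)
    then show "of_real pi = Gamma w * Gamma (1 - w) * sin (of_real pi * w)"
      by (simp add: Gamma_reflection_complex)
  qed (use z in auto)
  ultimately have "(Gamma z * Digamma z * Gamma (1 - z) + Gamma z * (Gamma (1 - z) * Digamma (1 - z) * (- 1))) * sin (of_real pi * z)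
      + Gamma z * Gamma (1 - z) * (cos (of_real pi * z) * of_real pi) = 0"
    by (rule DERIV_unique)
  then have "(Gamma z * Gamma (1 - z)) * ((Digamma z - Digamma (1 - z)) * sin (of_real pi * z) + of_real pi * cos (of_real pi * z)) = 0"
    by (simp add: algebra_simps)
  moreover have "Gamma z * Gamma (1 - z) \<noteq> 0" using nz by (simp add: Gamma_eq_zero_iff)
  ultimately have "(Digamma z - Digamma (1 - z)) * sin (of_real pi * z) + of_real pi * cos (of_real pi * z) = 0"
    by simp
  then have "(Digamma (1 - z) - Digamma z) * sin (of_real pi * z) = of_real pi * cos (of_real pi * z)"
    by algebra
  then show ?thesis using sin by (simp add: nonzero_eq_divide_eq)
qed

lemma sin_cos_i_times_of_real:
  "sin (\<i> * of_real y) = \<i> * of_real (sinh y)" "cos (\<i> * of_real y) = of_real (cosh y)"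
  by (simp_all add: sin_i_times cos_i_times sinh_field_def cosh_field_def exp_minus exp_of_real)

text \<open>The imaginary part of the reflection formula for \<open>Digamma\<close> at
  \<open>1/2 + \<i> * x / (2 * pi)\<close>: there the cotangent becomes a hyperbolic tangent, and
  the series for the two values of \<open>Digamma\<close> subtract termwise.\<close>

lemma tanh_partial_fractions:
  assumes x: "x > (0::real)"
  shows "(\<lambda>n. 2 * x / (x\<^sup>2 + (real (2 * n + 1) * pi)\<^sup>2)) sums (tanh (x / 2) / 2)"
proof -
  define y where "y = x / (2 * pi)"
  have y: "y > 0" using x by (simp add: y_def)
  define z where "z = 1 / 2 + \<i> * of_real y"
  have z: "z \<notin> \<int>" using y by (auto simp: z_def complex_is_Int_iff)
  then have nz: "z \<notin> \<int>\<^sub>\<le>\<^sub>0" "1 - z \<notin> \<int>\<^sub>\<le>\<^sub>0"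
    using nonpos_Ints_Int[of z] nonpos_Ints_Int[of "1 - z"] Ints_diff[of 1 "1 - z"] by auto
  have nz': "z + of_nat k \<noteq> 0" "1 - z + of_nat k \<noteq> 0" for k
    using y by (auto simp: z_def complex_eq_iff)
  have ds: "(\<lambda>k. inverse (of_nat (Suc k)) - inverse (w + of_nat k)) sums (Digamma w + euler_mascheroni)"
    if "w \<notin> \<int>\<^sub>\<le>\<^sub>0" for w :: complex
  proof -
    have "w \<noteq> 0" using that by auto
    from summable_sums[OF summable_Digamma[OF this]] show ?thesis by (simp add: Digamma_def)
  qed
  have "(\<lambda>k. inverse (z + of_nat k) - inverse (1 - z + of_nat k)) sums (Digamma (1 - z) - Digamma z)"
    using sums_diff[OF ds[OF nz(2)] ds[OF nz(1)]] by simp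
  also have "Digamma (1 - z) - Digamma z = of_real pi * cos (of_real pi * z) / sin (of_real pi * z)"
    by (rule Digamma_reflection[OF z])
  also have "\<dots> = - \<i> * of_real (pi * tanh (x / 2))"
  proof -
    have e: "of_real pi * z = of_real pi / 2 + \<i> * of_real (x / 2)"
      by (simp add: z_def y_def algebra_simps)
    have "cos (of_real pi * z) = - sin (\<i> * of_real (x / 2))"
      "sin (of_real pi * z) = cos (\<i> * of_real (x / 2))"
      unfolding e cos_add sin_add cos_of_real_pi_half sin_of_real_pi_half by simp_all
    then have "of_real pi * cos (of_real pi * z) / sin (of_real pi * z) =
        of_real pi * (- (\<i> * of_real (sinh (x / 2)))) / of_real (cosh (x / 2))"
      by (simp only: sin_cos_i_times_of_real)
    also have "\<dots> = - \<i> * of_real (pi * (sinh (x / 2) / cosh (x / 2)))" by simp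
    finally show ?thesis by (simp only: tanh_def)
  qed
  finally have "(\<lambda>k. Im (inverse (z + of_nat k) - inverse (1 - z + of_nat k))) sums Im (- \<i> * of_real (pi * tanh (x / 2)))"
    by (rule sums_Im)
  then have "(\<lambda>k. - 1 / (2 * pi) * Im (inverse (z + of_nat k) - inverse (1 - z + of_nat k))) sums
      (- 1 / (2 * pi) * (- (pi * tanh (x / 2))))"
    by (intro sums_mult) simp
  moreover have "- 1 / (2 * pi) * (- (pi * tanh (x / 2))) = tanh (x / 2) / 2" by simp
  moreover have "- 1 / (2 * pi) * Im (inverse (z + of_nat k) - inverse (1 - z + of_nat k)) =
      2 * x / (x\<^sup>2 + (real (2 * k + 1) * pi)\<^sup>2)" for k
  proof -
    define r where "r = real k + 1 / 2"
    have z1: "z + of_nat k = Complex r y" "1 - z + of_nat k = Complex r (- y)"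
      by (simp_all add: z_def r_def complex_eq_iff)
    have "Im (inverse (z + of_nat k) - inverse (1 - z + of_nat k)) = - (2 * y / (r\<^sup>2 + y\<^sup>2))"
      unfolding z1 by (simp add: add_divide_distrib[symmetric])
    then have "- 1 / (2 * pi) * Im (inverse (z + of_nat k) - inverse (1 - z + of_nat k)) = y / (pi * (r\<^sup>2 + y\<^sup>2))"
      by simp
    also have "\<dots> = (4 * pi\<^sup>2 * y) / (4 * pi\<^sup>2 * (pi * (r\<^sup>2 + y\<^sup>2)))" by simp
    also have "4 * pi\<^sup>2 * y = pi * (2 * x)" by (simp add: y_def power2_eq_square)
    also have "4 * pi\<^sup>2 * (pi * (r\<^sup>2 + y\<^sup>2)) = pi * ((2 * pi * r)\<^sup>2 + (2 * pi * y)\<^sup>2)"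
      by (simp add: power2_eq_square distrib_left)
    also have "2 * pi * r = real (2 * k + 1) * pi" by (simp add: r_def algebra_simps)
    also have "2 * pi * y = x" by (simp add: y_def)
    finally show ?thesis by (simp add: add.commute)
  qed
  ultimately show ?thesis by simp
qed

lemma nn_integral_powr_over_square_plus_square:
  assumes a: "-1 < a" "a < 1" and b: "b > 0"
  shows "(\<integral>\<^sup>+v. ennreal (indicator {0<..} v * (v powr a / (v\<^sup>2 + b\<^sup>2))) \<partial>lborel) =
         ennreal (b powr (a - 1) * (pi / (2 * cos (pi * a / 2))))"
proof -
  have "(\<integral>\<^sup>+v. ennreal (indicator {0<..} v * (v powr a / (v\<^sup>2 + b\<^sup>2))) \<partial>lborel) =
      ennreal b * (\<integral>\<^sup>+v. ennreal (indicator {0<..} (b * v) * ((b * v) powr a / ((b * v)\<^sup>2 + b\<^sup>2))) \<partial>lborel)"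
    using b by (subst nn_integral_real_affine[of _ b 0]) auto
  also have "(\<lambda>v. ennreal (indicator {0<..} (b * v) * ((b * v) powr a / ((b * v)\<^sup>2 + b\<^sup>2)))) =
      (\<lambda>v. ennreal (b powr a / b\<^sup>2) * ennreal (indicator {0<..} v * (v powr a / (1 + v\<^sup>2))))"
  proof
    fix v
    have "(b * v)\<^sup>2 + b\<^sup>2 = b\<^sup>2 * (1 + v\<^sup>2)" by (simp add: power_mult_distrib algebra_simps)
    moreover have "(b * v) powr a = b powr a * v powr a" if "v > 0" using that b by (simp add: powr_mult)
    ultimately have "indicator {0<..} (b * v) * ((b * v) powr a / ((b * v)\<^sup>2 + b\<^sup>2)) =
        b powr a / b\<^sup>2 * (indicator {0<..} v * (v powr a / (1 + v\<^sup>2)))"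
      using b by (cases "v > 0") (simp_all add: zero_less_mult_iff)
    then show "ennreal (indicator {0<..} (b * v) * ((b * v) powr a / ((b * v)\<^sup>2 + b\<^sup>2))) =
        ennreal (b powr a / b\<^sup>2) * ennreal (indicator {0<..} v * (v powr a / (1 + v\<^sup>2)))"
      by (simp only: ennreal_mult'[of "b powr a / b\<^sup>2"] powr_ge_zero zero_le_power2 divide_nonneg_nonneg)
  qed
  also have "(\<integral>\<^sup>+v. ennreal (b powr a / b\<^sup>2) * ennreal (indicator {0<..} v * (v powr a / (1 + v\<^sup>2))) \<partial>lborel) =
      ennreal (b powr a / b\<^sup>2) * ennreal (pi / (2 * cos (pi * a / 2)))"
    by (subst nn_integral_cmult) (measurable, simp only: nn_integral_powr_over_square_plus_1[OF a])
  also have "ennreal b * (ennreal (b powr a / b\<^sup>2) * ennreal (pi / (2 * cos (pi * a / 2)))) =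
      ennreal (b * (b powr a / b\<^sup>2 * (pi / (2 * cos (pi * a / 2)))))"
    using b by (simp only: ennreal_mult'[of b] ennreal_mult'[of "b powr a / b\<^sup>2"] less_imp_le
        powr_ge_zero zero_le_power2 divide_nonneg_nonneg)
  also have "b * (b powr a / b\<^sup>2 * (pi / (2 * cos (pi * a / 2)))) = b powr (a - 1) * (pi / (2 * cos (pi * a / 2)))"
    using b by (simp add: powr_diff power2_eq_square)
  finally show ?thesis .
qed

lemma odd_powr_sums:
  assumes e: "e > 1"
  shows "(\<lambda>n. real (2 * n + 1) powr (- e)) sums ((1 - 2 powr (- e)) * zeta_real e)"
proof -
  have "(\<lambda>n. \<Sum>m=n*2..<n*2+2. real (Suc m) powr (- e)) sums zeta_real e"
    by (rule sums_group[OF zeta_real_sums[OF e]]) simp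
  moreover have "(\<Sum>m=n*2..<n*2+2. real (Suc m) powr (- e)) =
      real (2 * n + 1) powr (- e) + 2 powr (- e) * real (Suc n) powr (- e)" for n
  proof -
    have "{n*2..<n*2+2} = {2 * n, 2 * n + 1}" by auto
    moreover have "real (Suc (2 * n + 1)) powr (- e) = 2 powr (- e) * real (Suc n) powr (- e)"
      by (subst powr_mult[symmetric]) (auto simp: algebra_simps)
    ultimately show ?thesis by (simp add: add.commute)
  qed
  ultimately have "(\<lambda>n. real (2 * n + 1) powr (- e) + 2 powr (- e) * real (Suc n) powr (- e)) sums zeta_real e"
    by (simp only:)
  from sums_diff[OF this sums_mult[OF zeta_real_sums[OF e], of "2 powr (- e)"]]
  show ?thesis by (simp add: algebra_simps)
qed

lemma integral_sech_kernel:
  assumes y: "y > 0"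
  shows "(\<integral>\<^sup>+u. ennreal (sech_kernel u) * indicator {0..y} u \<partial>lborel) = ennreal (tanh (y / 2) / 2)"
proof -
  have "(\<integral>\<^sup>+u. ennreal (sech_kernel u) * indicator {0..y} u \<partial>lborel) =
      ennreal (- 1 / (exp y + 1) - (- 1 / (exp 0 + 1)))"
  proof (rule nn_integral_FTC_Icc)
    show "((\<lambda>u. - 1 / (exp u + 1)) has_real_derivative sech_kernel u) (at u)" for u :: real
    proof -
      have "exp u + 1 \<noteq> 0" by (metis add_pos_pos exp_gt_zero less_irrefl zero_less_one)
      then show ?thesis
        by (auto intro!: derivative_eq_intros simp: sech_kernel_def power2_eq_square)
    qed
  qed (use y in \<open>auto simp: sech_kernel_nonneg\<close>)
  also have "- 1 / (exp y + 1) - (- 1 / (exp 0 + 1)) = tanh (y / 2) / 2"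
  proof -
    define E where "E = exp y"
    have E: "E > 0" "exp (- y) = 1 / E" by (simp_all add: E_def exp_minus inverse_eq_divide)
    then have "E + 1 \<noteq> 0" by linarith
    have "tanh (y / 2) = (1 - 1 / E) / (1 + 1 / E)" by (simp add: tanh_real_altdef E(2))
    also have "1 - 1 / E = (E - 1) / E" using E(1) by (simp add: diff_divide_distrib)
    also have "1 + 1 / E = (E + 1) / E" using E(1) by (simp add: add_divide_distrib)
    also have "(E - 1) / E / ((E + 1) / E) = (E - 1) / (E + 1)" using E(1) by simp
    also have "\<dots> / 2 = - 1 / (E + 1) - (- 1 / (1 + 1))" using \<open>E + 1 \<noteq> 0\<close> by (simp add: field_simps)
    finally show ?thesis by (simp add: E_def)
  qed
  finally show ?thesis .
qed

text \<open>Expresses \<open>u powr a\<close> through its derivative, so that integration by parts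
  against the kernel becomes an application of Tonelli.\<close>

lemma powr_eq_nn_integral:
  assumes a: "a < 0" and u: "u > 0"
  shows "(\<integral>\<^sup>+y. ennreal (- a * y powr (a - 1)) * indicator {u..} y \<partial>lborel) = ennreal (u powr a)"
proof -
  have "(\<integral>\<^sup>+y. ennreal (- a * y powr (a - 1)) * indicator {u..} y \<partial>lborel) = ennreal (0 - (- (u powr a)))"
  proof (rule nn_integral_FTC_atLeast)
    show "((\<lambda>y. - (y powr a)) has_real_derivative - a * y powr (a - 1)) (at y)" if "u \<le> y" for y
      using that u by (auto intro!: derivative_eq_intros simp: powr_diff)
    have "((\<lambda>y. y powr a) \<longlongrightarrow> 0) at_top"
      using a by (intro tendsto_neg_powr filterlim_ident)
    then show "((\<lambda>y. - (y powr a)) \<longlongrightarrow> 0) at_top" using tendsto_minus by fastforce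
  qed (use a in \<open>auto simp: mult_nonpos_nonneg\<close>)
  then show ?thesis by simp
qed

text \<open>After the exchange of integrals the kernel is integrated up to \<open>y\<close> and
  becomes \<open>tanh (y / 2) / 2\<close>. Its partial fractions are integrated one by one; the
  poles at odd multiples of \<open>pi\<close> produce the sum over odd integers, which is
  \<open>zeta_real (1 - a)\<close> up to its Euler factor at 2.\<close>

lemma mellin_sech_kernel_neg:
  assumes a: "-1 < a" "a < 0"
  shows "(\<integral>\<^sup>+u. ennreal (indicator {0<..} u * (sech_kernel u * u powr a)) \<partial>lborel) =
    ennreal (- 2 * a * (pi / (2 * cos (pi * a / 2))) * (pi powr (a - 1) * ((1 - 2 powr (a - 1)) * zeta_real (1 - a))))"
proof -
  define k where "k = - 2 * a"
  have k: "k \<ge> 0" "- a = k / 2" using a by (simp_all add: k_def)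
  define c where "c = pi / (2 * cos (pi * a / 2))"
  have "cos (pi * a / 2) > 0"
    using a mult_strict_left_mono[of "-1" a pi] mult_pos_neg[of pi a] by (intro cos_gt_zero_pi) auto
  then have c: "c > 0" by (simp add: c_def)
  define h where "h = (\<lambda>u y. ennreal (if 0 < u \<and> u \<le> y then sech_kernel u * (k / 2 * y powr (a - 1)) else 0))"
  have [measurable]: "(\<lambda>(u, y). h u y) \<in> borel_measurable (lborel \<Otimes>\<^sub>M lborel)"
    unfolding h_def by measurable
  have "(\<integral>\<^sup>+u. ennreal (indicator {0<..} u * (sech_kernel u * u powr a)) \<partial>lborel) =
      (\<integral>\<^sup>+u. (\<integral>\<^sup>+y. h u y \<partial>lborel) \<partial>lborel)"
  proof (rule nn_integral_cong)
    fix u :: real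
    show "ennreal (indicator {0<..} u * (sech_kernel u * u powr a)) = (\<integral>\<^sup>+y. h u y \<partial>lborel)"
    proof (cases "u > 0")
      case True
      have "(\<integral>\<^sup>+y. h u y \<partial>lborel) =
          (\<integral>\<^sup>+y. ennreal (sech_kernel u) * (ennreal (k / 2 * y powr (a - 1)) * indicator {u..} y) \<partial>lborel)"
        using True k(1) by (intro nn_integral_cong) (auto simp: h_def indicator_def ennreal_mult'[symmetric] sech_kernel_nonneg)
      also have "\<dots> = ennreal (sech_kernel u) * ennreal (u powr a)"
        by (subst nn_integral_cmult) (measurable, simp only: powr_eq_nn_integral[OF a(2) True, unfolded k(2)])
      finally show ?thesis using True by (simp add: ennreal_mult'[symmetric] sech_kernel_nonneg)
    qed (simp add: h_def)
  qed
  also have "\<dots> = (\<integral>\<^sup>+y. (\<integral>\<^sup>+u. h u y \<partial>lborel) \<partial>lborel)"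
    by (rule lborel_pair.Fubini'[symmetric]) measurable
  also have "\<dots> = (\<integral>\<^sup>+y. (\<Sum>n. ennreal (indicator {0<..} y * k * (y powr a / (y\<^sup>2 + (real (2 * n + 1) * pi)\<^sup>2)))) \<partial>lborel)"
  proof (rule nn_integral_cong)
    fix y :: real
    show "(\<integral>\<^sup>+u. h u y \<partial>lborel) = (\<Sum>n. ennreal (indicator {0<..} y * k * (y powr a / (y\<^sup>2 + (real (2 * n + 1) * pi)\<^sup>2))))"
    proof (cases "y > 0")
      case True
      have "(\<integral>\<^sup>+u. h u y \<partial>lborel) = (\<integral>\<^sup>+u. ennreal (k / 2 * y powr (a - 1)) * (ennreal (sech_kernel u) * indicator {0..y} u) \<partial>lborel)"
      proof (rule nn_integral_cong_AE)
        \<comment> \<open>The integrands may differ at \<open>u = 0\<close>, which \<open>h\<close>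
          excludes and the closed interval includes.\<close>
        have "AE u in lborel. u \<noteq> (0::real)" by (rule AE_lborel_singleton)
        then show "AE u in lborel. h u y = ennreal (k / 2 * y powr (a - 1)) * (ennreal (sech_kernel u) * indicator {0..y} u)"
        proof eventually_elim
          case (elim u)
          show ?case
            using elim k(1) by (auto simp: h_def indicator_def ennreal_mult'[symmetric] sech_kernel_nonneg mult.commute)
        qed
      qed
      also have "\<dots> = ennreal (k / 2 * y powr (a - 1)) * ennreal (tanh (y / 2) / 2)"
        using True by (subst nn_integral_cmult) (auto simp: integral_sech_kernel)
      also have "\<dots> = ennreal (k / 2 * y powr (a - 1) * (tanh (y / 2) / 2))"
        using k(1) by (intro ennreal_mult'[symmetric]) auto
      finally have 1: "(\<integral>\<^sup>+u. h u y \<partial>lborel) = ennreal (k / 2 * y powr (a - 1) * (tanh (y / 2) / 2))" .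
      have "(\<lambda>n. k / 2 * y powr (a - 1) * (2 * y / (y\<^sup>2 + (real (2 * n + 1) * pi)\<^sup>2))) sums
          (k / 2 * y powr (a - 1) * (tanh (y / 2) / 2))"
        by (intro sums_mult tanh_partial_fractions True)
      moreover have "k / 2 * y powr (a - 1) * (2 * y / D) = indicator {0<..} y * k * (y powr a / D)" for D
      proof -
        have "y powr (a - 1) * y = y powr a" using True by (simp add: powr_diff)
        then show ?thesis using True by simp
      qed
      ultimately have 2: "(\<lambda>n. indicator {0<..} y * k * (y powr a / (y\<^sup>2 + (real (2 * n + 1) * pi)\<^sup>2))) sums
          (k / 2 * y powr (a - 1) * (tanh (y / 2) / 2))" by (simp only:)
      have 3: "indicator {0<..} y * k * (y powr a / (y\<^sup>2 + (real (2 * n + 1) * pi)\<^sup>2)) \<ge> 0" for n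
        using k(1) by simp
      show ?thesis unfolding 1 by (simp only: suminf_ennreal2[OF 3 sums_summable[OF 2]] sums_unique[OF 2, symmetric])
    next
      case False
      then have "h u y = 0" for u by (auto simp: h_def)
      then show ?thesis using False by simp
    qed
  qed
  also have "\<dots> = (\<Sum>n. \<integral>\<^sup>+y. ennreal (indicator {0<..} y * k * (y powr a / (y\<^sup>2 + (real (2 * n + 1) * pi)\<^sup>2))) \<partial>lborel)"
    by (rule nn_integral_suminf) measurable
  also have "\<dots> = (\<Sum>n. ennreal (k * c * (pi powr (a - 1) * real (2 * n + 1) powr (- (1 - a)))))"
  proof (rule suminf_cong)
    fix n
    define b where "b = real (2 * n + 1) * pi"
    have b: "b > 0" by (simp add: b_def)
    have "(\<integral>\<^sup>+y. ennreal (indicator {0<..} y * k * (y powr a / (y\<^sup>2 + b\<^sup>2))) \<partial>lborel) =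
        (\<integral>\<^sup>+y. ennreal k * ennreal (indicator {0<..} y * (y powr a / (y\<^sup>2 + b\<^sup>2))) \<partial>lborel)"
      using k(1) by (intro nn_integral_cong) (auto simp: ennreal_mult'[symmetric] mult_ac)
    also have "\<dots> = ennreal k * ennreal (b powr (a - 1) * c)"
      using a unfolding c_def
      by (subst nn_integral_cmult) (measurable, simp only: nn_integral_powr_over_square_plus_square[OF _ _ b])
    also have "\<dots> = ennreal (k * (b powr (a - 1) * c))"
      using k(1) by (intro ennreal_mult'[symmetric]) auto
    also have "b powr (a - 1) = pi powr (a - 1) * real (2 * n + 1) powr (- (1 - a))"
      by (simp add: b_def powr_mult mult.commute)
    finally show "(\<integral>\<^sup>+y. ennreal (indicator {0<..} y * k * (y powr a / (y\<^sup>2 + (real (2 * n + 1) * pi)\<^sup>2))) \<partial>lborel) =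
        ennreal (k * c * (pi powr (a - 1) * real (2 * n + 1) powr (- (1 - a))))"
      by (simp only: b_def mult_ac)
  qed
  also have "\<dots> = ennreal (k * c * (pi powr (a - 1) * ((1 - 2 powr (a - 1)) * zeta_real (1 - a))))"
  proof -
    have "(\<lambda>n. k * c * (pi powr (a - 1) * real (2 * n + 1) powr (- (1 - a)))) sums
       (k * c * (pi powr (a - 1) * ((1 - 2 powr (- (1 - a))) * zeta_real (1 - a))))"
      using a by (intro sums_mult odd_powr_sums) auto
    moreover have "k * c * (pi powr (a - 1) * real (2 * n + 1) powr (- (1 - a))) \<ge> 0" for n
      using k(1) c by simp
    ultimately show ?thesis by (subst suminf_ennreal2) (auto simp: sums_iff)
  qed
  finally show ?thesis unfolding c_def k_def .
qed

lemma islimpt_of_real_image: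
  assumes "open U" "x \<in> U"
  shows "(of_real x :: complex) islimpt of_real ` U"
  unfolding islimpt_approachable
proof (intro allI impI)
  fix e :: real assume e: "e > 0"
  obtain d where d: "d > 0" "ball x d \<subseteq> U" using assms open_contains_ball by blast
  define h where "h = min e d / 2"
  have h: "0 < h" "h < e" "h < d" using e d by (auto simp: h_def)
  have "x + h \<in> U" using d(2) h by (intro subsetD[OF d(2)]) (simp add: dist_real_def)
  moreover have "dist (of_real (x + h)) (of_real x :: complex) < e" using h by (simp add: dist_norm)
  moreover have "of_real (x + h) \<noteq> (of_real x :: complex)" using h by (simp only: of_real_eq_iff)
  ultimately show "\<exists>x'\<in>of_real ` U. x' \<noteq> of_real x \<and> dist x' (of_real x :: complex) < e" by blast
qed

section \<open>Comparing the two evaluations\<close>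

definition sech_mellin :: "complex \<Rightarrow> complex" where
  "sech_mellin s = (\<integral>u. of_real (indicator {0<..} u * sech_kernel u) * of_real u powr s \<partial>lborel)"

lemma sech_mellin_holomorphic: "sech_mellin holomorphic_on {s. Re s > -1}"
  unfolding sech_mellin_def[abs_def]
  by (rule mellin_holomorphic) (auto intro: sech_kernel_nonneg sech_kernel_integrable)

lemma sech_mellin_of_real:
  assumes nn: "(\<integral>\<^sup>+u. ennreal (indicator {0<..} u * (sech_kernel u * u powr a)) \<partial>lborel) = ennreal v"
    and v: "v \<ge> 0"
  shows "sech_mellin (of_real a) = of_real v"
proof -
  have "sech_mellin (of_real a) = (\<integral>u. complex_of_real (indicator {0<..} u * (sech_kernel u * u powr a)) \<partial>lborel)"
    unfolding sech_mellin_def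
    by (rule Bochner_Integration.integral_cong) (auto simp: indicator_def powr_of_real)
  also have "\<dots> = of_real (\<integral>u. indicator {0<..} u * (sech_kernel u * u powr a) \<partial>lborel)"
    by (rule integral_complex_of_real)
  also have "(\<integral>u. indicator {0<..} u * (sech_kernel u * u powr a) \<partial>lborel) = v"
  proof (rule has_bochner_integral_integral_eq, rule has_bochner_integral_nn_integral)
    show "AE u in lborel. 0 \<le> indicator {0<..} u * (sech_kernel u * u powr a)"
      by (auto simp: sech_kernel_nonneg)
  qed (use nn v in auto)
  finally show ?thesis .
qed

text \<open>Both sides are holomorphic for \<open>Re s > -1\<close> away from 1 and agree for real
  \<open>s > 1\<close>, a set with limit points. The point 1 is removed because
  \<open>zeta 1\<close> has a conventional value.\<close>

lemma sech_mellin_eq: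
  assumes s: "Re s > -1" "s \<noteq> 1"
  shows "sech_mellin s = (1 - 2 powr (1 - s)) * (Gamma (s + 1) * zeta s)"
proof -
  define S where "S = {s. Re s > -1} - {1 :: complex}"
  define f where "f = (\<lambda>s. sech_mellin s - (1 - 2 powr (1 - s)) * (Gamma (s + 1) * zeta s))"
  have S: "open S" unfolding S_def by (intro open_delete open_halfspace_Re_gt)
  have "f s = 0"
  proof (rule analytic_continuation[where f = f and S = S and U = "of_real ` {1<..}" and \<xi> = 2])
    have "s + 1 \<notin> \<int>\<^sub>\<le>\<^sub>0" if "Re s > -1" for s :: complex
      using that by (auto elim!: nonpos_Ints_cases simp: complex_eq_iff)
    then show "f holomorphic_on S"
      unfolding f_def S_def
      by (intro holomorphic_intros holomorphic_on_subset[OF sech_mellin_holomorphic]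
          holomorphic_on_subset[OF zeta_holomorphic]) auto
    show "connected S"
      unfolding S_def
      by (intro connected_open_delete convex_connected convex_halfspace_Re_gt open_halfspace_Re_gt) simp
    show "of_real ` {1<..} \<subseteq> S" by (auto simp: S_def)
    show "(2 :: complex) islimpt of_real ` {1<..}"
      using islimpt_of_real_image[of "{1<..}" 2] by simp
    show "f z = 0" if "z \<in> of_real ` {1<..}" for z
    proof -
      from that obtain a where a: "a > 1" "z = of_real a" by auto
      have "(1 - 2 powr (1 - a)) * (Gamma (a + 1) * zeta_real a) \<ge> 0"
        using a zeta_real_nonneg[of a] powr_mono[of "1 - a" 0 2] by (intro mult_nonneg_nonneg) auto
      from sech_mellin_of_real[OF mellin_sech_kernel[OF a(1)] this]
      show ?thesis
        using a by (simp add: f_def zeta_of_real powr_of_real[symmetric] flip: Gamma_complex_of_real)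
    qed
  qed (use s S in \<open>auto simp: S_def\<close>)
  then show ?thesis by (simp add: f_def)
qed

text \<open>On \<open>(-1, 0)\<close> the transform is known both by continuation, in terms of
  \<open>zeta a\<close>, and directly, in terms of \<open>zeta_real (1 - a)\<close>. The factors at
  the prime 2 match: with \<open>x = 2 powr (a - 1)\<close> they are \<open>1 - 1 / x\<close> and
  \<open>1 - x\<close>, which differ by the factor \<open>- x\<close>.\<close>

lemma zeta_functional_equation_real:
  assumes a: "-1 < a" "a < 0"
  shows "2 * cos (of_real pi * of_real a / 2) * Gamma (of_real a) * zeta (of_real a) =
         (2 * of_real pi) powr of_real a * zeta (1 - of_real a)"
proof -
  define c where "c = cos (pi * a / 2)"
  have c: "c > 0"
    unfolding c_def using a mult_strict_left_mono[of "-1" a pi] mult_pos_neg[of pi a]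
    by (intro cos_gt_zero_pi) auto
  define v where "v = - 2 * a * (pi / (2 * c)) * (pi powr (a - 1) * ((1 - 2 powr (a - 1)) * zeta_real (1 - a)))"
  have "2 powr (a - 1) \<le> 2 powr 0" using a by (intro powr_mono) auto
  then have "v \<ge> 0"
    unfolding v_def using a c zeta_real_nonneg[of "1 - a"]
    by (intro mult_nonneg_nonneg[of "- 2 * a * (pi / (2 * c))"] mult_nonneg_nonneg[of "- 2 * a"]
          mult_nonneg_nonneg[of "pi powr (a - 1)"] mult_nonneg_nonneg[of "1 - 2 powr (a - 1)"]) simp_all
  have "sech_mellin (of_real a) = of_real v"
    by (rule sech_mellin_of_real[OF mellin_sech_kernel_neg[OF a, folded c_def, folded v_def] \<open>v \<ge> 0\<close>])
  moreover have "sech_mellin (of_real a) = (1 - 2 powr (1 - of_real a)) * (Gamma (of_real a + 1) * zeta (of_real a))"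
    using a by (intro sech_mellin_eq) (auto simp: complex_eq_iff)
  moreover have "Gamma (of_real a + 1) = of_real a * Gamma (of_real a :: complex)"
    using a by (intro Gamma_plus1) (auto elim!: nonpos_Ints_cases simp: complex_eq_iff)
  moreover have "(2 :: complex) powr (1 - of_real a) = of_real (2 powr (1 - a))"
    by (subst powr_of_real[symmetric]) auto
  ultimately have 1: "of_real (1 - 2 powr (1 - a)) * (of_real a * Gamma (of_real a) * zeta (of_real a)) = (of_real v :: complex)"
    by simp
  define x where "x = 2 powr (a - 1)"
  have x: "x > 0" "x < 1"
    using a powr_less_mono[of "a - 1" 0 2] by (auto simp: x_def)
  have x': "2 powr (1 - a) = 1 / x" by (simp add: x_def powr_diff)
  have ne: "1 - 1 / x \<noteq> 0" using x by simp
  have "v = (1 - 1 / x) * (a * (x * pi powr a * zeta_real (1 - a) / c))"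
  proof -
    have "pi * pi powr (a - 1) = pi powr a" by (simp add: powr_diff)
    then have "v = - a / c * (pi powr a * ((1 - x) * zeta_real (1 - a)))"
      unfolding v_def x_def[symmetric] by (simp flip: \<open>pi * pi powr (a - 1) = pi powr a\<close>)
    also have "\<dots> = (x - 1) * (a * pi powr a * zeta_real (1 - a) / c)"
      by (simp add: algebra_simps diff_divide_distrib)
    also have "x - 1 = (1 - 1 / x) * x" using x by (simp add: left_diff_distrib)
    finally show ?thesis by (simp add: mult_ac)
  qed
  then have "of_real (1 - 1 / x) * (of_real a * (Gamma (of_real a) * zeta (of_real a))) =
     of_real (1 - 1 / x) * (of_real a * (of_real (x * pi powr a * zeta_real (1 - a) / c) :: complex))"
    using 1 unfolding x' by (simp only: of_real_mult mult.assoc)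
  then have 2: "Gamma (of_real a) * zeta (of_real a) = (of_real (x * pi powr a * zeta_real (1 - a) / c) :: complex)"
    using ne a by (simp only: mult_cancel_left of_real_eq_0_iff) auto
  have "cos (of_real pi * of_real a / 2) = (of_real c :: complex)"
    unfolding c_def by (simp flip: cos_of_real)
  then have "2 * cos (of_real pi * of_real a / 2) * Gamma (of_real a) * zeta (of_real a) =
     2 * of_real c * (of_real (x * pi powr a * zeta_real (1 - a) / c) :: complex)"
    using 2 by (simp only: mult.assoc)
  also have "\<dots> = of_real (2 * c * (x * pi powr a * zeta_real (1 - a) / c))" by simp
  also have "2 * c * (x * pi powr a * zeta_real (1 - a) / c) = (2 * pi) powr a * zeta_real (1 - a)"
    using c by (simp add: x_def powr_diff powr_mult)
  also have "of_real \<dots> = (2 * of_real pi) powr of_real a * (zeta (1 - of_real a) :: complex)"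
    using zeta_of_real[of "1 - a"] a powr_of_real[of "2 * pi" a] by simp
  finally show ?thesis .
qed

theorem zeta_functional_equation:
  assumes s: "Im s > 0"
  shows "2 * cos (of_real pi * s / 2) * Gamma s * zeta s = (2 * of_real pi) powr s * zeta (1 - s)"
proof -
  \<comment> \<open>The identity is known on the real segment \<open>(-1, 0)\<close>, on the
    boundary of the upper half plane. Adjoining the strip gives an open connected set that contains
    the segment and avoids all integers, hence the poles of \<open>Gamma\<close> and the exceptional
    points of both zeta factors.\<close>
  define S where "S = {s. Im s > 0} \<union> {s. -1 < Re s \<and> Re s < 0}"
  define f where "f = (\<lambda>s. 2 * cos (of_real pi * s / 2) * Gamma s * zeta s - (2 * of_real pi) powr s * zeta (1 - s))"
  have strip: "{s. -1 < Re s \<and> Re s < 0} = {s. Re s > -1} \<inter> {s. Re s < 0}" by auto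
  have S: "open S"
    unfolding S_def strip by (intro open_Un open_Int open_halfspace_Re_gt open_halfspace_Re_lt open_halfspace_Im_gt)
  have nint: "z \<notin> \<int>\<^sub>\<le>\<^sub>0" "z \<noteq> 1" "1 - z \<noteq> 1" if "z \<in> S" for z
  proof -
    have "z \<notin> \<int>" using that by (auto simp: S_def complex_is_Int_iff Ints_def)
    then show "z \<notin> \<int>\<^sub>\<le>\<^sub>0" "z \<noteq> 1" "1 - z \<noteq> 1" using nonpos_Ints_Int[of z] by auto
  qed
  have "f s = 0"
  proof (rule analytic_continuation[where f = f and S = S and U = "of_real ` {-1<..<0}" and \<xi> = "-1/2"])
    have "(\<lambda>s. zeta (1 - s)) holomorphic_on S"
      by (rule holomorphic_on_compose_gen[OF _ zeta_holomorphic, unfolded o_def])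
         (use nint in \<open>auto intro!: holomorphic_intros\<close>)
    then show "f holomorphic_on S"
      unfolding f_def using nint
      by (intro holomorphic_intros holomorphic_on_subset[OF zeta_holomorphic]) auto
    show "connected S"
      unfolding S_def
    proof (rule connected_Un)
      show "connected {s :: complex. Im s > 0}" by (intro convex_connected convex_halfspace_Im_gt)
      show "connected {s. -1 < Re s \<and> Re s < 0}"
        unfolding strip by (intro convex_connected convex_Int convex_halfspace_Re_gt convex_halfspace_Re_lt)
      show "{s. Im s > 0} \<inter> {s. -1 < Re s \<and> Re s < 0} \<noteq> {}"
      proof -
        have "Complex (-1/2) 1 \<in> {s. Im s > 0} \<inter> {s. -1 < Re s \<and> Re s < 0}" by simp
        then show ?thesis by blast
      qed
    qed
    show "of_real ` {-1<..<0} \<subseteq> S" by (auto simp: S_def)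
    show "(-1/2 :: complex) islimpt of_real ` {-1<..<0}"
      using islimpt_of_real_image[of "{-1<..<0}" "-1/2"] by simp
    show "f z = 0" if "z \<in> of_real ` {-1<..<0}" for z
      using that zeta_functional_equation_real by (auto simp: f_def)
  qed (use s S in \<open>auto simp: S_def\<close>)
  then show ?thesis by (simp add: f_def)
qed

subsection \<open>The logarithmic derivative near the critical line\<close>

text \<open>The function \<open>\<kappa>\<close> of the overview: the logarithmic derivative of the
  factor \<open>(2 * pi) powr s / (2 * cos (pi * s / 2) * Gamma s)\<close> that relates
  \<open>zeta s\<close> to \<open>zeta (1 - s)\<close>.\<close>

definition zeta_twist :: "complex \<Rightarrow> complex" where
  "zeta_twist s = of_real (ln (2 * pi)) + of_real (pi / 2) * tan (of_real pi * s / 2) - Digamma s"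

lemma Im_pos_not_nonpos_Int: "Im s > 0 \<Longrightarrow> s \<notin> \<int>\<^sub>\<le>\<^sub>0"
  by (auto elim!: nonpos_Ints_cases)

lemma cos_half_pi_nonzero: "Im s > 0 \<Longrightarrow> cos (of_real pi * s / 2) \<noteq> 0"
proof
  assume s: "Im s > 0" and "cos (of_real pi * s / 2) = 0"
  then obtain n where "of_real pi * s / 2 = of_real (of_int n) * of_real pi + of_real pi / 2"
    by (auto simp: cos_eq_0)
  then have "Im (of_real pi * s / 2) = 0" by simp
  then show False using s by simp
qed

lemma zeta_reflect_eq_0: "Im s > 0 \<Longrightarrow> zeta (1 - s) = 0 \<longleftrightarrow> zeta s = 0"
  using zeta_functional_equation[of s] cos_half_pi_nonzero[of s] Im_pos_not_nonpos_Int[of s]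
  by (auto simp: Gamma_eq_zero_iff)

lemma zeta_logderiv_reflect:
  assumes s: "Im s > 0" and nz: "zeta s \<noteq> 0"
  shows "zeta_logderiv s + zeta_logderiv (1 - s) = zeta_twist s"
proof -
  define H where "H = {s. Im s > 0}"
  have H: "open H" "s \<in> H" using s by (auto simp: H_def open_halfspace_Im_gt)
  have s1: "s \<noteq> 1" "1 - s \<noteq> 1" using s by auto
  have c: "cos (of_real pi * s / 2) \<noteq> 0" by (rule cos_half_pi_nonzero[OF s])
  have G: "Gamma s \<noteq> 0" "s \<notin> \<int>\<^sub>\<le>\<^sub>0" using Im_pos_not_nonpos_Int[OF s] by (auto simp: Gamma_eq_zero_iff)
  have dc: "((\<lambda>s. 2 * cos (of_real pi * s / 2)) has_field_derivative
      - 2 * sin (of_real pi * s / 2) * (of_real pi / 2)) (at s)"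
    by (auto intro!: derivative_eq_intros)
  have dG: "(Gamma has_field_derivative Gamma s * Digamma s) (at s)"
    using G by (auto intro!: derivative_eq_intros)
  have dcG: "((\<lambda>s. 2 * cos (of_real pi * s / 2) * Gamma s) has_field_derivative
      - 2 * sin (of_real pi * s / 2) * (of_real pi / 2) * Gamma s + Gamma s * Digamma s * (2 * cos (of_real pi * s / 2))) (at s)"
    by (rule DERIV_mult[OF dc dG])
  have dp: "((\<lambda>s. (2 * of_real pi) powr s) has_field_derivative
      Ln (2 * of_real pi) * (2 * of_real pi) powr s) (at s)"
    by (rule has_field_derivative_powr_right) simp
  have dz: "((\<lambda>s. zeta (1 - s)) has_field_derivative deriv zeta (1 - s) * (- 1)) (at s)"
    by (rule DERIV_chain2[where f = zeta and g = "\<lambda>s. 1 - s", OF has_field_derivative_zeta[OF s1(2)]])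
       (auto intro!: derivative_eq_intros)
  have nz': "zeta (1 - s) \<noteq> 0" using nz zeta_reflect_eq_0[OF s] by simp
  have "deriv (\<lambda>s. 2 * cos (of_real pi * s / 2) * Gamma s * zeta s) s =
      deriv (\<lambda>s. (2 * of_real pi) powr s * zeta (1 - s)) s"
    using H zeta_functional_equation by (intro deriv_cong_open[of H]) (auto simp: H_def)
  then have "deriv (\<lambda>s. 2 * cos (of_real pi * s / 2) * Gamma s * zeta s) s / (2 * cos (of_real pi * s / 2) * Gamma s * zeta s) =
      deriv (\<lambda>s. (2 * of_real pi) powr s * zeta (1 - s)) s / ((2 * of_real pi) powr s * zeta (1 - s))"
    using zeta_functional_equation[OF s] by simp
  also have "\<dots> = Ln (2 * of_real pi) * (2 * of_real pi) powr s / (2 * of_real pi) powr s +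
      deriv zeta (1 - s) * (- 1) / zeta (1 - s)"
    by (rule logderiv_mult[OF dp dz]) (use nz' in auto)
  also have "deriv (\<lambda>s. 2 * cos (of_real pi * s / 2) * Gamma s * zeta s) s / (2 * cos (of_real pi * s / 2) * Gamma s * zeta s) =
      (- 2 * sin (of_real pi * s / 2) * (of_real pi / 2) * Gamma s + Gamma s * Digamma s * (2 * cos (of_real pi * s / 2)))
        / (2 * cos (of_real pi * s / 2) * Gamma s) + deriv zeta s / zeta s"
    by (rule logderiv_mult[OF dcG has_field_derivative_zeta[OF s1(1)]]) (use nz c G in auto)
  also have "(- 2 * sin (of_real pi * s / 2) * (of_real pi / 2) * Gamma s + Gamma s * Digamma s * (2 * cos (of_real pi * s / 2)))
        / (2 * cos (of_real pi * s / 2) * Gamma s) = - of_real (pi / 2) * tan (of_real pi * s / 2) + Digamma s"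
  proof -
    have "(- 2 * a * (p / 2) * g + g * d * (2 * b)) / (2 * b * g) = - (p / 2) * (a / b) + d"
      if "b \<noteq> 0" "g \<noteq> 0" for a b p g d :: complex
      using that by (simp add: divide_simps) (simp add: algebra_simps)
    from this[OF c G(1)] show ?thesis by (simp add: tan_def)
  qed
  finally have "- of_real (pi / 2) * tan (of_real pi * s / 2) + Digamma s + zeta_logderiv s =
      Ln (2 * of_real pi) - zeta_logderiv (1 - s)"
    by (simp add: zeta_logderiv_def)
  moreover have "Ln (2 * of_real pi) = of_real (ln (2 * pi))"
    using Ln_of_real[of "2 * pi"] by simp
  ultimately show ?thesis by (simp add: zeta_twist_def algebra_simps)
qed

lemma zeta_twist_holomorphic: "zeta_twist holomorphic_on {s. Im s > 0}"
  unfolding zeta_twist_def tan_def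
  by (intro holomorphic_intros) (use Im_pos_not_nonpos_Int cos_half_pi_nonzero in auto)

lemma norm_tan_le:
  assumes z: "Im z \<ge> 3 / 2"
  shows "norm (tan z) \<le> 2"
proof -
  \<comment> \<open>This is the squared hyperbolic sine of \<open>Im z\<close>: the squared modulus
    of the sine is at most \<open>1 + Q\<close>, that of the cosine at least
    \<open>Q\<close>.\<close>
  define Q where "Q = (exp (2 * Im z) + inverse (exp (2 * Im z)) - 2) / 4"
  have "exp (2 * Im z) \<ge> exp (3 :: real)" using z by simp
  moreover have "exp (3::real) \<ge> 6" using exp_lower_Taylor_quadratic[of 3] by simp
  moreover have "inverse (exp (2 * Im z)) \<ge> 0" by simp
  ultimately have "exp (2 * Im z) + inverse (exp (2 * Im z)) \<ge> 6" by linarith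
  then have Q: "Q \<ge> 1" by (simp add: Q_def)
  have s: "norm (sin z) ^ 2 \<le> 1 + Q" 
  proof -
    have "(A - 2 * c) / 4 \<le> 1 + (A - 2) / 4" if "-1 \<le> c" for A c :: real
      using that by (simp add: field_simps)
    from this[OF cos_ge_minus_one] show ?thesis unfolding norm_sin_squared Q_def .
  qed
  have c: "norm (cos z) ^ 2 \<ge> Q"
  proof -
    have "(exp (Im z) - inverse (exp (Im z)))\<^sup>2 = exp (2 * Im z) + inverse (exp (2 * Im z)) - 2"
      by (simp add: power2_diff exp_double power_inverse)
    then show ?thesis unfolding norm_cos_squared Q_def by simp
  qed
  have "norm (tan z) ^ 2 = norm (sin z) ^ 2 / norm (cos z) ^ 2"
    by (simp add: tan_def norm_divide power_divide)
  also have "\<dots> \<le> (1 + Q) / Q" using s c Q by (intro frac_le) auto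
  also have "\<dots> \<le> 2\<^sup>2" using Q by (simp add: divide_le_eq)
  finally show ?thesis by (rule power2_le_imp_le) simp
qed

lemma norm_Ln_diff_le:
  assumes z: "Re z > 0"
  shows "norm (Ln (z + 1) - Ln z - inverse z) \<le> 1 / (Re z)\<^sup>2"
proof -
  define f where "f = (\<lambda>(i::nat) x. if i = 0 then Ln x else if i = 1 then inverse x else - inverse (x\<^sup>2) :: complex)"
  define S where "S = {x. Re x \<ge> Re z}"
  have "norm (f 0 (z + 1) - (\<Sum>i\<le>1. f i z * (z + 1 - z) ^ i / fact i)) \<le> 1 / (Re z)\<^sup>2 * norm (z + 1 - z) ^ Suc 1 / fact 1"
  proof (rule complex_Taylor)
    show "convex S" unfolding S_def by (rule convex_halfspace_Re_ge)
    show "(f i has_field_derivative f (Suc i) x) (at x within S)" if "x \<in> S" "i \<le> 1" for i x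
    proof -
      have x: "Re x > 0" using that z by (auto simp: S_def)
      then have nz: "x \<noteq> 0" "x \<notin> \<real>\<^sub>\<le>\<^sub>0" by (auto simp: complex_nonpos_Reals_iff)
      have "(f i has_field_derivative f (Suc i) x) (at x)"
      proof (cases "i = 0")
        case True
        have "(Ln has_field_derivative inverse x) (at x)" by (rule has_field_derivative_Ln[OF nz(2)])
        then show ?thesis using True by (simp add: f_def)
      next
        case False
        then have "i = 1" using that by simp
        moreover have "(inverse has_field_derivative - (inverse x ^ Suc (Suc 0))) (at x)"
          by (rule DERIV_inverse[OF nz(1)])
        ultimately show ?thesis by (simp add: f_def power2_eq_square)
      qed
      then show ?thesis by (rule has_field_derivative_at_within)
    qed
    show "norm (f (Suc 1) x) \<le> 1 / (Re z)\<^sup>2" if "x \<in> S" for x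
    proof -
      have "Re z \<le> norm x" using that complex_Re_le_cmod[of x] by (simp add: S_def)
      then have "(Re z)\<^sup>2 \<le> norm x ^ 2" using z by (intro power_mono) auto
      then show ?thesis
        using z by (simp add: f_def norm_inverse norm_divide norm_power inverse_eq_divide frac_le)
    qed
  qed (auto simp: S_def)
  then show ?thesis by (simp add: f_def algebra_simps)
qed

text \<open>In the limit formula for \<open>Digamma\<close>, the terms \<open>1 / (z + k)\<close>
  are compared with the increments of \<open>Ln\<close>, which telescope. The errors are at most
  \<open>1 / (Re z + k)^2\<close>, summable uniformly since
  \<open>Re z + k \<ge> (k + 1) / 4\<close>.\<close>

lemma Digamma_asymp: "\<exists>C. \<forall>z. Re z \<ge> 1 / 4 \<longrightarrow> norm (Digamma z - Ln z) \<le> C"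
proof -
  define a where "a = (\<lambda>k::nat. 16 * real (Suc k) powr (-2))"
  have a: "summable a" unfolding a_def by (intro summable_mult summable_Suc_powr) simp
  have "norm (Digamma z - Ln z) \<le> suminf a" if z: "Re z \<ge> 1 / 4" for z
  proof -
    have nz: "z + of_nat k \<notin> \<real>\<^sub>\<le>\<^sub>0" for k using z by (auto simp: complex_nonpos_Reals_iff)
    have bound: "norm (of_real (ln (real m)) - (\<Sum>k<m. inverse (z + of_nat k)) - Ln z + (Ln (z + of_nat m) - of_real (ln (real m)))) \<le> suminf a" for m
    proof -
      have "Ln (z + of_nat m) - Ln z = (\<Sum>k<m. Ln (z + of_nat (Suc k)) - Ln (z + of_nat k))"
        by (subst sum_lessThan_telescope) simp
      then have "of_real (ln (real m)) - (\<Sum>k<m. inverse (z + of_nat k)) - Ln z + (Ln (z + of_nat m) - of_real (ln (real m)))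
          = (\<Sum>k<m. Ln (z + of_nat (Suc k)) - Ln (z + of_nat k) - inverse (z + of_nat k))"
        by (simp add: sum_subtractf)
      also have "norm \<dots> \<le> (\<Sum>k<m. a k)"
      proof (rule sum_norm_le)
        fix k
        have "norm (Ln (z + of_nat (Suc k)) - Ln (z + of_nat k) - inverse (z + of_nat k)) \<le> 1 / (Re (z + of_nat k))\<^sup>2"
          using norm_Ln_diff_le[of "z + of_nat k"] z by (simp add: add_ac)
        also have "\<dots> \<le> 1 / (real (Suc k) / 4)\<^sup>2"
          using z by (intro divide_left_mono power_mono) auto
        also have "\<dots> = a k" by (simp add: a_def powr_minus_divide power_divide)
        finally show "norm (Ln (z + of_nat (Suc k)) - Ln (z + of_nat k) - inverse (z + of_nat k)) \<le> a k" .
      qed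
      also have "\<dots> \<le> suminf a" by (rule sum_le_suminf[OF a]) (auto simp: a_def)
      finally show ?thesis .
    qed
    have "(\<lambda>m. of_real (ln (real m)) - (\<Sum>n<m. inverse (z + of_nat n))) \<longlonglongrightarrow> Digamma z"
      by (rule Digamma_LIMSEQ) (use nz[of 0] in auto)
    moreover have "(\<lambda>m. Ln (z + of_nat m) - of_real (ln (real m))) \<longlonglongrightarrow> 0"
    proof -
      have "(\<lambda>m. z / of_nat m) \<longlonglongrightarrow> 0" by (rule lim_const_over_n)
      then have "(\<lambda>m. Ln (1 + z / of_nat m)) \<longlonglongrightarrow> Ln (1 + 0)" by (intro tendsto_intros) auto
      moreover have "eventually (\<lambda>m. Ln (1 + z / of_nat m) = Ln (z + of_nat m) - of_real (ln (real m))) sequentially"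
        using eventually_gt_at_top[of 0]
      proof eventually_elim
        case (elim m)
        have "z + of_nat m = of_real (real m) * (1 + z / of_nat m)" using elim by (simp add: field_simps)
        moreover have "1 + z / of_nat m \<noteq> 0"
        proof
          assume "1 + z / of_nat m = 0"
          then have "z + of_nat m = 0" using elim by (simp add: field_simps)
          then show False using nz[of m] by simp
        qed
        ultimately have "Ln (z + of_nat m) = Ln (1 + z / of_nat m) + of_real (ln (real m))"
          using elim Ln_times_of_real[of "real m" "1 + z / of_nat m"] by (simp add: add.commute)
        then show ?case by simp
      qed
      ultimately show ?thesis by (simp add: tendsto_cong)
    qed
    ultimately have "(\<lambda>m. of_real (ln (real m)) - (\<Sum>k<m. inverse (z + of_nat k)) - Ln z + (Ln (z + of_nat m) - of_real (ln (real m))))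
        \<longlonglongrightarrow> Digamma z - Ln z + 0"
      by (intro tendsto_intros)
    from tendsto_norm[OF this] have "norm (Digamma z - Ln z + 0) \<le> suminf a"
      by (rule tendsto_upperbound) (rule always_eventually, rule allI, rule bound, simp)
    then show ?thesis by simp
  qed
  then show ?thesis by blast
qed

lemma zeta_twist_asymp: "\<exists>C. \<forall>s. Re s \<ge> 1 / 4 \<longrightarrow> Im s \<ge> 1 \<longrightarrow> norm (zeta_twist s + Ln s) \<le> C"
proof -
  obtain C where C: "\<And>z. Re z \<ge> 1 / 4 \<Longrightarrow> norm (Digamma z - Ln z) \<le> C"
    using Digamma_asymp by blast
  have "norm (zeta_twist s + Ln s) \<le> ln (2 * pi) + pi / 2 * 2 + C" if s: "Re s \<ge> 1 / 4" "Im s \<ge> 1" for s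
  proof -
    have "1 * (3 / 2) \<le> Im s * (pi / 2)" using s pi_gt3 by (intro mult_mono) auto
    then have t: "norm (tan (of_real pi * s / 2)) \<le> 2"
      by (intro norm_tan_le) (simp add: mult.commute)
    have "zeta_twist s + Ln s = of_real (ln (2 * pi)) + of_real (pi / 2) * tan (of_real pi * s / 2) - (Digamma s - Ln s)"
      by (simp add: zeta_twist_def)
    also have "norm \<dots> \<le> norm (of_real (ln (2 * pi)) + of_real (pi / 2) * tan (of_real pi * s / 2)) + norm (Digamma s - Ln s)"
      by (rule norm_triangle_ineq4)
    also have "\<dots> \<le> (norm (of_real (ln (2 * pi)) :: complex) + norm (of_real (pi / 2) * tan (of_real pi * s / 2))) + C"
      by (intro add_mono norm_triangle_ineq C s)
    also have "norm (of_real (ln (2 * pi)) :: complex) = ln (2 * pi)"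
      using pi_gt3 by simp
    also have "norm (of_real (pi / 2) * tan (of_real pi * s / 2)) \<le> pi / 2 * 2"
      using t by (simp add: norm_mult)
    finally show ?thesis by simp
  qed
  then show ?thesis by blast
qed

text \<open>A one-sided bound with a constant uniform in \<open>Re s\<close>. It is needed
  arbitrarily far to the right of the line, where \<open>Ln s\<close> is no longer within
  \<open>O(1)\<close> of \<open>ln (Im s)\<close>.\<close>

lemma Re_zeta_twist_le: "\<exists>C. \<forall>s. Re s \<ge> 1 / 4 \<longrightarrow> Im s \<ge> 1 \<longrightarrow> Re (zeta_twist s) \<le> C - ln (Im s)"
proof -
  obtain C where C: "\<And>s. Re s \<ge> 1 / 4 \<Longrightarrow> Im s \<ge> 1 \<Longrightarrow> norm (zeta_twist s + Ln s) \<le> C"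
    using zeta_twist_asymp by blast
  have "Re (zeta_twist s) \<le> C - ln (Im s)" if s: "Re s \<ge> 1 / 4" "Im s \<ge> 1" for s
  proof -
    have "s \<noteq> 0" using s by auto
    have "ln (Im s) \<le> ln (norm s)" using s abs_Im_le_cmod[of s] by (subst ln_le_cancel_iff) auto
    also have "\<dots> = Re (Ln s)" using \<open>s \<noteq> 0\<close> by simp
    finally show ?thesis using complex_Re_le_cmod[of "zeta_twist s + Ln s"] C[OF s] by simp
  qed
  then show ?thesis by blast
qed

lemma zeta_twist_local:
  "\<exists>C\<ge>1. \<forall>T\<ge>10. (\<forall>s\<in>ball (Complex (1/2) T) (1/4). norm (zeta_twist s + of_real (ln T)) \<le> C) \<and>
     (\<forall>s\<in>ball (Complex (1/2) T) (1/8). \<forall>s'\<in>ball (Complex (1/2) T) (1/8).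
        norm (zeta_twist s - zeta_twist s') \<le> C * norm (s - s'))"
proof -
  obtain C where C: "\<And>s. Re s \<ge> 1 / 4 \<Longrightarrow> Im s \<ge> 1 \<Longrightarrow> norm (zeta_twist s + Ln s) \<le> C"
    using zeta_twist_asymp by blast
  define D where "D = \<bar>C\<bar> + 5"
  have main: "norm (zeta_twist s + of_real (ln T)) \<le> D" if T: "T \<ge> 10" and s: "s \<in> ball (Complex (1/2) T) (1/4)" for T s
  proof -
    have d: "norm (s - Complex (1/2) T) < 1/4" using s by (simp add: dist_norm norm_minus_commute)
    have re: "Re s \<ge> 1/4" and im: "Im s \<ge> 1"
      using abs_Re_le_cmod[of "s - Complex (1/2) T"] abs_Im_le_cmod[of "s - Complex (1/2) T"] d T by auto
    have "s \<noteq> 0" using im by auto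
    have up: "norm s \<le> T + 1"
      using norm_triangle_ineq[of "s - Complex (1/2) T" "Complex (1/2) T"] cmod_le[of "Complex (1/2) T"] d T by simp
    have lo: "norm s \<ge> T - 1/4"
      using abs_Im_le_cmod[of s] abs_Im_le_cmod[of "s - Complex (1/2) T"] d T by auto
    have "ln (norm s) \<le> ln (T * 2)" using up T im abs_Im_le_cmod[of s] by (subst ln_le_cancel_iff) auto
    also have "\<dots> \<le> ln T + 1" using T ln_2_less_1 by (simp add: ln_mult)
    finally have 1: "ln (norm s) \<le> ln T + 1" .
    have "ln T \<le> ln (norm s * 2)" using lo T by (subst ln_le_cancel_iff) auto
    also have "\<dots> \<le> ln (norm s) + 1" using \<open>s \<noteq> 0\<close> ln_2_less_1 by (simp add: ln_mult)
    finally have 2: "ln T \<le> ln (norm s) + 1" .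
    have "norm (Ln s - of_real (ln T)) \<le> \<bar>Re (Ln s - of_real (ln T))\<bar> + \<bar>Im (Ln s - of_real (ln T))\<bar>" by (rule cmod_le)
    \<comment> \<open>The 1 bounds the change of the logarithm of the modulus, and 4 exceeds
      \<open>pi\<close>, which bounds the argument.\<close>
    also have "\<dots> \<le> 1 + 4"
      using 1 2 \<open>s \<noteq> 0\<close> Im_Ln_le_pi[of s] mpi_less_Im_Ln[of s] pi_less_4 by (intro add_mono) auto
    finally have 3: "norm (Ln s - of_real (ln T)) \<le> 5" by simp
    have "zeta_twist s + of_real (ln T) = (zeta_twist s + Ln s) - (Ln s - of_real (ln T))" by simp
    also have "norm \<dots> \<le> C + 5"
      by (rule order_trans[OF norm_triangle_ineq4 add_mono[OF C[OF re im] 3]])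
    finally show ?thesis by (simp add: D_def)
  qed
  have lip: "norm (zeta_twist s - zeta_twist s') \<le> 8 * D * norm (s - s')"
    if T: "T \<ge> 10" and s: "s \<in> ball (Complex (1/2) T) (1/8)" "s' \<in> ball (Complex (1/2) T) (1/8)" for T s s'
  proof -
    have "norm ((zeta_twist s + of_real (ln T)) - (zeta_twist s' + of_real (ln T))) \<le> D / (1/8) * norm (s - s')"
    proof (rule Lipschitz_inner_ball[where w = "Complex (1/2) T"])
      have "ball (Complex (1/2) T) (2 * (1/8)) \<subseteq> {s. Im s > 0}"
      proof
        fix s assume "s \<in> ball (Complex (1/2) T) (2 * (1/8))"
        then show "s \<in> {s. Im s > 0}" using T abs_Im_le_cmod[of "Complex (1/2) T - s"] by (auto simp: dist_norm)
      qed
      then show "(\<lambda>s. zeta_twist s + of_real (ln T)) holomorphic_on ball (Complex (1/2) T) (2 * (1/8))"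
        by (intro holomorphic_intros holomorphic_on_subset[OF zeta_twist_holomorphic])
    qed (use s main[OF T] in auto)
    then show ?thesis by simp
  qed
  have "8 * D \<ge> 1" "D \<le> 8 * D" by (auto simp: D_def)
  then show ?thesis using main lip order_trans by (intro exI[of _ "8 * D"]) blast
qed

section \<open>Local partial fractions under the Riemann hypothesis\<close>

lemma ln_ge_1: "(T::real) \<ge> 10 \<Longrightarrow> ln T \<ge> 1"
  using exp_le by (subst ln_ge_iff) auto

lemma ball_half_subset:
  assumes "s \<in> ball (Complex (1/2) T) (1/4)"
  shows "norm (s - Complex 2 T) < 7 / 4" "Im s > T - 1 / 4"
proof -
  have "s - Complex 2 T = (s - Complex (1/2) T) - of_real (3/2)" by (simp add: complex_eq_iff)
  then have "norm (s - Complex 2 T) \<le> norm (s - Complex (1/2) T) + norm (of_real (3/2) :: complex)"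
    using norm_triangle_ineq4 by metis
  also have "norm (of_real (3/2) :: complex) = 3 / 2" by (subst norm_of_real) simp
  finally show "norm (s - Complex 2 T) < 7 / 4"
    using assms by (simp add: dist_norm norm_minus_commute)
  show "Im s > T - 1 / 4"
    using assms abs_Im_le_cmod[of "Complex (1/2) T - s"] by (simp add: dist_norm)
qed

text \<open>The local expansion around \<open>2 + \<i>T\<close> with radii \<open>7/4\<close>,
  \<open>2\<close>, \<open>9/4\<close>, \<open>5/2\<close>. The smallest disc just contains the disc
  of radius \<open>1/4\<close> around \<open>1/2 + \<i>T\<close>; the largest stays in
  \<open>Re s \<ge> -1/2\<close>, where zeta has polynomial growth.\<close>

lemma zeta_logderiv_local:
  assumes RH: riemann_hypothesis
  shows "\<exists>C\<ge>1. \<forall>T\<ge>10. \<exists>Z m h. finite Z \<and>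
      (\<forall>a\<in>Z. Re a = 1 / 2 \<and> zeta a = 0 \<and> m a > (0::nat)) \<and> real (\<Sum>a\<in>Z. m a) \<le> C * ln T \<and>
      h holomorphic_on ball (Complex 2 T) (7/4) \<and>
      (\<forall>s\<in>ball (Complex 2 T) (7/4). norm (h s) \<le> C * ln T \<and> (zeta s = 0 \<longrightarrow> s \<in> Z) \<and>
         (zeta s \<noteq> 0 \<longrightarrow> zeta_logderiv s = (\<Sum>a\<in>Z. of_nat (m a) / (s - a)) + h s))"
proof -
  obtain C1 where C1: "C1 \<ge> 1" "\<And>T s. T \<ge> 10 \<Longrightarrow> norm (s - Complex 2 T) \<le> 5 / 2 \<Longrightarrow>
      norm (zeta s) \<le> exp (C1 * ln T) * norm (zeta (Complex 2 T))"
    using zeta_growth by blast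
  obtain C2 where C2: "\<forall>f w M. f holomorphic_on ball w (5/2) \<longrightarrow> f w \<noteq> 0 \<longrightarrow> M \<ge> 1 \<longrightarrow>
      (\<forall>z. norm (z - w) = 9/4 \<longrightarrow> norm (f z) \<le> exp M * norm (f w)) \<longrightarrow>
      (\<exists>Z m h. finite Z \<and> Z = {z \<in> cball w 2. f z = 0} \<and> (\<forall>a\<in>Z. m a > (0::nat)) \<and>
         real (\<Sum>a\<in>Z. m a) \<le> C2 * M \<and> h holomorphic_on ball w 2 \<and>
         (\<forall>z\<in>cball w (7/4). norm (h z) \<le> C2 * M) \<and>
         (\<forall>z\<in>ball w 2. f z \<noteq> 0 \<longrightarrow> deriv f z / f z = (\<Sum>a\<in>Z. of_nat (m a) / (z - a)) + h z))"
    by (atomize_elim, rule local_logderiv) simp_all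
  define C where "C = max 1 (C2 * C1)"
  have "\<exists>Z m h. finite Z \<and>
      (\<forall>a\<in>Z. Re a = 1 / 2 \<and> zeta a = 0 \<and> m a > (0::nat)) \<and> real (\<Sum>a\<in>Z. m a) \<le> C * ln T \<and>
      h holomorphic_on ball (Complex 2 T) (7/4) \<and>
      (\<forall>s\<in>ball (Complex 2 T) (7/4). norm (h s) \<le> C * ln T \<and> (zeta s = 0 \<longrightarrow> s \<in> Z) \<and>
         (zeta s \<noteq> 0 \<longrightarrow> zeta_logderiv s = (\<Sum>a\<in>Z. of_nat (m a) / (s - a)) + h s))"
    if T: "T \<ge> 10" for T
  proof -
    define w where "w = Complex 2 T"
    have im: "Im z > 0" if "norm (z - w) \<le> 5/2" for z
      using that T abs_Im_le_cmod[of "z - w"] by (auto simp: w_def)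
    have hol: "zeta holomorphic_on ball w (5/2)"
    proof (rule holomorphic_on_subset[OF zeta_holomorphic])
      show "ball w (5/2) \<subseteq> - {1}" using im[of 1] by (auto simp: dist_norm norm_minus_commute)
    qed
    have nz: "zeta w \<noteq> 0" using norm_zeta_ge[of w] by (auto simp: w_def)
    have M: "C1 * ln T \<ge> 1"
      using C1(1) ln_ge_1[OF T] mult_mono[of 1 C1 1 "ln T"] by simp
    have CM: "C2 * (C1 * ln T) \<le> C * ln T"
      using ln_ge_1[OF T] unfolding C_def mult.assoc[symmetric] by (intro mult_right_mono) auto
    have bd: "\<forall>z. norm (z - w) = 9/4 \<longrightarrow> norm (zeta z) \<le> exp (C1 * ln T) * norm (zeta w)"
      using C1(2)[OF T] by (simp add: w_def)
    obtain Z m h where *: "finite Z" "Z = {z \<in> cball w 2. zeta z = 0}" "\<forall>a\<in>Z. m a > (0::nat)"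
      "real (\<Sum>a\<in>Z. m a) \<le> C2 * (C1 * ln T)" "h holomorphic_on ball w 2"
      "\<forall>z\<in>cball w (7/4). norm (h z) \<le> C2 * (C1 * ln T)"
      "\<forall>z\<in>ball w 2. zeta z \<noteq> 0 \<longrightarrow> deriv zeta z / zeta z = (\<Sum>a\<in>Z. of_nat (m a) / (z - a)) + h z"
      using C2[THEN spec, THEN spec, THEN spec, THEN mp, THEN mp, THEN mp, THEN mp, OF hol nz M bd] by blast
    show ?thesis
    proof (intro exI[of _ Z] exI[of _ m] exI[of _ h] conjI ballI impI)
      fix a assume a: "a \<in> Z"
      then have "norm (a - w) \<le> 2" "zeta a = 0" using *(2) by (auto simp: dist_norm norm_minus_commute)
      then show "Re a = 1 / 2" "zeta a = 0" "m a > 0"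
        using RH im[of a] a *(3) unfolding riemann_hypothesis_def by auto
    next
      show "h holomorphic_on ball (Complex 2 T) (7/4)"
        by (rule holomorphic_on_subset[OF *(5)]) (auto simp: w_def)
      show "real (\<Sum>a\<in>Z. m a) \<le> C * ln T" using *(4) CM by linarith
    next
      fix s assume s: "s \<in> ball (Complex 2 T) (7/4)"
      have "s \<in> cball w (7/4)" using s by (simp add: w_def)
      then have "norm (h s) \<le> C2 * (C1 * ln T)" using *(6) by blast
      then show "norm (h s) \<le> C * ln T" using CM by linarith
      show "s \<in> Z" if "zeta s = 0" using that s *(2) by (auto simp: w_def)
      show "zeta_logderiv s = (\<Sum>a\<in>Z. of_nat (m a) / (s - a)) + h s" if "zeta s \<noteq> 0"
        using that s *(7) by (auto simp: w_def zeta_logderiv_def)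
    qed fact
  qed
  then show ?thesis by (intro exI[of _ C]) (auto simp: C_def)
qed

text \<open>The trivial estimate: the multiplicities add up to \<open>O(ln T)\<close> and each term
  is at most \<open>1 / d\<close>. The condition \<open>d \<le> 1\<close> absorbs the
  remainder.\<close>

lemma norm_zeta_logderiv_le_dist:
  assumes RH: riemann_hypothesis
  shows "\<exists>C\<ge>1. \<forall>T s d. T \<ge> 10 \<longrightarrow> s \<in> ball (Complex 2 T) (7/4) \<longrightarrow> 0 < d \<longrightarrow> d \<le> 1 \<longrightarrow>
      (\<forall>a. zeta a = 0 \<and> Re a = 1 / 2 \<longrightarrow> norm (s - a) \<ge> d) \<longrightarrow> norm (zeta_logderiv s) \<le> C * ln T / d"
proof -
  obtain C where C: "C \<ge> 1" "\<forall>T\<ge>10. \<exists>Z m h. finite Z \<and>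
      (\<forall>a\<in>Z. Re a = 1 / 2 \<and> zeta a = 0 \<and> m a > (0::nat)) \<and> real (\<Sum>a\<in>Z. m a) \<le> C * ln T \<and>
      h holomorphic_on ball (Complex 2 T) (7/4) \<and>
      (\<forall>s\<in>ball (Complex 2 T) (7/4). norm (h s) \<le> C * ln T \<and> (zeta s = 0 \<longrightarrow> s \<in> Z) \<and>
         (zeta s \<noteq> 0 \<longrightarrow> zeta_logderiv s = (\<Sum>a\<in>Z. of_nat (m a) / (s - a)) + h s))"
    by (atomize_elim, rule zeta_logderiv_local[OF RH])
  have "norm (zeta_logderiv s) \<le> 2 * C * ln T / d"
    if T: "T \<ge> 10" and s: "s \<in> ball (Complex 2 T) (7/4)" and d: "0 < d" "d \<le> 1"
      and far: "\<forall>a. zeta a = 0 \<and> Re a = 1 / 2 \<longrightarrow> norm (s - a) \<ge> d" for T s d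
  proof -
    from C(2)[THEN spec, THEN mp, OF T] obtain Z m h where Z: "finite Z"
      "\<forall>a\<in>Z. Re a = 1 / 2 \<and> zeta a = 0 \<and> m a > (0::nat)" "real (\<Sum>a\<in>Z. m a) \<le> C * ln T"
      "\<forall>s\<in>ball (Complex 2 T) (7/4). norm (h s) \<le> C * ln T \<and> (zeta s = 0 \<longrightarrow> s \<in> Z) \<and>
         (zeta s \<noteq> 0 \<longrightarrow> zeta_logderiv s = (\<Sum>a\<in>Z. of_nat (m a) / (s - a)) + h s)"
      by (elim exE conjE) (rule that; assumption)
    have "zeta s \<noteq> 0"
    proof
      assume "zeta s = 0"
      then have "s \<in> Z" using Z(4) s by blast
      then have "norm (s - s) \<ge> d" using Z(2) far by blast
      then show False using d by simp
    qed
    then have "zeta_logderiv s = (\<Sum>a\<in>Z. of_nat (m a) / (s - a)) + h s" using Z(4) s by blast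
    also have "norm \<dots> \<le> (\<Sum>a\<in>Z. real (m a) * (1 / d)) + C * ln T"
    proof (rule order_trans[OF norm_triangle_ineq add_mono])
      show "norm (\<Sum>a\<in>Z. of_nat (m a) / (s - a)) \<le> (\<Sum>a\<in>Z. real (m a) * (1 / d))"
      proof (rule sum_norm_le)
        fix a assume "a \<in> Z"
        then have "norm (s - a) \<ge> d" using far Z(2) by blast
        then show "norm (of_nat (m a) / (s - a)) \<le> real (m a) * (1 / d)"
          using d by (simp add: norm_divide frac_le)
      qed
      show "norm (h s) \<le> C * ln T" using Z(4) s by blast
    qed
    finally have 1: "norm (zeta_logderiv s) \<le> (\<Sum>a\<in>Z. real (m a) * (1 / d)) + C * ln T" .
    have "(\<Sum>a\<in>Z. real (m a) * (1 / d)) = real (\<Sum>a\<in>Z. m a) * (1 / d)"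
      by (simp only: of_nat_sum sum_distrib_right)
    also have "\<dots> \<le> C * ln T * (1 / d)" using Z(3) d by (intro mult_right_mono) auto
    finally have 2: "(\<Sum>a\<in>Z. real (m a) * (1 / d)) \<le> C * ln T / d" by simp
    have 3: "C * ln T \<le> C * ln T / d"
      using C(1) ln_ge_1[OF T] d mult_left_mono[of 1 "1 / d" "C * ln T"] by simp
    have "2 * C * ln T / d = C * ln T / d + C * ln T / d" by simp
    with 1 2 3 show ?thesis by linarith
  qed
  moreover have "2 * C \<ge> 1" using C(1) by simp
  ultimately show ?thesis by (intro exI[of _ "2 * C"] conjI allI impI) auto
qed

text \<open>On the critical line the functional equation gives
  \<open>2 * Re F = Re \<kappa>\<close>, and the partial fractions are purely imaginary. Splitting
  off \<open>zeta_twist s / 2\<close> therefore leaves a remainder \<open>k\<close> that is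
  imaginary on the line. The Lipschitz bound then makes \<open>Re (k s)\<close> small in proportion
  to the distance from the line.\<close>

lemma zeta_logderiv_critical_local:
  assumes RH: riemann_hypothesis
  shows "\<exists>C\<ge>1. \<forall>T\<ge>10. \<exists>Z m k. finite Z \<and>
      (\<forall>a\<in>Z. Re a = 1 / 2 \<and> zeta a = 0 \<and> m a > (0::nat)) \<and>
      (\<forall>s\<in>ball (Complex (1/2) T) (1/4). norm (k s) \<le> C * ln T \<and> (zeta s = 0 \<longrightarrow> s \<in> Z) \<and>
         (Re s = 1 / 2 \<longrightarrow> Re (k s) = 0) \<and>
         (zeta s \<noteq> 0 \<longrightarrow> zeta_logderiv s = zeta_twist s / 2 + (\<Sum>a\<in>Z. of_nat (m a) / (s - a)) + k s)) \<and>
      (\<forall>s\<in>ball (Complex (1/2) T) (1/8). \<forall>s'\<in>ball (Complex (1/2) T) (1/8).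
         norm (k s - k s') \<le> C * ln T * norm (s - s'))"
proof -
  obtain C1 where C1: "C1 \<ge> 1" "\<forall>T\<ge>10. \<exists>Z m h. finite Z \<and>
      (\<forall>a\<in>Z. Re a = 1 / 2 \<and> zeta a = 0 \<and> m a > (0::nat)) \<and> real (\<Sum>a\<in>Z. m a) \<le> C1 * ln T \<and>
      h holomorphic_on ball (Complex 2 T) (7/4) \<and>
      (\<forall>s\<in>ball (Complex 2 T) (7/4). norm (h s) \<le> C1 * ln T \<and> (zeta s = 0 \<longrightarrow> s \<in> Z) \<and>
         (zeta s \<noteq> 0 \<longrightarrow> zeta_logderiv s = (\<Sum>a\<in>Z. of_nat (m a) / (s - a)) + h s))"
    by (atomize_elim, rule zeta_logderiv_local[OF RH])
  obtain C2 where C2: "C2 \<ge> 1" "\<And>T s. T \<ge> 10 \<Longrightarrow> s \<in> ball (Complex (1/2) T) (1/4) \<Longrightarrow> norm (zeta_twist s + of_real (ln T)) \<le> C2"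
    using zeta_twist_local by blast
  define C where "C = C1 + C2 + 1"
  have "\<exists>Z m k. finite Z \<and>
      (\<forall>a\<in>Z. Re a = 1 / 2 \<and> zeta a = 0 \<and> m a > (0::nat)) \<and>
      (\<forall>s\<in>ball (Complex (1/2) T) (1/4). norm (k s) \<le> 8 * C * ln T \<and> (zeta s = 0 \<longrightarrow> s \<in> Z) \<and>
         (Re s = 1 / 2 \<longrightarrow> Re (k s) = 0) \<and>
         (zeta s \<noteq> 0 \<longrightarrow> zeta_logderiv s = zeta_twist s / 2 + (\<Sum>a\<in>Z. of_nat (m a) / (s - a)) + k s)) \<and>
      (\<forall>s\<in>ball (Complex (1/2) T) (1/8). \<forall>s'\<in>ball (Complex (1/2) T) (1/8).
         norm (k s - k s') \<le> 8 * C * ln T * norm (s - s'))"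
    if T: "T \<ge> 10" for T
  proof -
    define B where "B = ball (Complex (1/2) T) (1/4)"
    from C1(2)[THEN spec, THEN mp, OF T] obtain Z m h where Z: "finite Z"
      "\<forall>a\<in>Z. Re a = 1 / 2 \<and> zeta a = 0 \<and> m a > (0::nat)" "h holomorphic_on ball (Complex 2 T) (7/4)"
      "\<forall>s\<in>ball (Complex 2 T) (7/4). norm (h s) \<le> C1 * ln T \<and> (zeta s = 0 \<longrightarrow> s \<in> Z) \<and>
         (zeta s \<noteq> 0 \<longrightarrow> zeta_logderiv s = (\<Sum>a\<in>Z. of_nat (m a) / (s - a)) + h s)"
      by (elim exE conjE) (rule that; assumption)
    have lnT: "ln T \<ge> 1" by (rule ln_ge_1[OF T])
    have sub: "B \<subseteq> ball (Complex 2 T) (7/4)"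
      using ball_half_subset(1) unfolding B_def by (auto simp: dist_norm norm_minus_commute)
    have Bim: "Im s > 0" if "s \<in> B" for s using ball_half_subset(2)[of s T] that T by (simp add: B_def)
    define k where "k = (\<lambda>s. h s - zeta_twist s / 2)"
    have k_hol: "k holomorphic_on B"
      unfolding k_def using Bim
      by (intro holomorphic_intros holomorphic_on_subset[OF Z(3) sub] holomorphic_on_subset[OF zeta_twist_holomorphic]) auto
    have k_le: "norm (k s) \<le> C * ln T" if s: "s \<in> B" for s
    proof -
      have "norm (zeta_twist s) \<le> norm (zeta_twist s + of_real (ln T)) + norm (of_real (ln T) :: complex)"
        using norm_triangle_ineq4[of "zeta_twist s + of_real (ln T)" "of_real (ln T)"] by simp
      also have "\<dots> \<le> C2 + ln T" using C2(2)[OF T] s lnT by (intro add_mono) (auto simp: B_def)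
      also have "\<dots> \<le> C2 * ln T + ln T" using C2(1) lnT mult_left_mono[of 1 "ln T" C2] by simp
      finally have "norm (zeta_twist s) \<le> (C2 + 1) * ln T" by (simp add: algebra_simps)
      moreover have "norm (zeta_twist s / 2) \<le> norm (zeta_twist s)" by (simp add: norm_divide)
      ultimately have "norm (zeta_twist s / 2) \<le> (C2 + 1) * ln T" by linarith
      moreover have "norm (h s) \<le> C1 * ln T" using Z(4) s sub by blast
      ultimately have "norm (k s) \<le> C1 * ln T + (C2 + 1) * ln T"
        unfolding k_def by (intro order_trans[OF norm_triangle_ineq4]) auto
      then show ?thesis by (simp add: C_def algebra_simps)
    qed
    have logd: "zeta_logderiv s = zeta_twist s / 2 + (\<Sum>a\<in>Z. of_nat (m a) / (s - a)) + k s"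
      if "s \<in> B" "zeta s \<noteq> 0" for s
      using Z(4) that sub by (auto simp: k_def)
    have Re_k_nz: "Re (k s) = 0" if s: "s \<in> B" "Re s = 1 / 2" "zeta s \<noteq> 0" for s
    proof -
      have "1 - s = cnj s" using s by (simp add: complex_eq_iff)
      moreover have "s \<noteq> 1" using Bim[OF s(1)] by auto
      ultimately have "zeta_logderiv s + cnj (zeta_logderiv s) = zeta_twist s"
        using zeta_logderiv_reflect[OF Bim[OF s(1)] s(3)] zeta_logderiv_cnj[of s] by simp
      then have "Re (zeta_logderiv s + cnj (zeta_logderiv s)) = Re (zeta_twist s)" by (rule arg_cong)
      then have e1: "2 * Re (zeta_logderiv s) = Re (zeta_twist s)" by simp
      have e2: "Re (\<Sum>a\<in>Z. of_nat (m a) / (s - a)) = 0"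
        unfolding Re_sum
      proof (rule sum.neutral, rule ballI)
        fix a assume "a \<in> Z"
        then have "Re a = 1 / 2" using Z(2) by blast
        then have "Re a = Re s" using s(2) by simp
        then show "Re (of_nat (m a) / (s - a)) = 0" by (simp add: Re_divide)
      qed
      have "Re (zeta_logderiv s) = Re (zeta_twist s) / 2 + Re (\<Sum>a\<in>Z. of_nat (m a) / (s - a)) + Re (k s)"
        using arg_cong[OF logd[OF s(1,3)], of Re] by (simp only: plus_complex.sel Re_divide_numeral)
      then show ?thesis using e1 e2 by linarith
    qed
    have Re_k: "Re (k s) = 0" if s: "s \<in> B" "Re s = 1 / 2" for s
    proof -
      have "(\<lambda>u::real. s + \<i> * of_real u) \<midarrow>0\<rightarrow> s + \<i> * of_real 0" by (intro tendsto_intros)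
      then have lim: "((\<lambda>u::real. s + \<i> * of_real u) \<longlongrightarrow> s) (at 0)" by simp
      have "isCont k s" using k_hol s(1) by (intro holomorphic_on_imp_continuous_on[THEN continuous_on_interior]) (auto simp: B_def interior_open)
      from isCont_tendsto_compose[OF this lim]
      have "((\<lambda>u::real. Re (k (s + \<i> * of_real u))) \<longlongrightarrow> Re (k s)) (at 0)" by (rule tendsto_Re)
      moreover have "eventually (\<lambda>u::real. Re (k (s + \<i> * of_real u)) = 0) (at 0)"
      proof -
        have "eventually (\<lambda>u::real. s + \<i> * of_real u \<in> B) (at 0)"
          using topological_tendstoD[OF lim, of B] s by (simp add: B_def)
        moreover have "eventually (\<lambda>u::real. u \<notin> (\<lambda>a. Im (a - s)) ` Z) (at 0)"
        proof -
          have "finite ((\<lambda>a. Im (a - s)) ` Z - {0})" using Z(1) by simp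
          then have "open (- ((\<lambda>a. Im (a - s)) ` Z - {0}))" by (intro open_Compl finite_imp_closed)
          then have "eventually (\<lambda>u. u \<in> - ((\<lambda>a. Im (a - s)) ` Z - {0})) (nhds 0)"
            by (rule eventually_nhds_in_open) simp
          then show ?thesis by (auto simp: eventually_at_filter elim!: eventually_mono)
        qed
        ultimately show ?thesis
        proof eventually_elim
          fix u :: real assume u: "s + \<i> * of_real u \<in> B" "u \<notin> (\<lambda>a. Im (a - s)) ` Z"
          have "zeta (s + \<i> * of_real u) \<noteq> 0"
          proof
            assume "zeta (s + \<i> * of_real u) = 0"
            then have "s + \<i> * of_real u \<in> Z" using Z(4) u(1) sub by blast
            then have "Im (s + \<i> * of_real u - s) \<in> (\<lambda>a. Im (a - s)) ` Z" by (rule imageI)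
            then show False using u(2) by simp
          qed
          then show "Re (k (s + \<i> * of_real u)) = 0" using u(1) s(2) by (intro Re_k_nz) auto
        qed
      qed
      then have "((\<lambda>u::real. Re (k (s + \<i> * of_real u))) \<longlongrightarrow> 0) (at 0)" by (rule tendsto_eventually)
      ultimately show ?thesis by (intro tendsto_unique[of "at (0::real)"]) auto
    qed
    have C0: "C \<ge> 0" using C1(1) C2(1) by (simp add: C_def)
    show ?thesis
    proof (intro exI[of _ Z] exI[of _ m] exI[of _ k] conjI ballI impI)
      fix s assume s: "s \<in> ball (Complex (1/2) T) (1/4)"
      show "norm (k s) \<le> 8 * C * ln T" 
      proof -
        have "norm (k s) \<le> C * ln T" using k_le[of s] s by (simp add: B_def)
        moreover have "0 \<le> C * ln T" using C0 lnT by simp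
        ultimately show ?thesis unfolding mult.assoc by linarith
      qed
      have sB: "s \<in> B" using s by (simp only: B_def)
      show "s \<in> Z" if "zeta s = 0" using Z(4)[THEN bspec, OF subsetD[OF sub sB]] that by simp
      show "Re (k s) = 0" if "Re s = 1 / 2" using Re_k that s by (simp add: B_def)
      show "zeta_logderiv s = zeta_twist s / 2 + (\<Sum>a\<in>Z. of_nat (m a) / (s - a)) + k s" if "zeta s \<noteq> 0"
        using logd that s by (simp add: B_def)
    next
      fix s s' assume "s \<in> ball (Complex (1/2) T) (1/8)" "s' \<in> ball (Complex (1/2) T) (1/8)"
      then have "norm (k s - k s') \<le> C * ln T / (1/8) * norm (s - s')"
        using k_hol k_le by (intro Lipschitz_inner_ball[where w = "Complex (1/2) T"]) (auto simp: B_def)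
      then show "norm (k s - k s') \<le> 8 * C * ln T * norm (s - s')" by simp
    qed (use Z(1,2) in auto)
  qed
  note main = this
  have "8 * C \<ge> 1" using C1(1) C2(1) by (simp add: C_def)
  show ?thesis
    by (rule exI[of _ "8 * C"], rule conjI, fact, intro allI impI, rule main)
qed

lemma zeta_nonzero:
  assumes riemann_hypothesis "Im s > 0" "Re s \<noteq> 1 / 2"
  shows "zeta s \<noteq> 0"
  using assms unfolding riemann_hypothesis_def by auto

lemma Re_of_nat_divide:
  "Re (of_nat n / z) = real n * Re z / (norm z)\<^sup>2"
  by (simp add: Re_divide cmod_power2)

text \<open>For a zero \<open>a\<close> on the line, \<open>Re (1 / (s - a))\<close> has the sign of
  \<open>Re s - 1/2\<close>. So the sum over zeros has a sign on each side, however the zeros are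
  distributed, and only the remainder causes an error.\<close>

lemma zeta_logderiv_sign:
  assumes RH: riemann_hypothesis
  shows "\<exists>C\<ge>1. \<forall>T\<ge>10. \<forall>s\<in>ball (Complex (1/2) T) (1/8). zeta s \<noteq> 0 \<longrightarrow>
      (Re s \<ge> 1 / 2 \<longrightarrow> Re (zeta_logderiv s - zeta_twist s / 2) \<ge> - (C * ln T * (Re s - 1 / 2))) \<and>
      (Re s \<le> 1 / 2 \<longrightarrow> Re (zeta_logderiv s - zeta_twist s / 2) \<le> C * ln T * (1 / 2 - Re s))"
proof -
  obtain C where C: "C \<ge> 1" "\<forall>T\<ge>10. \<exists>Z m k. finite Z \<and>
      (\<forall>a\<in>Z. Re a = 1 / 2 \<and> zeta a = 0 \<and> m a > (0::nat)) \<and>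
      (\<forall>s\<in>ball (Complex (1/2) T) (1/4). norm (k s) \<le> C * ln T \<and> (zeta s = 0 \<longrightarrow> s \<in> Z) \<and>
         (Re s = 1 / 2 \<longrightarrow> Re (k s) = 0) \<and>
         (zeta s \<noteq> 0 \<longrightarrow> zeta_logderiv s = zeta_twist s / 2 + (\<Sum>a\<in>Z. of_nat (m a) / (s - a)) + k s)) \<and>
      (\<forall>s\<in>ball (Complex (1/2) T) (1/8). \<forall>s'\<in>ball (Complex (1/2) T) (1/8).
         norm (k s - k s') \<le> C * ln T * norm (s - s'))"
    by (atomize_elim, rule zeta_logderiv_critical_local[OF RH])
  have main: "(Re s \<ge> 1 / 2 \<longrightarrow> Re (zeta_logderiv s - zeta_twist s / 2) \<ge> - (C * ln T * (Re s - 1 / 2))) \<and>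
      (Re s \<le> 1 / 2 \<longrightarrow> Re (zeta_logderiv s - zeta_twist s / 2) \<le> C * ln T * (1 / 2 - Re s))"
    if T: "T \<ge> 10" and s: "s \<in> ball (Complex (1/2) T) (1/8)" and nz: "zeta s \<noteq> 0" for T s
  proof -
    from C(2)[THEN spec, THEN mp, OF T] obtain Z m k where Z:
      "\<forall>a\<in>Z. Re a = 1 / 2 \<and> zeta a = 0 \<and> m a > (0::nat)"
      "\<forall>s\<in>ball (Complex (1/2) T) (1/4). norm (k s) \<le> C * ln T \<and> (zeta s = 0 \<longrightarrow> s \<in> Z) \<and>
         (Re s = 1 / 2 \<longrightarrow> Re (k s) = 0) \<and>
         (zeta s \<noteq> 0 \<longrightarrow> zeta_logderiv s = zeta_twist s / 2 + (\<Sum>a\<in>Z. of_nat (m a) / (s - a)) + k s)"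
      "\<forall>s\<in>ball (Complex (1/2) T) (1/8). \<forall>s'\<in>ball (Complex (1/2) T) (1/8).
         norm (k s - k s') \<le> C * ln T * norm (s - s')"
      by (elim exE conjE) (rule that; assumption)
    define s' where "s' = Complex (1/2) (Im s)"
    define x where "x = Re s - 1 / 2"
    have s4: "s \<in> ball (Complex (1/2) T) (1/4)" using s by auto
    have d: "s - s' = of_real x" by (simp add: s'_def x_def complex_eq_iff)
    have "norm (Complex (1/2) T - s') = \<bar>Im (Complex (1/2) T - s)\<bar>"
      by (simp add: s'_def cmod_def)
    also have "\<dots> \<le> norm (Complex (1/2) T - s)" by (rule abs_Im_le_cmod)
    finally have s'8: "s' \<in> ball (Complex (1/2) T) (1/8)" using s by (simp add: dist_norm)
    then have s'4: "s' \<in> ball (Complex (1/2) T) (1/4)" by auto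
    have "Re (k s') = 0" using Z(2)[THEN bspec, OF s'4] by (simp add: s'_def)
    moreover have "norm (k s - k s') \<le> C * ln T * norm (s - s')"
      using Z(3)[THEN bspec, THEN bspec, OF s s'8] .
    ultimately have k: "\<bar>Re (k s)\<bar> \<le> C * ln T * \<bar>x\<bar>"
      using abs_Re_le_cmod[of "k s - k s'"] by (simp add: d)
    have F: "zeta_logderiv s = zeta_twist s / 2 + (\<Sum>a\<in>Z. of_nat (m a) / (s - a)) + k s"
      using Z(2)[THEN bspec, OF s4] nz by blast
    have "Re (zeta_logderiv s - zeta_twist s / 2) = Re ((\<Sum>a\<in>Z. of_nat (m a) / (s - a)) + k s)"
      unfolding F by simp
    also have "\<dots> = (\<Sum>a\<in>Z. real (m a) * Re (s - a) / (norm (s - a))\<^sup>2) + Re (k s)"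
      by (simp only: plus_complex.sel Re_sum Re_of_nat_divide)
    also have "(\<Sum>a\<in>Z. real (m a) * Re (s - a) / (norm (s - a))\<^sup>2) = x * (\<Sum>a\<in>Z. real (m a) / (norm (s - a))\<^sup>2)"
      unfolding sum_distrib_left
    proof (rule sum.cong[OF refl])
      fix a assume "a \<in> Z"
      then have "Re a = 1 / 2" using Z(1) by blast
      then have "Re (s - a) = x" by (simp add: x_def)
      then show "real (m a) * Re (s - a) / (norm (s - a))\<^sup>2 = x * (real (m a) / (norm (s - a))\<^sup>2)" by simp
    qed
    finally have eq: "Re (zeta_logderiv s - zeta_twist s / 2) = x * (\<Sum>a\<in>Z. real (m a) / (norm (s - a))\<^sup>2) + Re (k s)" .
    have pos: "(\<Sum>a\<in>Z. real (m a) / (norm (s - a))\<^sup>2) \<ge> 0" by (intro sum_nonneg) auto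
    show ?thesis
    proof (intro conjI impI)
      assume "Re s \<ge> 1 / 2"
      then have "x \<ge> 0" by (simp add: x_def)
      then have "x * (\<Sum>a\<in>Z. real (m a) / (norm (s - a))\<^sup>2) \<ge> 0" using pos by simp
      moreover have "\<bar>x\<bar> = Re s - 1 / 2" using \<open>x \<ge> 0\<close> by (simp add: x_def)
      ultimately show "Re (zeta_logderiv s - zeta_twist s / 2) \<ge> - (C * ln T * (Re s - 1 / 2))"
        using k unfolding eq by simp
    next
      assume "Re s \<le> 1 / 2"
      then have "x \<le> 0" by (simp add: x_def)
      then have "x * (\<Sum>a\<in>Z. real (m a) / (norm (s - a))\<^sup>2) \<le> 0" using pos by (simp add: mult_nonpos_nonneg)
      moreover have "\<bar>x\<bar> = 1 / 2 - Re s" using \<open>x \<le> 0\<close> by (simp add: x_def)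
      ultimately show "Re (zeta_logderiv s - zeta_twist s / 2) \<le> C * ln T * (1 / 2 - Re s)"
        using k unfolding eq by simp
    qed
  qed
  show ?thesis
    by (rule exI[of _ C], rule conjI[OF C(1)], intro allI impI ballI, rule main)
qed

lemma norm_zeta_logderiv_le_strip:
  assumes RH: riemann_hypothesis
  shows "\<exists>C\<ge>1. \<forall>x u d. u \<ge> 10 \<longrightarrow> 0 < d \<longrightarrow> d \<le> 1 \<longrightarrow> 1 / 2 + d \<le> x \<longrightarrow> x \<le> 2 \<longrightarrow>
     norm (zeta_logderiv (Complex x u)) \<le> C * ln u / d"
proof -
  obtain C where C: "C \<ge> 1" "\<forall>T s d. T \<ge> 10 \<longrightarrow> s \<in> ball (Complex 2 T) (7/4) \<longrightarrow> 0 < d \<longrightarrow> d \<le> 1 \<longrightarrow>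
      (\<forall>a. zeta a = 0 \<and> Re a = 1 / 2 \<longrightarrow> norm (s - a) \<ge> d) \<longrightarrow> norm (zeta_logderiv s) \<le> C * ln T / d"
    by (atomize_elim, rule norm_zeta_logderiv_le_dist[OF RH])
  have "norm (zeta_logderiv (Complex x u)) \<le> C * ln u / d"
    if "u \<ge> 10" "0 < d" "d \<le> 1" "1 / 2 + d \<le> x" "x \<le> 2" for x u d
  proof (rule C(2)[THEN spec, THEN spec, THEN spec, THEN mp, THEN mp, THEN mp, THEN mp, THEN mp])
    have "norm (Complex 2 u - Complex x u) = \<bar>2 - x\<bar>" by (simp add: cmod_def)
    then show "Complex x u \<in> ball (Complex 2 u) (7/4)" using that by (simp add: dist_norm)
    show "\<forall>a. zeta a = 0 \<and> Re a = 1 / 2 \<longrightarrow> norm (Complex x u - a) \<ge> d"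
    proof (intro allI impI)
      fix a assume "zeta a = 0 \<and> Re a = 1 / 2"
      then show "norm (Complex x u - a) \<ge> d" using that abs_Re_le_cmod[of "Complex x u - a"] by simp
    qed
  qed (use that in auto)
  then show ?thesis using C(1) by blast
qed

lemma zeta_logderiv_holomorphic_right:
  assumes RH: riemann_hypothesis
  shows "zeta_logderiv holomorphic_on {s. Re s > 1 / 2 \<and> Im s > 0}"
  by (rule zeta_logderiv_holomorphic) (use zeta_nonzero[OF RH] in auto)

section \<open>The derivative of zeta to the left of the line\<close>

text \<open>At a fixed distance from the line, three lines between a bound \<open>O(L)\<close> and a
  bound \<open>O(1)\<close> gives a power of \<open>L\<close> below 1. This makes the logarithmic
  derivative at the reflected point smaller than \<open>\<kappa>\<close>.\<close>

lemma zeta_logderiv_small: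
  assumes RH: riemann_hypothesis and \<delta>: "0 < \<delta>" "\<delta> \<le> 1"
  shows "\<exists>T0. \<forall>\<sigma> t. t \<ge> T0 \<longrightarrow> \<sigma> \<ge> 1 / 2 + \<delta> \<longrightarrow> norm (zeta_logderiv (Complex \<sigma> t)) \<le> ln t / 2"
proof -
  obtain C where C: "C \<ge> 1" "\<forall>x u d. u \<ge> 10 \<longrightarrow> 0 < d \<longrightarrow> d \<le> 1 \<longrightarrow> 1 / 2 + d \<le> x \<longrightarrow> x \<le> 2 \<longrightarrow>
     norm (zeta_logderiv (Complex x u)) \<le> C * ln u / d"
    by (atomize_elim, rule norm_zeta_logderiv_le_strip[OF RH])
  define K where "K = 4 * C / \<delta> + 8"
  have K: "K \<ge> 8" "K \<ge> 4 * C / \<delta>" using C(1) \<delta> by (auto simp: K_def)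
  have "eventually (\<lambda>t::real. ln t \<ge> 1 \<and> t \<ge> 20 \<and> ln t \<le> t / 2 \<and> ln (2 * t) \<le> 2 * ln t \<and> ln t / 2 \<ge> 8 \<and>
      ln t * ln t powr (3/8) * exp (- (ln t)\<^sup>2) \<le> 1 \<and>
      exp (9/4) * (K * ln t powr (1 - \<delta> / 8)) \<le> ln t / 2) at_top"
    using \<delta> by (intro eventually_conj; real_asymp)
  then obtain T0 where T0: "\<And>t. t \<ge> T0 \<Longrightarrow> ln t \<ge> 1 \<and> t \<ge> 20 \<and> ln t \<le> t / 2 \<and> ln (2 * t) \<le> 2 * ln t \<and> ln t / 2 \<ge> 8 \<and>
      ln t * ln t powr (3/8) * exp (- (ln t)\<^sup>2) \<le> 1 \<and>
      exp (9/4) * (K * ln t powr (1 - \<delta> / 8)) \<le> ln t / 2"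
    unfolding eventually_at_top_linorder by blast
  have "norm (zeta_logderiv (Complex \<sigma> t)) \<le> ln t / 2" if t: "t \<ge> T0" and \<sigma>: "\<sigma> \<ge> 1 / 2 + \<delta>" for \<sigma> t
  proof (cases "\<sigma> \<ge> 2")
    case True
    then show ?thesis using norm_zeta_logderiv_le_8[of "Complex \<sigma> t"] T0[OF t] by auto
  next
    case False
    define L where "L = ln t"
    note T = T0[OF t, folded L_def]
    have L: "L \<ge> 1" "L \<le> t / 2" "t \<ge> 20" using T by auto
    have F: "norm (zeta_logderiv (Complex x u)) \<le> K * L" if "\<bar>u - t\<bar> \<le> L" "1 / 2 + \<delta> / 2 \<le> x" "x \<le> 2" for x u
    proof -
      have u: "u \<ge> 10" "u \<le> 2 * t" using that L by auto
      have "norm (zeta_logderiv (Complex x u)) \<le> C * ln u / (\<delta> / 2)"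
        by (rule C(2)[THEN spec, THEN spec, THEN spec, THEN mp, THEN mp, THEN mp, THEN mp, THEN mp]) (use that u \<delta> in auto)
      also have "\<dots> \<le> C * (2 * L) / (\<delta> / 2)"
      proof (intro divide_right_mono mult_left_mono)
        have "ln u \<le> ln (2 * t)" using u by (subst ln_le_cancel_iff) auto
        then show "ln u \<le> 2 * L" using T by linarith
      qed (use C(1) \<delta> in auto)
      also have "\<dots> = 4 * C / \<delta> * L" by simp
      also have "\<dots> \<le> K * L" using K L by (intro mult_right_mono) auto
      finally show ?thesis .
    qed
    \<comment> \<open>The weight \<open>L powr (y / 4)\<close> gains at least
      \<open>L powr (- \<delta> / 8)\<close> on the left side, which is \<open>\<delta> / 2\<close>
      or more away from \<open>\<sigma>\<close>, and costs at most \<open>L powr (3 / 8)\<close> on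
      the right, where the bound is only 8.\<close>
    define k where "k = ln L / 4"
    have ek: "exp (k * y) = L powr (y / 4)" for y
      using L by (simp add: k_def powr_def)
    have p1: "L powr y \<le> L powr z" if "y \<le> z" for y z using that L by (intro powr_mono) auto
    define B where "B = K * L powr (1 - \<delta> / 8)"
    have "norm (zeta_logderiv (Complex \<sigma> t)) \<le> exp ((2 - (1 / 2 + \<delta> / 2))\<^sup>2) * B"
    proof (rule three_lines_rectangle[where k = k and R = L, OF zeta_logderiv_holomorphic_right[OF RH]])
      show "cbox (Complex (1/2 + \<delta>/2) (t - L)) (Complex 2 (t + L)) \<subseteq> {s. Re s > 1 / 2 \<and> Im s > 0}"
        using L \<delta> by (auto simp: in_cbox_complex_iff)
      fix u assume u: "\<bar>u - t\<bar> \<le> L"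
      have "norm (zeta_logderiv (Complex (1/2 + \<delta>/2) u)) * exp (k * (1/2 + \<delta>/2 - \<sigma>)) \<le> K * L * L powr (- (\<delta> / 8))"
      proof (rule mult_mono)
        show "norm (zeta_logderiv (Complex (1/2 + \<delta>/2) u)) \<le> K * L"
          using u \<delta> by (intro F) auto
        show "exp (k * (1/2 + \<delta>/2 - \<sigma>)) \<le> L powr (- (\<delta> / 8))"
          unfolding ek using \<sigma> by (intro p1) simp
      qed (use K L in auto)
      also have "\<dots> = B"
      proof -
        have "L powr (1 + - (\<delta> / 8)) = L powr 1 * L powr (- (\<delta> / 8))" by (rule powr_add)
        then show ?thesis using L by (simp add: B_def)
      qed
      finally show "norm (zeta_logderiv (Complex (1/2 + \<delta>/2) u)) * exp (k * (1/2 + \<delta>/2 - \<sigma>)) \<le> B" .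
      have "norm (zeta_logderiv (Complex 2 u)) * exp (k * (2 - \<sigma>)) \<le> 8 * L powr (3/8)"
      proof (rule mult_mono)
        show "norm (zeta_logderiv (Complex 2 u)) \<le> 8" by (rule norm_zeta_logderiv_le_8) simp
        show "exp (k * (2 - \<sigma>)) \<le> L powr (3/8)" unfolding ek using \<sigma> \<delta> by (intro p1) simp
      qed auto
      also have "\<dots> \<le> B" unfolding B_def
      proof (rule mult_mono)
        show "L powr (3/8) \<le> L powr (1 - \<delta> / 8)" using \<delta> by (intro p1) simp
      qed (use K in auto)
      finally show "norm (zeta_logderiv (Complex 2 u)) * exp (k * (2 - \<sigma>)) \<le> B" .
    next
      fix x u assume x: "1 / 2 + \<delta> / 2 \<le> x" "x \<le> 2" and u: "\<bar>u - t\<bar> = L"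
      have "norm (zeta_logderiv (Complex x u)) * exp (k * (x - \<sigma>)) * exp (- L\<^sup>2) \<le> K * L * L powr (3/8) * exp (- L\<^sup>2)"
      proof (rule mult_right_mono, rule mult_mono)
        show "norm (zeta_logderiv (Complex x u)) \<le> K * L" using x u by (intro F) auto
        show "exp (k * (x - \<sigma>)) \<le> L powr (3/8)" unfolding ek using x \<sigma> \<delta> by (intro p1) simp
      qed (use K L in auto)
      also have "\<dots> = K * (L * L powr (3/8) * exp (- L\<^sup>2))" by simp
      also have "\<dots> \<le> K * L powr 0" using T K L by (intro mult_left_mono) auto
      also have "\<dots> \<le> B" unfolding B_def
      proof (rule mult_left_mono)
        show "L powr 0 \<le> L powr (1 - \<delta> / 8)" using \<delta> by (intro p1) simp
      qed (use K in auto)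
      finally show "norm (zeta_logderiv (Complex x u)) * exp (k * (x - \<sigma>)) * exp (- L\<^sup>2) \<le> B" .
    qed (use \<sigma> False \<delta> L in auto)
    also have "\<dots> \<le> exp (9 / 4) * B"
    proof (rule mult_right_mono)
      have "(2 - (1 / 2 + \<delta> / 2))\<^sup>2 \<le> (3 / 2)\<^sup>2" using \<delta> by (intro power_mono) auto
      then show "exp ((2 - (1 / 2 + \<delta> / 2))\<^sup>2) \<le> exp (9 / 4)" by (simp add: power2_eq_square)
    qed (use K in \<open>auto simp: B_def\<close>)
    also have "\<dots> \<le> L / 2" using T by (simp add: B_def)
    finally show ?thesis by (simp add: L_def)
  qed
  then show ?thesis by blast
qed

text \<open>A form of Speiser's theorem for large height. On the left \<open>Re F\<close> is
  negative: near the line because the sum over zeros is nonpositive there and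
  \<open>\<kappa>\<close> contributes about \<open>- L / 2\<close>; further left because the
  reflected value is at most \<open>L / 2\<close> while \<open>\<kappa>\<close> is about
  \<open>- L\<close>.\<close>

lemma deriv_zeta_nonzero_left:
  assumes RH: riemann_hypothesis
  shows "\<exists>T0. \<forall>s. Im s \<ge> T0 \<longrightarrow> Re s < 1 / 2 \<longrightarrow> deriv zeta s \<noteq> 0"
proof -
  obtain C where C: "C \<ge> 1" "\<forall>T\<ge>10. \<forall>s\<in>ball (Complex (1/2) T) (1/8). zeta s \<noteq> 0 \<longrightarrow>
      (Re s \<ge> 1 / 2 \<longrightarrow> Re (zeta_logderiv s - zeta_twist s / 2) \<ge> - (C * ln T * (Re s - 1 / 2))) \<and>
      (Re s \<le> 1 / 2 \<longrightarrow> Re (zeta_logderiv s - zeta_twist s / 2) \<le> C * ln T * (1 / 2 - Re s))"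
    by (atomize_elim, rule zeta_logderiv_sign[OF RH])
  obtain D where D: "\<And>s. Re s \<ge> 1 / 4 \<Longrightarrow> Im s \<ge> 1 \<Longrightarrow> Re (zeta_twist s) \<le> D - ln (Im s)"
    using Re_zeta_twist_le by blast
  \<comment> \<open>Chosen so that the error \<open>C * ln t * \<delta>\<close> of the sign lemma is
    \<open>ln t / 16\<close>, well below \<open>ln t / 2\<close>.\<close>
  define \<delta> where "\<delta> = 1 / (16 * C)"
  have \<delta>: "0 < \<delta>" "\<delta> < 1 / 8" "C * \<delta> = 1 / 16" using C(1) by (auto simp: \<delta>_def field_simps)
  obtain T1 where T1: "\<And>\<sigma> t. t \<ge> T1 \<Longrightarrow> \<sigma> \<ge> 1 / 2 + \<delta> \<Longrightarrow> norm (zeta_logderiv (Complex \<sigma> t)) \<le> ln t / 2"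
    using zeta_logderiv_small[OF RH, of \<delta>] \<delta> by auto
  have "eventually (\<lambda>t::real. t \<ge> T1 \<and> t \<ge> 10 \<and> ln t > 4 * D \<and> ln t > 4) at_top"
    by (intro eventually_conj; real_asymp)
  then obtain T0 where T0: "\<And>t. t \<ge> T0 \<Longrightarrow> t \<ge> T1 \<and> t \<ge> 10 \<and> ln t > 4 * D \<and> ln t > 4"
    unfolding eventually_at_top_linorder by blast
  have "deriv zeta s \<noteq> 0" if s: "Im s \<ge> T0" "Re s < 1 / 2" for s
  proof -
    define t where "t = Im s"
    have t: "t \<ge> T1" "t \<ge> 10" "ln t > 4 * D" "ln t > 4" using T0[of t] s by (auto simp: t_def)
    have nz: "zeta s \<noteq> 0" using zeta_nonzero[OF RH, of s] s t by (simp add: t_def)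
    have "zeta_logderiv s \<noteq> 0"
    proof (cases "Re s > 1 / 2 - \<delta>")
      case True
      have "norm (Complex (1/2) t - s) = \<bar>1 / 2 - Re s\<bar>" by (simp add: cmod_def t_def)
      then have "s \<in> ball (Complex (1/2) t) (1/8)" using True s \<delta> by (simp add: dist_norm)
      then have "Re (zeta_logderiv s - zeta_twist s / 2) \<le> C * ln t * (1 / 2 - Re s)"
        using C(2) t(2) nz s(2) by auto
      also have "\<dots> \<le> C * ln t * \<delta>" using True C(1) t by (intro mult_left_mono) auto
      also have "\<dots> = (C * \<delta>) * ln t" by simp
      also have "\<dots> = ln t / 16" unfolding \<delta>(3) by simp
      finally have "Re (zeta_logderiv s) \<le> ln t / 16 + Re (zeta_twist s) / 2" by simp
      moreover have "Re (zeta_twist s) \<le> D - ln t" using D[of s] True \<delta> t by (simp add: t_def)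
      ultimately have "Re (zeta_logderiv s) < 0" using t(3,4) by linarith
      then show ?thesis by auto
    next
      case False
      \<comment> \<open>Reflection in the critical line keeps the height, so \<open>w\<close> is at
        distance at least \<open>\<delta>\<close> to the right.\<close>
      define w where "w = 1 - cnj s"
      have w: "Re w \<ge> 1 / 2 + \<delta>" "Im w = t" using False by (auto simp: w_def t_def)
      have "norm (zeta_logderiv (Complex (Re w) (Im w))) \<le> ln t / 2" using T1 t w by simp
      then have F: "norm (zeta_logderiv w) \<le> ln t / 2" by simp
      have "zeta w \<noteq> 0" using zeta_nonzero[OF RH, of w] w \<delta> t by simp
      then have "zeta_logderiv w + zeta_logderiv (1 - w) = zeta_twist w"
        using w t by (intro zeta_logderiv_reflect) auto
      moreover have "zeta_logderiv (1 - w) = cnj (zeta_logderiv s)"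
      proof -
        have "s \<noteq> 1" using t(2) by (auto simp: t_def)
        then show ?thesis using zeta_logderiv_cnj[of s] by (simp add: w_def)
      qed
      ultimately have "zeta_logderiv w + cnj (zeta_logderiv s) = zeta_twist w" by simp
      from arg_cong[OF this, of Re] have "Re (zeta_logderiv w) + Re (zeta_logderiv s) = Re (zeta_twist w)" by simp
      moreover have "Re (zeta_twist w) \<le> D - ln t" using D[of w] w \<delta> t by simp
      moreover have "\<bar>Re (zeta_logderiv w)\<bar> \<le> ln t / 2" using abs_Re_le_cmod[of "zeta_logderiv w"] F by linarith
      ultimately have "Re (zeta_logderiv s) < 0" using t(3,4) by linarith
      then show ?thesis by auto
    qed
    then show ?thesis by (auto simp: zeta_logderiv_def)
  qed
  then show ?thesis by blast
qed

subsection \<open>Circles around the zeros\<close>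

text \<open>A holomorphic function \<open>l\<close> with \<open>l w = 0\<close> whose real part has the sign of \<open>Re (z - w)\<close>
  behaves like a typically real function: \<open>(R\<^sup>2 + (z - w)\<^sup>2) / (z - w) * l z\<close> has nonnegative real
  part on the circle of radius \<open>R\<close>, because there \<open>(R\<^sup>2 + (z - w)\<^sup>2) / (z - w) = 2 * Re (z - w)\<close>.
  A small error \<open>e\<close> is allowed in the sign condition.\<close>

lemma typically_real_bounds:
  assumes hol: "l holomorphic_on ball w R'" and R: "0 < R" "R < R'" and l0: "l w = 0" and e: "e > 0"
    and right: "\<And>z. z \<in> ball w R' \<Longrightarrow> Re z \<ge> Re w \<Longrightarrow> Re (l z) \<ge> - e"
    and left: "\<And>z. z \<in> ball w R' \<Longrightarrow> Re z \<le> Re w \<Longrightarrow> Re (l z) \<le> e"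
    and z: "norm (z - w) = R / 2"
  shows "norm (l z) \<ge> 2 / (5 * R) * (R\<^sup>2 * norm (deriv l w) / 3 - 7 * R * e)"
    and "norm (l z) \<le> 2 / (3 * R) * (3 * R\<^sup>2 * norm (deriv l w) + 15 * R * e)"
proof -
  define q where "q = (\<lambda>z. if z = w then deriv l w else (l z - l w) / (z - w))"
  define p where "p = (\<lambda>z. (of_real R ^ 2 + (z - w)\<^sup>2) * q z)"
  \<comment> \<open>On the sphere \<open>Re p\<close> can be as low as \<open>- 2 * R * e\<close>;
    the shift by \<open>3 * R * e\<close> makes the real part strictly positive, as Harnack's
    inequality requires.\<close>
  define P where "P = (\<lambda>z. p z + of_real (3 * R * e))"
  have q_hol: "q holomorphic_on ball w R'"
    unfolding q_def by (rule pole_lemma_open[OF hol open_ball])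
  then have p_hol: "p holomorphic_on ball w R'"
    unfolding p_def by (intro holomorphic_intros)
  have lq: "l z = (z - w) * q z" for z by (simp add: q_def l0)
  have sphere: "Re (p z) \<ge> - (2 * R * e)" if z: "norm (z - w) = R" for z
  proof -
    define x where "x = Re (z - w)"
    have zb: "z \<in> ball w R'" using z R by (simp add: dist_norm norm_minus_commute)
    have "z - w \<noteq> 0" using z R by auto
    have "of_real R ^ 2 = (z - w) * cnj (z - w)"
      using z by (simp only: complex_norm_square[symmetric]) simp
    then have "of_real R ^ 2 + (z - w)\<^sup>2 = (z - w) * (cnj (z - w) + (z - w))"
      by (simp only: power2_eq_square distrib_left)
    also have "cnj (z - w) + (z - w) = of_real (2 * x)" by (simp add: complex_eq_iff x_def)
    finally have "p z = of_real (2 * x) * l z" by (simp add: p_def lq mult_ac)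
    then have "Re (p z) = 2 * x * Re (l z)" by simp
    moreover have "\<bar>x\<bar> \<le> R" using abs_Re_le_cmod[of "z - w"] z by (simp add: x_def)
    moreover have "2 * x * Re (l z) \<ge> - (2 * \<bar>x\<bar> * e)"
    proof (cases "x \<ge> 0")
      case True
      then have "Re (l z) \<ge> - e" by (intro right zb) (simp add: x_def)
      from mult_left_mono[OF this, of "2 * x"] show ?thesis using True by simp
    next
      case False
      then have "Re (l z) \<le> e" by (intro left zb) (simp add: x_def)
      from mult_left_mono_neg[OF this, of "2 * x"] show ?thesis using False by simp
    qed
    moreover have "2 * \<bar>x\<bar> * e \<le> 2 * R * e" using \<open>\<bar>x\<bar> \<le> R\<close> e by (intro mult_right_mono) auto
    ultimately show ?thesis by linarith
  qed
  have P_pos: "Re (P z) > 0" if "z \<in> ball w R" for z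
  proof -
    have "Re (p z) \<ge> - (2 * R * e)"
      using that by (intro Re_ge_from_sphere[OF p_hol R sphere]) (auto simp: dist_norm norm_minus_commute)
    moreover have "0 < R * e" using R e by simp
    moreover have "Re (P z) = Re (p z) + 3 * (R * e)" by (simp add: P_def)
    ultimately show ?thesis unfolding mult.assoc by linarith
  qed
  have P_hol: "P holomorphic_on ball w R"
    unfolding P_def by (intro holomorphic_intros holomorphic_on_subset[OF p_hol]) (use R in auto)
  have ne: "norm (of_real (3 * R * e) :: complex) = 3 * R * e"
    using R e by (simp only: norm_of_real) simp
  have Pp: "norm (P z) \<le> norm (p z) + 3 * R * e" "norm (p z) \<le> norm (P z) + 3 * R * e" for z
    using norm_triangle_ineq[of "p z" "of_real (3 * R * e)"] norm_triangle_ineq4[of "P z" "of_real (3 * R * e)"] ne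
    by (simp_all only: P_def add_diff_cancel_right')
  have H: "norm (P z) * (1 - 1 / 2) \<le> norm (P w) * (1 + 1 / 2)"
    "norm (P w) * (1 - 1 / 2) \<le> norm (P z) * (1 + 1 / 2)"
    using Harnack_norm[OF P_hol R(1) P_pos, of z "1 / 2"] z by auto
  have pw: "norm (p w) = R\<^sup>2 * norm (deriv l w)" by (simp add: p_def q_def norm_mult norm_power)
  \<comment> \<open>Harnack at half the radius costs a factor 3. The constants 7 and 15 collect the
    two shifts by \<open>3 * R * e\<close> with some room.\<close>
  have aux: "a / 3 - 7 * x \<le> q \<and> q \<le> 3 * a + 15 * x"
    if "u * (1 - 1 / 2) \<le> v * (1 + 1 / 2)" "v * (1 - 1 / 2) \<le> u * (1 + 1 / 2)" "u \<le> q + 3 * x" "q \<le> u + 3 * x"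
      "v \<le> a + 3 * x" "a \<le> v + 3 * x" "0 < x" for a x q u v :: real
    using that by (auto simp: field_simps)
  have lower: "norm (p z) \<ge> R\<^sup>2 * norm (deriv l w) / 3 - 7 * R * e"
    and upper: "norm (p z) \<le> 3 * R\<^sup>2 * norm (deriv l w) + 15 * R * e"
    using aux[OF H, of "norm (p z)" "R * e" "R\<^sup>2 * norm (deriv l w)"] Pp[of z] Pp[of w] mult_pos_pos[OF R(1) e]
    unfolding pw mult.assoc by blast+
  \<comment> \<open>At \<open>norm (z - w) = R / 2\<close> the auxiliary factor has modulus between
    \<open>3/4\<close> and \<open>5/4\<close> of \<open>R\<^sup>2\<close>, so bounds for
    \<open>p\<close> pass to \<open>l\<close>.\<close>
  define N where "N = norm (of_real R ^ 2 + (z - w)\<^sup>2)"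
  have z2: "norm ((z - w)\<^sup>2) = R\<^sup>2 / 4" by (simp only: norm_power z power_divide) simp
  have R2: "norm (of_real R ^ 2 :: complex) = R\<^sup>2" by (simp add: norm_power)
  have N: "N \<le> 5 / 4 * R\<^sup>2" "N \<ge> 3 / 4 * R\<^sup>2"
    using norm_triangle_ineq[of "of_real R ^ 2" "(z - w)\<^sup>2"] norm_diff_ineq[of "of_real R ^ 2" "(z - w)\<^sup>2"]
    unfolding N_def z2 R2 by linarith+
  have pN: "norm (p z) = N * norm (q z)" by (simp add: p_def N_def norm_mult)
  have lN: "norm (l z) = R / 2 * norm (q z)" by (simp only: lq norm_mult z)
  have pl: "norm (p z) * R = 2 * N * norm (l z)" unfolding pN lN by simp
  have "norm (p z) * R \<le> 5 / 2 * R\<^sup>2 * norm (l z)"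
    unfolding pl using N by (intro mult_right_mono) auto
  then have a: "norm (p z) \<le> 5 / 2 * R * norm (l z)" using R by (simp add: power2_eq_square)
  have "3 / 2 * R\<^sup>2 * norm (l z) \<le> norm (p z) * R"
    unfolding pl using N by (intro mult_right_mono) auto
  then have b: "3 / 2 * R * norm (l z) \<le> norm (p z)" using R by (simp add: power2_eq_square)
  show "norm (l z) \<ge> 2 / (5 * R) * (R\<^sup>2 * norm (deriv l w) / 3 - 7 * R * e)"
    using order_trans[OF lower a] R by (simp add: field_simps)
  show "norm (l z) \<le> 2 / (3 * R) * (3 * R\<^sup>2 * norm (deriv l w) + 15 * R * e)"
    using order_trans[OF b upper] R by (simp add: field_simps)
qed

text \<open>Since \<open>B - 1 = - \<kappa> / F\<close> away from zeros, an upper bound for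
  \<open>F\<close> is a lower bound for \<open>B - 1\<close>. The latter follows from the lower
  bound for a typically real function applied to \<open>log B\<close>, whose derivative at the zero
  has size about \<open>L\<close>; on a circle of radius \<open>r / L\<close> this gives a
  constant.\<close>

lemma zeta_logderiv_near_zero:
  assumes RH: riemann_hypothesis and a: "a > 0"
    and free: "\<And>s. Im s \<ge> T0 \<Longrightarrow> deriv zeta s = 0 \<Longrightarrow> (Re s - 1 / 2) * ln (Im s) \<ge> a"
    and r: "0 < r" "r \<le> 1 / 32" "16 * r \<le> a"
  shows "\<exists>C\<ge>1. \<exists>T1. \<forall>\<gamma>\<ge>T1. zeta (Complex (1/2) \<gamma>) = 0 \<longrightarrow>
      (\<forall>s. norm (s - Complex (1/2) \<gamma>) = r / ln \<gamma> \<longrightarrow> norm (zeta_logderiv s) \<le> C * ln \<gamma>)"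
proof -
  obtain C where C: "C \<ge> 1" "\<forall>T\<ge>10. \<forall>s\<in>ball (Complex (1/2) T) (1/8). zeta s \<noteq> 0 \<longrightarrow>
      (Re s \<ge> 1 / 2 \<longrightarrow> Re (zeta_logderiv s - zeta_twist s / 2) \<ge> - (C * ln T * (Re s - 1 / 2))) \<and>
      (Re s \<le> 1 / 2 \<longrightarrow> Re (zeta_logderiv s - zeta_twist s / 2) \<le> C * ln T * (1 / 2 - Re s))"
    by (atomize_elim, rule zeta_logderiv_sign[OF RH])
  obtain D where D: "D \<ge> 1" "\<And>T s. T \<ge> 10 \<Longrightarrow> s \<in> ball (Complex (1/2) T) (1/4) \<Longrightarrow>
      norm (zeta_twist s + of_real (ln T)) \<le> D"
    using zeta_twist_local by blast
  define E where "E = 4 * C * r + D"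
  have "0 \<le> 4 * C * r" using C(1) r by simp
  then have E: "E \<ge> 1" "D \<le> E" using D(1) unfolding E_def by linarith+
  \<comment> \<open>\<open>L \<ge> 8 * E\<close> lets \<open>L\<close> dominate all bounded errors
    in \<open>W\<close> and in \<open>\<kappa>\<close>, and \<open>L \<ge> 600 * E / r\<close> gives
    \<open>e \<le> r / 75\<close>.\<close>
  define M where "M = max 8 (max (8 * E) (600 * E / r))"
  have "eventually (\<lambda>\<gamma>::real. \<gamma> \<ge> 20 \<and> \<gamma> \<ge> T0 + 1 \<and> ln \<gamma> \<ge> M \<and> ln (\<gamma> + 1) \<le> 2 * ln \<gamma>) at_top"
    by (intro eventually_conj; real_asymp)
  then obtain T1 where T1: "\<And>\<gamma>. \<gamma> \<ge> T1 \<Longrightarrow> \<gamma> \<ge> 20 \<and> \<gamma> \<ge> T0 + 1 \<and> ln \<gamma> \<ge> M \<and> ln (\<gamma> + 1) \<le> 2 * ln \<gamma>"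
    unfolding eventually_at_top_linorder by blast
  have main: "norm (zeta_logderiv s) \<le> 60 / r * ln \<gamma>"
    if \<gamma>: "\<gamma> \<ge> T1" and zero: "zeta (Complex (1/2) \<gamma>) = 0" and s: "norm (s - Complex (1/2) \<gamma>) = r / ln \<gamma>" for \<gamma> s
  proof -
    define L where "L = ln \<gamma>"
    define w where "w = Complex (1/2) \<gamma>"
    \<comment> \<open>The bounds for typically real functions hold at half the radius, so
      \<open>R / 2\<close> is the radius \<open>r / L\<close> of the claim; the ball
      \<open>S\<close> of radius \<open>2 * R\<close> is the domain.\<close>
    define R where "R = 2 * r / L"
    define S where "S = ball w (2 * R)"
    have g: "\<gamma> \<ge> 20" "\<gamma> \<ge> T0 + 1" "L \<ge> M" "ln (\<gamma> + 1) \<le> 2 * L" using T1[OF \<gamma>] by (auto simp: L_def)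
    have L: "L \<ge> 8" "L \<ge> 8 * E" "L \<ge> 600 * E / r" using g(3) by (auto simp: M_def)
    have R: "R > 0" "2 * R \<le> 1 / 32" "R * L = 2 * r"
      using L r by (auto simp: R_def field_simps)
    have Sw: "norm (z - w) < 2 * R" if "z \<in> S" for z using that by (simp add: S_def dist_norm norm_minus_commute)
    have S8: "z \<in> ball w (1/8)" "z \<in> ball w (1/4)" if "z \<in> S" for z using Sw[OF that] R by (auto simp: dist_norm norm_minus_commute)
    have SRe: "\<bar>Re z - 1 / 2\<bar> < 2 * R" if "z \<in> S" for z
      using Sw[OF that] abs_Re_le_cmod[of "z - w"] by (simp add: w_def)
    have SIm: "\<bar>Im z - \<gamma>\<bar> < 1" if "z \<in> S" for z
      using Sw[OF that] R abs_Im_le_cmod[of "z - w"] by (simp add: w_def)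
    have Im_pos: "Im z > 0" if "z \<in> S" for z using SIm[OF that] g by simp
    have ne1: "z \<noteq> 1" if "z \<in> S" for z using Im_pos[OF that] by auto
    \<comment> \<open>A zero of the derivative in \<open>S\<close> would have
      \<open>\<bar>Re z - 1 / 2\<bar> < 4 * r / L\<close> and \<open>ln (Im z) \<le> 2 * L\<close>;
      the product is below \<open>8 * r\<close>, hence below \<open>a\<close>.\<close>
    have deriv_nz: "deriv zeta z \<noteq> 0" if z: "z \<in> S" for z
    proof
      assume "deriv zeta z = 0"
      then have "a \<le> (Re z - 1 / 2) * ln (Im z)" using SIm[OF z] g by (intro free) auto
      also have "\<dots> \<le> \<bar>Re z - 1 / 2\<bar> * ln (Im z)" using SIm[OF z] g by (intro mult_right_mono) auto
      also have "\<dots> \<le> \<bar>Re z - 1 / 2\<bar> * (2 * L)"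
      proof (rule mult_left_mono)
        have "ln (Im z) \<le> ln (\<gamma> + 1)" using SIm[OF z] g by (subst ln_le_cancel_iff) auto
        then show "ln (Im z) \<le> 2 * L" using g by linarith
      qed auto
      also have "\<dots> < 2 * R * (2 * L)" using SRe[OF z] L by (intro mult_strict_right_mono) auto
      also have "\<dots> = 8 * r" using R(3) by simp
      finally show False using r a by linarith
    qed
    define B where "B = (\<lambda>z. 1 - zeta_twist z * zeta z / deriv zeta z)"
    have z_hol: "zeta holomorphic_on S" using ne1 by (intro holomorphic_on_subset[OF zeta_holomorphic]) auto
    have oS: "open S" by (simp add: S_def)
    have B_hol: "B holomorphic_on S"
      unfolding B_def using deriv_nz Im_pos
      by (intro holomorphic_intros z_hol holomorphic_deriv oS holomorphic_on_subset[OF zeta_twist_holomorphic]) auto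
    have refl: "1 - cnj z \<in> S" if "z \<in> S" for z
    proof -
      have "(1 - cnj z) - w = - cnj (z - w)" by (simp add: complex_eq_iff w_def)
      then have "norm ((1 - cnj z) - w) = norm (z - w)" by (simp only: norm_minus_cancel complex_mod_cnj)
      then show ?thesis using Sw[OF that] by (simp add: S_def dist_norm norm_minus_commute)
    qed
    have B_eq: "B z = - zeta_logderiv (1 - z) / zeta_logderiv z" if z: "z \<in> S" "zeta z \<noteq> 0" for z
    proof -
      have F: "zeta_logderiv z \<noteq> 0" using z deriv_nz by (simp add: zeta_logderiv_def)
      have "B z = 1 - zeta_twist z / zeta_logderiv z"
        using z deriv_nz[OF z(1)] by (simp add: B_def zeta_logderiv_def)
      also have "zeta_twist z = zeta_logderiv z + zeta_logderiv (1 - z)"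
        using zeta_logderiv_reflect[OF Im_pos[OF z(1)] z(2)] by simp
      finally show ?thesis using F by (simp add: add_divide_distrib)
    qed
    \<comment> \<open>Reflection in the line conjugates and exchanges numerator and denominator of
      \<open>B\<close>. This yields that \<open>B\<close> has no zeros, and it turns the estimate on
      the left into the one on the right.\<close>
    have B_refl: "norm (B z) * norm (B (1 - cnj z)) = 1" if z: "z \<in> S" for z
    proof (cases "zeta z = 0")
      case True
      then have "Re z = 1 / 2" using RH Im_pos[OF z] by (auto simp: riemann_hypothesis_def)
      then have "1 - cnj z = z" by (simp add: complex_eq_iff)
      then show ?thesis using True by (simp add: B_def)
    next
      case False
      have nz2: "zeta (1 - cnj z) \<noteq> 0"
        using False zeta_reflect_eq_0[OF Im_pos[OF z]] zeta_cnj[of "1 - z"] by simp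
      have c1: "zeta_logderiv (cnj z) = cnj (zeta_logderiv z)" by (rule zeta_logderiv_cnj[OF ne1[OF z]])
      have "1 - z \<noteq> 1" using Im_pos[OF z] by auto
      from zeta_logderiv_cnj[OF this]
      have c2: "zeta_logderiv (1 - cnj z) = cnj (zeta_logderiv (1 - z))" by simp
      have F: "zeta_logderiv z \<noteq> 0" using z False deriv_nz by (simp add: zeta_logderiv_def)
      have "zeta_logderiv (1 - cnj z) \<noteq> 0"
        using nz2 deriv_nz[OF refl[OF z]] by (simp add: zeta_logderiv_def)
      then have F2: "zeta_logderiv (1 - z) \<noteq> 0" unfolding c2 by simp
      have "B (1 - cnj z) = - cnj (zeta_logderiv z) / cnj (zeta_logderiv (1 - z))"
        using B_eq[OF refl[OF z] nz2] c1 c2 by simp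
      then show ?thesis using B_eq[OF z False] F F2 by (simp add: norm_divide)
    qed
    have B_nz: "B z \<noteq> 0" if "z \<in> S" for z using B_refl[OF that] by auto
    define e where "e = 8 * E / L"
    have e: "e > 0" using E L by (simp add: e_def)
    have left: "ln (norm (B z)) \<le> e" if z: "z \<in> S" "Re z \<le> 1 / 2" for z
    proof (cases "zeta z = 0")
      case True
      then show ?thesis using e by (simp add: B_def)
    next
      case False
      define Y where "Y = zeta_logderiv z - zeta_twist z / 2"
      define \<eta> where "\<eta> = 4 * C * r"
      \<comment> \<open>\<open>\<eta>\<close> is the error of the sign lemma on \<open>S\<close>;
        the shift makes the real part nonpositive. Up to bounded errors, \<open>F(1 - z)\<close> is
        then \<open>- (L/2 + Y1)\<close> and \<open>F(z)\<close> is
        \<open>- (L/2 - Y1)\<close>.\<close>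
      define Y1 where "Y1 = Y - of_real \<eta>"
      define \<delta> where "\<delta> = zeta_twist z / 2 + of_real (L / 2)"
      define W where "W = norm (of_real (L / 2) - Y1)"
      have "Re Y \<le> C * L * (1 / 2 - Re z)"
        using C(2) S8[OF z(1)] False z(2) g unfolding Y_def w_def L_def by auto
      also have "\<dots> \<le> C * L * (2 * R)"
        using SRe[OF z(1)] C(1) L z(2) by (intro mult_left_mono) auto
      also have "\<dots> = 2 * C * (R * L)" by simp
      also have "\<dots> = \<eta>" unfolding R(3) by (simp add: \<eta>_def)
      finally have Y1: "Re Y1 \<le> 0" by (simp add: Y1_def)
      have \<eta>: "\<eta> \<ge> 0" using C r by (simp add: \<eta>_def)
      have d2: "norm (2 * \<delta>) \<le> D"
        using D(2)[of \<gamma> z] S8[OF z(1)] g by (simp add: \<delta>_def w_def L_def)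
      then have "2 * norm \<delta> \<le> D" by (simp add: norm_mult)
      then have \<delta>: "norm \<delta> \<le> D" using norm_ge_zero[of \<delta>] by linarith
      have nrm_\<eta>: "norm (of_real \<eta> :: complex) = \<eta>" using \<eta> by simp
      have \<eta>E: "\<eta> + norm \<delta> \<le> E" using \<delta> by (simp add: E_def \<eta>_def)
      have W: "W \<ge> L / 2"
        using complex_Re_le_cmod[of "of_real (L / 2) - Y1"] Y1 by (simp add: W_def)
      \<comment> \<open>A point of the closed left half plane is at least as close to
        \<open>- L / 2\<close> as to \<open>L / 2\<close>.\<close>
      have W2: "norm (of_real (L / 2) + Y1) \<le> W"
      proof -
        have "(norm (of_real (L / 2) + Y1))\<^sup>2 \<le> (norm (of_real (L / 2) - Y1))\<^sup>2"
          unfolding cmod_power2 using mult_nonneg_nonpos[of L "Re Y1"] Y1 L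
          by (simp add: power2_eq_square algebra_simps)
        then show ?thesis unfolding W_def by (rule power2_le_imp_le) simp
      qed
      have "zeta_logderiv (1 - z) = zeta_twist z - zeta_logderiv z"
        using zeta_logderiv_reflect[OF Im_pos[OF z(1)] False] by (simp add: algebra_simps)
      also have "\<dots> = - ((of_real (L / 2) + Y1) + of_real \<eta> - \<delta>)"
        by (simp add: Y_def Y1_def \<delta>_def)
      finally have "norm (zeta_logderiv (1 - z)) = norm ((of_real (L / 2) + Y1) + of_real \<eta> - \<delta>)"
        by (simp only: norm_minus_cancel)
      also have "\<dots> \<le> norm (of_real (L / 2) + Y1) + norm (of_real \<eta> :: complex) + norm \<delta>"
        by (intro order_trans[OF norm_triangle_ineq4] add_mono norm_triangle_ineq) auto
      also have "\<dots> \<le> W + E" using W2 \<eta>E nrm_\<eta> by linarith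
      finally have num: "norm (zeta_logderiv (1 - z)) \<le> W + E" .
      have "zeta_logderiv z = - ((of_real (L / 2) - Y1) - (of_real \<eta> + \<delta>))"
        by (simp add: Y_def Y1_def \<delta>_def)
      then have "norm (zeta_logderiv z) = norm ((of_real (L / 2) - Y1) - (of_real \<eta> + \<delta>))"
        by (simp only: norm_minus_cancel)
      moreover have "norm (of_real \<eta> + \<delta>) \<le> E"
        using norm_triangle_ineq[of "of_real \<eta>" \<delta>] \<eta>E nrm_\<eta> by linarith
      ultimately have den: "norm (zeta_logderiv z) \<ge> W - E"
        using norm_triangle_ineq2[of "of_real (L / 2) - Y1" "of_real \<eta> + \<delta>"] by (simp add: W_def)
      have WE: "W \<ge> 4 * E" using W L by linarith
      have "norm (B z) = norm (zeta_logderiv (1 - z)) / norm (zeta_logderiv z)"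
        using B_eq[OF z(1) False] by (simp add: norm_divide)
      also have "\<dots> \<le> (W + E) / (W - E)"
        using num den WE E by (intro frac_le) auto
      also have "\<dots> \<le> 1 + 4 * E / W"
      proof -
        have "(W + E) * W \<le> (W + 4 * E) * (W - E)"
          using mult_left_mono[of "2 * E" W E] WE E by (simp add: algebra_simps)
        then have "(W + E) / (W - E) \<le> (W + 4 * E) / W"
          using WE E by (simp add: divide_le_eq le_divide_eq mult_ac) 
        then show ?thesis using WE E by (simp add: add_divide_distrib)
      qed
      also have "\<dots> \<le> 1 + e"
      proof -
        have "4 * E / W \<le> 4 * E / (L / 2)" using W L E by (intro divide_left_mono) auto
        then show ?thesis by (simp add: e_def)
      qed
      finally have "norm (B z) \<le> 1 + e" .
      then have "ln (norm (B z)) \<le> ln (1 + e)" using B_nz[OF z(1)] e by (subst ln_le_cancel_iff) auto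
      also have "\<dots> \<le> e" using e by (intro ln_add_one_self_le_self) auto
      finally show ?thesis .
    qed
    obtain l0 where l0: "l0 holomorphic_on S" "\<And>z. z \<in> S \<Longrightarrow> exp (l0 z) = B z"
      by (rule holomorphic_logarithm_exists[of S B w]) (use B_hol B_nz R in \<open>auto simp: S_def\<close>)
    define l where "l = (\<lambda>z. l0 z - l0 w)"
    have wS: "w \<in> S" using R by (simp add: S_def)
    have Bw: "B w = 1" using zero by (simp add: B_def w_def)
    have l_hol: "l holomorphic_on S" unfolding l_def by (intro holomorphic_intros l0)
    have l_exp: "exp (l z) = B z" if "z \<in> S" for z
      using l0(2)[OF that] l0(2)[OF wS] Bw by (simp add: l_def exp_diff)
    have Re_l: "Re (l z) = ln (norm (B z))" if "z \<in> S" for z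
      using l_exp[OF that] by (metis ln_exp norm_exp_eq_Re)
    have l_left: "Re (l z) \<le> e" if "z \<in> S" "Re z \<le> Re w" for z
      using left[of z] Re_l that by (simp add: w_def)
    have l_right: "Re (l z) \<ge> - e" if z: "z \<in> S" "Re z \<ge> Re w" for z
    proof -
      have "ln (norm (B (1 - cnj z))) \<le> e" using z by (intro left refl) (auto simp: w_def)
      moreover have "ln (norm (B z)) + ln (norm (B (1 - cnj z))) = 0"
        using B_refl[OF z(1)] B_nz[OF z(1)] B_nz[OF refl[OF z(1)]] ln_mult[of "norm (B z)" "norm (B (1 - cnj z))"] by simp
      ultimately show ?thesis using Re_l[OF z(1)] by simp
    qed
    have dl: "deriv l w = - zeta_twist w"
    proof -
      have "(l has_field_derivative deriv l w) (at w)" by (rule holomorphic_derivI[OF l_hol oS wS])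
      then have "((\<lambda>z. exp (l z)) has_field_derivative exp (l w) * deriv l w) (at w)"
        by (auto intro!: derivative_eq_intros)
      then have "deriv (\<lambda>z. exp (l z)) w = deriv l w" by (simp add: DERIV_imp_deriv l_def)
      moreover have "deriv (\<lambda>z. exp (l z)) w = deriv B w"
        using wS oS l_exp by (intro deriv_cong_open[of S]) auto
      moreover have "deriv B w = - zeta_twist w"
      proof (rule DERIV_imp_deriv)
        have dt: "(zeta_twist has_field_derivative deriv zeta_twist w) (at w)"
          by (rule holomorphic_derivI[OF zeta_twist_holomorphic])
             (use Im_pos[OF wS] in \<open>auto simp: open_halfspace_Im_gt\<close>)
        have dz: "(zeta has_field_derivative deriv zeta w) (at w)" by (rule has_field_derivative_zeta[OF ne1[OF wS]])
        have dd: "(deriv zeta has_field_derivative deriv (deriv zeta) w) (at w)"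
          by (rule holomorphic_derivI[OF holomorphic_deriv[OF z_hol oS] oS wS])
        have zw: "zeta w = 0" using zero by (simp add: w_def)
        have "(B has_field_derivative
           (0 - ((deriv zeta_twist w * zeta w + deriv zeta w * zeta_twist w) * deriv zeta w -
             zeta_twist w * zeta w * deriv (deriv zeta) w) / (deriv zeta w * deriv zeta w))) (at w)"
          unfolding B_def by (intro DERIV_diff DERIV_const DERIV_divide DERIV_mult dt dz dd deriv_nz wS)
        moreover have "(0 - ((deriv zeta_twist w * zeta w + deriv zeta w * zeta_twist w) * deriv zeta w -
             zeta_twist w * zeta w * deriv (deriv zeta) w) / (deriv zeta w * deriv zeta w)) = - zeta_twist w"
          using deriv_nz[OF wS] by (simp add: zw)
        ultimately show "(B has_field_derivative - zeta_twist w) (at w)" by simp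
      qed
      ultimately show ?thesis by simp
    qed
    have tw: "norm (zeta_twist z) \<le> 2 * L" "norm (zeta_twist z) \<ge> L / 2" if z: "z \<in> S" for z
    proof -
      have "norm (zeta_twist z + of_real L) \<le> D" using D(2)[of \<gamma> z] S8[OF z] g by (simp add: w_def L_def)
      moreover have "norm (of_real L :: complex) = L" using L by simp
      ultimately show "norm (zeta_twist z) \<le> 2 * L" "norm (zeta_twist z) \<ge> L / 2"
        using norm_triangle_ineq4[of "zeta_twist z + of_real L" "of_real L"]
          norm_diff_ineq[of "of_real L" "zeta_twist z"] L E by (auto simp: add.commute)
    qed
    have sR: "norm (s - w) = R / 2" using s by (simp add: w_def R_def L_def)
    have sS: "s \<in> S" using sR R by (simp add: S_def dist_norm norm_minus_commute)
    have bounds: "norm (l s) \<ge> 2 / (5 * R) * (R\<^sup>2 * norm (deriv l w) / 3 - 7 * R * e)"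
      "norm (l s) \<le> 2 / (3 * R) * (3 * R\<^sup>2 * norm (deriv l w) + 15 * R * e)"
      using typically_real_bounds[of l w "2 * R" R e s] l_hol R e l_left l_right sR
      by (auto simp: S_def l_def)
    have eR: "e \<le> r / 75"
    proof -
      have "600 * E \<le> L * r" using L(3) r by (simp add: divide_le_eq)
      then have "8 * E \<le> r / 75 * L" by (simp add: mult.commute)
      then show ?thesis using L by (simp add: e_def pos_divide_le_eq)
    qed
    have RL: "R * norm (deriv l w) \<ge> r" "R * norm (deriv l w) \<le> 4 * r"
    proof -
      have "R * norm (deriv l w) \<ge> R * (L / 2)" using tw(2)[OF wS] R unfolding dl by (intro mult_left_mono) auto
      then show "R * norm (deriv l w) \<ge> r" using R(3) by simp
      have "R * norm (deriv l w) \<le> R * (2 * L)" using tw(1)[OF wS] R unfolding dl by (intro mult_left_mono) auto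
      then show "R * norm (deriv l w) \<le> 4 * r" using R(3) by simp
    qed
    have "2 / (5 * R) * (R\<^sup>2 * norm (deriv l w) / 3 - 7 * R * e) = 2 / 5 * (R * norm (deriv l w) / 3 - 7 * e)"
      using R by (simp add: power2_eq_square field_simps)
    moreover have "r / 15 \<le> 2 / 5 * (x / 3 - 7 * e)" if "x \<ge> r" for x using that eR r(1) by (simp add: field_simps)
    ultimately have low: "norm (l s) \<ge> r / 15" using bounds(1) RL(1) by (metis order_trans)
    have "2 / (3 * R) * (3 * R\<^sup>2 * norm (deriv l w) + 15 * R * e) = 2 / 3 * (3 * (R * norm (deriv l w)) + 15 * e)"
      using R by (simp add: power2_eq_square field_simps)
    moreover have "2 / 3 * (3 * x + 15 * e) \<le> 1 / 2" if "x \<le> 4 * r" for x using that eR r(1,2) by (simp add: field_simps)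
    ultimately have up: "norm (l s) \<le> 1 / 2" using bounds(2) RL(2) by (metis order_trans)
    \<comment> \<open>The upper bound \<open>1/2\<close> for \<open>norm (l s)\<close> keeps the
      value away from the other periods of \<open>exp\<close>, so smallness of
      \<open>B s - 1\<close> would force smallness of \<open>l s\<close>.\<close>
    have "norm (exp (l s) - 1) \<ge> 1 / 2 * norm (l s)" by (rule norm_exp_bounds(1)) (use up in auto)
    then have Bs: "norm (B s - 1) \<ge> r / 30" using low l_exp[OF sS] by simp
    have "zeta s \<noteq> 0"
    proof
      assume "zeta s = 0"
      then have "B s = 1" by (simp add: B_def)
      then show False using Bs r by simp
    qed
    then have "zeta_logderiv s \<noteq> 0" using deriv_nz[OF sS] by (simp add: zeta_logderiv_def)
    have "B s - 1 = - zeta_twist s / zeta_logderiv s"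
      using \<open>zeta s \<noteq> 0\<close> deriv_nz[OF sS] by (simp add: B_def zeta_logderiv_def)
    then have "norm (B s - 1) * norm (zeta_logderiv s) = norm (zeta_twist s)"
      using \<open>zeta_logderiv s \<noteq> 0\<close> by (simp add: norm_divide)
    then have "r / 30 * norm (zeta_logderiv s) \<le> 2 * L"
      using mult_right_mono[OF Bs, of "norm (zeta_logderiv s)"] tw(1)[OF sS] by simp
    then show ?thesis using r by (simp add: L_def field_simps)
  qed
  have "60 / r \<ge> 1" using r by simp
  then show ?thesis using main by (intro exI[of _ "60 / r"] conjI exI[of _ T1] allI impI)
qed

subsection \<open>The line at distance of order \<open>1 / log t\<close>\<close>

lemma critical_zero_eq: "Re a = 1 / 2 \<Longrightarrow> a = Complex (1/2) (Im a)"
  by (simp add: complex_eq_iff)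

lemma dist_critical: "norm (Complex x u - Complex x v) = \<bar>u - v\<bar>"
  by (simp add: cmod_def)

text \<open>Finiteness guarantees that a nearest zero on a given side exists.\<close>

lemma finite_critical_zeros:
  assumes RH: riemann_hypothesis and t: "t \<ge> 10"
  shows "finite {\<gamma>. zeta (Complex (1/2) \<gamma>) = 0 \<and> \<bar>\<gamma> - t\<bar> \<le> 1 / 16}"
proof -
  obtain C where C: "C \<ge> 1" "\<forall>T\<ge>10. \<exists>Z m k. finite Z \<and>
      (\<forall>a\<in>Z. Re a = 1 / 2 \<and> zeta a = 0 \<and> m a > (0::nat)) \<and>
      (\<forall>s\<in>ball (Complex (1/2) T) (1/4). norm (k s) \<le> C * ln T \<and> (zeta s = 0 \<longrightarrow> s \<in> Z) \<and>
         (Re s = 1 / 2 \<longrightarrow> Re (k s) = 0) \<and>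
         (zeta s \<noteq> 0 \<longrightarrow> zeta_logderiv s = zeta_twist s / 2 + (\<Sum>a\<in>Z. of_nat (m a) / (s - a)) + k s)) \<and>
      (\<forall>s\<in>ball (Complex (1/2) T) (1/8). \<forall>s'\<in>ball (Complex (1/2) T) (1/8).
         norm (k s - k s') \<le> C * ln T * norm (s - s'))"
    by (atomize_elim, rule zeta_logderiv_critical_local[OF RH])
  from C(2)[THEN spec, THEN mp, OF t] obtain Z k where Z: "finite Z"
    "\<And>s. s \<in> ball (Complex (1/2) t) (1/4) \<Longrightarrow> zeta s = 0 \<Longrightarrow> s \<in> Z" by metis
  have "Complex (1/2) ` {\<gamma>. zeta (Complex (1/2) \<gamma>) = 0 \<and> \<bar>\<gamma> - t\<bar> \<le> 1 / 16} \<subseteq> Z"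
    using Z(2) by (auto simp: dist_norm dist_critical abs_minus_commute)
  then have "finite (Complex (1/2) ` {\<gamma>. zeta (Complex (1/2) \<gamma>) = 0 \<and> \<bar>\<gamma> - t\<bar> \<le> 1 / 16})"
    using Z(1) finite_subset by blast
  then show ?thesis by (rule finite_imageD) (simp add: inj_on_def)
qed

text \<open>On the critical line, each side of a point that is not close to a zero contains a point
  where the logarithmic derivative is \<open>O(log t)\<close> and which can be reached without crossing a
  zero: either just before the next zero, or at a fixed distance if there is none nearby.
  The sign \<open>e\<close> selects the side.\<close>

lemma zeta_logderiv_gap_end:
  assumes RH: riemann_hypothesis and a: "a > 0"
    and free: "\<And>s. Im s \<ge> T0 \<Longrightarrow> deriv zeta s = 0 \<Longrightarrow> (Re s - 1 / 2) * ln (Im s) \<ge> a"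
    and c: "c > 0"
  shows "\<exists>C\<ge>1. \<exists>T1. \<forall>t\<ge>T1. \<forall>e\<in>{1,-1}.
      (\<forall>\<gamma>. zeta (Complex (1/2) \<gamma>) = 0 \<longrightarrow> \<bar>\<gamma> - t\<bar> > 2 * c / ln t) \<longrightarrow>
      (\<exists>u. c / ln t \<le> e * (u - t) \<and> e * (u - t) \<le> 1 / 16 \<and>
         (\<forall>\<gamma>. zeta (Complex (1/2) \<gamma>) = 0 \<longrightarrow> \<not> (0 \<le> e * (\<gamma> - t) \<and> e * (\<gamma> - t) \<le> e * (u - t))) \<and>
         norm (zeta_logderiv (Complex (1/2) u)) \<le> C * ln t)"
proof -
  \<comment> \<open>The part \<open>c / 2\<close> makes the step back from a zero at most
    \<open>c / ln t\<close>; the zero is more than \<open>2 * c / ln t\<close> away, so at least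
    \<open>c / ln t\<close> remains.\<close>
  define r where "r = min (1/32) (min (a/16) (c/2))"
  have r: "0 < r" "r \<le> 1/32" "16 * r \<le> a" "r \<le> c / 2" using a c by (auto simp: r_def)
  obtain C1 T1 where C1: "C1 \<ge> 1" "\<And>\<gamma> s. \<gamma> \<ge> T1 \<Longrightarrow> zeta (Complex (1/2) \<gamma>) = 0 \<Longrightarrow>
      norm (s - Complex (1/2) \<gamma>) = r / ln \<gamma> \<Longrightarrow> norm (zeta_logderiv s) \<le> C1 * ln \<gamma>"
    using zeta_logderiv_near_zero[OF RH a free r(1-3)] by blast
  obtain C2 where C2: "C2 \<ge> 1" "\<forall>T s d. T \<ge> 10 \<longrightarrow> s \<in> ball (Complex 2 T) (7/4) \<longrightarrow> 0 < d \<longrightarrow> d \<le> 1 \<longrightarrow>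
      (\<forall>a. zeta a = 0 \<and> Re a = 1 / 2 \<longrightarrow> norm (s - a) \<ge> d) \<longrightarrow> norm (zeta_logderiv s) \<le> C2 * ln T / d"
    by (atomize_elim, rule norm_zeta_logderiv_le_dist[OF RH])
  define C where "C = 2 * C1 + 64 * C2"
  have "eventually (\<lambda>t::real. t \<ge> 20 \<and> t \<ge> T1 + 1 \<and> ln t \<ge> 1 \<and> ln (t + 1) \<le> 2 * ln t \<and> ln (t - 1) \<ge> ln t / 2 \<and>
      c / ln t \<le> 1 / 32) at_top"
    using c by (intro eventually_conj; real_asymp)
  then obtain T2 where T2: "\<And>t. t \<ge> T2 \<Longrightarrow> t \<ge> 20 \<and> t \<ge> T1 + 1 \<and> ln t \<ge> 1 \<and> ln (t + 1) \<le> 2 * ln t \<and> ln (t - 1) \<ge> ln t / 2 \<and>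
      c / ln t \<le> 1 / 32"
    unfolding eventually_at_top_linorder by blast
  have main: "\<exists>u. c / ln t \<le> e * (u - t) \<and> e * (u - t) \<le> 1 / 16 \<and>
         (\<forall>\<gamma>. zeta (Complex (1/2) \<gamma>) = 0 \<longrightarrow> \<not> (0 \<le> e * (\<gamma> - t) \<and> e * (\<gamma> - t) \<le> e * (u - t))) \<and>
         norm (zeta_logderiv (Complex (1/2) u)) \<le> C * ln t"
    if t0: "t \<ge> T2" and e: "e \<in> {1,-1}" and far: "\<forall>\<gamma>. zeta (Complex (1/2) \<gamma>) = 0 \<longrightarrow> \<bar>\<gamma> - t\<bar> > 2 * c / ln t" for t e
  proof -
    define L where "L = ln t"
    have t: "t \<ge> 20" "t \<ge> T1 + 1" "L \<ge> 1" "ln (t + 1) \<le> 2 * L" "ln (t - 1) \<ge> L / 2" "c / L \<le> 1 / 32"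
      using T2[OF t0] by (auto simp: L_def)
    have ln_up: "ln u \<le> 2 * L" and ln_lo: "ln u \<ge> L / 2" if "\<bar>u - t\<bar> \<le> 1" for u
    proof -
      have "ln u \<le> ln (t + 1)" "ln (t - 1) \<le> ln u" using that t by (auto intro: ln_mono)
      then show "ln u \<le> 2 * L" "ln u \<ge> L / 2" using t by linarith+
    qed
    have ee: "e * e = 1" "\<bar>e\<bar> = 1" using e by auto
    have abs_e: "\<bar>x\<bar> = \<bar>e * x\<bar>" for x using ee by (simp add: abs_mult)
    define G where "G = {\<gamma>. zeta (Complex (1/2) \<gamma>) = 0 \<and> 0 \<le> e * (\<gamma> - t) \<and> e * (\<gamma> - t) \<le> 1 / 16}"
    show ?thesis
    proof (cases "G = {}")
      case True
      \<comment> \<open>Without zeros up to distance \<open>1/16\<close> on this side, the midpoint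
        is at least \<open>1/32\<close> from every zero, on either side of \<open>t\<close>, and the
        trivial estimate is enough.\<close>
      define u where "u = t + e / 32"
      have u: "e * (u - t) = 1 / 32" "\<bar>u - t\<bar> \<le> 1" using ee by (auto simp: u_def abs_if split: if_splits)
      have "norm (zeta_logderiv (Complex (1/2) u)) \<le> C2 * ln u / (1 / 32)"
      proof (rule C2(2)[THEN spec, THEN spec, THEN spec, THEN mp, THEN mp, THEN mp, THEN mp, THEN mp])
        show "Complex (1/2) u \<in> ball (Complex 2 u) (7/4)" by (simp add: dist_norm cmod_def)
        show "\<forall>a. zeta a = 0 \<and> Re a = 1 / 2 \<longrightarrow> norm (Complex (1/2) u - a) \<ge> 1 / 32"
        proof (intro allI impI)
          fix a assume a: "zeta a = 0 \<and> Re a = 1 / 2"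
          then have "zeta (Complex (1/2) (Im a)) = 0" using critical_zero_eq[of a] by metis
          then have "\<not> (0 \<le> e * (Im a - t) \<and> e * (Im a - t) \<le> 1 / 16)" using True by (auto simp: G_def)
          moreover have "e * (u - Im a) = 1 / 32 - e * (Im a - t)" using u(1) by (simp add: algebra_simps)
          ultimately have "\<bar>e * (u - Im a)\<bar> \<ge> 1 / 32" by auto
          then have "\<bar>u - Im a\<bar> \<ge> 1 / 32" using abs_e by metis
          then show "norm (Complex (1/2) u - a) \<ge> 1 / 32"
            using abs_Im_le_cmod[of "Complex (1/2) u - a"] by simp
        qed
      qed (use u t in auto)
      also have "\<dots> \<le> C2 * (2 * L) / (1 / 32)"
        using ln_up[OF u(2)] C2(1) by (intro divide_right_mono mult_left_mono) auto
      also have "\<dots> = 64 * C2 * L" by simp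
      also have "\<dots> \<le> C * L" using C1(1) t(3) unfolding C_def by (intro mult_right_mono) auto
      finally have "norm (zeta_logderiv (Complex (1/2) u)) \<le> C * L" .
      moreover have "\<not> (0 \<le> e * (\<gamma> - t) \<and> e * (\<gamma> - t) \<le> e * (u - t))" if "zeta (Complex (1/2) \<gamma>) = 0" for \<gamma>
        using True that u(1) by (auto simp: G_def)
      moreover have "c / L \<le> e * (u - t)" unfolding u(1) by (rule t(6))
      moreover have "e * (u - t) \<le> 1 / 16" by (simp add: u(1))
      ultimately show ?thesis unfolding L_def by blast
    next
      case False
      have "G \<subseteq> {\<gamma>. zeta (Complex (1/2) \<gamma>) = 0 \<and> \<bar>\<gamma> - t\<bar> \<le> 1 / 16}"
      proof (intro subsetI CollectI)
        fix x assume "x \<in> G"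
        then have "zeta (Complex (1/2) x) = 0" "0 \<le> e * (x - t)" "e * (x - t) \<le> 1 / 16" by (auto simp: G_def)
        then show "zeta (Complex (1/2) x) = 0 \<and> \<bar>x - t\<bar> \<le> 1 / 16" using abs_e[of "x - t"] by simp
      qed
      then have fin: "finite G" using finite_critical_zeros[OF RH, of t] t finite_subset by auto
      \<comment> \<open>Distance to the nearest zero on the chosen side; stopping short of it on its
        circle of radius \<open>r / ln \<gamma>\<close> crosses no other zero.\<close>
      define y where "y = Min ((\<lambda>\<gamma>. e * (\<gamma> - t)) ` G)"
      have "y \<in> (\<lambda>\<gamma>. e * (\<gamma> - t)) ` G" unfolding y_def using fin False by (intro Min_in) auto
      then obtain \<gamma> where g: "\<gamma> \<in> G" "y = e * (\<gamma> - t)" by auto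
      have y_min: "y \<le> e * (\<gamma>' - t)" if "\<gamma>' \<in> G" for \<gamma>' unfolding y_def using fin that by (intro Min_le) auto
      have y: "0 \<le> y" "y \<le> 1 / 16" using g by (auto simp: G_def)
      have zg: "zeta (Complex (1/2) \<gamma>) = 0" using g by (simp add: G_def)
      have "\<bar>\<gamma> - t\<bar> > 2 * c / L" using far zg by (simp add: L_def)
      moreover have ay: "\<bar>\<gamma> - t\<bar> = y" using y g abs_e[of "\<gamma> - t"] by simp
      ultimately have y2: "y > 2 * c / L" by simp
      have "ln \<gamma> \<ge> L / 2" using ln_lo[of \<gamma>] ay y by simp
      define h where "h = r / ln \<gamma>"
      have "h \<le> r / (L / 2)" unfolding h_def using \<open>ln \<gamma> \<ge> L / 2\<close> r t by (intro divide_left_mono) auto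
      also have "\<dots> \<le> (c / 2) / (L / 2)" using r t by (intro divide_right_mono) auto
      finally have h: "h \<le> c / L" "h > 0" using \<open>ln \<gamma> \<ge> L / 2\<close> r t by (auto simp: h_def)
      define u where "u = \<gamma> - e * h"
      have "e * (u - t) = e * (\<gamma> - t) - (e * e) * h" by (simp add: u_def algebra_simps)
      then have eu: "e * (u - t) = y - h" using g(2) ee(1) by simp
      have "norm (zeta_logderiv (Complex (1/2) u)) \<le> C1 * ln \<gamma>"
      proof (rule C1(2))
        show "\<gamma> \<ge> T1" using t ay y by linarith
        have "\<bar>u - \<gamma>\<bar> = h" using h ee by (simp add: u_def abs_mult)
        then show "norm (Complex (1/2) u - Complex (1/2) \<gamma>) = r / ln \<gamma>" unfolding dist_critical by (simp add: h_def)
      qed (rule zg)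
      also have "\<dots> \<le> C1 * (2 * L)" using ln_up[of \<gamma>] ay y C1(1) by (intro mult_left_mono) auto
      also have "\<dots> = 2 * C1 * L" by simp
      also have "\<dots> \<le> C * L" using C2(1) t(3) unfolding C_def by (intro mult_right_mono) auto
      finally have "norm (zeta_logderiv (Complex (1/2) u)) \<le> C * L" .
      moreover have "c / L \<le> e * (u - t)" "e * (u - t) \<le> 1 / 16" unfolding eu using y y2 h by linarith+
      moreover have "\<not> (0 \<le> e * (\<gamma>' - t) \<and> e * (\<gamma>' - t) \<le> e * (u - t))" if "zeta (Complex (1/2) \<gamma>') = 0" for \<gamma>'
      proof
        assume as: "0 \<le> e * (\<gamma>' - t) \<and> e * (\<gamma>' - t) \<le> e * (u - t)"
        then have "\<gamma>' \<in> G" unfolding eu G_def using that y h by auto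
        then have "y \<le> e * (\<gamma>' - t)" by (rule y_min)
        then show False using as h unfolding eu by linarith
      qed
      ultimately show ?thesis unfolding L_def by blast
    qed
  qed
  have "C \<ge> 1" using C1(1) C2(1) by (simp add: C_def)
  show ?thesis
    by (rule exI[of _ C], rule conjI, fact, rule exI[of _ T2], intro allI impI ballI, rule main)
qed

text \<open>Half of \<open>\<kappa>\<close> accounts for about \<open>- L / 2\<close>, and within
  \<open>M / L\<close> of the line the sign lemma loses only a constant. Hence \<open>F + L\<close>
  has positive real part there, which is what Harnack's inequality needs.\<close>

lemma zeta_logderiv_Re_gt:
  assumes RH: riemann_hypothesis and M: "M > 0"
  shows "\<exists>T1\<ge>20. \<forall>t\<ge>T1. \<forall>s. 1 / 2 < Re s \<longrightarrow> Re s - 1 / 2 \<le> M / ln t \<longrightarrow> \<bar>Im s - t\<bar> \<le> 1 / 16 \<longrightarrow>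
      Re (zeta_logderiv s) > - ln t"
proof -
  obtain C where C: "C \<ge> 1" "\<forall>T\<ge>10. \<forall>s\<in>ball (Complex (1/2) T) (1/8). zeta s \<noteq> 0 \<longrightarrow>
      (Re s \<ge> 1 / 2 \<longrightarrow> Re (zeta_logderiv s - zeta_twist s / 2) \<ge> - (C * ln T * (Re s - 1 / 2))) \<and>
      (Re s \<le> 1 / 2 \<longrightarrow> Re (zeta_logderiv s - zeta_twist s / 2) \<le> C * ln T * (1 / 2 - Re s))"
    by (atomize_elim, rule zeta_logderiv_sign[OF RH])
  obtain D where D: "D \<ge> 1" "\<And>T s. T \<ge> 10 \<Longrightarrow> s \<in> ball (Complex (1/2) T) (1/4) \<Longrightarrow>
      norm (zeta_twist s + of_real (ln T)) \<le> D"
    using zeta_twist_local by blast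
  have "eventually (\<lambda>t::real. t \<ge> 20 \<and> ln t \<ge> 1 \<and> M / ln t \<le> 1 / 32 \<and> ln t > 2 * (M * C) + D) at_top"
    by (intro eventually_conj; real_asymp)
  then obtain T1 where T1: "\<And>t. t \<ge> T1 \<Longrightarrow> t \<ge> 20 \<and> ln t \<ge> 1 \<and> M / ln t \<le> 1 / 32 \<and> ln t > 2 * (M * C) + D"
    unfolding eventually_at_top_linorder by blast
  have "Re (zeta_logderiv s) > - ln t"
    if t0: "t \<ge> T1" and s: "1 / 2 < Re s" "Re s - 1 / 2 \<le> M / ln t" "\<bar>Im s - t\<bar> \<le> 1 / 16" for t s
  proof -
    have t: "t \<ge> 20" "ln t \<ge> 1" "M / ln t \<le> 1 / 32" "ln t > 2 * (M * C) + D" using T1[OF t0] by auto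
    have "norm (s - Complex (1/2) t) \<le> \<bar>Re s - 1 / 2\<bar> + \<bar>Im s - t\<bar>"
      using cmod_le[of "s - Complex (1/2) t"] by simp
    then have "norm (s - Complex (1/2) t) < 1 / 8" using s t(3) by linarith
    then have b: "s \<in> ball (Complex (1/2) t) (1/8)" "s \<in> ball (Complex (1/2) t) (1/4)"
      by (auto simp: dist_norm norm_minus_commute)
    have "Im s > 0" using s(3) t(1) by linarith
    then have nz: "zeta s \<noteq> 0" using s(1) by (intro zeta_nonzero[OF RH]) auto
    have "Re (zeta_logderiv s - zeta_twist s / 2) \<ge> - (C * ln t * (Re s - 1 / 2))"
      using C(2) b nz t s(1) by auto
    moreover have "C * ln t * (Re s - 1 / 2) \<le> C * ln t * (M / ln t)"
      using s(2) C(1) t by (intro mult_left_mono) auto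
    moreover have "C * ln t * (M / ln t) = M * C" using t by simp
    moreover have "norm (zeta_twist s + of_real (ln t)) \<le> D" using D(2)[of t s] b t by auto
    then have "Re (zeta_twist s) \<ge> - ln t - D" using abs_Re_le_cmod[of "zeta_twist s + of_real (ln t)"] by simp
    ultimately have "Re (zeta_logderiv s) \<ge> - (M * C) - ln t / 2 - D / 2" by simp
    then show ?thesis using t(4) by linarith
  qed
  then show ?thesis by (intro exI[of _ "max 20 T1"]) auto
qed

text \<open>Harnack's inequality on a disc that touches the critical line at the zero connects a point of
  the circle around the zero with the given point.\<close>

lemma zeta_logderiv_near_line_close:
  assumes RH: riemann_hypothesis and a: "a > 0"
    and free: "\<And>s. Im s \<ge> T0 \<Longrightarrow> deriv zeta s = 0 \<Longrightarrow> (Re s - 1 / 2) * ln (Im s) \<ge> a"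
    and c: "c > 0"
  shows "\<exists>C\<ge>1. \<exists>T1. \<forall>t\<ge>T1. (\<exists>\<gamma>. zeta (Complex (1/2) \<gamma>) = 0 \<and> \<bar>\<gamma> - t\<bar> \<le> 2 * c / ln t) \<longrightarrow>
      norm (zeta_logderiv (Complex (1/2 + c / ln t) t)) \<le> C * ln t"
proof -
  define r where "r = min (1/32) (min (a/16) (c/2))"
  have r: "0 < r" "r \<le> 1/32" "16 * r \<le> a" "r \<le> c / 2" using a c by (auto simp: r_def)
  obtain C1 T1 where C1: "C1 \<ge> 1" "\<And>\<gamma> s. \<gamma> \<ge> T1 \<Longrightarrow> zeta (Complex (1/2) \<gamma>) = 0 \<Longrightarrow>
      norm (s - Complex (1/2) \<gamma>) = r / ln \<gamma> \<Longrightarrow> norm (zeta_logderiv s) \<le> C1 * ln \<gamma>"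
    using zeta_logderiv_near_zero[OF RH a free r(1-3)] by blast
  \<comment> \<open>The disc has centre at distance \<open>M / L\<close> right of the zero and
    radius \<open>M / L\<close>. The target has horizontal offset \<open>c / L\<close> and vertical
    offset at most \<open>2 * c / L\<close>, so its scaled squared distance is at most
    \<open>(c - M)^2 + 4 * c^2\<close>. For \<open>M = 5 * c\<close> this equals
    \<open>(1 - c / M) * M^2\<close>, strictly inside.\<close>
  define M where "M = 5 * c"
  \<comment> \<open>The larger of two relative distances from the centre: that of the point on the
    circle around the zero and that of the target.\<close>
  define \<rho> where "\<rho> = max (1 - r / (2 * M)) (sqrt (1 - c / M))"
  have M: "M > 0" "2 * r \<le> M" using c r by (auto simp: M_def)
  have \<rho>: "0 < \<rho>" "\<rho> < 1" "1 - r / (2 * M) \<le> \<rho>" "sqrt (1 - c / M) \<le> \<rho>"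
    using r c by (auto simp: \<rho>_def M_def less_max_iff_disj)
  obtain T3 where T3: "T3 \<ge> 20" "\<forall>t\<ge>T3. \<forall>s. 1 / 2 < Re s \<longrightarrow> Re s - 1 / 2 \<le> 2 * M / ln t \<longrightarrow> \<bar>Im s - t\<bar> \<le> 1 / 16 \<longrightarrow>
      Re (zeta_logderiv s) > - ln t"
    using zeta_logderiv_Re_gt[OF RH, of "2 * M"] M(1) by (metis mult_pos_pos zero_less_numeral)
  define q where "q = (1 + \<rho>) / (1 - \<rho>)"
  have q: "q \<ge> 1" using \<rho> by (simp add: q_def)
  define C where "C = q * q * (2 * C1 + 1) + 1"
  have "eventually (\<lambda>t::real. t \<ge> 20 \<and> t \<ge> T1 + 1 \<and> ln t \<ge> 1 \<and> ln (t + 1) \<le> 2 * ln t \<and> ln (t - 1) \<ge> ln t / 2 \<and>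
      2 * c / ln t \<le> 1 / 32 \<and> 2 * M / ln t \<le> 1 / 32 \<and> t \<ge> T3) at_top"
    using c M(1) by (intro eventually_conj; real_asymp)
  then obtain T2 where T2: "\<And>t. t \<ge> T2 \<Longrightarrow> t \<ge> 20 \<and> t \<ge> T1 + 1 \<and> ln t \<ge> 1 \<and> ln (t + 1) \<le> 2 * ln t \<and> ln (t - 1) \<ge> ln t / 2 \<and>
      2 * c / ln t \<le> 1 / 32 \<and> 2 * M / ln t \<le> 1 / 32 \<and> t \<ge> T3"
    unfolding eventually_at_top_linorder by blast
  have main: "norm (zeta_logderiv (Complex (1/2 + c / ln t) t)) \<le> C * ln t"
    if t0: "t \<ge> T2" and zg: "zeta (Complex (1/2) \<gamma>) = 0" and g: "\<bar>\<gamma> - t\<bar> \<le> 2 * c / ln t" for t \<gamma>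
  proof -
    define L where "L = ln t"
    have t: "t \<ge> 20" "t \<ge> T1 + 1" "L \<ge> 1" "ln (t + 1) \<le> 2 * L" "ln (t - 1) \<ge> L / 2" "2 * c / L \<le> 1 / 32"
      "2 * M / L \<le> 1 / 32" "t \<ge> T3"
      using T2[OF t0] by (auto simp: L_def)
    have g': "\<bar>\<gamma> - t\<bar> \<le> 2 * c / L" using g by (simp add: L_def)
    have g2: "\<bar>\<gamma> - t\<bar> \<le> 1 / 32" using order_trans[OF g' t(6)] .
    have lng: "ln \<gamma> \<le> 2 * L" "ln \<gamma> \<ge> L / 2"
    proof -
      have "t - 1 \<le> \<gamma>" "\<gamma> \<le> t + 1" "0 < \<gamma>" "0 < t - 1" using g2 t(1) by linarith+
      then have "ln \<gamma> \<le> ln (t + 1)" "ln (t - 1) \<le> ln \<gamma>" by (auto intro: ln_mono)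
      then show "ln \<gamma> \<le> 2 * L" "ln \<gamma> \<ge> L / 2" using t by linarith+
    qed
    define w where "w = Complex (1/2 + M / L) \<gamma>"
    define R where "R = M / L"
    have R: "R > 0" using M t by (simp add: R_def)
    define G where "G = (\<lambda>s. zeta_logderiv s + of_real L)"
    have inb: "Re z > 1 / 2" "Re z - 1 / 2 < 2 * R" "z \<in> ball (Complex (1/2) t) (1/8)" if "z \<in> ball w R" for z
    proof -
      have d: "norm (z - w) < R" using that by (simp add: dist_norm norm_minus_commute)
      then show "Re z > 1 / 2" "Re z - 1 / 2 < 2 * R"
        using abs_Re_le_cmod[of "z - w"] by (auto simp: w_def R_def)
      have "w - Complex (1/2) t = Complex R (\<gamma> - t)" by (simp add: w_def R_def complex_eq_iff)
      then have "norm (w - Complex (1/2) t) \<le> R + 1 / 32"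
        using cmod_le[of "w - Complex (1/2) t"] g2 R by simp
      then have "norm (z - Complex (1/2) t) < 2 * R + 1 / 32"
        using norm_triangle_ineq[of "z - w" "w - Complex (1/2) t"] d by simp
      then show "z \<in> ball (Complex (1/2) t) (1/8)" using t(7) by (simp add: dist_norm norm_minus_commute R_def)
    qed
    have Im_pos: "Im z > 0" if "z \<in> ball w R" for z
      using inb(3)[OF that] t abs_Im_le_cmod[of "Complex (1/2) t - z"] by (simp add: dist_norm)
    have hol: "G holomorphic_on ball w R"
      unfolding G_def
      by (intro holomorphic_intros holomorphic_on_subset[OF zeta_logderiv_holomorphic_right[OF RH]])
         (use inb Im_pos in auto)
    have pos: "Re (G z) > 0" if z: "z \<in> ball w R" for z
    proof -
      have "\<bar>Im z - \<gamma>\<bar> < R"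
        using z abs_Im_le_cmod[of "w - z"] by (simp add: dist_norm w_def)
      moreover have "2 * R \<le> 1 / 32" using t(7) unfolding R_def times_divide_eq_right .
      ultimately have "\<bar>Im z - t\<bar> \<le> 1 / 16" using g2 by linarith
      moreover have "Re z - 1 / 2 \<le> 2 * M / ln t" using inb(2)[OF z] by (simp add: R_def L_def)
      ultimately have "Re (zeta_logderiv z) > - ln t"
        by (intro T3(2)[rule_format, OF t(8) inb(1)[OF z]])
      then show ?thesis by (simp add: G_def L_def)
    qed
    define s1 where "s1 = Complex (1/2 + r / ln \<gamma>) \<gamma>"
    define s2 where "s2 = Complex (1/2 + c / L) t"
    have r1: "r / ln \<gamma> \<le> 2 * r / L" "r / ln \<gamma> \<ge> r / (2 * L)"
    proof -
      have "r / ln \<gamma> \<le> r / (L / 2)" using lng t r by (intro divide_left_mono) auto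
      then show "r / ln \<gamma> \<le> 2 * r / L" by (simp add: mult.commute)
      show "r / ln \<gamma> \<ge> r / (2 * L)" using lng t r by (intro divide_left_mono) auto
    qed
    have "norm (s1 - w) = \<bar>r / ln \<gamma> - M / L\<bar>" by (simp add: s1_def w_def cmod_def)
    also have "\<dots> \<le> M / L - r / (2 * L)"
    proof -
      have "2 * r / L \<le> M / L" using M t by (intro divide_right_mono) auto
      then show ?thesis using r1 by linarith
    qed
    also have "\<dots> = (1 - r / (2 * M)) * R" using M t by (simp add: R_def field_simps)
    also have "\<dots> \<le> \<rho> * R" using \<rho> R by (intro mult_right_mono) auto
    finally have s1w: "norm (s1 - w) \<le> \<rho> * R" .
    have s2w: "norm (s2 - w) \<le> \<rho> * R"
    proof -
      have "(norm (s2 - w))\<^sup>2 = (c / L - M / L)\<^sup>2 + (t - \<gamma>)\<^sup>2" by (simp add: cmod_power2 s2_def w_def)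
      also have "(t - \<gamma>)\<^sup>2 \<le> (2 * c / L)\<^sup>2"
        using power_mono[OF g', of 2] by (simp add: power2_commute)
      also have "(c / L - M / L)\<^sup>2 + (2 * c / L)\<^sup>2 = ((c - M)\<^sup>2 + (2 * c)\<^sup>2) / L\<^sup>2"
        by (simp add: power_divide add_divide_distrib diff_divide_distrib[symmetric])
      also have "(c - M)\<^sup>2 + (2 * c)\<^sup>2 = (1 - c / M) * M\<^sup>2"
        using c by (simp add: M_def power2_eq_square algebra_simps)
      also have "\<dots> / L\<^sup>2 = (sqrt (1 - c / M) * R)\<^sup>2"
        using c by (simp add: R_def power_mult_distrib power_divide M_def)
      finally have "norm (s2 - w) \<le> sqrt (1 - c / M) * R"
        by (rule power2_le_imp_le) (use R c in \<open>auto simp: M_def\<close>)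
      also have "\<dots> \<le> \<rho> * R" using \<rho> R by (intro mult_right_mono) auto
      finally show ?thesis .
    qed
    have nL: "norm (of_real L :: complex) = L" using t by simp
    have "norm (zeta_logderiv s1) \<le> C1 * ln \<gamma>"
    proof (rule C1(2)[OF _ zg])
      show "\<gamma> \<ge> T1" using g2 t by linarith
      show "norm (s1 - Complex (1/2) \<gamma>) = r / ln \<gamma>" using r lng t by (simp add: s1_def cmod_def)
    qed
    also have "\<dots> \<le> C1 * (2 * L)" using lng C1(1) by (intro mult_left_mono) auto
    finally have Gs1: "norm (G s1) \<le> (2 * C1 + 1) * L"
      using norm_triangle_ineq[of "zeta_logderiv s1" "of_real L"] nL by (simp add: G_def algebra_simps)
    have "norm (G w) * (1 - \<rho>) \<le> norm (G s1) * (1 + \<rho>)"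
      by (rule Harnack_norm(2)[OF hol R pos s1w \<rho>(2)])
    then have Gw: "norm (G w) \<le> q * norm (G s1)" using \<rho> by (simp add: q_def field_simps)
    have "norm (G s2) * (1 - \<rho>) \<le> norm (G w) * (1 + \<rho>)"
      by (rule Harnack_norm(1)[OF hol R pos s2w \<rho>(2)])
    then have "norm (G s2) \<le> q * norm (G w)" using \<rho> by (simp add: q_def field_simps)
    also have "\<dots> \<le> q * (q * ((2 * C1 + 1) * L))"
      using Gw Gs1 q by (intro mult_left_mono order_trans[OF Gw]) auto
    finally have "norm (G s2) \<le> q * q * (2 * C1 + 1) * L" by (simp only: mult.assoc)
    moreover have "norm (zeta_logderiv s2) \<le> norm (G s2) + L"
      using norm_triangle_ineq4[of "G s2" "of_real L"] nL by (simp add: G_def)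
    ultimately show ?thesis by (simp add: C_def s2_def L_def algebra_simps)
  qed
  have "0 \<le> q * q * (2 * C1 + 1)" using q C1(1) by simp
  then have "C \<ge> 1" by (simp add: C_def)
  then show ?thesis using main by (intro exI[of _ C] conjI exI[of _ T2] allI impI) auto
qed

text \<open>Here \<open>V\<close> is the imaginary part on the critical line. Its partial fractions increase between
  zeros, so the bounds at the gap ends bound \<open>V\<close> near \<open>t\<close>, and the difference of \<open>V\<close> at \<open>t + x\<close> and
  \<open>t - x\<close> dominates the sum \<open>Q\<close> of the terms \<open>m x / (t - \<gamma>)\<^sup>2\<close>. That sum controls the step from the
  line to its right.\<close>

lemma zeta_logderiv_near_line_far:
  assumes RH: riemann_hypothesis and a: "a > 0"
    and free: "\<And>s. Im s \<ge> T0 \<Longrightarrow> deriv zeta s = 0 \<Longrightarrow> (Re s - 1 / 2) * ln (Im s) \<ge> a"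
    and c: "c > 0"
  shows "\<exists>C\<ge>1. \<exists>T1. \<forall>t\<ge>T1. (\<forall>\<gamma>. zeta (Complex (1/2) \<gamma>) = 0 \<longrightarrow> \<bar>\<gamma> - t\<bar> > 2 * c / ln t) \<longrightarrow>
      norm (zeta_logderiv (Complex (1/2 + c / ln t) t)) \<le> C * ln t"
proof -
  obtain C1 T1 where C1: "C1 \<ge> 1" "\<forall>t\<ge>T1. \<forall>e\<in>{1,-1}.
      (\<forall>\<gamma>. zeta (Complex (1/2) \<gamma>) = 0 \<longrightarrow> \<bar>\<gamma> - t\<bar> > 2 * c / ln t) \<longrightarrow>
      (\<exists>u. c / ln t \<le> e * (u - t) \<and> e * (u - t) \<le> 1 / 16 \<and>
         (\<forall>\<gamma>. zeta (Complex (1/2) \<gamma>) = 0 \<longrightarrow> \<not> (0 \<le> e * (\<gamma> - t) \<and> e * (\<gamma> - t) \<le> e * (u - t))) \<and>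
         norm (zeta_logderiv (Complex (1/2) u)) \<le> C1 * ln t)"
    by (rule exE[OF zeta_logderiv_gap_end[OF RH a _ c]], rule free, assumption+, elim exE conjE, rule that, assumption+)
  obtain C2 where C2: "C2 \<ge> 1" "\<forall>T\<ge>10. \<exists>Z m k. finite Z \<and>
      (\<forall>a\<in>Z. Re a = 1 / 2 \<and> zeta a = 0 \<and> m a > (0::nat)) \<and>
      (\<forall>s\<in>ball (Complex (1/2) T) (1/4). norm (k s) \<le> C2 * ln T \<and> (zeta s = 0 \<longrightarrow> s \<in> Z) \<and>
         (Re s = 1 / 2 \<longrightarrow> Re (k s) = 0) \<and>
         (zeta s \<noteq> 0 \<longrightarrow> zeta_logderiv s = zeta_twist s / 2 + (\<Sum>a\<in>Z. of_nat (m a) / (s - a)) + k s)) \<and>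
      (\<forall>s\<in>ball (Complex (1/2) T) (1/8). \<forall>s'\<in>ball (Complex (1/2) T) (1/8).
         norm (k s - k s') \<le> C2 * ln T * norm (s - s'))"
    by (atomize_elim, rule zeta_logderiv_critical_local[OF RH])
  obtain D where D: "D \<ge> 1" "\<And>T s. T \<ge> 10 \<Longrightarrow> s \<in> ball (Complex (1/2) T) (1/4) \<Longrightarrow>
      norm (zeta_twist s + of_real (ln T)) \<le> D"
    using zeta_twist_local by blast
  define A where "A = C1 + C2 + D"
  define C where "C = 2 * A + 3 * C2 + D"
  have "eventually (\<lambda>t::real. t \<ge> 20 \<and> t \<ge> T1 \<and> ln t \<ge> 1 \<and> c / ln t \<le> 1 / 32) at_top"
    using c by (intro eventually_conj; real_asymp)
  then obtain T2 where T2: "\<And>t. t \<ge> T2 \<Longrightarrow> t \<ge> 20 \<and> t \<ge> T1 \<and> ln t \<ge> 1 \<and> c / ln t \<le> 1 / 32"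
    unfolding eventually_at_top_linorder by blast
  have main: "norm (zeta_logderiv (Complex (1/2 + c / ln t) t)) \<le> C * ln t"
    if t0: "t \<ge> T2" and far: "\<forall>\<gamma>. zeta (Complex (1/2) \<gamma>) = 0 \<longrightarrow> \<bar>\<gamma> - t\<bar> > 2 * c / ln t" for t
  proof -
    define L where "L = ln t"
    define x where "x = c / L"
    have t: "t \<ge> 20" "t \<ge> T1" "L \<ge> 1" "x \<le> 1 / 32" using T2[OF t0] by (auto simp: L_def x_def)
    have x: "x > 0" using c t by (simp add: x_def)
    have t10: "t \<ge> 10" using t by simp
    from C2(2)[THEN spec, THEN mp, OF t10] obtain Z m k where Z: "finite Z"
      "\<forall>a\<in>Z. Re a = 1 / 2 \<and> zeta a = 0 \<and> m a > (0::nat)"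
      "\<forall>s\<in>ball (Complex (1/2) t) (1/4). norm (k s) \<le> C2 * ln t \<and> (zeta s = 0 \<longrightarrow> s \<in> Z) \<and>
         (Re s = 1 / 2 \<longrightarrow> Re (k s) = 0) \<and>
         (zeta s \<noteq> 0 \<longrightarrow> zeta_logderiv s = zeta_twist s / 2 + (\<Sum>a\<in>Z. of_nat (m a) / (s - a)) + k s)"
      "\<forall>s\<in>ball (Complex (1/2) t) (1/8). \<forall>s'\<in>ball (Complex (1/2) t) (1/8).
         norm (k s - k s') \<le> C2 * ln t * norm (s - s')"
      by (elim exE conjE) (rule that; assumption)
    have zZ: "zeta (Complex (1/2) (Im a)) = 0" if "a \<in> Z" for a
      using Z(2) that critical_zero_eq[of a] by metis
    have farZ: "\<bar>Im a - t\<bar> > 2 * x" if "a \<in> Z" for a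
      using far zZ[OF that] by (auto simp: x_def L_def)
    have line: "Complex (1/2) u \<in> ball (Complex (1/2) t) (1/4)" "Complex (1/2) u \<in> ball (Complex (1/2) t) (1/8)"
      if "\<bar>u - t\<bar> \<le> 1 / 16" for u
      using that by (auto simp: dist_norm dist_critical abs_minus_commute)
    have tw: "norm (zeta_twist s / 2) \<le> D * L" if s: "s \<in> ball (Complex (1/2) t) (1/4)" for s
    proof -
      have "norm (zeta_twist s) \<le> norm (zeta_twist s + of_real L) + norm (of_real L :: complex)"
        using norm_triangle_ineq4[of "zeta_twist s + of_real L" "of_real L"] by simp
      also have "\<dots> \<le> D + L" using D(2)[OF t10 s] t by (simp add: L_def)
      finally have "norm (zeta_twist s / 2) \<le> (D + L) / 2" by simp
      moreover have "D * 1 \<le> D * L" "1 * L \<le> D * L"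
        using D(1) t by (auto intro: mult_left_mono mult_right_mono simp del: mult_1 mult_1_right)
      ultimately show ?thesis by simp
    qed
    define V where "V = (\<lambda>u. Im (k (Complex (1/2) u)) - (\<Sum>a\<in>Z. real (m a) / (u - Im a)))"
    have crit_sum: "(\<Sum>a\<in>Z. of_nat (m a) / (Complex (1/2) u - a)) = Complex 0 (- (\<Sum>a\<in>Z. real (m a) / (u - Im a)))" for u
    proof -
      have "(\<Sum>a\<in>Z. of_nat (m a) / (Complex (1/2) u - a)) = (\<Sum>a\<in>Z. Complex 0 (- (real (m a) / (u - Im a))))"
      proof (rule sum.cong[OF refl])
        fix a assume "a \<in> Z"
        then have eq: "Complex (1/2) u - a = Complex 0 (u - Im a)" using Z(2) by (auto simp: complex_eq_iff)
        show "of_nat (m a) / (Complex (1/2) u - a) = Complex 0 (- (real (m a) / (u - Im a)))"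
          unfolding eq by (cases "u = Im a") (simp_all add: complex_eq_iff Re_divide Im_divide power2_eq_square)
      qed
      also have "\<dots> = Complex 0 (- (\<Sum>a\<in>Z. real (m a) / (u - Im a)))"
        by (simp add: complex_eq_iff sum_negf)
      finally show ?thesis .
    qed
    have V_line: "\<bar>V u\<bar> \<le> norm (zeta_logderiv (Complex (1/2) u)) + D * L"
      if u: "\<bar>u - t\<bar> \<le> 1 / 16" and nz: "zeta (Complex (1/2) u) \<noteq> 0" for u
    proof -
      have "zeta_logderiv (Complex (1/2) u) - zeta_twist (Complex (1/2) u) / 2 =
          Complex 0 (- (\<Sum>a\<in>Z. real (m a) / (u - Im a))) + k (Complex (1/2) u)"
        using Z(3)[THEN bspec, OF line(1)[OF u]] nz crit_sum[of u] by simp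
      then have "V u = Im (zeta_logderiv (Complex (1/2) u) - zeta_twist (Complex (1/2) u) / 2)"
        by (simp only: V_def plus_complex.sel complex.sel)
      also have "\<bar>\<dots>\<bar> \<le> norm (zeta_logderiv (Complex (1/2) u)) + norm (zeta_twist (Complex (1/2) u) / 2)"
        by (rule order_trans[OF abs_Im_le_cmod norm_triangle_ineq4])
      also have "\<dots> \<le> norm (zeta_logderiv (Complex (1/2) u)) + D * L"
        using tw[OF line(1)[OF u]] by simp
      finally show ?thesis .
    qed
    \<comment> \<open>Bounds \<open>V\<close> from above on the upper side of \<open>t\<close> and
      from below on the lower side. Moving from \<open>p\<close> away from \<open>t\<close> to the
      gap end \<open>u\<close>, \<open>e * V\<close> decreases at most by the variation of the
      remainder \<open>k\<close>.\<close>
    have eV: "e * V p \<le> A * L" if e: "e \<in> {1,-1}" and p: "0 \<le> e * (p - t)" "e * (p - t) \<le> x" for e p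
    proof -
      have ee: "e * e = 1" "\<bar>e\<bar> = 1" using e by auto
      have abs_e: "\<bar>y\<bar> = \<bar>e * y\<bar>" for y using ee by (simp add: abs_mult)
      obtain u where u: "x \<le> e * (u - t)" "e * (u - t) \<le> 1 / 16"
        "\<forall>\<gamma>. zeta (Complex (1/2) \<gamma>) = 0 \<longrightarrow> \<not> (0 \<le> e * (\<gamma> - t) \<and> e * (\<gamma> - t) \<le> e * (u - t))"
        "norm (zeta_logderiv (Complex (1/2) u)) \<le> C1 * L"
        using C1(2)[THEN spec, THEN mp, OF t(2), THEN bspec, OF e, THEN mp, OF far]
        unfolding x_def L_def by blast
      have u16: "\<bar>u - t\<bar> \<le> 1 / 16" using u(1,2) x abs_e[of "u - t"] by simp
      have p16: "\<bar>p - t\<bar> \<le> 1 / 16" using p t(4) abs_e[of "p - t"] by simp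
      have pu: "e * (p - t) \<le> e * (u - t)" using p u by linarith
      have pu2: "0 \<le> e * (u - p)" using pu by (simp add: algebra_simps)
      have "zeta (Complex (1/2) u) \<noteq> 0" using u(1,3) x by force
      then have "\<bar>V u\<bar> \<le> (C1 + D) * L" using V_line[OF u16] u(4) by (simp add: algebra_simps)
      then have Vu: "e * V u \<le> (C1 + D) * L" using abs_e[of "V u"] by linarith
      have "norm (k (Complex (1/2) u) - k (Complex (1/2) p)) \<le> C2 * L * \<bar>u - p\<bar>"
        using Z(4)[THEN bspec, OF line(2)[OF u16], THEN bspec, OF line(2)[OF p16]]
        by (simp add: L_def dist_critical)
      also have "\<bar>u - p\<bar> \<le> 1" using u16 p16 by linarith
      then have "C2 * L * \<bar>u - p\<bar> \<le> C2 * L * 1" using C2(1) t by (intro mult_left_mono) auto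
      finally have "\<bar>Im (k (Complex (1/2) u) - k (Complex (1/2) p))\<bar> \<le> C2 * L"
        using abs_Im_le_cmod order_trans by fastforce
      then have kd: "e * (Im (k (Complex (1/2) u)) - Im (k (Complex (1/2) p))) \<ge> - (C2 * L)"
        using abs_e[of "Im (k (Complex (1/2) u)) - Im (k (Complex (1/2) p))"] by simp
      \<comment> \<open>No zero lies between \<open>p\<close> and \<open>u\<close>, so both are on
        the same side of each \<open>Im a\<close>, where \<open>1 / (v - Im a)\<close> is decreasing
        in \<open>v\<close>.\<close>
      have "0 \<le> (\<Sum>a\<in>Z. e * (real (m a) / (p - Im a) - real (m a) / (u - Im a)))"
      proof (rule sum_nonneg)
        fix a assume a: "a \<in> Z"
        define U P g where "U = e * (u - t)" and "P = e * (p - t)" and "g = e * (Im a - t)"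
        have "g < 0 \<or> g > U" using u(3) zZ[OF a] by (auto simp: U_def g_def)
        moreover have "0 \<le> P" "P \<le> U" using p pu by (auto simp: P_def U_def)
        ultimately have pos: "(P - g) * (U - g) > 0" by (auto simp: zero_less_mult_iff)
        have "(P - g) * (U - g) = (e * e) * ((p - Im a) * (u - Im a))"
          by (simp add: P_def U_def g_def algebra_simps)
        then have pos': "(p - Im a) * (u - Im a) > 0" using pos ee by simp
        then have "p \<noteq> Im a" "u \<noteq> Im a" by auto
        then have "e * (real (m a) / (p - Im a) - real (m a) / (u - Im a)) =
            real (m a) * (e * (u - p)) / ((p - Im a) * (u - Im a))"
          by (simp add: field_simps)
        also have "\<dots> \<ge> 0" by (rule divide_nonneg_pos[OF mult_nonneg_nonneg[OF of_nat_0_le_iff pu2] pos'])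
        finally show "0 \<le> e * (real (m a) / (p - Im a) - real (m a) / (u - Im a))" .
      qed
      also have "\<dots> = e * ((\<Sum>a\<in>Z. real (m a) / (p - Im a)) - (\<Sum>a\<in>Z. real (m a) / (u - Im a)))"
        by (simp add: sum_subtractf flip: sum_distrib_left)
      finally have "e * V p \<le> e * V u + C2 * L" using kd by (simp add: V_def algebra_simps)
      then show ?thesis using Vu by (simp add: A_def algebra_simps)
    qed
    have Vt: "\<bar>V t\<bar> \<le> A * L" using eV[of 1 t] eV[of "-1" t] x by (simp add: abs_le_iff)
    define Q where "Q = (\<Sum>a\<in>Z. real (m a) * x / (t - Im a)\<^sup>2)"
    have Q: "Q \<le> (A + C2) * L"
    proof -
      have pm: "\<bar>(t + x) - t\<bar> \<le> 1 / 16" "\<bar>(t - x) - t\<bar> \<le> 1 / 16" using x t by auto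
      have "norm (k (Complex (1/2) (t + x)) - k (Complex (1/2) (t - x))) \<le> C2 * L * (2 * x)"
        using Z(4)[THEN bspec, OF line(2)[OF pm(1)], THEN bspec, OF line(2)[OF pm(2)]] x
        by (simp add: L_def dist_critical)
      also have "\<dots> \<le> C2 * L * 1" using t C2(1) by (intro mult_left_mono) auto
      finally have kd: "\<bar>Im (k (Complex (1/2) (t + x)) - k (Complex (1/2) (t - x)))\<bar> \<le> C2 * L"
        using abs_Im_le_cmod order_trans by fastforce
      \<comment> \<open>Termwise, \<open>1 / (t - x - \<gamma>) - 1 / (t + x - \<gamma>)\<close>
        equals \<open>2 * x / ((t - \<gamma>)^2 - x^2)\<close>. The denominator is positive because
        all zeros are more than \<open>2 * x\<close> away.\<close>
      have "2 * Q = (\<Sum>a\<in>Z. 2 * (real (m a) * x / (t - Im a)\<^sup>2))" by (simp add: Q_def sum_distrib_left)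
      also have "\<dots> \<le> (\<Sum>a\<in>Z. real (m a) / (t - x - Im a) - real (m a) / (t + x - Im a))"
      proof (rule sum_mono)
        fix a assume "a \<in> Z"
        then have "2 * x < \<bar>t - Im a\<bar>" using farZ by (simp add: abs_minus_commute)
        then have ne: "t - x - Im a \<noteq> 0" "t + x - Im a \<noteq> 0" and "x < \<bar>t - Im a\<bar>"
          using x by auto
        then have "x\<^sup>2 < \<bar>t - Im a\<bar>\<^sup>2" using x by (intro power_strict_mono) auto
        then have pos: "0 < (t - Im a)\<^sup>2 - x\<^sup>2" by simp
        then have "0 < (t - Im a)\<^sup>2" using zero_le_power2[of x] by linarith
        then have "real (m a) * (2 * x) / (t - Im a)\<^sup>2 \<le> real (m a) * (2 * x) / ((t - Im a)\<^sup>2 - x\<^sup>2)"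
          using x pos by (intro divide_left_mono mult_pos_pos) auto
        also have "(t - Im a)\<^sup>2 - x\<^sup>2 = (t - x - Im a) * (t + x - Im a)"
          by (simp add: power2_eq_square algebra_simps)
        also have "real (m a) * (2 * x) / ((t - x - Im a) * (t + x - Im a)) =
            real (m a) / (t - x - Im a) - real (m a) / (t + x - Im a)"
          using ne by (simp add: field_simps)
        finally show "2 * (real (m a) * x / (t - Im a)\<^sup>2) \<le> real (m a) / (t - x - Im a) - real (m a) / (t + x - Im a)"
          by (simp add: mult_ac)
      qed
      also have "\<dots> = V (t + x) - V (t - x) - Im (k (Complex (1/2) (t + x)) - k (Complex (1/2) (t - x)))"
        by (simp add: V_def sum_subtractf)
      also have "\<dots> \<le> A * L + A * L + C2 * L" using eV[of 1 "t + x"] eV[of "-1" "t - x"] x kd by simp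
      finally have "2 * Q \<le> 2 * (A * L) + C2 * L" by simp
      moreover have "0 \<le> C2 * L" using C2(1) t by simp
      ultimately show ?thesis by (simp add: algebra_simps)
    qed
    define s st where "s = Complex (1/2 + x) t" and "st = Complex (1/2) t"
    have sst: "st - s = - of_real x" by (simp add: s_def st_def complex_eq_iff)
    then have "norm (st - s) = x" using x by simp
    then have sb: "s \<in> ball (Complex (1/2) t) (1/4)" using t(4) by (simp add: dist_norm st_def)
    have kt: "norm (k st) \<le> C2 * L" using Z(3)[THEN bspec, of st] by (auto simp: st_def L_def)
    have ks: "norm (k s) \<le> C2 * L" using Z(3)[THEN bspec, OF sb] by (auto simp: L_def)
    \<comment> \<open>In the step from the line to its right each term changes by at most
      \<open>m * x / (t - \<gamma>)^2\<close>, because horizontal displacement only increases the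
      distance to a zero.\<close>
    have diff: "norm ((\<Sum>a\<in>Z. of_nat (m a) / (s - a)) - (\<Sum>a\<in>Z. of_nat (m a) / (st - a))) \<le> Q"
      unfolding Q_def sum_subtractf[symmetric]
    proof (rule sum_norm_le)
      fix a assume a: "a \<in> Z"
      have g: "\<bar>t - Im a\<bar> > 0" using farZ[OF a] x by (simp add: abs_minus_commute)
      have n1: "norm (s - a) \<ge> \<bar>t - Im a\<bar>" "norm (st - a) \<ge> \<bar>t - Im a\<bar>"
        using abs_Im_le_cmod[of "s - a"] abs_Im_le_cmod[of "st - a"] by (auto simp: s_def st_def)
      then have "s - a \<noteq> 0" "st - a \<noteq> 0" using g by auto
      then have "of_nat (m a) / (s - a) - of_nat (m a) / (st - a) = of_nat (m a) * (st - s) / ((s - a) * (st - a))"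
        by (simp add: field_simps)
      then have "norm (of_nat (m a) / (s - a) - of_nat (m a) / (st - a)) = real (m a) * x / (norm (s - a) * norm (st - a))"
        using \<open>norm (st - s) = x\<close> by (simp add: norm_divide norm_mult)
      also have "\<dots> \<le> real (m a) * x / (\<bar>t - Im a\<bar> * \<bar>t - Im a\<bar>)"
        using n1 g x by (intro divide_left_mono mult_mono mult_pos_pos) auto
      finally show "norm (of_nat (m a) / (s - a) - of_nat (m a) / (st - a)) \<le> real (m a) * x / (t - Im a)\<^sup>2"
        by (simp add: power2_eq_square)
    qed
    have "norm (\<Sum>a\<in>Z. of_nat (m a) / (st - a)) = \<bar>V t - Im (k st)\<bar>"
      unfolding st_def crit_sum by (simp add: V_def cmod_def)
    also have "\<dots> \<le> A * L + C2 * L" using Vt kt abs_Im_le_cmod[of "k st"] by linarith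
    finally have "norm (\<Sum>a\<in>Z. of_nat (m a) / (s - a)) \<le> A * L + C2 * L + (A + C2) * L"
      using diff Q norm_triangle_sub[of "\<Sum>a\<in>Z. of_nat (m a) / (s - a)" "\<Sum>a\<in>Z. of_nat (m a) / (st - a)"] by linarith
    moreover have "zeta s \<noteq> 0" by (rule zeta_nonzero[OF RH]) (use x t in \<open>auto simp: s_def\<close>)
    then have "norm (zeta_logderiv s) \<le> norm (zeta_twist s / 2) + norm (\<Sum>a\<in>Z. of_nat (m a) / (s - a)) + norm (k s)"
      using Z(3)[THEN bspec, OF sb] norm_triangle_ineq[of "zeta_twist s / 2 + (\<Sum>a\<in>Z. of_nat (m a) / (s - a))" "k s"]
        norm_triangle_ineq[of "zeta_twist s / 2" "\<Sum>a\<in>Z. of_nat (m a) / (s - a)"] by simp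
    ultimately have "norm (zeta_logderiv s) \<le> D * L + (A * L + C2 * L + (A + C2) * L) + C2 * L"
      using tw[OF sb] ks by linarith
    also have "\<dots> = C * L" by (simp add: C_def algebra_simps)
    finally show ?thesis by (simp add: s_def x_def L_def)
  qed
  have "C \<ge> 1" using C1(1) C2(1) D(1) by (simp add: C_def A_def)
  then show ?thesis using main by (intro exI[of _ C] conjI exI[of _ T2] allI impI)
qed

text \<open>Harnack around \<open>1/2 + c / ln t + \<i>t\<close> extends the bound to a range of
  distances. The range is needed because the left side of the later rectangle is a vertical segment
  at a fixed abscissa, while \<open>ln u\<close> varies along it by a bounded factor.\<close>

lemma zeta_logderiv_near_line:
  assumes RH: riemann_hypothesis and a: "a > 0"
    and free: "\<And>s. Im s \<ge> T0 \<Longrightarrow> deriv zeta s = 0 \<Longrightarrow> (Re s - 1 / 2) * ln (Im s) \<ge> a"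
    and c: "c > 0"
  shows "\<exists>C\<ge>1. \<exists>T1. \<forall>t\<ge>T1. \<forall>x. c / 2 \<le> x * ln t \<and> x * ln t \<le> 3 * c / 2 \<longrightarrow>
      norm (zeta_logderiv (Complex (1/2 + x) t)) \<le> C * ln t"
proof -
  obtain C1 T1 where C1: "C1 \<ge> 1" "\<And>t. t \<ge> T1 \<Longrightarrow> \<exists>\<gamma>. zeta (Complex (1/2) \<gamma>) = 0 \<and> \<bar>\<gamma> - t\<bar> \<le> 2 * c / ln t \<Longrightarrow>
      norm (zeta_logderiv (Complex (1/2 + c / ln t) t)) \<le> C1 * ln t"
    using zeta_logderiv_near_line_close[OF RH a free c] by metis
  obtain C2 T2 where C2: "C2 \<ge> 1" "\<And>t. t \<ge> T2 \<Longrightarrow> \<forall>\<gamma>. zeta (Complex (1/2) \<gamma>) = 0 \<longrightarrow> \<bar>\<gamma> - t\<bar> > 2 * c / ln t \<Longrightarrow>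
      norm (zeta_logderiv (Complex (1/2 + c / ln t) t)) \<le> C2 * ln t"
    using zeta_logderiv_near_line_far[OF RH a free c] by metis
  obtain T3 where T3: "T3 \<ge> 20" "\<forall>t\<ge>T3. \<forall>s. 1 / 2 < Re s \<longrightarrow> Re s - 1 / 2 \<le> 2 * c / ln t \<longrightarrow> \<bar>Im s - t\<bar> \<le> 1 / 16 \<longrightarrow>
      Re (zeta_logderiv s) > - ln t"
    using zeta_logderiv_Re_gt[OF RH, of "2 * c"] c by (metis mult_pos_pos zero_less_numeral)
  have "eventually (\<lambda>t::real. t \<ge> T1 \<and> t \<ge> T2 \<and> t \<ge> T3 \<and> ln t \<ge> 1 \<and> c / ln t \<le> 1 / 16) at_top"
    by (intro eventually_conj; real_asymp)
  then obtain T4 where T4: "\<And>t. t \<ge> T4 \<Longrightarrow> t \<ge> T1 \<and> t \<ge> T2 \<and> t \<ge> T3 \<and> ln t \<ge> 1 \<and> c / ln t \<le> 1 / 16"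
    unfolding eventually_at_top_linorder by blast
  define C where "C = 3 * (C1 + C2 + 1) + 1"
  have main: "norm (zeta_logderiv (Complex (1/2 + x) t)) \<le> C * ln t"
    if t0: "t \<ge> T4" and x: "c / 2 \<le> x * ln t" "x * ln t \<le> 3 * c / 2" for t x
  proof -
    define L where "L = ln t"
    define R where "R = c / L"
    define w where "w = Complex (1/2 + R) t"
    define G where "G = (\<lambda>s. zeta_logderiv s + of_real L)"
    have t: "t \<ge> T1" "t \<ge> T2" "t \<ge> T3" "L \<ge> 1" "R \<le> 1 / 16" using T4[OF t0] by (auto simp: L_def R_def)
    have R: "R > 0" using c t by (simp add: R_def)
    have Fw: "norm (zeta_logderiv w) \<le> (C1 + C2) * L"
    proof (cases "\<exists>\<gamma>. zeta (Complex (1/2) \<gamma>) = 0 \<and> \<bar>\<gamma> - t\<bar> \<le> 2 * c / ln t")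
      case True
      have "norm (zeta_logderiv w) \<le> C1 * L" using C1(2)[OF t(1) True] by (simp add: w_def R_def L_def)
      also have "\<dots> \<le> (C1 + C2) * L" using C2(1) t by (intro mult_right_mono) auto
      finally show ?thesis .
    next
      case False
      then have "norm (zeta_logderiv w) \<le> C2 * L" using C2(2)[OF t(2)] by (auto simp: w_def R_def L_def not_le)
      also have "\<dots> \<le> (C1 + C2) * L" using C1(1) t by (intro mult_right_mono) auto
      finally show ?thesis .
    qed
    have zb: "Re z > 1 / 2" "Re z - 1 / 2 \<le> 2 * c / ln t" "\<bar>Im z - t\<bar> \<le> 1 / 16" if "z \<in> ball w R" for z
    proof -
      have "\<bar>Re z - (1 / 2 + R)\<bar> < R" "\<bar>Im z - t\<bar> < R"
        using that abs_Re_le_cmod[of "w - z"] abs_Im_le_cmod[of "w - z"] by (auto simp: dist_norm w_def)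
      then show "Re z > 1 / 2" "\<bar>Im z - t\<bar> \<le> 1 / 16" using t(5) by linarith+
      have "Re z - 1 / 2 \<le> 2 * R" using \<open>\<bar>Re z - (1 / 2 + R)\<bar> < R\<close> by linarith
      then show "Re z - 1 / 2 \<le> 2 * c / ln t" by (simp add: R_def L_def)
    qed
    have Im_pos: "Im z > 0" if "z \<in> ball w R" for z
      using zb(3)[OF that] t(3) T3(1) by linarith
    have hol: "G holomorphic_on ball w R"
      unfolding G_def
      by (intro holomorphic_intros holomorphic_on_subset[OF zeta_logderiv_holomorphic_right[OF RH]])
         (use zb(1) Im_pos in auto)
    have pos: "Re (G z) > 0" if z: "z \<in> ball w R" for z
      using T3(2)[rule_format, OF t(3) zb[OF z]] by (simp add: G_def L_def)
    have nL: "norm (of_real L :: complex) = L" using t by simp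
    have "c / 2 \<le> x * L" "x * L \<le> 3 * c / 2" using x by (auto simp: L_def)
    then have "\<bar>x * L - c\<bar> \<le> c / 2" unfolding abs_le_iff by auto
    moreover have "x * L - c = (x - R) * L" using t by (simp add: R_def algebra_simps)
    ultimately have "\<bar>x - R\<bar> * L \<le> (1/2 * R) * L" using t by (simp add: abs_mult R_def)
    then have xR: "\<bar>x - R\<bar> \<le> 1 / 2 * R" using t by simp
    have "norm (Complex (1/2 + x) t - w) \<le> 1 / 2 * R" using xR by (simp add: w_def cmod_def)
    from Harnack_norm(1)[OF hol R pos this]
    have "norm (G (Complex (1/2 + x) t)) \<le> 3 * norm (G w)" by simp
    also have "norm (G w) \<le> (C1 + C2) * L + L"
      using norm_triangle_ineq[of "zeta_logderiv w" "of_real L"] Fw nL by (simp add: G_def)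
    finally have "norm (G (Complex (1/2 + x) t)) \<le> 3 * ((C1 + C2) * L + L)" by simp
    moreover have "norm (zeta_logderiv (Complex (1/2 + x) t)) \<le> norm (G (Complex (1/2 + x) t)) + L"
      using norm_triangle_ineq4[of "G (Complex (1/2 + x) t)" "of_real L"] nL by (simp add: G_def)
    ultimately show ?thesis by (simp add: C_def L_def algebra_simps)
  qed
  have "C \<ge> 1" using C1(1) C2(1) by (simp add: C_def)
  then show ?thesis using main by (intro exI[of _ C] conjI exI[of _ T4] allI impI) auto
qed

subsection \<open>Interpolation\<close>

text \<open>With no zeros to the left at large height, the limit inferior is nonnegative, so being
  nonzero means being positive. It may be infinite, hence a real \<open>a\<close> strictly below it
  is chosen.\<close>

lemma deriv_zeta_zeros_away:
  assumes RH: riemann_hypothesis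
    and lim: "Liminf (inf (filtercomap Im at_top) (principal upper_zeta_deriv_zeros))
           (\<lambda>\<rho>. ereal ((Re \<rho> - 1 / 2) * ln (Im \<rho>))) \<noteq> 0"
  shows "\<exists>a>0. \<exists>T0. \<forall>s. Im s \<ge> T0 \<longrightarrow> deriv zeta s = 0 \<longrightarrow> (Re s - 1 / 2) * ln (Im s) \<ge> a"
proof -
  define F where "F = inf (filtercomap Im at_top) (principal upper_zeta_deriv_zeros)"
  define g where "g = (\<lambda>\<rho>. ereal ((Re \<rho> - 1 / 2) * ln (Im \<rho>)))"
  have ev: "eventually P F \<longleftrightarrow> (\<exists>T. \<forall>s. T \<le> Im s \<longrightarrow> s \<in> upper_zeta_deriv_zeros \<longrightarrow> P s)" for P
    by (simp add: F_def eventually_inf_principal eventually_filtercomap_at_top_linorder)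
  obtain T where T: "\<And>s. Im s \<ge> T \<Longrightarrow> Re s < 1 / 2 \<Longrightarrow> deriv zeta s \<noteq> 0"
    using deriv_zeta_nonzero_left[OF RH] by blast
  have "eventually (\<lambda>\<rho>. 0 \<le> g \<rho>) F"
    unfolding ev
  proof (intro exI[of _ "max 1 T"] allI impI)
    fix s assume s: "max 1 T \<le> Im s" "s \<in> upper_zeta_deriv_zeros"
    then have "deriv zeta s = 0" "T \<le> Im s" by (auto simp: upper_zeta_deriv_zeros_def)
    then have "Re s \<ge> 1 / 2" using T[of s] by linarith
    then show "0 \<le> g s" using s by (simp add: g_def)
  qed
  then have "0 \<le> Liminf F g" by (rule Liminf_bounded)
  then have "0 < Liminf F g" using lim by (simp add: F_def g_def less_le)
  then obtain a where a: "0 < ereal a" "ereal a < Liminf F g" using ereal_dense2 by blast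
  have "eventually (\<lambda>\<rho>. ereal a < g \<rho>) F" by (rule less_LiminfD[OF a(2)])
  then obtain T1 where T1: "\<And>s. T1 \<le> Im s \<Longrightarrow> s \<in> upper_zeta_deriv_zeros \<Longrightarrow> ereal a < g s"
    unfolding ev by blast
  have "(Re s - 1 / 2) * ln (Im s) \<ge> a" if "Im s \<ge> max 1 T1" "deriv zeta s = 0" for s
    using T1[of s] that by (simp add: upper_zeta_deriv_zeros_def g_def)
  then show ?thesis using a(1) by (intro exI[of _ a] conjI exI[of _ "max 1 T1"]) auto
qed

text \<open>A geometric sum with ratio \<open>2 powr (1 - Re s)\<close> is comparable to its last
  term because the ratio is at least \<open>2 powr (1 - \<sigma>\<^sub>1) > 1\<close>. This is where
  the constant comes to depend on \<open>\<sigma>\<^sub>1\<close>.\<close>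

lemma norm_prime_part_le_powr:
  assumes s: "Re s \<ge> 1 / 2" "Re s \<le> \<sigma>\<^sub>1" and \<sigma>\<^sub>1: "\<sigma>\<^sub>1 < 1" and K: "2 ^ K \<le> L\<^sup>2" and L: "L > 0"
  shows "norm (prime_part (2 ^ K) s) \<le> 8 / (2 powr (1 - \<sigma>\<^sub>1) - 1) * L powr (2 - 2 * Re s)"
proof -
  define y where "y = (2::real) powr (1 - Re s)"
  define b where "b = (2::real) powr (1 - \<sigma>\<^sub>1)"
  have b: "b > 1" unfolding b_def using \<sigma>\<^sub>1 by (intro gr_one_powr) auto
  have yb: "y \<ge> b" unfolding y_def b_def using s by (intro powr_mono) auto
  have yK: "y ^ K \<le> L powr (2 - 2 * Re s)"
  proof -
    have "y ^ K = (2 ^ K) powr (1 - Re s)"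
      by (simp add: y_def powr_powr mult.commute flip: powr_realpow)
    also have "\<dots> \<le> (L\<^sup>2) powr (1 - Re s)" using K s \<sigma>\<^sub>1 by (intro powr_mono2) auto
    also have "L\<^sup>2 = L powr 2" using L by simp
    also have "(L powr 2) powr (1 - Re s) = L powr (2 - 2 * Re s)" by (simp only: powr_powr) (simp add: algebra_simps)
    finally show ?thesis .
  qed
  have "norm (prime_part (2 ^ K) s) \<le> 8 * (\<Sum>k<K. y ^ k)"
    unfolding y_def by (rule norm_prime_part_le[OF s(1)])
  also have "(\<Sum>k<K. y ^ k) = (y ^ K - 1) / (y - 1)" using yb b by (intro geometric_sum) auto
  also have "\<dots> \<le> y ^ K / (b - 1)" using yb b by (intro frac_le) auto
  also have "\<dots> \<le> L powr (2 - 2 * Re s) / (b - 1)" using yK b by (intro divide_right_mono) auto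
  finally show ?thesis by (simp add: b_def)
qed

lemma zeta_logderiv_large:
  assumes RH: riemann_hypothesis and a: "a > 0"
    and free: "\<And>s. Im s \<ge> T0 \<Longrightarrow> deriv zeta s = 0 \<Longrightarrow> (Re s - 1 / 2) * ln (Im s) \<ge> a"
    and c: "c > 0" and \<sigma>\<^sub>1: "\<sigma>\<^sub>1 < 1"
  shows "\<exists>C T1. \<forall>t\<ge>T1. \<forall>\<sigma>. 1 / 2 + c / ln t \<le> \<sigma> \<longrightarrow> \<sigma> \<le> \<sigma>\<^sub>1 \<longrightarrow>
      norm (zeta_logderiv (Complex \<sigma> t)) \<le> C * ln t powr (2 - 2 * \<sigma>)"
proof -
  obtain C1 T1 where C1: "C1 \<ge> 1" "\<And>t x. t \<ge> T1 \<Longrightarrow> c / 2 \<le> x * ln t \<and> x * ln t \<le> 3 * c / 2 \<Longrightarrow>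
      norm (zeta_logderiv (Complex (1/2 + x) t)) \<le> C1 * ln t"
    using zeta_logderiv_near_line[OF RH a free c] by metis
  obtain C2 where C2: "C2 \<ge> 1" "\<And>x u d. u \<ge> 10 \<Longrightarrow> 0 < d \<Longrightarrow> d \<le> 1 \<Longrightarrow> 1 / 2 + d \<le> x \<Longrightarrow> x \<le> 2 \<Longrightarrow>
     norm (zeta_logderiv (Complex x u)) \<le> C2 * ln u / d"
    using norm_zeta_logderiv_le_strip[OF RH] by metis
  define B1 where "B1 = 8 / (2 powr (1 - \<sigma>\<^sub>1) - 1)"
  have "2 powr (1 - \<sigma>\<^sub>1) > (1::real)" using \<sigma>\<^sub>1 by (intro gr_one_powr) auto
  then have B1: "B1 \<ge> 0" by (simp add: B1_def)
  \<comment> \<open>The three summands come from the left side, the right side and the horizontal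
    sides of the rectangle.\<close>
  define A where "A = (2 * C1 * exp (2 * c) + B1) + 16 + (2 * C2 / c + 8)"
  define C where "C = exp 4 * A + B1"
  have "eventually (\<lambda>t::real. ln t \<ge> 2 \<and> ln (t + ln t) \<le> 3 / 2 * ln t \<and> ln (t - ln t) \<ge> ln t / 2 \<and>
      t - ln t \<ge> 10 \<and> t - ln t \<ge> T1 \<and> ln t ^ 6 * exp (- (ln t)\<^sup>2) \<le> 1) at_top"
    by (intro eventually_conj; real_asymp)
  then obtain T2 where T2: "\<And>t. t \<ge> T2 \<Longrightarrow> ln t \<ge> 2 \<and> ln (t + ln t) \<le> 3 / 2 * ln t \<and> ln (t - ln t) \<ge> ln t / 2 \<and>
      t - ln t \<ge> 10 \<and> t - ln t \<ge> T1 \<and> ln t ^ 6 * exp (- (ln t)\<^sup>2) \<le> 1"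
    unfolding eventually_at_top_linorder by blast
  have main: "norm (zeta_logderiv (Complex \<sigma> t)) \<le> C * ln t powr (2 - 2 * \<sigma>)"
    if t0: "t \<ge> T2" and \<sigma>0: "1 / 2 + c / ln t \<le> \<sigma>" and \<sigma>: "\<sigma> \<le> \<sigma>\<^sub>1" for t \<sigma>
  proof -
    define L where "L = ln t"
    define P where "P = L powr (2 - 2 * \<sigma>)"
    define \<alpha> where "\<alpha> = 1 / 2 + c / L"
    have L: "L \<ge> 2" "ln (t + L) \<le> 3 / 2 * L" "ln (t - L) \<ge> L / 2" "t - L \<ge> 10" "t - L \<ge> T1" "L ^ 6 * exp (- L\<^sup>2) \<le> 1"
      using T2[OF t0] by (auto simp: L_def)
    have cL: "c / L > 0" "c / L \<le> 1" "\<alpha> \<le> \<sigma>" "\<alpha> > 1 / 2"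
    proof -
      show "c / L > 0" using c L by simp
      then show "\<alpha> > 1 / 2" by (simp add: \<alpha>_def)
      show "\<alpha> \<le> \<sigma>" using \<sigma>0 by (simp add: \<alpha>_def L_def)
      then show "c / L \<le> 1" using \<sigma> \<sigma>\<^sub>1 by (simp add: \<alpha>_def)
    qed
    have P: "P \<ge> 1" unfolding P_def using L \<sigma> \<sigma>\<^sub>1 by (intro ge_one_powr_ge_zero) auto
    have lnu: "ln u \<le> 3 / 2 * L" "ln u \<ge> L / 2" "u \<ge> 10" "u \<ge> T1" if "\<bar>u - t\<bar> \<le> L" for u
    proof -
      have u: "t - L \<le> u" "u \<le> t + L" "0 < u" "0 < t - L" using that L by linarith+
      then show "u \<ge> 10" "u \<ge> T1" using L by linarith+
      have "ln u \<le> ln (t + L)" "ln (t - L) \<le> ln u" using u by (auto intro: ln_mono)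
      then show "ln u \<le> 3 / 2 * L" "ln u \<ge> L / 2" using L by linarith+
    qed
    \<comment> \<open>The largest power of two up to \<open>L\<^sup>2\<close>, since the sums over
      primes are organised in dyadic blocks.\<close>
    obtain K where K: "2 ^ K \<le> L\<^sup>2" "L\<^sup>2 < 2 * 2 ^ K"
    proof -
      define K where "K = nat \<lfloor>log 2 (L\<^sup>2)\<rfloor>"
      have "log 2 (L\<^sup>2) \<ge> 0" using L power_mono[of 1 L 2] by (intro zero_le_log_cancel_iff[THEN iffD2]) auto
      then have "real K \<le> log 2 (L\<^sup>2)" "log 2 (L\<^sup>2) < real K + 1" unfolding K_def by linarith+
      then have "2 powr real K \<le> L\<^sup>2" "L\<^sup>2 < 2 powr (real K + 1)"
        using L by (auto simp: le_log_iff log_less_iff)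
      then show ?thesis by (intro that[of K]) (auto simp: powr_realpow powr_add)
    qed
    define H where "H = (\<lambda>s. zeta_logderiv s + prime_part (2 ^ K) s)"
    \<comment> \<open>The slope \<open>2 * ln L\<close> gives weights \<open>L powr (2 * y)\<close>,
      matching the exponent \<open>2 - 2 * \<sigma>\<close>: a bound
      \<open>O(L powr (2 - 2 * x))\<close> at abscissa \<open>x\<close> turns into
      \<open>O(P)\<close>.\<close>
    have ek: "exp (2 * ln L * y) = L powr (2 * y)" for y using L by (simp add: powr_def mult_ac)
    have H: "norm (H (Complex \<sigma> t)) \<le> exp ((2 - \<alpha>)\<^sup>2) * (A * P)"
    proof (rule three_lines_rectangle[where k = "2 * ln L" and R = L and S = "{s. Re s > 1 / 2 \<and> Im s > 0}"])
      show "H holomorphic_on {s. Re s > 1 / 2 \<and> Im s > 0}" unfolding H_def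
        by (intro holomorphic_intros zeta_logderiv_holomorphic_right[OF RH]
              holomorphic_on_subset[OF prime_part_holomorphic]) auto
      show "cbox (Complex \<alpha> (t - L)) (Complex 2 (t + L)) \<subseteq> {s. Re s > 1 / 2 \<and> Im s > 0}"
        using L cL by (auto simp: in_cbox_complex_iff)
      show "\<alpha> \<le> \<sigma>" "\<sigma> \<le> 2" "L > 0" using cL \<sigma> \<sigma>\<^sub>1 L by auto
    next
      fix u assume u: "\<bar>u - t\<bar> \<le> L"
      have "c / 2 \<le> c / L * ln u \<and> c / L * ln u \<le> 3 * c / 2"
        using mult_left_mono[OF lnu(1)[OF u], of "c / L"] mult_left_mono[OF lnu(2)[OF u], of "c / L"] cL L by simp
      then have "norm (zeta_logderiv (Complex \<alpha> u)) \<le> C1 * ln u"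
        unfolding \<alpha>_def by (rule C1(2)[OF lnu(4)[OF u]])
      also have "\<dots> \<le> C1 * (2 * L)" using lnu(1)[OF u] C1(1) L by (intro mult_left_mono) auto
      finally have f: "norm (zeta_logderiv (Complex \<alpha> u)) \<le> 2 * C1 * L" by simp
      have p: "norm (prime_part (2 ^ K) (Complex \<alpha> u)) \<le> B1 * L powr (2 - 2 * \<alpha>)"
        using norm_prime_part_le_powr[of "Complex \<alpha> u" \<sigma>\<^sub>1 K L] cL \<sigma> \<sigma>\<^sub>1 K L by (simp add: B1_def)
      \<comment> \<open>The side lies at \<open>1/2 + c / L\<close> and not at \<open>1/2\<close>;
        this costs only \<open>L powr (2 * c / L)\<close>, which is bounded.\<close>
      have LP: "L * L powr (2 * (\<alpha> - \<sigma>)) \<le> exp (2 * c) * P"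
      proof -
        have "L * L powr (2 * (\<alpha> - \<sigma>)) = L powr (1 + 2 * (\<alpha> - \<sigma>))" using L by (simp add: powr_add)
        also have "1 + 2 * (\<alpha> - \<sigma>) = 2 * (c / L) + (2 - 2 * \<sigma>)" by (simp add: \<alpha>_def)
        also have "L powr (2 * (c / L) + (2 - 2 * \<sigma>)) = L powr (2 * (c / L)) * P" by (simp add: powr_add P_def)
        also have "L powr (2 * (c / L)) \<le> exp (2 * c)"
        proof -
          have "ln L \<le> L" using L ln_le_minus_one[of L] by linarith
          then have "2 * (c / L) * ln L \<le> 2 * (c / L) * L" using cL by (intro mult_left_mono) auto
          also have "\<dots> = 2 * c" using L by simp
          finally show ?thesis using L by (simp add: powr_def)
        qed
        finally show ?thesis using P by simp
      qed
      have PP: "L powr (2 - 2 * \<alpha>) * L powr (2 * (\<alpha> - \<sigma>)) = P"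
        unfolding P_def powr_add[symmetric] by (simp add: algebra_simps)
      have "norm (H (Complex \<alpha> u)) * L powr (2 * (\<alpha> - \<sigma>)) \<le>
          (2 * C1 * L + B1 * L powr (2 - 2 * \<alpha>)) * L powr (2 * (\<alpha> - \<sigma>))"
        unfolding H_def using f p by (intro mult_right_mono order_trans[OF norm_triangle_ineq] add_mono) auto
      also have "\<dots> = 2 * C1 * (L * L powr (2 * (\<alpha> - \<sigma>))) + B1 * P"
        unfolding PP[symmetric] by (simp add: algebra_simps)
      also have "\<dots> \<le> 2 * C1 * (exp (2 * c) * P) + B1 * P"
        using LP C1(1) by (intro add_right_mono mult_left_mono) auto
      also have "\<dots> = (2 * C1 * exp (2 * c) + B1) * P" by (simp add: algebra_simps)
      also have "\<dots> \<le> A * P" using P C2(1) c unfolding A_def by (intro mult_right_mono) auto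
      finally show "norm (H (Complex \<alpha> u)) * exp (2 * ln L * (\<alpha> - \<sigma>)) \<le> A * P" unfolding ek .
    next
      fix u :: real
      have L2: "L powr (2 * (2 - \<sigma>)) = L\<^sup>2 * P"
      proof -
        have "2 * (2 - \<sigma>) = 2 + (2 - 2 * \<sigma>)" by simp
        then show ?thesis using L by (simp only: powr_add P_def) simp
      qed
      have "norm (H (Complex 2 u)) * L powr (2 * (2 - \<sigma>)) \<le> 8 / 2 ^ K * (L\<^sup>2 * P)"
        unfolding L2 H_def using P by (intro mult_right_mono norm_zeta_logderiv_add_prime_part_le) auto
      also have "\<dots> \<le> 8 / 2 ^ K * (2 * 2 ^ K * P)"
        using K P by (intro mult_left_mono mult_right_mono) auto
      also have "\<dots> = 16 * P" by simp
      also have "\<dots> \<le> A * P" using P B1 C1(1) C2(1) c unfolding A_def by (intro mult_right_mono) auto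
      finally show "norm (H (Complex 2 u)) * exp (2 * ln L * (2 - \<sigma>)) \<le> A * P" unfolding ek .
    next
      \<comment> \<open>On the horizontal sides the crude bound \<open>O(L^2)\<close> and a weight
        of at most \<open>L^4\<close> are beaten by \<open>exp (- L\<^sup>2)\<close>.\<close>
      fix x u assume x: "\<alpha> \<le> x" "x \<le> 2" and "\<bar>u - t\<bar> = L"
      then have u: "\<bar>u - t\<bar> \<le> L" by simp
      have "norm (zeta_logderiv (Complex x u)) \<le> C2 * ln u / (c / L)"
        using C2(2)[OF lnu(3)[OF u] cL(1,2)] x by (simp add: \<alpha>_def)
      also have "\<dots> \<le> C2 * (2 * L) / (c / L)"
        using lnu(1)[OF u] C2(1) L cL by (intro divide_right_mono mult_left_mono) auto
      also have "\<dots> = 2 * C2 / c * L\<^sup>2" by (simp add: power2_eq_square)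
      finally have f: "norm (zeta_logderiv (Complex x u)) \<le> 2 * C2 / c * L\<^sup>2" .
      have "norm (prime_part (2 ^ K) (Complex x u)) \<le> 8 * (\<Sum>k<K. (2 powr (1 - x)) ^ k)"
        using norm_prime_part_le[of "Complex x u" K] x cL by simp
      also have "(\<Sum>k<K. (2 powr (1 - x)) ^ k) \<le> (\<Sum>k<K. 2 ^ k)"
      proof (intro sum_mono power_mono)
        have "(2::real) powr (1 - x) \<le> 2 powr 1" using x cL by (intro powr_mono) auto
        then show "(2::real) powr (1 - x) \<le> 2" by simp
      qed auto
      also have "(\<Sum>k<K. (2::real) ^ k) \<le> L\<^sup>2" using K(1) geometric_sum[of "2::real" K] by simp
      finally have p: "norm (prime_part (2 ^ K) (Complex x u)) \<le> 8 * L\<^sup>2" by simp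
      have h: "norm (H (Complex x u)) \<le> (2 * C2 / c + 8) * L\<^sup>2"
        unfolding H_def using f p by (intro order_trans[OF norm_triangle_ineq]) (simp add: algebra_simps)
      have "L powr (2 * (x - \<sigma>)) \<le> L powr 4" using L x cL by (intro powr_mono) auto
      also have "\<dots> = L ^ 4" using L by simp
      finally have l4: "L powr (2 * (x - \<sigma>)) \<le> L ^ 4" .
      have "norm (H (Complex x u)) * L powr (2 * (x - \<sigma>)) * exp (- L\<^sup>2) \<le>
          (2 * C2 / c + 8) * L\<^sup>2 * L ^ 4 * exp (- L\<^sup>2)"
        using h l4 C2(1) c by (intro mult_right_mono mult_mono) auto
      also have "\<dots> = (2 * C2 / c + 8) * (L ^ 6 * exp (- L\<^sup>2))"
        by (simp add: mult.assoc flip: power_add)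
      also have "\<dots> \<le> (2 * C2 / c + 8) * P" using L(6) P C2(1) c by (intro mult_left_mono) auto
      also have "\<dots> \<le> A * P" using P B1 C1(1) unfolding A_def by (intro mult_right_mono) auto
      finally show "norm (H (Complex x u)) * exp (2 * ln L * (x - \<sigma>)) * exp (- L\<^sup>2) \<le> A * P" unfolding ek .
    qed
    have "(2 - \<alpha>)\<^sup>2 \<le> 2\<^sup>2" using cL \<sigma> \<sigma>\<^sub>1 by (intro power_mono) auto
    then have "exp ((2 - \<alpha>)\<^sup>2) * (A * P) \<le> exp 4 * (A * P)"
      using P B1 C1(1) C2(1) c by (intro mult_right_mono mult_nonneg_nonneg) (auto simp: A_def)
    then have H4: "norm (H (Complex \<sigma> t)) \<le> exp 4 * (A * P)" using H by linarith
    have p: "norm (prime_part (2 ^ K) (Complex \<sigma> t)) \<le> B1 * P"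
      using norm_prime_part_le_powr[of "Complex \<sigma> t" \<sigma>\<^sub>1 K L] cL \<sigma> \<sigma>\<^sub>1 K L by (simp add: B1_def P_def)
    have "norm (zeta_logderiv (Complex \<sigma> t)) \<le> norm (H (Complex \<sigma> t)) + norm (prime_part (2 ^ K) (Complex \<sigma> t))"
      using norm_triangle_ineq4[of "H (Complex \<sigma> t)" "prime_part (2 ^ K) (Complex \<sigma> t)"] by (simp add: H_def)
    also have "\<dots> \<le> exp 4 * (A * P) + B1 * P" using H4 p by linarith
    also have "\<dots> = C * P" by (simp add: C_def algebra_simps)
    finally show ?thesis by (simp add: P_def L_def)
  qed
  then show ?thesis by blast
qed

theorem corollary1:
  fixes c \<sigma>\<^sub>1 :: real
  assumes "riemann_hypothesis"
    and "Liminf (inf (filtercomap Im at_top) (principal upper_zeta_deriv_zeros))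
           (\<lambda>\<rho>. ereal ((Re \<rho> - 1 / 2) * ln (Im \<rho>))) \<noteq> 0"
    and "c > 0" and "\<sigma>\<^sub>1 < 1"
  shows "\<exists>C. \<forall>\<sigma> t. t \<ge> 10 \<and> 1 / 2 + c / ln t \<le> \<sigma> \<and> \<sigma> \<le> \<sigma>\<^sub>1 \<longrightarrow>
           norm (deriv zeta (Complex \<sigma> t) / zeta (Complex \<sigma> t)) \<le> C * ln t powr (2 - 2 * \<sigma>)"
proof -
  note RH = assms(1) and c = assms(3) and \<sigma>\<^sub>1 = assms(4)
  obtain a T0 where a: "a > 0"
    "\<And>s. Im s \<ge> T0 \<Longrightarrow> deriv zeta s = 0 \<Longrightarrow> (Re s - 1 / 2) * ln (Im s) \<ge> a"
    using deriv_zeta_zeros_away[OF RH assms(2)] by blast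
  obtain C1 T1 where C1: "\<And>t \<sigma>. t \<ge> T1 \<Longrightarrow> 1 / 2 + c / ln t \<le> \<sigma> \<Longrightarrow> \<sigma> \<le> \<sigma>\<^sub>1 \<Longrightarrow>
      norm (zeta_logderiv (Complex \<sigma> t)) \<le> C1 * ln t powr (2 - 2 * \<sigma>)"
    using zeta_logderiv_large[OF RH a c \<sigma>\<^sub>1] by metis
  obtain C2 where C2: "C2 \<ge> 1" "\<And>x u d. u \<ge> 10 \<Longrightarrow> 0 < d \<Longrightarrow> d \<le> 1 \<Longrightarrow> 1 / 2 + d \<le> x \<Longrightarrow> x \<le> 2 \<Longrightarrow>
     norm (zeta_logderiv (Complex x u)) \<le> C2 * ln u / d"
    using norm_zeta_logderiv_le_strip[OF RH] by metis
  \<comment> \<open>For \<open>10 \<le> t < T1\<close> the trivial estimate at distance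
    \<open>c / ln t\<close> gives the second entry; the claimed bound has a power of
    \<open>ln t\<close> that is at least 1.\<close>
  define C where "C = max C1 (C2 * (ln T1)\<^sup>2 / c)"
  have "norm (zeta_logderiv (Complex \<sigma> t)) \<le> C * ln t powr (2 - 2 * \<sigma>)"
    if t: "t \<ge> 10" and \<sigma>: "1 / 2 + c / ln t \<le> \<sigma>" "\<sigma> \<le> \<sigma>\<^sub>1" for \<sigma> t
  proof (cases "t \<ge> T1")
    case True
    have "C1 * ln t powr (2 - 2 * \<sigma>) \<le> C * ln t powr (2 - 2 * \<sigma>)"
      by (intro mult_right_mono) (auto simp: C_def)
    then show ?thesis using C1[OF True \<sigma>] by linarith
  next
    case False
    have l: "ln t \<ge> 1" "ln t \<le> ln T1" using ln_ge_1[OF t] t False by auto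
    have P: "ln t powr (2 - 2 * \<sigma>) \<ge> 1" using l \<sigma> \<sigma>\<^sub>1 by (intro ge_one_powr_ge_zero) auto
    have d: "0 < c / ln t" "c / ln t \<le> 1" using c l \<sigma> \<sigma>\<^sub>1 by (auto simp del: divide_le_eq_1_pos)
    have "norm (zeta_logderiv (Complex \<sigma> t)) \<le> C2 * ln t / (c / ln t)"
      by (rule C2(2)[OF t d \<sigma>(1)]) (use \<sigma> \<sigma>\<^sub>1 in simp)
    also have "\<dots> = C2 * (ln t)\<^sup>2 / c" by (simp add: power2_eq_square)
    also have "\<dots> \<le> C2 * (ln T1)\<^sup>2 / c"
      using l C2(1) c by (intro divide_right_mono mult_left_mono power_mono) auto
    also have "\<dots> \<le> C * 1" by (simp add: C_def)
    also have "\<dots> \<le> C * ln t powr (2 - 2 * \<sigma>)"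
    proof (rule mult_left_mono[OF P])
      have "0 \<le> C2 * (ln T1)\<^sup>2 / c" using C2(1) c by simp
      then show "0 \<le> C" by (simp add: C_def)
    qed
    finally show ?thesis .
  qed
  then show ?thesis unfolding zeta_logderiv_def by blast
qed

end
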